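(* Let $M$ be a closed oriented hyperbolic surface and let $\Lambda=(\lambda,\nu)$ be an oriented geodesic lamination with a transverse measure $\nu$. Then the Ruelle–Sullivan current $T_\Lambda$ is a well-defined 1-current on $M$ (independent of the choices of flow boxes and of decomposition of the test form) and it is closed, so it defines a class $[T_\Lambda]\in H_1(M,\mathbb{R})$. Moreover a primitive of $T_\Lambda$ exists and is locally of bounded variation: there are a homomorphism $\alpha:\pi_1(M)\to\mathbb{R}$ and a function $\tilde v\in BV_{loc}(\tilde M)$ on the universal cover $\tilde M$, with $\tilde v(\gamma z)=\tilde v(z)+\alpha(\gamma)$ for all $\gamma\in\pi_1(M)$ and a.e. $z$ (equivalently a section $v$ of bounded variation of the flat real affine line bundle $\tilde M\times_\alpha\mathbb{R}\to M$), such that $T_\Lambda=dv$.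
   Context: A geodesic lamination $\lambda$ is a closed subset that is a disjoint union of simple complete geodesics (leaves). A flow box is a bi-Lipschitz homeomorphism $F:[a,b]\times[c,d]\to R\subset M$, $F=F(t,s)$, with $F^{-1}(\lambda)=[a,b]\times K$ for some closed $K\subset(c,d)$ of Hausdorff dimension $0$; flow boxes are chosen with $\partial F/\partial t$ a Lipschitz vector field along $F$. $\lambda$ is oriented if a neighborhood of it is covered by flow boxes that preserve orientation (product orientation $dt\wedge ds$ on the rectangle) and such that the given orientation of each leaf corresponds to increasing $t$. A transverse measure $\nu$ assigns to the local leaf space $[c,d]$ of each flow box a (finite, nonnegative) measure supported in $K$, such that coordinate changes between flow boxes are measure preserving. Ruelle–Sullivan current: let $F_i:[a_i,b_i]\times[c_i,d_i]\to R_i$ be oriented flow boxes covering a neighborhood $\mathcal U$ of $\lambda$. For a smooth 1-form $\phi=\sum_i\phi_i$ compactly supported in $\mathcal U$, with $\phi_i$ compactly supported in $R_i$, $$T_\Lambda(\phi)=\sum_i\int_{(c_i,d_i)}\Big(\int_{[a_i,b_i]\times\{s\}}F_i^*\phi_i\Big)d\nu(s).$$ It is supported on $\lambda$ and so extends by zero to a current on $M$. A current $T$ is closed if $T(df)=0$ for all smooth test functions $f$. For a locally integrable function $w$, $dw$ is the current $\phi\mapsto\int w\,d\phi$ (i.e. "$\int\phi\wedge dw$"); for the section $v$, $T_\Lambda=dv$ means that $d\tilde v$ is the pullback of $T_\Lambda$ to $\tilde M$, i.e. they agree on test forms supported in sets mapped diffeomorphically into $M$. *)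

theory Defs
  imports "HOL-Analysis.Analysis"
begin

section \<open>Closed oriented hyperbolic surfaces\<close>

definition upper_half :: "complex set" where
  "upper_half = {z. 0 < Im z}"

definition hyp_dist :: "complex \<Rightarrow> complex \<Rightarrow> real" where
  "hyp_dist z w = arcosh (1 + (cmod (z - w))\<^sup>2 / (2 * Im z * Im w))"

text \<open>The orientation-preserving isometries of the hyperbolic plane, that is, PSL(2,R).  They are
  extended by the identity off the half-plane, so that an isometry is one function only and the
  isometries are closed under composition of functions.\<close>

definition hyp_isometries :: "(complex \<Rightarrow> complex) set" where
  "hyp_isometries =
     {\<lambda>z. if z \<in> upper_half
           then (of_real a * z + of_real b) / (of_real c * z + of_real d) else z
      | a b c d :: real. a * d - b * c = 1}"

text \<open>The deck group of the universal covering \<open>p\<close>; it plays the role of the fundamental group.\<close>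

definition deck_group :: "(complex \<Rightarrow> 'm) \<Rightarrow> (complex \<Rightarrow> complex) set" where
  "deck_group p = {g \<in> hyp_isometries. \<forall>z\<in>upper_half. p (g z) = p z}"

text \<open>A closed oriented (connected) hyperbolic surface, presented with its universal covering
  \<open>p\<close> by the hyperbolic plane.  The distance of \<open>M\<close> is required to be hyperbolic only locally.
  The last clause says that the fibres of \<open>p\<close> are the orbits of a group of orientation-preserving
  isometries, so \<open>M\<close> is oriented through \<open>p\<close>.\<close>

definition closed_oriented_hyperbolic_surface ::
    "'m::metric_space set \<Rightarrow> (complex \<Rightarrow> 'm) \<Rightarrow> bool" where
  "closed_oriented_hyperbolic_surface M p \<longleftrightarrow>
     compact M \<and> covering_space upper_half p M \<and>
     (\<forall>z\<in>upper_half. \<exists>e>0. \<forall>w\<in>upper_half. \<forall>w'\<in>upper_half.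
        hyp_dist z w < e \<and> hyp_dist z w' < e \<longrightarrow> dist (p w) (p w') = hyp_dist w w') \<and>
     (\<forall>z\<in>upper_half. \<forall>w\<in>upper_half. p z = p w \<longrightarrow> (\<exists>g\<in>deck_group p. g z = w))"

definition is_lift :: "(complex \<Rightarrow> 'm) \<Rightarrow> 'a::topological_space set \<Rightarrow> ('a \<Rightarrow> 'm) \<Rightarrow> ('a \<Rightarrow> complex) \<Rightarrow> bool" where
  "is_lift p S f g \<longleftrightarrow> continuous_on S g \<and> g ` S \<subseteq> upper_half \<and> (\<forall>x\<in>S. p (g x) = f x)"


section \<open>Smooth functions, differential forms and currents\<close>

text \<open>Iterated directional derivatives; only used on open sets.\<close>

primrec iter_deriv :: "complex list \<Rightarrow> (complex \<Rightarrow> real) \<Rightarrow> complex \<Rightarrow> real" where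
  "iter_deriv [] f = f"
| "iter_deriv (v # vs) f = (\<lambda>z. frechet_derivative (iter_deriv vs f) (at z) v)"

definition smooth :: "complex set \<Rightarrow> (complex \<Rightarrow> real) \<Rightarrow> bool" where
  "smooth S f \<longleftrightarrow> (\<forall>vs. iter_deriv vs f differentiable_on S)"

definition smooth_conv :: "(nat \<Rightarrow> complex \<Rightarrow> real) \<Rightarrow> (complex \<Rightarrow> real) \<Rightarrow> bool" where
  "smooth_conv F f \<longleftrightarrow>
     (\<forall>vs K. compact K \<and> K \<subseteq> upper_half \<longrightarrow>
        uniform_limit K (\<lambda>n. iter_deriv vs (F n)) (iter_deriv vs f) sequentially)"

text \<open>Functions on \<open>M\<close> are smooth if their lifts are.  A differential form on \<open>M\<close> is given by its
  pullback under \<open>p\<close>, a form on the half-plane invariant under the deck group: a 1-form is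
  \<open>\<phi> z v\<close> with \<open>v\<close> a tangent vector at \<open>z\<close>, and a 2-form is the coefficient \<open>\<omega>\<close> of dx dy.
  Values at points outside the half-plane are irrelevant.\<close>

type_synonym one_form = "complex \<Rightarrow> complex \<Rightarrow> real"
type_synonym two_form = "complex \<Rightarrow> real"

definition smooth_function :: "(complex \<Rightarrow> 'm) \<Rightarrow> ('m \<Rightarrow> real) \<Rightarrow> bool" where
  "smooth_function p f \<longleftrightarrow> smooth upper_half (f \<circ> p)"

definition one_forms :: "(complex \<Rightarrow> 'm) \<Rightarrow> one_form set" where
  "one_forms p =
     {\<phi>. (\<forall>z\<in>upper_half. linear (\<phi> z)) \<and>
          (\<forall>v. smooth upper_half (\<lambda>z. \<phi> z v)) \<and>
          (\<forall>g\<in>deck_group p. \<forall>z\<in>upper_half. \<forall>v. \<phi> (g z) (deriv g z * v) = \<phi> z v)}"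

definition two_forms :: "(complex \<Rightarrow> 'm) \<Rightarrow> two_form set" where
  "two_forms p =
     {\<omega>. smooth upper_half \<omega> \<and>
          (\<forall>g\<in>deck_group p. \<forall>z\<in>upper_half. \<omega> (g z) * (cmod (deriv g z))\<^sup>2 = \<omega> z)}"

definition d0 :: "(complex \<Rightarrow> 'm) \<Rightarrow> ('m \<Rightarrow> real) \<Rightarrow> one_form" where
  "d0 p f = (\<lambda>z v. frechet_derivative (f \<circ> p) (at z) v)"

definition d1 :: "one_form \<Rightarrow> two_form" where
  "d1 \<phi> = (\<lambda>z. frechet_derivative (\<lambda>w. \<phi> w \<i>) (at z) 1 - frechet_derivative (\<lambda>w. \<phi> w 1) (at z) \<i>)"

text \<open>Closed subsets of the compact surface are compact, so a form is compactly supported in a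
  set as soon as its support is contained in it.\<close>

definition form_support :: "'m::metric_space set \<Rightarrow> (complex \<Rightarrow> 'm) \<Rightarrow> one_form \<Rightarrow> 'm set" where
  "form_support M p \<phi> = M \<inter> closure {p z | z. z \<in> upper_half \<and> (\<exists>v. \<phi> z v \<noteq> 0)}"

text \<open>Currents are continuous linear functionals on smooth forms.  The space of forms is
  metrizable, so that sequential continuity suffices.\<close>

definition one_current :: "(complex \<Rightarrow> 'm) \<Rightarrow> (one_form \<Rightarrow> real) \<Rightarrow> bool" where
  "one_current p T \<longleftrightarrow>
     (\<forall>\<phi>\<in>one_forms p. \<forall>\<psi>\<in>one_forms p. \<forall>a b.
        T (\<lambda>z v. a * \<phi> z v + b * \<psi> z v) = a * T \<phi> + b * T \<psi>) \<and>
     (\<forall>\<Phi> \<phi>. (\<forall>n. \<Phi> n \<in> one_forms p) \<and> \<phi> \<in> one_forms p \<and>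
        (\<forall>v. smooth_conv (\<lambda>n z. \<Phi> n z v) (\<lambda>z. \<phi> z v)) \<longrightarrow> (\<lambda>n. T (\<Phi> n)) \<longlonglongrightarrow> T \<phi>)"

definition two_current :: "(complex \<Rightarrow> 'm) \<Rightarrow> (two_form \<Rightarrow> real) \<Rightarrow> bool" where
  "two_current p S \<longleftrightarrow>
     (\<forall>\<omega>\<in>two_forms p. \<forall>\<eta>\<in>two_forms p. \<forall>a b.
        S (\<lambda>z. a * \<omega> z + b * \<eta> z) = a * S \<omega> + b * S \<eta>) \<and>
     (\<forall>\<Omega> \<omega>. (\<forall>n. \<Omega> n \<in> two_forms p) \<and> \<omega> \<in> two_forms p \<and> smooth_conv \<Omega> \<omega> \<longrightarrow>
        (\<lambda>n. S (\<Omega> n)) \<longlonglongrightarrow> S \<omega>)"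

definition closed_current :: "(complex \<Rightarrow> 'm) \<Rightarrow> (one_form \<Rightarrow> real) \<Rightarrow> bool" where
  "closed_current p T \<longleftrightarrow> one_current p T \<and> (\<forall>f. smooth_function p f \<longrightarrow> T (d0 p f) = 0)"

text \<open>The first real homology in de Rham's sense: closed 1-currents modulo boundaries of
  2-currents.\<close>

definition homologous :: "(complex \<Rightarrow> 'm) \<Rightarrow> (one_form \<Rightarrow> real) rel" where
  "homologous p =
     {(T, T'). closed_current p T \<and> closed_current p T' \<and>
        (\<exists>S. two_current p S \<and> (\<forall>\<phi>\<in>one_forms p. T \<phi> - T' \<phi> = S (d1 \<phi>)))}"

definition H1 :: "(complex \<Rightarrow> 'm) \<Rightarrow> (one_form \<Rightarrow> real) set set" where
  "H1 p = {T. closed_current p T} // homologous p"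

definition homology_class :: "(complex \<Rightarrow> 'm) \<Rightarrow> (one_form \<Rightarrow> real) \<Rightarrow> (one_form \<Rightarrow> real) set" where
  "homology_class p T = homologous p `` {T}"


section \<open>Hausdorff dimension\<close>

definition hausdorff_measure :: "real \<Rightarrow> 'a::metric_space set \<Rightarrow> ennreal" where
  "hausdorff_measure r A =
     (SUP \<delta>\<in>{0<..}.
        INF U\<in>{U :: nat \<Rightarrow> 'a set. A \<subseteq> (\<Union>i. U i) \<and> (\<forall>i. bounded (U i) \<and> diameter (U i) \<le> \<delta>)}.
          (\<Sum>i. ennreal (diameter (U i) powr r)))"

text \<open>Only exponents \<open>r > 0\<close> are used, which avoids the convention for the zeroth power of 0 and
  does not affect the infimum.\<close>

definition hausdorff_dim :: "'a::metric_space set \<Rightarrow> ennreal" where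
  "hausdorff_dim A = (INF r\<in>{r. 0 < r \<and> hausdorff_measure r A = 0}. ennreal r)"


section \<open>Geodesic laminations, flow boxes and transverse measures\<close>

text \<open>Complete geodesics in unit speed parametrization.  Simplicity means injective, or periodic
  and injective on a period.\<close>

definition complete_geodesic :: "'m::metric_space set \<Rightarrow> (real \<Rightarrow> 'm) \<Rightarrow> bool" where
  "complete_geodesic M c \<longleftrightarrow>
     range c \<subseteq> M \<and>
     (\<forall>t. \<exists>e>0. \<forall>s s'. \<bar>s - t\<bar> < e \<and> \<bar>s' - t\<bar> < e \<longrightarrow> dist (c s) (c s') = \<bar>s - s'\<bar>)"

definition simple_geodesic :: "'m::metric_space set \<Rightarrow> (real \<Rightarrow> 'm) \<Rightarrow> bool" where
  "simple_geodesic M c \<longleftrightarrow>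
     complete_geodesic M c \<and> (\<forall>s t. c s = c t \<longrightarrow> (\<forall>u. c (s + u) = c (t + u)))"

text \<open>A geodesic lamination together with an orientation of each leaf.  The leaves are the ranges of
  the members of \<open>G\<close>; two members with the same range differ by a time shift, so that \<open>G\<close> selects a
  direction on every leaf.\<close>

definition geodesic_lamination :: "'m::metric_space set \<Rightarrow> 'm set \<Rightarrow> (real \<Rightarrow> 'm) set \<Rightarrow> bool" where
  "geodesic_lamination M lam G \<longleftrightarrow>
     closedin (top_of_set M) lam \<and> lam = (\<Union>c\<in>G. range c) \<and>
     (\<forall>c\<in>G. simple_geodesic M c) \<and>
     (\<forall>c\<in>G. \<forall>c'\<in>G. range c \<inter> range c' \<noteq> {} \<longrightarrow> (\<exists>u. \<forall>t. c' t = c (t + u)))"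

text \<open>A map \<open>F(t,s)\<close> on the rectangle \<open>[t0,t1] \<times> [s0,s1]\<close>.\<close>

datatype 'm box = Box (t0: real) (t1: real) (s0: real) (s1: real) (box_map: "real \<times> real \<Rightarrow> 'm")

definition rect :: "'m box \<Rightarrow> (real \<times> real) set" where
  "rect B = {t0 B..t1 B} \<times> {s0 B..s1 B}"

definition box_image :: "'m box \<Rightarrow> 'm set" where
  "box_image B = box_map B ` rect B"

definition leaf_space :: "'m set \<Rightarrow> 'm box \<Rightarrow> real set" where
  "leaf_space lam B = {s. \<exists>t. (t, s) \<in> rect B \<and> box_map B (t, s) \<in> lam}"

text \<open>The last clause says that \<open>\<partial>F/\<partial>t\<close> exists and is a Lipschitz vector field along \<open>F\<close>, read in a lift to
  the half-plane.  On the compact image of the lift the hyperbolic and Euclidean metrics are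
  comparable.\<close>

definition flow_box :: "'m::metric_space set \<Rightarrow> (complex \<Rightarrow> 'm) \<Rightarrow> 'm set \<Rightarrow> 'm box \<Rightarrow> bool" where
  "flow_box M p lam B \<longleftrightarrow>
     t0 B < t1 B \<and> s0 B < s1 B \<and> box_image B \<subseteq> M \<and>
     inj_on (box_map B) (rect B) \<and>
     (\<exists>C. C-lipschitz_on (rect B) (box_map B)) \<and>
     (\<exists>C. C-lipschitz_on (box_image B) (inv_into (rect B) (box_map B))) \<and>
     {x \<in> rect B. box_map B x \<in> lam} = {t0 B..t1 B} \<times> leaf_space lam B \<and>
     closed (leaf_space lam B) \<and> leaf_space lam B \<subseteq> {s0 B<..<s1 B} \<and>
     hausdorff_dim (leaf_space lam B) = 0 \<and>
     (\<exists>F V C. is_lift p (rect B) (box_map B) F \<and>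
        (\<forall>t s. (t, s) \<in> rect B \<longrightarrow>
           ((\<lambda>\<tau>. F (\<tau>, s)) has_vector_derivative V (t, s)) (at t within {t0 B..t1 B})) \<and>
        C-lipschitz_on (rect B) V)"

text \<open>A bi-Lipschitz map is differentiable almost everywhere; it preserves orientation if its
  Jacobian determinant is positive almost everywhere.\<close>

definition orientation_preserving :: "(complex \<Rightarrow> 'm) \<Rightarrow> 'm box \<Rightarrow> bool" where
  "orientation_preserving p B \<longleftrightarrow>
     (\<exists>F. is_lift p (rect B) (box_map B) F \<and>
        (AE x in lborel. x \<in> rect B \<longrightarrow>
           (\<exists>D. (F has_derivative D) (at x) \<and>
              Re (D (1, 0)) * Im (D (0, 1)) - Im (D (1, 0)) * Re (D (0, 1)) > 0)))"

definition oriented_flow_box ::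
    "'m::metric_space set \<Rightarrow> (complex \<Rightarrow> 'm) \<Rightarrow> 'm set \<Rightarrow> (real \<Rightarrow> 'm) set \<Rightarrow> 'm box \<Rightarrow> bool" where
  "oriented_flow_box M p lam G B \<longleftrightarrow>
     flow_box M p lam B \<and> orientation_preserving p B \<and>
     (\<forall>s\<in>leaf_space lam B. \<exists>c\<in>G. \<exists>\<theta>.
        continuous_on {t0 B..t1 B} \<theta> \<and> strict_mono_on {t0 B..t1 B} \<theta> \<and>
        (\<forall>t\<in>{t0 B..t1 B}. box_map B (t, s) = c (\<theta> t)))"

text \<open>The rectangles are closed; that they cover a neighborhood is understood, as usual, in the sense
  that their interiors do, so that there are partitions of unity subordinate to the cover.\<close>

definition oriented_lamination ::
    "'m::metric_space set \<Rightarrow> (complex \<Rightarrow> 'm) \<Rightarrow> 'm set \<Rightarrow> (real \<Rightarrow> 'm) set \<Rightarrow> bool" where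
  "oriented_lamination M p lam G \<longleftrightarrow>
     geodesic_lamination M lam G \<and>
     (\<exists>U. openin (top_of_set M) U \<and> lam \<subseteq> U \<and>
        (\<forall>x\<in>U. \<exists>B. oriented_flow_box M p lam G B \<and> x \<in> top_of_set M interior_of box_image B))"

text \<open>The coordinate change from \<open>B\<close> to \<open>B'\<close> is read on a transversal \<open>{t} \<times> A\<close> that \<open>B\<close> sends into the
  image of \<open>B'\<close>: it induces a map \<open>\<sigma>\<close> of local leaf spaces, which has to preserve the measure
  wherever it is injective.  (It is injective locally, but not globally when a plaque of \<open>B'\<close>
  meets the transversal repeatedly.)\<close>

definition transverse_measure ::
    "'m::metric_space set \<Rightarrow> (complex \<Rightarrow> 'm) \<Rightarrow> 'm set \<Rightarrow> ('m box \<Rightarrow> real measure) \<Rightarrow> bool" where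
  "transverse_measure M p lam \<nu> \<longleftrightarrow>
     (\<forall>B. flow_box M p lam B \<longrightarrow>
        sets (\<nu> B) = sets borel \<and> finite_measure (\<nu> B) \<and>
        emeasure (\<nu> B) (- leaf_space lam B) = 0) \<and>
     (\<forall>B B' t A \<sigma>. flow_box M p lam B \<and> flow_box M p lam B' \<and>
        t \<in> {t0 B..t1 B} \<and> A \<subseteq> leaf_space lam B \<and> A \<in> sets borel \<and>
        (\<forall>s\<in>A. \<exists>t'. (t', \<sigma> s) \<in> rect B' \<and> box_map B (t, s) = box_map B' (t', \<sigma> s)) \<and>
        inj_on \<sigma> A \<and> \<sigma> ` A \<in> sets borel \<longrightarrow>
        emeasure (\<nu> B) A = emeasure (\<nu> B') (\<sigma> ` A))"


section \<open>The Ruelle--Sullivan current\<close>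

text \<open>The integral of a 1-form on \<open>M\<close> along a path in \<open>M\<close>, computed in a lift of the path; by invariance
  of the form it does not depend on the lift.\<close>

definition path_integral :: "(complex \<Rightarrow> 'm) \<Rightarrow> one_form \<Rightarrow> (real \<Rightarrow> 'm) \<Rightarrow> real \<Rightarrow> real \<Rightarrow> real" where
  "path_integral p \<phi> c a b =
     (let g = (SOME g. is_lift p {a..b} c g)
      in integral {a..b} (\<lambda>t. \<phi> (g t) (vector_derivative g (at t within {a..b}))))"

text \<open>The defining formula is required for every choice of boxes and of the decomposition of the
  form.  Vanishing on forms supported off the lamination expresses the extension by zero.\<close>

definition ruelle_sullivan_current ::
    "'m::metric_space set \<Rightarrow> (complex \<Rightarrow> 'm) \<Rightarrow> 'm set \<Rightarrow> (real \<Rightarrow> 'm) set \<Rightarrow>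
     ('m box \<Rightarrow> real measure) \<Rightarrow> (one_form \<Rightarrow> real) \<Rightarrow> bool" where
  "ruelle_sullivan_current M p lam G \<nu> T \<longleftrightarrow>
     one_current p T \<and>
     (\<forall>\<phi>\<in>one_forms p. form_support M p \<phi> \<inter> lam = {} \<longrightarrow> T \<phi> = 0) \<and>
     (\<forall>U n B \<phi> \<Phi>.
        openin (top_of_set M) U \<and> lam \<subseteq> U \<and>
        (\<forall>i<n::nat. oriented_flow_box M p lam G (B i)) \<and> U \<subseteq> (\<Union>i<n. box_image (B i)) \<and>
        \<phi> \<in> one_forms p \<and> form_support M p \<phi> \<subseteq> U \<and>
        (\<forall>i<n. \<Phi> i \<in> one_forms p \<and> form_support M p (\<Phi> i) \<subseteq> box_image (B i)) \<and>
        (\<forall>z\<in>upper_half. \<forall>v. \<phi> z v = (\<Sum>i<n. \<Phi> i z v)) \<longrightarrow>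
        T \<phi> = (\<Sum>i<n. LINT s:{s0 (B i)<..<s1 (B i)}|\<nu> (B i).
                 path_integral p (\<Phi> i) (\<lambda>t. box_map (B i) (t, s)) (t0 (B i)) (t1 (B i))))"


section \<open>Primitives of locally bounded variation\<close>

definition locally_integrable :: "(complex \<Rightarrow> real) \<Rightarrow> bool" where
  "locally_integrable w \<longleftrightarrow>
     (\<forall>K. compact K \<and> K \<subseteq> upper_half \<longrightarrow> set_integrable lborel K w)"

text \<open>The variation on compact sets may be computed in the Euclidean metric, which is comparable to
  the hyperbolic one there.\<close>

definition BV_loc :: "(complex \<Rightarrow> real) \<Rightarrow> bool" where
  "BV_loc w \<longleftrightarrow>
     locally_integrable w \<and>
     (\<forall>K. compact K \<and> K \<subseteq> upper_half \<longrightarrow>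
        (\<exists>C. \<forall>X :: complex \<Rightarrow> complex.
           smooth UNIV (\<lambda>z. Re (X z)) \<and> smooth UNIV (\<lambda>z. Im (X z)) \<and>
           (\<forall>z. z \<notin> K \<longrightarrow> X z = 0) \<and> (\<forall>z. cmod (X z) \<le> 1) \<longrightarrow>
           \<bar>LINT z:K|lborel. w z *
              (frechet_derivative (\<lambda>z. Re (X z)) (at z) 1 +
               frechet_derivative (\<lambda>z. Im (X z)) (at z) \<i>)\<bar> \<le> C))"

text \<open>\<open>T = dw\<close>: for an open set \<open>W\<close> that \<open>p\<close> maps diffeomorphically into \<open>M\<close>, the test forms on \<open>W\<close> are the
  restrictions to \<open>W\<close> of the (pulled back) forms on \<open>M\<close> compactly supported in \<open>p ` W\<close>.\<close>

definition current_eq_d :: "'m::metric_space set \<Rightarrow> (complex \<Rightarrow> 'm) \<Rightarrow> (one_form \<Rightarrow> real) \<Rightarrow> (complex \<Rightarrow> real) \<Rightarrow> bool" where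
  "current_eq_d M p T w \<longleftrightarrow>
     (\<forall>W \<phi>. open W \<and> W \<subseteq> upper_half \<and> inj_on p W \<and>
        \<phi> \<in> one_forms p \<and> form_support M p \<phi> \<subseteq> p ` W \<longrightarrow>
        T \<phi> = (LINT z:W|lborel. w z * d1 \<phi> z))"

end

theory Submission
  imports Defs
begin

text \<open>
  In the half-plane the lamination consists of oriented complete geodesics, each with a well-defined
  left side.  The primitive counts them: \<open>v z - v y\<close> is the transverse measure of the leaves with \<open>z\<close> but
  not \<open>y\<close> on their left, minus that of the leaves with \<open>y\<close> but not \<open>z\<close> on their left, whenever \<open>y\<close> and \<open>z\<close>
  lie in a small convex region seen by one flow box.  Stokes' formula on the left side of a single
  geodesic says that the integral of a compactly supported form along the geodesic is the integral of
  its exterior derivative over that side (\<open>stokes_left_side\<close>).  Integrating this over the leaves of a flow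
  box and interchanging the integrals gives the Ruelle--Sullivan expression on one hand and the integral
  of \<open>v d\<phi>\<close> on the other (\<open>box_integral_chart\<close>).  So the current \<open>dv\<close> is the Ruelle--Sullivan current, and
  its properties follow from those of \<open>v\<close>.

  Why \<open>v\<close> exists: a leaf that separates two points of a convex region crosses the segment between them in
  that region.  Any two flow boxes that see the region see the same separating leaves, and
  the invariance of the transverse measure gives them the same mass, after they have been decomposed
  into countably many pieces, each visible on one transversal (\<open>emeasure_matching\<close>).  Hence the local
  counting functions agree up to constants (\<open>local_primitives_compatible\<close>) and glue on the half-plane
  (\<open>glue_primitives\<close>).  Deck transformations respect leaves, boxes and measures, so they change \<open>v\<close> by
  constants (\<open>primitive_deck\<close>), and these constants are the homomorphism \<open>\<alpha>\<close>.

  To obtain a functional on forms of the surface, which are not compactly supported in the half-plane,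
  such a form is multiplied by a cutoff whose translates under the deck group sum to one, and then paired
  with \<open>dv\<close>.  Exterior derivatives of compactly supported forms have integral zero, so the pairing is
  invariant under the deck group in spite of the constants (\<open>pairing_pull\<close>).  By unfolding
  (\<open>current_deck_sum\<close>) a form that is the sum of the translates of a compactly supported form has the value
  of that form.  This yields the Ruelle--Sullivan formula for every choice of boxes and every
  decomposition (\<open>current_box\<close>), the identity \<open>T = dv\<close>, and closedness, since compactly supported exact forms
  integrate to zero along every leaf (\<open>pairing_exact\<close>).  The pairing needs no derivatives of the form to be bounded, because plaques have
  bounded length (\<open>pairing_bound\<close>); this gives both the continuity of the current and the locally bounded
  variation of \<open>v\<close>.  Finally, a partition of unity splits every form into a part off the lamination
  and parts in flow boxes, so that the defining formula leaves no choice for the current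
  (\<open>ruelle_sullivan_unique\<close>).
\<close>

section \<open>Calculus of smooth functions\<close>

text \<open>The iterated derivatives in the definition of \<open>smooth\<close> add one derivative on the outside at a time.
  Recursion that takes the first derivative first turns the closure properties into inductions on the
  order.\<close>

primrec ksmooth :: "nat \<Rightarrow> complex set \<Rightarrow> (complex \<Rightarrow> real) \<Rightarrow> bool" where
  "ksmooth 0 S f \<longleftrightarrow> f differentiable_on S"
| "ksmooth (Suc n) S f \<longleftrightarrow>
     f differentiable_on S \<and> (\<forall>v. ksmooth n S (\<lambda>z. frechet_derivative f (at z) v))"

lemma iter_deriv_snoc:
  "iter_deriv (vs @ [v]) f = iter_deriv vs (\<lambda>z. frechet_derivative f (at z) v)"
  by (induction vs) auto

lemma ksmooth_iff: "ksmooth n S f \<longleftrightarrow> (\<forall>vs. length vs \<le> n \<longrightarrow> iter_deriv vs f differentiable_on S)"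
proof (induction n arbitrary: f)
  case (Suc n)
  show ?case
  proof
    assume A: "ksmooth (Suc n) S f"
    show "\<forall>vs. length vs \<le> Suc n \<longrightarrow> iter_deriv vs f differentiable_on S"
    proof (intro allI impI)
      fix vs :: "complex list" assume "length vs \<le> Suc n"
      then show "iter_deriv vs f differentiable_on S"
        using A Suc by (cases vs rule: rev_cases) (auto simp: iter_deriv_snoc)
    qed
  next
    assume A: "\<forall>vs. length vs \<le> Suc n \<longrightarrow> iter_deriv vs f differentiable_on S"
    have "f differentiable_on S" using A[rule_format, of "[]"] by simp
    moreover have "ksmooth n S (\<lambda>z. frechet_derivative f (at z) v)" for v
      unfolding Suc using A[rule_format, of "_ @ [v]"] by (auto simp: iter_deriv_snoc)
    ultimately show "ksmooth (Suc n) S f" by simp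
  qed
qed simp

lemma smooth_iff_ksmooth: "smooth S f \<longleftrightarrow> (\<forall>n. ksmooth n S f)"
  unfolding smooth_def ksmooth_iff by blast

lemma ksmooth_differentiable: "ksmooth n S f \<Longrightarrow> f differentiable_on S"
  by (cases n) auto

lemma ksmooth_Suc_imp: "ksmooth (Suc n) S f \<Longrightarrow> ksmooth n S f"
  by (induction n arbitrary: f) auto

lemma ksmooth_subset: "ksmooth n S f \<Longrightarrow> T \<subseteq> S \<Longrightarrow> ksmooth n T f"
  by (induction n arbitrary: f) (auto intro: differentiable_on_subset)

lemma differentiable_on_openD:
  "f differentiable_on S \<Longrightarrow> open S \<Longrightarrow> z \<in> S \<Longrightarrow> f differentiable (at z)"
  by (simp add: differentiable_on_eq_differentiable_at)

lemma differentiable_has_frechet: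
  "f differentiable_on S \<Longrightarrow> open S \<Longrightarrow> z \<in> S \<Longrightarrow> (f has_derivative frechet_derivative f (at z)) (at z)"
  by (metis differentiable_on_openD frechet_derivative_works)

lemma frechet_derivative_cong_open:
  assumes "open S" "z \<in> S" "\<And>w. w \<in> S \<Longrightarrow> f w = g w"
  shows "frechet_derivative f (at z) = frechet_derivative g (at z)"
proof -
  have "(f has_derivative D) (at z) \<longleftrightarrow> (g has_derivative D) (at z)" for D
    using assms has_derivative_transform_within_open[of _ D z UNIV S]
    by (metis)
  then show ?thesis by (simp add: frechet_derivative_def)
qed

lemma differentiable_on_cong_open:
  assumes "open S" "\<And>w. w \<in> S \<Longrightarrow> f w = g w" "f differentiable_on S"
  shows "g differentiable_on S"
  unfolding differentiable_on_eq_differentiable_at[OF assms(1)]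
proof
  fix z assume z: "z \<in> S"
  obtain D where "(f has_derivative D) (at z)"
    using assms(3) z by (auto simp: differentiable_on_eq_differentiable_at[OF assms(1)] differentiable_def)
  from has_derivative_transform_within_open[OF this assms(1) z assms(2)]
  show "g differentiable at z" by (auto simp: differentiable_def)
qed

lemma ksmooth_cong:
  assumes "open S" "\<And>w. w \<in> S \<Longrightarrow> f w = g w" "ksmooth n S f"
  shows "ksmooth n S g"
  using assms(2,3)
proof (induction n arbitrary: f g)
  case 0 then show ?case using differentiable_on_cong_open[OF assms(1), of f g] by simp
next
  case (Suc n)
  have "ksmooth n S (\<lambda>z. frechet_derivative g (at z) v)" for v
  proof (rule Suc.IH)
    show "ksmooth n S (\<lambda>z. frechet_derivative f (at z) v)" using Suc.prems by simp
    show "frechet_derivative f (at w) v = frechet_derivative g (at w) v" if "w \<in> S" for w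
      using frechet_derivative_cong_open[OF assms(1) that, of f g] Suc.prems by simp
  qed
  then show ?case using differentiable_on_cong_open[OF assms(1), of f g] Suc.prems by auto
qed

lemma ksmooth_SucI:
  assumes "open S" "\<And>z. z \<in> S \<Longrightarrow> (f has_derivative f' z) (at z)"
    "\<And>v. ksmooth n S (\<lambda>z. f' z v)"
  shows "ksmooth (Suc n) S f"
proof -
  have "f differentiable_on S"
    using assms(1,2) by (auto simp: differentiable_on_eq_differentiable_at differentiable_def)
  moreover have "ksmooth n S (\<lambda>z. frechet_derivative f (at z) v)" for v
    by (rule ksmooth_cong[OF assms(1) _ assms(3)[of v]]) (use assms(2) frechet_derivative_at in metis)
  ultimately show ?thesis by simp
qed

lemma ksmooth_const [simp]: "ksmooth n S (\<lambda>z. c)"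
  by (induction n arbitrary: c) (simp_all add: frechet_derivative_const)

lemma ksmooth_linear:
  assumes "open S" "bounded_linear f" shows "ksmooth n S f"
proof (cases n)
  case 0 then show ?thesis using assms
    by (simp add: bounded_linear_imp_differentiable_on)
next
  case (Suc m)
  show ?thesis unfolding Suc
    by (rule ksmooth_SucI[OF assms(1) bounded_linear_imp_has_derivative[OF assms(2)]]) simp
qed

lemma ksmooth_add:
  assumes "open S" "ksmooth n S f" "ksmooth n S g"
  shows "ksmooth n S (\<lambda>z. f z + g z)"
  using assms(2,3)
proof (induction n arbitrary: f g)
  case 0 then show ?case by (simp add: differentiable_on_add)
next
  case (Suc n)
  show ?case
    by (rule ksmooth_SucI[OF assms(1) has_derivative_add[OF differentiable_has_frechet differentiable_has_frechet]])
      (use Suc assms(1) in auto)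
qed

lemma ksmooth_mult:
  assumes "open S" "ksmooth n S f" "ksmooth n S g"
  shows "ksmooth n S (\<lambda>z. f z * g z)"
  using assms(2,3)
proof (induction n arbitrary: f g)
  case 0 then show ?case by (simp add: differentiable_on_mult)
next
  case (Suc n)
  show ?case
  proof (rule ksmooth_SucI[OF assms(1) has_derivative_mult[OF differentiable_has_frechet differentiable_has_frechet]])
    show "ksmooth n S (\<lambda>z. f z * frechet_derivative g (at z) v + frechet_derivative f (at z) v * g z)" for v
      using Suc.prems ksmooth_Suc_imp[OF Suc.prems(1)] ksmooth_Suc_imp[OF Suc.prems(2)]
      by (intro ksmooth_add[OF assms(1)] Suc.IH) auto
  qed (use Suc assms(1) in auto)
qed

text \<open>The same notion for functions of one real variable, used for the outer functions in compositions.\<close>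

primrec rsmooth :: "nat \<Rightarrow> real set \<Rightarrow> (real \<Rightarrow> real) \<Rightarrow> bool" where
  "rsmooth 0 U h \<longleftrightarrow> (\<exists>h'. \<forall>x\<in>U. (h has_real_derivative h' x) (at x))"
| "rsmooth (Suc n) U h \<longleftrightarrow> (\<exists>h'. (\<forall>x\<in>U. (h has_real_derivative h' x) (at x)) \<and> rsmooth n U h')"

lemma rsmooth_add: "rsmooth n U g \<Longrightarrow> rsmooth n U h \<Longrightarrow> rsmooth n U (\<lambda>x. g x + h x)"
proof (induction n arbitrary: g h)
  case 0
  then obtain g' h' where "\<forall>x\<in>U. (g has_real_derivative g' x) (at x)"
    "\<forall>x\<in>U. (h has_real_derivative h' x) (at x)" by auto
  then show ?case by (auto intro!: exI[of _ "\<lambda>x. g' x + h' x"] DERIV_add)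
next
  case (Suc n)
  then obtain g' h' where "\<forall>x\<in>U. (g has_real_derivative g' x) (at x)" "rsmooth n U g'"
    "\<forall>x\<in>U. (h has_real_derivative h' x) (at x)" "rsmooth n U h'" by auto
  then show ?case using Suc.IH[of g' h']
    by (auto intro!: exI[of _ "\<lambda>x. g' x + h' x"] DERIV_add)
qed

lemma ksmooth_compose_real:
  assumes "open S" "ksmooth n S f" "rsmooth n U h" "f ` S \<subseteq> U"
  shows "ksmooth n S (\<lambda>z. h (f z))"
  using assms(2-4)
proof (induction n arbitrary: f h)
  case 0
  then obtain h' where h': "\<forall>x\<in>U. (h has_real_derivative h' x) (at x)" by auto
  have "((\<lambda>z. h (f z)) has_derivative (\<lambda>v. h' (f z) * frechet_derivative f (at z) v)) (at z)" if "z \<in> S" for z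
    using has_derivative_compose[OF differentiable_has_frechet[of f S z], of h "(*) (h' (f z))"] h' 0 that assms(1)
    by (auto simp: has_field_derivative_def)
  then show ?case using assms(1) by (auto simp: differentiable_on_eq_differentiable_at differentiable_def)
next
  case (Suc n)
  then obtain h' where h': "\<forall>x\<in>U. (h has_real_derivative h' x) (at x)" "rsmooth n U h'" by auto
  have f: "f differentiable_on S" "ksmooth n S f" using Suc.prems ksmooth_Suc_imp by auto
  show ?case
  proof (rule ksmooth_SucI[OF assms(1)])
    show "((\<lambda>z. h (f z)) has_derivative (\<lambda>v. h' (f z) * frechet_derivative f (at z) v)) (at z)" if "z \<in> S" for z
      using has_derivative_compose[OF differentiable_has_frechet[of f S z], of h "(*) (h' (f z))"] h' f Suc.prems that assms(1)
      by (auto simp: has_field_derivative_def)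
    show "ksmooth n S (\<lambda>z. h' (f z) * frechet_derivative f (at z) v)" for v
      using Suc.prems h'(2) by (intro ksmooth_mult[OF assms(1)] Suc.IH[OF f(2)]) simp_all
  qed
qed

lemma inverse_power_derivative:
  assumes "x \<noteq> (0::real)"
  shows "((\<lambda>x. c * inverse x ^ k) has_real_derivative (- c * of_nat k) * inverse x ^ (k + 1)) (at x)"
proof -
  have eq: "of_nat k * (inverse x ^ (k - 1) * (inverse x)\<^sup>2) = of_nat k * inverse x ^ (k + 1)"
    by (cases k) (auto simp: power2_eq_square)
  have "((\<lambda>x. c * inverse x ^ k) has_real_derivative c * (of_nat k * (inverse x ^ (k - Suc 0) * - ((inverse x)\<^sup>2)))) (at x)"
    using assms by (auto intro!: derivative_eq_intros simp: power2_eq_square)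
  moreover have "c * (of_nat k * (inverse x ^ (k - Suc 0) * - ((inverse x)\<^sup>2))) = (- c * of_nat k) * inverse x ^ (k + 1)"
    using eq by (simp add: mult.assoc)
  ultimately show ?thesis by (simp only:)
qed

lemma rsmooth_inverse_power: "rsmooth n (- {0}) (\<lambda>x. c * inverse x ^ k)"
proof (induction n arbitrary: c k)
  case 0 show ?case unfolding rsmooth.simps using inverse_power_derivative by (metis ComplD singletonI)
next
  case (Suc n)
  show ?case unfolding rsmooth.simps using inverse_power_derivative Suc by (metis ComplD singletonI)
qed

lemma ksmooth_divide:
  assumes "open S" "ksmooth n S f" "ksmooth n S g" "\<And>z. z \<in> S \<Longrightarrow> g z \<noteq> 0"
  shows "ksmooth n S (\<lambda>z. f z / g z)"
proof -
  have "ksmooth n S (\<lambda>z. 1 * inverse (g z) ^ 1)"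
    by (rule ksmooth_compose_real[OF assms(1,3) rsmooth_inverse_power]) (use assms(4) in auto)
  from ksmooth_mult[OF assms(1,2) this] show ?thesis by (simp add: divide_inverse)
qed

text \<open>The classical smooth function that vanishes to infinite order at 0.\<close>

definition flat :: "real \<Rightarrow> real" where
  "flat x = (if x \<le> 0 then 0 else exp (- inverse x))"

lemma flat_bounds: "0 \<le> flat x" "flat x \<le> 1" "0 < flat x \<longleftrightarrow> 0 < x" "flat x = 0 \<longleftrightarrow> x \<le> 0"
  by (auto simp: flat_def)

lemma flat_over_power_tendsto: "((\<lambda>x. flat x * inverse x ^ k) \<longlongrightarrow> 0) (at 0)"
proof -
  have "((\<lambda>y::real. y ^ k / exp y) \<longlongrightarrow> 0) at_top" by (rule tendsto_power_div_exp_0)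
  then have "((\<lambda>x::real. inverse x ^ k / exp (inverse x)) \<longlongrightarrow> 0) (at_right 0)"
    by (rule filterlim_compose[OF _ filterlim_inverse_at_top_right])
  then have "((\<lambda>x. flat x * inverse x ^ k) \<longlongrightarrow> 0) (at_right 0)"
    by (rule Lim_transform_eventually)
      (auto simp: eventually_at_filter flat_def exp_minus field_simps intro!: always_eventually)
  moreover have "((\<lambda>x. flat x * inverse x ^ k) \<longlongrightarrow> 0) (at_left 0)"
    by (rule Lim_transform_eventually[OF tendsto_const])
      (auto simp: eventually_at_filter flat_def intro!: always_eventually)
  ultimately show ?thesis by (simp add: filterlim_split_at)
qed

text \<open>Derivatives of \<open>flat x\<close> divided by a power of \<open>x\<close> are combinations of functions of the same kind, also
  at 0, so that one induction shows them all to be smooth.\<close>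

lemma flat_over_power_derivative:
  "((\<lambda>x. flat x * inverse x ^ k) has_real_derivative
     flat x * inverse x ^ (k + 2) - of_nat k * (flat x * inverse x ^ (k + 1))) (at x)"
proof (cases "x = 0")
  case True
  have "(\<lambda>h. (flat (0 + h) * inverse (0 + h) ^ k - flat 0 * inverse 0 ^ k) / h) = (\<lambda>h. flat h * inverse h ^ (k + 1))"
    by (auto simp: flat_def field_simps)
  then show ?thesis unfolding True DERIV_def
    using flat_over_power_tendsto[of "k+1"] by (simp add: flat_def)
next
  case False
  show ?thesis
  proof (cases "x < 0")
    case True
    have "((\<lambda>x. 0) has_real_derivative 0) (at x)" by simp
    then have "((\<lambda>x. flat x * inverse x ^ k) has_real_derivative 0) (at x)"
      by (rule has_field_derivative_transform_within_open[where S = "{..<0}"]) (use True in \<open>auto simp: flat_def\<close>)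
    then show ?thesis using True by (simp add: flat_def)
  next
    case F: False
    then have x: "x > 0" using \<open>x \<noteq> 0\<close> by simp
    have 1: "((\<lambda>x. exp (- inverse x)) has_real_derivative exp (- inverse x) * (inverse x)\<^sup>2) (at x)"
      using x by (auto intro!: derivative_eq_intros simp: power2_eq_square)
    have 2: "((\<lambda>x. inverse x ^ k) has_real_derivative (- of_nat k) * inverse x ^ (k + 1)) (at x)"
      using inverse_power_derivative[of x 1 k] x by simp
    have "((\<lambda>x. exp (- inverse x) * inverse x ^ k) has_real_derivative
       exp (- inverse x) * inverse x ^ (k + 2) - of_nat k * (exp (- inverse x) * inverse x ^ (k + 1))) (at x)"
      using DERIV_mult[OF 1 2] by (simp add: power2_eq_square algebra_simps)
    then have "((\<lambda>x. flat x * inverse x ^ k) has_real_derivative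
       exp (- inverse x) * inverse x ^ (k + 2) - of_nat k * (exp (- inverse x) * inverse x ^ (k + 1))) (at x)"
      by (rule has_field_derivative_transform_within_open[where S = "{0<..}"]) (use x in \<open>auto simp: flat_def\<close>)
    then show ?thesis using x by (simp add: flat_def)
  qed
qed

lemma rsmooth_cmult: "rsmooth n U g \<Longrightarrow> rsmooth n U (\<lambda>x. c * g x)"
proof (induction n arbitrary: g)
  case 0
  then obtain g' where "\<forall>x\<in>U. (g has_real_derivative g' x) (at x)" by auto
  then show ?case by (auto intro!: exI[of _ "\<lambda>x. c * g' x"] DERIV_cmult)
next
  case (Suc n)
  then obtain g' where "\<forall>x\<in>U. (g has_real_derivative g' x) (at x)" "rsmooth n U g'" by auto
  then show ?case using Suc.IH[of g'] by (auto intro!: exI[of _ "\<lambda>x. c * g' x"] DERIV_cmult)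
qed

lemma rsmooth_flat_over_power: "rsmooth n UNIV (\<lambda>x. flat x * inverse x ^ k)"
proof (induction n arbitrary: k)
  case 0 show ?case using flat_over_power_derivative by fastforce
next
  case (Suc n)
  have "rsmooth n UNIV (\<lambda>x. flat x * inverse x ^ (k + 2) + (- of_nat k) * (flat x * inverse x ^ (k + 1)))"
    by (intro rsmooth_add rsmooth_cmult Suc)
  then show ?case using flat_over_power_derivative[of k] by (auto intro!: exI)
qed

lemma rsmooth_flat: "rsmooth n UNIV flat"
  using rsmooth_flat_over_power[of n 0] by simp

lemma smooth_cong: "open S \<Longrightarrow> (\<And>w. w \<in> S \<Longrightarrow> f w = g w) \<Longrightarrow> smooth S f \<Longrightarrow> smooth S g"
  using ksmooth_cong smooth_iff_ksmooth by metis

lemma smooth_subset: "smooth S f \<Longrightarrow> T \<subseteq> S \<Longrightarrow> smooth T f"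
  using ksmooth_subset smooth_iff_ksmooth by metis

lemma smooth_const [simp]: "smooth S (\<lambda>z. c)"
  by (simp add: smooth_iff_ksmooth)

lemma smooth_linear: "open S \<Longrightarrow> bounded_linear f \<Longrightarrow> smooth S f"
  by (simp add: smooth_iff_ksmooth ksmooth_linear)

lemma smooth_add: "open S \<Longrightarrow> smooth S f \<Longrightarrow> smooth S g \<Longrightarrow> smooth S (\<lambda>z. f z + g z)"
  by (simp add: smooth_iff_ksmooth ksmooth_add)

lemma smooth_mult: "open S \<Longrightarrow> smooth S f \<Longrightarrow> smooth S g \<Longrightarrow> smooth S (\<lambda>z. f z * g z)"
  by (simp add: smooth_iff_ksmooth ksmooth_mult)

lemma smooth_diff: "open S \<Longrightarrow> smooth S f \<Longrightarrow> smooth S g \<Longrightarrow> smooth S (\<lambda>z. f z - g z)"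
  using smooth_add[of S f "\<lambda>z. -1 * g z"] smooth_mult[of S "\<lambda>z. -1" g] by simp

lemma smooth_sum: "open S \<Longrightarrow> (\<And>i. i \<in> I \<Longrightarrow> smooth S (f i)) \<Longrightarrow> smooth S (\<lambda>z. \<Sum>i\<in>I. f i z)"
  by (induction I rule: infinite_finite_induct) (auto intro: smooth_add)

lemma smooth_divide:
  "open S \<Longrightarrow> smooth S f \<Longrightarrow> smooth S g \<Longrightarrow> (\<And>z. z \<in> S \<Longrightarrow> g z \<noteq> 0) \<Longrightarrow> smooth S (\<lambda>z. f z / g z)"
  by (simp add: smooth_iff_ksmooth ksmooth_divide)

lemma smooth_flat: "open S \<Longrightarrow> smooth S f \<Longrightarrow> smooth S (\<lambda>z. flat (f z))"
  using ksmooth_compose_real[OF _ _ rsmooth_flat] by (auto simp: smooth_iff_ksmooth)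

lemma smooth_differentiable: "smooth S f \<Longrightarrow> f differentiable_on S"
  using smooth_iff_ksmooth ksmooth_differentiable by metis

lemma smooth_derivative: "smooth S f \<Longrightarrow> smooth S (\<lambda>z. frechet_derivative f (at z) v)"
  unfolding smooth_iff_ksmooth using ksmooth.simps(2) by blast

lemma smooth_continuous_on: "smooth S f \<Longrightarrow> continuous_on S f"
  using smooth_differentiable differentiable_imp_continuous_on by blast

lemma smooth_local:
  assumes "\<And>z. z \<in> S \<Longrightarrow> \<exists>T. open T \<and> z \<in> T \<and> smooth T f"
  shows "smooth S f"
  unfolding smooth_def differentiable_on_def
proof (intro allI ballI)
  fix vs z assume "z \<in> S"
  then obtain T where T: "open T" "z \<in> T" "smooth T f" using assms by blast
  then have "iter_deriv vs f differentiable (at z)"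
    using differentiable_on_openD[of "iter_deriv vs f" T z] by (auto simp: smooth_def)
  then show "iter_deriv vs f differentiable (at z within S)" by (rule differentiable_at_withinI)
qed

lemma smooth_extend:
  assumes U: "open U" "smooth U f" and C: "compact C" "C \<subseteq> U" "\<And>z. z \<notin> C \<Longrightarrow> f z = 0"
  shows "smooth UNIV f"
proof (rule smooth_local)
  fix z :: complex
  show "\<exists>T. open T \<and> z \<in> T \<and> smooth T f"
  proof (cases "z \<in> U")
    case True then show ?thesis using U by blast
  next
    case False
    have "open (- C)" using C(1) by (simp add: compact_imp_closed open_Compl)
    moreover have "smooth (- C) f" by (rule smooth_cong[OF \<open>open (- C)\<close> _ smooth_const[of _ 0]]) (simp add: C(3))
    ultimately show ?thesis using False C(2) by blast
  qed
qed

lemma frechet_derivative_complex: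
  assumes "f differentiable (at w)"
  shows "frechet_derivative f (at w) u = Re u * frechet_derivative f (at w) 1 + Im u * (frechet_derivative f (at w) \<i> :: real)"
proof -
  have L: "linear (frechet_derivative f (at w))"
    using assms linear_frechet_derivative by blast
  have "u = Re u *\<^sub>R 1 + Im u *\<^sub>R \<i>" by (simp add: complex_eq_iff)
  then have "frechet_derivative f (at w) u = frechet_derivative f (at w) (Re u *\<^sub>R 1 + Im u *\<^sub>R \<i>)" by simp
  also have "\<dots> = Re u * frechet_derivative f (at w) 1 + Im u * frechet_derivative f (at w) \<i>"
    using L by (simp add: linear_add linear_scale)
  finally show ?thesis .
qed

text \<open>The derivative of the composition is a combination of first derivatives of \<open>f\<close>, composed with \<open>g\<close>,
  whose coefficients are the real and imaginary parts of \<open>g'\<close>; so the claim for one order follows from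
  that for the order below.\<close>

lemma smooth_compose_holomorphic:
  assumes "open S" "open T" "\<And>z. z \<in> S \<Longrightarrow> (g has_field_derivative g' z) (at z)" "g ` S \<subseteq> T"
    "smooth S (\<lambda>z. Re (g' z))" "smooth S (\<lambda>z. Im (g' z))" "smooth T f"
  shows "smooth S (\<lambda>z. f (g z))"
proof -
  have der: "((\<lambda>z. f (g z)) has_derivative (\<lambda>v. frechet_derivative f (at (g z)) (g' z * v))) (at z)"
    if "z \<in> S" "f differentiable_on T" for z f
    using has_derivative_compose[OF assms(3)[OF that(1), unfolded has_field_derivative_def]
      differentiable_has_frechet[OF that(2) assms(2)]] that assms(4) by auto
  have "ksmooth n S (\<lambda>z. f (g z))" if "ksmooth n T f" for n
    using that
  proof (induction n arbitrary: f)
    case 0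
    then show ?case using der assms(1)
      by (fastforce simp: differentiable_on_eq_differentiable_at differentiable_def)
  next
    case (Suc n)
    then have f: "f differentiable_on T" by simp
    show ?case
    proof (rule ksmooth_SucI[OF assms(1)])
      show "((\<lambda>z. f (g z)) has_derivative (\<lambda>v. frechet_derivative f (at (g z)) (g' z * v))) (at z)"
        if "z \<in> S" for z by (rule der[OF that f])
      fix v
      have "ksmooth n S (\<lambda>z. (Re (g' z) * Re v + - Im v * Im (g' z)) * frechet_derivative f (at (g z)) 1
          + (Re (g' z) * Im v + Im (g' z) * Re v) * frechet_derivative f (at (g z)) \<i>)"
        using assms(5,6) Suc.prems
        by (intro ksmooth_add[OF assms(1)] ksmooth_mult[OF assms(1)] Suc.IH[of "\<lambda>w. frechet_derivative f (at w) _"]) (auto simp: smooth_iff_ksmooth)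
      then show "ksmooth n S (\<lambda>z. frechet_derivative f (at (g z)) (g' z * v))"
      proof (rule ksmooth_cong[OF assms(1), rotated])
        fix z assume "z \<in> S"
        then have "f differentiable (at (g z))" using differentiable_on_openD[OF f assms(2)] assms(4) by blast
        from frechet_derivative_complex[OF this, of "g' z * v"]
        show "(Re (g' z) * Re v + - Im v * Im (g' z)) * frechet_derivative f (at (g z)) 1
          + (Re (g' z) * Im v + Im (g' z) * Re v) * frechet_derivative f (at (g z)) \<i>
          = frechet_derivative f (at (g z)) (g' z * v)" by (simp add: algebra_simps)
      qed
    qed
  qed
  then show ?thesis using assms(7) by (simp add: smooth_iff_ksmooth)
qed

definition bump :: "complex \<Rightarrow> real \<Rightarrow> complex \<Rightarrow> real" where
  "bump x r z = flat (r\<^sup>2 - (norm (z - x))\<^sup>2)"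

lemma smooth_bump: "open S \<Longrightarrow> smooth S (bump x r)"
proof -
  assume S: "open S"
  have R: "smooth S Re" "smooth S Im" by (simp_all add: smooth_linear S bounded_linear_Re bounded_linear_Im)
  have "smooth S (\<lambda>z. r\<^sup>2 - ((Re z - Re x) * (Re z - Re x) + (Im z - Im x) * (Im z - Im x)))"
    by (intro smooth_diff smooth_add smooth_mult smooth_const R S)
  then have "smooth S (\<lambda>z. r\<^sup>2 - (norm (z - x))\<^sup>2)"
    by (rule smooth_cong[OF S, rotated]) (simp only: cmod_power2, simp add: power2_eq_square)
  then show ?thesis unfolding bump_def[abs_def] by (rule smooth_flat[OF S])
qed

lemma bump_pos: "0 \<le> bump x r z" "0 < r \<Longrightarrow> bump x r z > 0 \<longleftrightarrow> z \<in> ball x r" "0 < r \<Longrightarrow> z \<notin> ball x r \<Longrightarrow> bump x r z = 0"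
proof -
  show "0 \<le> bump x r z" by (simp add: bump_def flat_bounds)
  assume r: "0 < r"
  have *: "(norm (z - x))\<^sup>2 < r\<^sup>2 \<longleftrightarrow> z \<in> ball x r"
    using r by (simp add: dist_norm norm_minus_commute abs_le_square_iff[symmetric] not_le[symmetric])
  show "bump x r z > 0 \<longleftrightarrow> z \<in> ball x r"
    using * by (simp add: bump_def flat_bounds)
  show "z \<notin> ball x r \<Longrightarrow> bump x r z = 0"
    using * by (simp add: bump_def flat_bounds)
qed

section \<open>Isometries and geodesics of the hyperbolic plane\<close>

definition mob :: "real \<Rightarrow> real \<Rightarrow> real \<Rightarrow> real \<Rightarrow> complex \<Rightarrow> complex" where
  "mob a b c d = (\<lambda>z. if z \<in> upper_half then (of_real a * z + of_real b) / (of_real c * z + of_real d) else z)"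

lemma hyp_isometries_mob: "g \<in> hyp_isometries \<longleftrightarrow> (\<exists>a b c d. g = mob a b c d \<and> a * d - b * c = 1)"
  by (auto simp: hyp_isometries_def mob_def)

lemma open_upper_half: "open upper_half"
  unfolding upper_half_def by (rule open_halfspace_Im_gt)

lemma convex_upper_half: "convex upper_half"
  unfolding upper_half_def by (rule convex_halfspace_Im_gt)

lemma mob_denom_nonzero:
  assumes "z \<in> upper_half" "a * d - b * c = (1::real)"
  shows "of_real c * z + of_real d \<noteq> 0"
proof
  assume "of_real c * z + of_real d = 0"
  then have "c * Im z = 0" "c * Re z + d = 0" by (auto simp: complex_eq_iff)
  then show False using assms by (auto simp: upper_half_def)
qed

lemma mob_denom_cnj_nonzero:
  assumes "z \<in> upper_half" "a * d - b * c = (1::real)"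
  shows "of_real c * cnj z + of_real d \<noteq> 0"
proof -
  have "of_real c * cnj z + of_real d = cnj (of_real c * z + of_real d)" by simp
  then show ?thesis using mob_denom_nonzero[OF assms] by (metis complex_cnj_zero_iff)
qed

lemma mob_diff:
  assumes "z \<in> upper_half" "w \<in> upper_half" "a * d - b * c = 1"
  shows "mob a b c d z - mob a b c d w = (z - w) / ((of_real c * z + of_real d) * (of_real c * w + of_real d))"
proof -
  have "of_real a * of_real d - of_real b * of_real c = (1 :: complex)"
    using assms(3) by (metis of_real_1 of_real_diff of_real_mult)
  then have "(of_real a * z + of_real b) * (of_real c * w + of_real d) - (of_real a * w + of_real b) * (of_real c * z + of_real d) = z - w"
    by algebra
  then show ?thesis
    using mob_denom_nonzero[OF assms(1,3)] mob_denom_nonzero[OF assms(2,3)] assms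
    by (simp add: mob_def diff_frac_eq)
qed

lemma mob_cnj_diff:
  assumes "z \<in> upper_half" "w \<in> upper_half" "a * d - b * c = 1"
  shows "cnj (mob a b c d z) - mob a b c d w = (cnj z - w) / ((of_real c * cnj z + of_real d) * (of_real c * w + of_real d))"
proof -
  have "of_real a * of_real d - of_real b * of_real c = (1 :: complex)"
    using assms(3) by (metis of_real_1 of_real_diff of_real_mult)
  then have "(of_real a * cnj z + of_real b) * (of_real c * w + of_real d) - (of_real a * w + of_real b) * (of_real c * cnj z + of_real d) = cnj z - w"
    by algebra
  then show ?thesis
    using mob_denom_cnj_nonzero[OF assms(1,3)] mob_denom_nonzero[OF assms(2,3)] assms
    by (simp add: mob_def diff_frac_eq)
qed

lemma Im_mob:
  assumes "z \<in> upper_half" "a * d - b * c = 1"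
  shows "Im (mob a b c d z) = Im z / (cmod (of_real c * z + of_real d))\<^sup>2"
proof -
  have "mob a b c d z = (of_real a * z + of_real b) * cnj (of_real c * z + of_real d) / (cmod (of_real c * z + of_real d))\<^sup>2"
    by (simp only: mob_def if_P[OF assms(1)]) (rule complex_div_cnj)
  then have "Im (mob a b c d z) = Im ((of_real a * z + of_real b) * cnj (of_real c * z + of_real d)) / (cmod (of_real c * z + of_real d))\<^sup>2"
    by (metis Im_divide_of_real)
  also have "Im ((of_real a * z + of_real b) * cnj (of_real c * z + of_real d)) = (a * d - b * c) * Im z"
    by (simp add: algebra_simps)
  finally show ?thesis using assms by simp
qed

lemma mob_upper_half:
  assumes "z \<in> upper_half" "a * d - b * c = 1" shows "mob a b c d z \<in> upper_half"
  using Im_mob[OF assms] mob_denom_nonzero[OF assms] assms(1) by (simp add: upper_half_def)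

lemma mob_compose:
  assumes "a * d - b * c = 1" "a' * d' - b' * c' = 1"
  shows "mob a b c d \<circ> mob a' b' c' d' = mob (a*a'+b*c') (a*b'+b*d') (c*a'+d*c') (c*b'+d*d')"
proof
  fix z
  show "(mob a b c d \<circ> mob a' b' c' d') z = mob (a*a'+b*c') (a*b'+b*d') (c*a'+d*c') (c*b'+d*d') z"
  proof (cases "z \<in> upper_half")
    case True
    let ?D = "of_real c' * z + of_real d'"
    have nz: "?D \<noteq> 0" by (rule mob_denom_nonzero[OF True assms(2)])
    have "(of_real a * ((of_real a' * z + of_real b') / ?D) + of_real b) =
        (of_real (a*a'+b*c') * z + of_real (a*b'+b*d')) / ?D"
      "(of_real c * ((of_real a' * z + of_real b') / ?D) + of_real d) =
        (of_real (c*a'+d*c') * z + of_real (c*b'+d*d')) / ?D"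
      using nz by (simp_all add: field_simps)
    then show ?thesis using True nz mob_upper_half[OF True assms(2)]
      by (simp add: mob_def)
  qed (simp add: mob_def)
qed

lemma mob_id: "mob 1 0 0 1 = id"
  by (auto simp: mob_def)

lemma isometry_id: "id \<in> hyp_isometries"
  unfolding hyp_isometries_mob by (rule exI[of _ 1], rule exI[of _ 0], rule exI[of _ 0], rule exI[of _ 1]) (simp add: mob_id)

lemma isometry_compose:
  assumes "g \<in> hyp_isometries" "h \<in> hyp_isometries" shows "g \<circ> h \<in> hyp_isometries"
proof -
  obtain a b c d where g: "g = mob a b c d" "a * d - b * c = 1" using assms(1) hyp_isometries_mob by blast
  obtain a' b' c' d' where h: "h = mob a' b' c' d'" "a' * d' - b' * c' = 1" using assms(2) hyp_isometries_mob by blast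
  have "(a*a'+b*c') * (c*b'+d*d') - (a*b'+b*d') * (c*a'+d*c') = (a * d - b * c) * (a' * d' - b' * c')"
    by (simp add: algebra_simps)
  then show ?thesis unfolding g(1) h(1) mob_compose[OF g(2) h(2)] hyp_isometries_mob using g h by auto
qed

lemma isometry_inverse:
  assumes "g \<in> hyp_isometries" obtains h where "h \<in> hyp_isometries" "g \<circ> h = id" "h \<circ> g = id"
proof -
  obtain a b c d where g: "g = mob a b c d" "a * d - b * c = 1" using assms(1) hyp_isometries_mob by blast
  have d: "d * a - (- b) * (- c) = 1" using g by (simp add: algebra_simps)
  have "mob d (-b) (-c) a \<in> hyp_isometries" using d hyp_isometries_mob by blast
  moreover have "g \<circ> mob d (-b) (-c) a = id" "mob d (-b) (-c) a \<circ> g = id"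
    unfolding g(1) mob_compose[OF g(2) d] mob_compose[OF d g(2)] using g(2)
    by (simp_all add: mult.commute mob_id)
  ultimately show ?thesis using that by blast
qed

lemma isometry_upper_half: "g \<in> hyp_isometries \<Longrightarrow> z \<in> upper_half \<Longrightarrow> g z \<in> upper_half"
  using hyp_isometries_mob mob_upper_half by auto

lemma isometry_off_upper_half: "g \<in> hyp_isometries \<Longrightarrow> z \<notin> upper_half \<Longrightarrow> g z = z"
  using hyp_isometries_mob by (auto simp: mob_def)

lemma isometry_upper_half_iff: "g \<in> hyp_isometries \<Longrightarrow> g z \<in> upper_half \<longleftrightarrow> z \<in> upper_half"
  by (metis isometry_off_upper_half isometry_upper_half)

lemma isometry_bij: "g \<in> hyp_isometries \<Longrightarrow> bij g"
  by (metis isometry_inverse o_bij)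

lemma mob_derivative:
  assumes "z \<in> upper_half" "a * d - b * c = 1"
  shows "(mob a b c d has_field_derivative 1 / (of_real c * z + of_real d)\<^sup>2) (at z)"
proof -
  have nz: "of_real c * z + of_real d \<noteq> 0" by (rule mob_denom_nonzero[OF assms])
  have 1: "of_real a * of_real d - of_real b * of_real c = (1 :: complex)"
    using assms(2) by (metis of_real_1 of_real_diff of_real_mult)
  have "((\<lambda>z. (of_real a * z + of_real b) / (of_real c * z + of_real d)) has_field_derivative
     (of_real a * (of_real c * z + of_real d) - (of_real a * z + of_real b) * of_real c) / ((of_real c * z + of_real d) * (of_real c * z + of_real d))) (at z)"
    using nz by (auto intro!: derivative_eq_intros)
  moreover have "of_real a * (of_real c * z + of_real d) - (of_real a * z + of_real b) * of_real c = 1"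
    using 1 by algebra
  ultimately have "((\<lambda>z. (of_real a * z + of_real b) / (of_real c * z + of_real d)) has_field_derivative
     1 / (of_real c * z + of_real d)\<^sup>2) (at z)" by (simp add: power2_eq_square)
  then show ?thesis
    by (rule has_field_derivative_transform_within_open[OF _ open_upper_half assms(1)]) (simp add: mob_def)
qed

lemma isometry_has_deriv:
  "g \<in> hyp_isometries \<Longrightarrow> z \<in> upper_half \<Longrightarrow> (g has_field_derivative deriv g z) (at z)"
  using hyp_isometries_mob mob_derivative by (metis DERIV_imp_deriv)

lemma deriv_mob:
  "z \<in> upper_half \<Longrightarrow> a * d - b * c = 1 \<Longrightarrow> deriv (mob a b c d) z = 1 / (of_real c * z + of_real d)\<^sup>2"
  using mob_derivative DERIV_imp_deriv by blast

lemma isometry_continuous_on: "g \<in> hyp_isometries \<Longrightarrow> S \<subseteq> upper_half \<Longrightarrow> continuous_on S g"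
  by (meson DERIV_isCont continuous_at_imp_continuous_on isometry_has_deriv subsetD)

lemma isometry_open_image:
  assumes "g \<in> hyp_isometries" "open W" "W \<subseteq> upper_half" shows "open (g ` W)"
proof -
  obtain h where h: "h \<in> hyp_isometries" "g \<circ> h = id" "h \<circ> g = id" by (rule isometry_inverse[OF assms(1)])
  have "g ` W = upper_half \<inter> h -` W"
  proof -
    have hg: "h (g w) = w" "g (h w) = w" for w using h by (auto simp: fun_eq_iff)
    show ?thesis
    proof (intro set_eqI iffI)
      fix z assume "z \<in> g ` W"
      then show "z \<in> upper_half \<inter> h -` W"
        using hg assms(3) isometry_upper_half[OF assms(1)] by auto
    next
      fix z assume "z \<in> upper_half \<inter> h -` W"
      then show "z \<in> g ` W" using hg by (metis IntD2 imageI vimageD)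
    qed
  qed
  then show ?thesis
    using continuous_open_preimage[OF isometry_continuous_on[OF h(1) order_refl] open_upper_half assms(2)] by simp
qed

lemma deriv_isometry_compose:
  assumes "g \<in> hyp_isometries" "h \<in> hyp_isometries" "z \<in> upper_half"
  shows "deriv (g \<circ> h) z = deriv g (h z) * deriv h z"
  using DERIV_imp_deriv[OF DERIV_chain[OF isometry_has_deriv[OF assms(1) isometry_upper_half[OF assms(2,3)]] isometry_has_deriv[OF assms(2,3)]]] .

lemma smooth_isometry_deriv:
  assumes "g \<in> hyp_isometries"
  shows "smooth upper_half (\<lambda>z. Re (deriv g z))" "smooth upper_half (\<lambda>z. Im (deriv g z))"
proof -
  obtain a b c d where g: "g = mob a b c d" "a * d - b * c = 1" using assms(1) hyp_isometries_mob by blast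
  let ?u = "\<lambda>z. c * Re z + d" and ?v = "\<lambda>z. c * Im z"
  have R: "smooth upper_half Re" "smooth upper_half Im"
    by (simp_all add: smooth_linear open_upper_half bounded_linear_Re bounded_linear_Im)
  have nz: "?u z * ?u z + ?v z * ?v z \<noteq> 0" if "z \<in> upper_half" for z
    using that g(2) by (auto simp: upper_half_def sum_squares_eq_zero_iff)
  have uv: "smooth upper_half ?u" "smooth upper_half ?v"
    by (intro smooth_add smooth_mult smooth_const R open_upper_half)+
  have n: "smooth upper_half (\<lambda>z. (?u z * ?u z + ?v z * ?v z) * (?u z * ?u z + ?v z * ?v z))"
    by (intro smooth_add smooth_mult uv open_upper_half)
  have eq: "deriv g z = Complex ((?u z * ?u z - ?v z * ?v z) / ((?u z * ?u z + ?v z * ?v z) * (?u z * ?u z + ?v z * ?v z)))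
      (((-2) * (?u z * ?v z)) / ((?u z * ?u z + ?v z * ?v z) * (?u z * ?u z + ?v z * ?v z)))" if z: "z \<in> upper_half" for z
  proof -
    define u v where "u = ?u z" and "v = ?v z"
    have w: "of_real c * z + of_real d = Complex u v" by (simp add: complex_eq_iff u_def v_def)
    have "deriv g z = 1 / (Complex u v)\<^sup>2" using deriv_mob[OF z g(2)] w by (simp add: g(1))
    also have "(Complex u v)\<^sup>2 = Complex (u * u - v * v) (2*(u * v))" by (simp add: power2_eq_square complex_eq_iff)
    also have "1 / Complex (u * u - v * v) (2*(u * v)) = Complex ((u * u - v * v)/((u * u - v * v)\<^sup>2+(2*(u * v))\<^sup>2)) (-(2*(u * v))/((u * u - v * v)\<^sup>2+(2*(u * v))\<^sup>2))"
      by (simp add: complex_eq_iff Re_divide Im_divide)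
    also have "(u * u - v * v)\<^sup>2+(2*(u * v))\<^sup>2 = (u * u + v * v)*(u * u + v * v)" by (simp add: power2_eq_square algebra_simps)
    finally show ?thesis by (simp add: u_def v_def)
  qed
  have "smooth upper_half (\<lambda>z. (?u z * ?u z - ?v z * ?v z) / ((?u z * ?u z + ?v z * ?v z) * (?u z * ?u z + ?v z * ?v z)))"
    using nz by (intro smooth_divide n smooth_diff smooth_mult uv open_upper_half) auto
  then show "smooth upper_half (\<lambda>z. Re (deriv g z))"
    by (rule smooth_cong[OF open_upper_half, rotated]) (simp add: eq)
  have "smooth upper_half (\<lambda>z. ((-2) * (?u z * ?v z)) / ((?u z * ?u z + ?v z * ?v z) * (?u z * ?u z + ?v z * ?v z)))"
    using nz by (intro smooth_divide n smooth_mult uv smooth_const open_upper_half) auto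
  then show "smooth upper_half (\<lambda>z. Im (deriv g z))"
    by (rule smooth_cong[OF open_upper_half, rotated]) (simp add: eq)
qed

lemma smooth_compose_isometry:
  assumes "g \<in> hyp_isometries" "smooth upper_half f" shows "smooth upper_half (\<lambda>z. f (g z))"
  by (rule smooth_compose_holomorphic[OF open_upper_half open_upper_half isometry_has_deriv[OF assms(1)] _
     smooth_isometry_deriv[OF assms(1)] assms(2)]) (use isometry_upper_half[OF assms(1)] in auto)

text \<open>The hyperbolic distance is a monotone function of this algebraic expression, on which
  invariance and continuity are visible.\<close>

definition hyp_delta :: "complex \<Rightarrow> complex \<Rightarrow> real" where
  "hyp_delta z w = (cmod (z - w))\<^sup>2 / (2 * Im z * Im w)"

lemma hyp_dist_delta: "hyp_dist z w = arcosh (1 + hyp_delta z w)"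
  by (simp add: hyp_dist_def hyp_delta_def)

lemma hyp_delta_nonneg: "z \<in> upper_half \<Longrightarrow> w \<in> upper_half \<Longrightarrow> 0 \<le> hyp_delta z w"
  by (simp add: hyp_delta_def upper_half_def)

lemma hyp_dist_eqD:
  assumes "z \<in> upper_half" "w \<in> upper_half" "hyp_dist z w = r"
  shows "1 + hyp_delta z w = cosh r"
  using assms hyp_delta_nonneg[OF assms(1,2)] cosh_arcosh_real[of "1 + hyp_delta z w"] by (simp add: hyp_dist_delta)

lemma hyp_dist_eqI:
  assumes "1 + hyp_delta z w = cosh r" "0 \<le> r" shows "hyp_dist z w = r"
  using assms arcosh_cosh_real by (simp add: hyp_dist_delta)

lemma hyp_dist_nonneg: "z \<in> upper_half \<Longrightarrow> w \<in> upper_half \<Longrightarrow> 0 \<le> hyp_dist z w"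
  using hyp_delta_nonneg[of z w] by (simp add: hyp_dist_delta)

lemma hyp_dist_eq_0:
  assumes "z \<in> upper_half" "w \<in> upper_half" shows "hyp_dist z w = 0 \<longleftrightarrow> z = w"
proof
  assume "hyp_dist z w = 0"
  then have "hyp_delta z w = 0" using hyp_dist_eqD[OF assms] by fastforce
  then show "z = w" using assms by (simp add: hyp_delta_def upper_half_def)
qed (simp add: hyp_dist_delta hyp_delta_def)

lemma hyp_delta_mob:
  assumes "z \<in> upper_half" "w \<in> upper_half" "a * d - b * c = 1"
  shows "hyp_delta (mob a b c d z) (mob a b c d w) = hyp_delta z w"
proof -
  let ?D = "\<lambda>z. cmod (of_real c * z + of_real d)"
  have "?D z \<noteq> 0" "?D w \<noteq> 0" "Im z \<noteq> 0" "Im w \<noteq> 0"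
    using mob_denom_nonzero[OF assms(1,3)] mob_denom_nonzero[OF assms(2,3)] assms by (auto simp: upper_half_def)
  moreover have "(cmod (mob a b c d z - mob a b c d w))\<^sup>2 = (cmod (z - w))\<^sup>2 / ((?D z)\<^sup>2 * (?D w)\<^sup>2)"
    by (simp add: mob_diff[OF assms] norm_divide norm_mult power_divide power_mult_distrib)
  ultimately show ?thesis
    unfolding hyp_delta_def Im_mob[OF assms(1,3)] Im_mob[OF assms(2,3)] by (simp add: field_simps)
qed

lemma isometry_hyp_delta:
  "g \<in> hyp_isometries \<Longrightarrow> z \<in> upper_half \<Longrightarrow> w \<in> upper_half \<Longrightarrow> hyp_delta (g z) (g w) = hyp_delta z w"
  using hyp_isometries_mob hyp_delta_mob by auto

lemma isometry_hyp_dist: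
  "g \<in> hyp_isometries \<Longrightarrow> z \<in> upper_half \<Longrightarrow> w \<in> upper_half \<Longrightarrow> hyp_dist (g z) (g w) = hyp_dist z w"
  by (simp add: hyp_dist_delta isometry_hyp_delta)

lemma continuous_on_hyp_dist:
  assumes "continuous_on S f" "continuous_on S g" "f ` S \<subseteq> upper_half" "g ` S \<subseteq> upper_half"
  shows "continuous_on S (\<lambda>x. hyp_dist (f x) (g x))"
proof -
  have c: "continuous_on S (\<lambda>x. hyp_delta (f x) (g x))"
    unfolding hyp_delta_def using assms by (intro continuous_intros) (force simp: upper_half_def)+
  have b: "1 + hyp_delta (f x) (g x) \<ge> 1" if "x \<in> S" for x
    using hyp_delta_nonneg[of "f x" "g x"] assms(3,4) that by (auto simp: image_subset_iff)
  show ?thesis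
    unfolding hyp_dist_delta
    by (rule continuous_on_compose2[OF continuous_on_arcosh[OF order.refl] continuous_on_add[OF continuous_on_const c]])
      (use b in auto)
qed

text \<open>The image of the imaginary axis under an isometry, at unit speed.  Representing oriented complete
  geodesics by isometries reduces questions about them to the imaginary axis.\<close>

definition geod :: "(complex \<Rightarrow> complex) \<Rightarrow> real \<Rightarrow> complex" where
  "geod A t = A (\<i> * of_real (exp t))"

lemma axis_upper_half [simp]: "\<i> * of_real (exp t) \<in> upper_half"
  by (simp add: upper_half_def)

lemma geod_upper_half: "A \<in> hyp_isometries \<Longrightarrow> geod A t \<in> upper_half"
  by (simp add: geod_def isometry_upper_half)

lemma geod_compose: "geod (g \<circ> A) t = g (geod A t)"
  by (simp add: geod_def)

lemma hyp_dist_axis: "hyp_dist (\<i> * of_real (exp s)) (\<i> * of_real (exp t)) = \<bar>s - t\<bar>"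
proof -
  have "(cmod (\<i> * of_real (exp s) - \<i> * of_real (exp t)))\<^sup>2 = (exp s - exp t)\<^sup>2"
    by (simp add: cmod_def)
  then have "1 + hyp_delta (\<i> * of_real (exp s)) (\<i> * of_real (exp t)) = 1 + (exp s - exp t)\<^sup>2 / (2 * exp s * exp t)"
    by (simp add: hyp_delta_def)
  also have "\<dots> = cosh (s - t)"
    by (simp add: cosh_def exp_diff exp_minus field_simps power2_eq_square)
  also have "\<dots> = cosh \<bar>s - t\<bar>" by simp
  finally show ?thesis by (rule hyp_dist_eqI) simp
qed

lemma hyp_dist_geod: "A \<in> hyp_isometries \<Longrightarrow> hyp_dist (geod A s) (geod A t) = \<bar>s - t\<bar>"
  by (simp add: geod_def isometry_hyp_dist hyp_dist_axis)

lemma continuous_on_geod: "A \<in> hyp_isometries \<Longrightarrow> continuous_on S (geod A)"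
  unfolding geod_def[abs_def]
  by (rule continuous_on_compose2[OF isometry_continuous_on[OF _ order_refl]]) (auto intro!: continuous_intros)

lemma geod_inj: "A \<in> hyp_isometries \<Longrightarrow> geod A s = geod A t \<longleftrightarrow> s = t"
  by (metis abs_eq_0 eq_iff_diff_eq_0 geod_upper_half hyp_dist_eq_0 hyp_dist_geod)

lemma geod_shift:
  assumes "A \<in> hyp_isometries"
  obtains A' where "A' \<in> hyp_isometries" "\<And>t. geod A' t = geod A (t + k)"
proof -
  let ?S = "mob (exp (k/2)) 0 0 (exp (- k/2))"
  have d: "exp (k/2) * exp (- k/2) - 0 * 0 = (1::real)" by (simp add: exp_minus)
  then have S: "?S \<in> hyp_isometries" using hyp_isometries_mob by blast
  have "complex_of_real (exp (k/2)) / of_real (exp (- (k/2))) = of_real (exp (k/2) / exp (- (k/2)))" by simp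
  also have "exp (k/2) / exp (- (k/2)) = exp k" by (metis diff_minus_eq_add exp_diff field_sum_of_halves)
  finally have e: "complex_of_real (exp (k/2)) / of_real (exp (- (k/2))) = of_real (exp k)" .
  have "?S (\<i> * of_real (exp t)) = \<i> * of_real (exp t) * (complex_of_real (exp (k/2)) / of_real (exp (- (k/2))))" for t
    by (simp add: mob_def)
  then have S1: "?S (\<i> * of_real (exp t)) = \<i> * of_real (exp t) * of_real (exp k)" for t
    by (simp only: e)
  have "?S (\<i> * of_real (exp t)) = \<i> * of_real (exp (t + k))" for t
    unfolding S1 by (simp add: exp_add mult.assoc)
  then have "geod (A \<circ> ?S) t = geod A (t + k)" for t by (simp add: geod_def)
  then show ?thesis using that isometry_compose[OF assms S] by blast
qed

lemma isometry_fix_two_axis_points: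
  assumes "g \<in> hyp_isometries" "s \<noteq> t" "g (\<i> * of_real (exp s)) = \<i> * of_real (exp s)"
    "g (\<i> * of_real (exp t)) = \<i> * of_real (exp t)"
  shows "g = id"
proof -
  obtain a b c d where g: "g = mob a b c d" "a * d - b * c = 1" using assms(1) hyp_isometries_mob by blast
  have *: "a = d \<and> b = - c * (exp x)\<^sup>2" if "g (\<i> * of_real (exp x)) = \<i> * of_real (exp x)" for x
  proof -
    let ?z = "\<i> * complex_of_real (exp x)"
    have nz: "of_real c * ?z + of_real d \<noteq> 0" by (rule mob_denom_nonzero[OF axis_upper_half g(2)])
    have "(of_real a * ?z + of_real b) / (of_real c * ?z + of_real d) = ?z"
      using that g(1) by (simp add: mob_def)
    then have "of_real a * ?z + of_real b = ?z * (of_real c * ?z + of_real d)"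
      using nz by (metis nonzero_divide_eq_eq)
    then show ?thesis by (simp add: complex_eq_iff power2_eq_square)
  qed
  have "c * (exp s)\<^sup>2 = c * (exp t)\<^sup>2" using *[OF assms(3)] *[OF assms(4)] by linarith
  moreover have "(exp s)\<^sup>2 \<noteq> (exp t)\<^sup>2" using assms(2)
    by (metis exp_ge_zero exp_inj_iff power2_eq_imp_eq)
  ultimately have "c = 0" by simp
  then have "b = 0" "a = d" using *[OF assms(3)] by auto
  then have "a * a = 1" using g(2) \<open>c = 0\<close> by simp
  then show ?thesis using g(1) \<open>c = 0\<close> \<open>b = 0\<close> \<open>a = d\<close> by (auto simp: mob_def fun_eq_iff)
qed

lemma geod_unique:
  assumes "A \<in> hyp_isometries" "B \<in> hyp_isometries" "s \<noteq> t" "geod A s = geod B s" "geod A t = geod B t"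
  shows "A = B"
proof -
  obtain h where h: "h \<in> hyp_isometries" "B \<circ> h = id" "h \<circ> B = id" by (rule isometry_inverse[OF assms(2)])
  have "h \<circ> A = id"
  proof (rule isometry_fix_two_axis_points[OF isometry_compose[OF h(1) assms(1)] assms(3)])
    show "(h \<circ> A) (\<i> * of_real (exp s)) = \<i> * of_real (exp s)"
      using assms(4) h(3) by (simp add: geod_def fun_eq_iff)
    show "(h \<circ> A) (\<i> * of_real (exp t)) = \<i> * of_real (exp t)"
      using assms(5) h(3) by (simp add: geod_def fun_eq_iff)
  qed
  then show ?thesis using h(2) by (metis comp_assoc comp_id id_comp)
qed

text \<open>Two points and their distances to a third point on the segment between them determine that
  point: the two cosine equations are linear in the imaginary part and the squared modulus.\<close>

lemma axis_between:
  assumes "y \<in> upper_half" "0 < L" "hyp_dist (\<i> * of_real (exp 0)) y = a" "hyp_dist y (\<i> * of_real (exp L)) = L - a"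
  shows "y = \<i> * of_real (exp a)"
proof -
  define u v E where "u = Re y" and "v = Im y" and "E = exp L"
  have v: "v > 0" using assms by (simp add: v_def upper_half_def)
  have E: "E > 1" using assms(2) by (simp add: E_def)
  have 1: "1 + hyp_delta (\<i> * of_real (exp 0)) y = cosh a"
    by (rule hyp_dist_eqD[OF axis_upper_half assms(1,3)])
  have 2: "1 + hyp_delta y (\<i> * of_real (exp L)) = cosh (L - a)"
    by (rule hyp_dist_eqD[OF assms(1) axis_upper_half assms(4)])
  have d1: "hyp_delta (\<i> * of_real (exp 0)) y = (u\<^sup>2 + (1 - v)\<^sup>2) / (2 * v)"
    by (simp add: hyp_delta_def cmod_def u_def v_def)
  have d2: "hyp_delta y (\<i> * of_real (exp L)) = (u\<^sup>2 + (v - E)\<^sup>2) / (2 * v * E)"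
    by (simp add: hyp_delta_def cmod_def u_def v_def E_def)
  have e: "exp a * exp (- a) = 1" by (simp add: exp_minus)
  have "u\<^sup>2 + (1 - v)\<^sup>2 = 2 * v * (cosh a - 1)" using 1 v unfolding d1 by (simp add: field_simps)
  then have A: "u\<^sup>2 + v\<^sup>2 + 1 = v * (exp a + exp (- a))" by (simp add: cosh_def power2_eq_square algebra_simps)
  have E_mult: "v * E * (E * x + y / E) = v * (E\<^sup>2 * x + y)" for x y
    using E by (simp add: field_simps power2_eq_square)
  have "u\<^sup>2 + (v - E)\<^sup>2 = 2 * v * E * (cosh (L - a) - 1)" using 2 v E unfolding d2 by (simp add: field_simps)
  moreover have "2 * cosh (L - a) = E * exp (- a) + exp a / E"
    by (simp add: cosh_def E_def exp_diff exp_minus field_simps)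
  then have "2 * v * E * cosh (L - a) = v * E * (E * exp (- a) + exp a / E)"
    by (metis (no_types, lifting) mult.assoc mult.left_commute)
  then have "2 * v * E * cosh (L - a) = v * (E\<^sup>2 * exp (- a) + exp a)"
    using E by (metis (no_types, lifting) E_mult)
  ultimately have B: "u\<^sup>2 + v\<^sup>2 + E\<^sup>2 = v * (E\<^sup>2 * exp (- a) + exp a)"
    by (simp add: power2_eq_square algebra_simps)
  have "(E\<^sup>2 - 1) * (v * exp (- a) - 1) = 0" using A B by (simp add: algebra_simps)
  moreover have "E\<^sup>2 > 1" using E by (simp add: one_less_power)
  ultimately have "v * exp (- a) = 1" by simp
  then have va: "v = exp a" by (simp add: exp_minus field_simps)
  have "u\<^sup>2 = 0" using A e unfolding va by (simp add: power2_eq_square algebra_simps)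
  then show ?thesis using va by (simp add: complex_eq_iff u_def v_def)
qed

text \<open>Move the first point to \<open>\<i>\<close>, rotate about \<open>\<i>\<close> until the second lies on the imaginary axis, and apply a
  half-turn about \<open>\<i>\<close> if it lies below \<open>\<i>\<close>.\<close>

lemma exists_geod_through:
  assumes "z \<in> upper_half" "w \<in> upper_half" "z \<noteq> w"
  obtains A where "A \<in> hyp_isometries" "geod A 0 = z" "geod A (hyp_dist z w) = w"
proof -
  define m where "m = sqrt (Im z)"
  have m: "m > 0" "m * m = Im z" using assms by (auto simp: m_def upper_half_def)
  have iu: "\<i> \<in> upper_half" by (simp add: upper_half_def)
  let ?B = "mob m (Re z / m) 0 (1/m)"
  have dB: "m * (1/m) - (Re z / m) * 0 = 1" using m by simp
  then have B: "?B \<in> hyp_isometries" using hyp_isometries_mob by blast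
  have Bi: "?B \<i> = z" using m iu by (simp add: mob_def complex_eq_iff field_simps)
  obtain C where C: "C \<in> hyp_isometries" "?B \<circ> C = id" "C \<circ> ?B = id" by (rule isometry_inverse[OF B])
  define w1 where "w1 = C w"
  have w1: "w1 \<in> upper_half" "?B w1 = w"
    using C(2) assms(2) isometry_upper_half[OF C(1)] by (auto simp: w1_def fun_eq_iff)
  have "w1 \<noteq> \<i>" using w1(2) Bi assms(3) by auto
  note w1 = w1 this
  \<comment> \<open>The angle \<open>th\<close> is chosen such that the rotation by it about \<open>\<i>\<close> takes \<open>w1\<close> to the imaginary axis.\<close>
  define u n r where "u = Re w1" and "n = (cmod w1)\<^sup>2" and "r = sqrt (u\<^sup>2 + ((n-1)/2)\<^sup>2)"
  have "r > 0"
  proof (rule ccontr)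
    assume "\<not> r > 0"
    then have "u = 0 \<and> n = 1" unfolding r_def
      by (metis (no_types, opaque_lifting) add.commute divide_eq_0_iff eq_iff_diff_eq_0 not_sum_power2_lt_zero not_less_iff_gr_or_eq real_sqrt_gt_0_iff sum_power2_eq_zero_iff zero_neq_numeral)
    then have "Re w1 = 0" "Im w1 = 1" using w1(1) by (auto simp: u_def n_def cmod_power2 upper_half_def power2_eq_1_iff)
    then show False using w1(3) by (simp add: complex_eq_iff)
  qed
  have "(((n-1)/2)/r)\<^sup>2 + (u/r)\<^sup>2 = ((n-1)/2)\<^sup>2/r\<^sup>2 + u\<^sup>2/r\<^sup>2" by (simp only: power_divide)
  also have "\<dots> = (u\<^sup>2 + ((n-1)/2)\<^sup>2) / r\<^sup>2" by (simp add: add_divide_distrib)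
  also have "\<dots> = 1" using \<open>r > 0\<close> unfolding r_def by (subst real_sqrt_pow2) (auto simp: sum_power2_gt_zero_iff)
  finally obtain th where th: "((n-1)/2)/r = cos th" "u/r = sin th"
    using sincos_total_2pi by metis
  define c s where "c = cos (th/2)" and "s = sin (th/2)"
  have cs: "c * c - s * (- s) = 1" "cos th = c * c - s * s" "sin th = 2 * (c * s)"
    using cos_double[of "th/2"] sin_double[of "th/2"] by (auto simp: c_def s_def power2_eq_square)
  let ?R = "mob c s (- s) c"
  have R: "?R \<in> hyp_isometries" using cs(1) hyp_isometries_mob by blast
  have Ri: "?R \<i> = \<i>"
  proof -
    have nz: "of_real (- s) * \<i> + of_real c \<noteq> (0::complex)" using cs(1) by (auto simp: complex_eq_iff)
    have "of_real c * \<i> + of_real s = \<i> * (of_real (- s) * \<i> + of_real c)" by (simp add: complex_eq_iff)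
    then show ?thesis using nz iu by (simp add: mob_def nonzero_divide_eq_eq)
  qed
  have "Re (?R w1) = 0"
  proof -
    have nz: "of_real (- s) * w1 + of_real c \<noteq> (0::complex)" by (rule mob_denom_nonzero[OF w1(1) cs(1)])
    have "?R w1 = (of_real c * w1 + of_real s) * cnj (of_real (- s) * w1 + of_real c) / (cmod (of_real (- s) * w1 + of_real c))\<^sup>2"
      by (simp only: mob_def if_P[OF w1(1)]) (rule complex_div_cnj)
    then have "Re (?R w1) = Re ((of_real c * w1 + of_real s) * cnj (of_real (- s) * w1 + of_real c)) / (cmod (of_real (- s) * w1 + of_real c))\<^sup>2"
      by (metis Re_divide_of_real)
    also have "Re ((of_real c * w1 + of_real s) * cnj (of_real (- s) * w1 + of_real c)) = u * (c * c - s * s) + (1 - n) * (c * s)"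
      unfolding u_def n_def cmod_power2 by (simp add: power2_eq_square algebra_simps)
    also have "\<dots> = u * cos th + (1 - n)/2 * sin th" using cs by simp
    also have "\<dots> = u * (((n-1)/2)/r) + (1 - n)/2 * (u / r)" by (simp only: th)
    also have "\<dots> = 0" using \<open>r > 0\<close> by (simp add: field_simps)
    finally show ?thesis by simp
  qed
  define E where "E = Im (?R w1)"
  have E: "E > 0" using isometry_upper_half[OF R w1(1)] by (simp add: E_def upper_half_def)
  have RE: "?R w1 = \<i> * of_real E" using \<open>Re (?R w1) = 0\<close> by (simp add: complex_eq_iff E_def)
  have "E \<noteq> 1"
    using RE Ri w1(3) isometry_bij[OF R] by (metis bij_is_inj injD mult.right_neutral of_real_1)
  have "\<exists>Q E. Q \<in> hyp_isometries \<and> Q \<i> = \<i> \<and> Q w1 = \<i> * of_real E \<and> E > 1"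
  proof (cases "E > 1")
    case True then show ?thesis using R Ri RE by blast
  next
    case False
    let ?J = "mob 0 1 (-1) 0"
    have "(0::real) * 0 - 1 * (-1) = 1" by simp
    then have J: "?J \<in> hyp_isometries" using hyp_isometries_mob by blast
    have J1: "?J (\<i> * of_real x) = \<i> * of_real (1/x)" if "x > 0" for x
      using that by (simp add: mob_def upper_half_def complex_eq_iff Re_divide Im_divide power2_eq_square)
    have "?J \<i> = \<i>" using J1[of 1] by simp
    then have "(?J \<circ> ?R) \<i> = \<i>" "(?J \<circ> ?R) w1 = \<i> * of_real (1/E)" using Ri RE J1[OF E] by auto
    moreover have "1/E > 1" using E \<open>E \<noteq> 1\<close> False by simp
    ultimately show ?thesis using isometry_compose[OF J R] by blast
  qed
  then obtain Q E' where Q: "Q \<in> hyp_isometries" "Q \<i> = \<i>" "Q w1 = \<i> * of_real E'" "E' > 1" by blast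
  obtain P where P: "P \<in> hyp_isometries" "Q \<circ> P = id" "P \<circ> Q = id" by (rule isometry_inverse[OF Q(1)])
  define L where "L = ln E'"
  have L: "L > 0" "exp L = E'" using Q(4) by (auto simp: L_def)
  let ?A = "?B \<circ> P"
  have A: "?A \<in> hyp_isometries" by (rule isometry_compose[OF B P(1)])
  have g0: "geod ?A 0 = z" using P(3) Q(2) Bi by (simp add: geod_def fun_eq_iff) (metis)
  have gL: "geod ?A L = w" using P(3) Q(3) w1(2) L by (simp add: geod_def fun_eq_iff) (metis)
  have "hyp_dist z w = L" using hyp_dist_geod[OF A, of 0 L] g0 gL L by simp
  then show ?thesis using that A g0 gL by blast
qed

text \<open>On a short interval a point of the curve is determined by its distances from the two ends
  (\<open>axis_between\<close>), so that the curve runs along a geodesic there.  The geodesics of overlapping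
  intervals have two points in common and are equal.\<close>

theorem local_isometry_is_geod:
  assumes g: "range g \<subseteq> upper_half"
    and loc: "\<And>t. \<exists>e>0. \<forall>s s'. \<bar>s - t\<bar> < e \<and> \<bar>s' - t\<bar> < e \<longrightarrow> hyp_dist (g s) (g s') = \<bar>s - s'\<bar>"
  obtains A where "A \<in> hyp_isometries" "g = geod A"
proof -
  have L: "\<exists>d>0. \<exists>A\<in>hyp_isometries. \<forall>t. \<bar>t - x\<bar> \<le> d \<longrightarrow> g t = geod A t" for x
  proof -
    obtain e where e: "e > 0" "\<And>s s'. \<bar>s - x\<bar> < e \<Longrightarrow> \<bar>s' - x\<bar> < e \<Longrightarrow> hyp_dist (g s) (g s') = \<bar>s - s'\<bar>"
      using loc[of x] by blast
    define l r where "l = x - e/2" and "r = x + e/2"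
    have lr: "hyp_dist (g l) (g r) = e" using e by (simp add: l_def r_def)
    have gu: "g t \<in> upper_half" for t using g by auto
    have "g l \<noteq> g r" using lr e(1) hyp_dist_eq_0[OF gu[of l] gu[of r]] by linarith
    then obtain A where A: "A \<in> hyp_isometries" "geod A 0 = g l" "geod A e = g r"
      using exists_geod_through[OF gu gu] lr by metis
    obtain h where h: "h \<in> hyp_isometries" "A \<circ> h = id" "h \<circ> A = id" by (rule isometry_inverse[OF A(1)])
    have P: "g t = geod A (t - l)" if "\<bar>t - x\<bar> \<le> e/2" for t
    proof -
      have 1: "h (g l) = \<i> * of_real (exp 0)" "h (g r) = \<i> * of_real (exp e)"
        using A h(3) by (auto simp: geod_def fun_eq_iff) (metis)+
      have "hyp_dist (g l) (g t) = t - l" "hyp_dist (g t) (g r) = e - (t - l)"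
        using e that by (auto simp: l_def r_def field_simps abs_if split: if_splits)
      then have "hyp_dist (h (g l)) (h (g t)) = t - l" "hyp_dist (h (g t)) (h (g r)) = e - (t - l)"
        by (simp_all add: isometry_hyp_dist[OF h(1) gu gu])
      then have "h (g t) = \<i> * of_real (exp (t - l))"
        unfolding 1 by (intro axis_between[OF isometry_upper_half[OF h(1) gu] e(1)])
      then have "A (h (g t)) = geod A (t - l)" by (simp add: geod_def)
      then show ?thesis using h(2) by (simp add: fun_eq_iff)
    qed
    obtain A' where A': "A' \<in> hyp_isometries" "\<And>t. geod A' t = geod A (t + (- l))"
      by (rule geod_shift[OF A(1), of "- l"]) blast
    have "g t = geod A' t" if "\<bar>t - x\<bar> \<le> e/2" for t using P[OF that] A'(2)[of t] by simp
    then show ?thesis using A'(1) e(1) by (meson half_gt_zero)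
  qed
  have U: "A = B" if "A \<in> hyp_isometries" "B \<in> hyp_isometries" "a < b"
    "\<And>t. a \<le> t \<Longrightarrow> t \<le> b \<Longrightarrow> geod A t = geod B t" for A B a b
    using geod_unique[OF that(1,2), of a b] that(3,4) by auto
  have B: "\<exists>A\<in>hyp_isometries. \<forall>t\<in>{a..b}. g t = geod A t" if "a \<le> b" for a b
    using that
  proof (induction rule: Bolzano)
    case (trans a b c)
    obtain A1 where A1: "A1 \<in> hyp_isometries" "\<forall>t\<in>{a..b}. g t = geod A1 t" using trans by blast
    obtain A2 where A2: "A2 \<in> hyp_isometries" "\<forall>t\<in>{b..c}. g t = geod A2 t" using trans by blast
    obtain d A where d: "d > 0" "A \<in> hyp_isometries" "\<And>t. \<bar>t - b\<bar> \<le> d \<Longrightarrow> g t = geod A t" using L[of b] by blast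
    show ?case
    proof (cases "a = b \<or> b = c")
      case True then show ?thesis using A1 A2 by auto
    next
      case False
      then have abc: "a < b" "b < c" using trans by auto
      have "A1 = A"
      proof (rule U[OF A1(1) d(2), of "max a (b - d)" b])
        fix t assume t: "max a (b - d) \<le> t" "t \<le> b"
        then have "g t = geod A1 t" "g t = geod A t" using A1(2) d(3)[of t] by auto
        then show "geod A1 t = geod A t" by simp
      qed (use d abc in auto)
      moreover have "A2 = A"
      proof (rule U[OF A2(1) d(2), of b "min c (b + d)"])
        fix t assume t: "b \<le> t" "t \<le> min c (b + d)"
        then have "g t = geod A2 t" "g t = geod A t" using A2(2) d(3)[of t] by auto
        then show "geod A2 t = geod A t" by simp
      qed (use d abc in auto)
      ultimately have "\<forall>t\<in>{a..c}. g t = geod A t" using A1 A2 by (metis atLeastAtMost_iff linear)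
      then show ?thesis using d by blast
    qed
  next
    case (local x)
    obtain d A where d: "d > 0" "A \<in> hyp_isometries" "\<And>t. \<bar>t - x\<bar> \<le> d \<Longrightarrow> g t = geod A t" using L[of x] by blast
    then show ?case by (intro exI[of _ d]) (auto intro!: bexI[of _ A])
  qed
  obtain A where A: "A \<in> hyp_isometries" "\<forall>t\<in>{-1..1}. g t = geod A t" using B[of "-1" 1] by auto
  have "g t = geod A t" for t
  proof -
    obtain n where n: "1 \<le> n" "\<bar>t\<bar> \<le> n" by (metis max.cobounded1 max.cobounded2)
    then have "- n \<le> n" by simp
    then obtain A' where A': "A' \<in> hyp_isometries" "\<forall>t\<in>{-n..n}. g t = geod A' t" using B by blast
    have "A' = A"
    proof (rule U[OF A'(1) A(1), of "-1" 1])
      fix t :: real assume t: "-1 \<le> t" "t \<le> 1"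
      then have "g t = geod A t" "g t = geod A' t" using A(2) A'(2) n by auto
      then show "geod A' t = geod A t" by simp
    qed simp
    then show ?thesis using A' n by (auto simp: abs_le_iff)
  qed
  then show ?thesis using that A by blast
qed

text \<open>On which side of the geodesic from \<open>q\<close> through \<open>q'\<close> a point lies: the expression is the
  imaginary part of the quotient of the positions of \<open>z\<close> and \<open>q'\<close> in the disc model centred at \<open>q\<close>,
  cleared of its denominators.  It is a polynomial, hence jointly continuous.\<close>

definition side :: "complex \<Rightarrow> complex \<Rightarrow> complex \<Rightarrow> real" where
  "side q q' z = Im ((z - q) * (cnj z - q) * cnj ((q' - q) * (cnj q' - q)))"

lemma side_mob:
  assumes "q \<in> upper_half" "q' \<in> upper_half" "z \<in> upper_half" "a * d - b * c = 1"
  shows "0 < side (mob a b c d q) (mob a b c d q') (mob a b c d z) \<longleftrightarrow> 0 < side q q' z"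
proof -
  let ?D = "\<lambda>z. of_real c * z + of_real d"
  let ?N = "(cmod (?D z))\<^sup>2 * (cmod (?D q'))\<^sup>2 * (cmod (?D q))^4"
  have nz: "?D z \<noteq> 0" "?D q \<noteq> 0" "?D q' \<noteq> 0" using mob_denom_nonzero assms by blast+
  have cn: "of_real c * cnj w + of_real d = cnj (?D w)" for w by simp
  have E: "(mob a b c d w - mob a b c d q) * (cnj (mob a b c d w) - mob a b c d q) = (w - q) * (cnj w - q) / (of_real ((cmod (?D w))\<^sup>2) * (?D q)\<^sup>2)"
    if w: "w \<in> upper_half" for w
  proof -
    have "(mob a b c d w - mob a b c d q) * (cnj (mob a b c d w) - mob a b c d q) =
      (w - q) * (cnj w - q) / ((?D w * cnj (?D w)) * (?D q)\<^sup>2)"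
      unfolding mob_diff[OF w assms(1,4)] mob_cnj_diff[OF w assms(1,4)] cn by (simp add: power2_eq_square mult_ac)
    also have "?D w * cnj (?D w) = of_real ((cmod (?D w))\<^sup>2)" by (rule complex_norm_square[symmetric])
    finally show ?thesis .
  qed
  have "(?D q)\<^sup>2 * cnj ((?D q)\<^sup>2) = of_real ((cmod ((?D q)\<^sup>2))\<^sup>2)" by (rule complex_norm_square[symmetric])
  then have D4: "(?D q)\<^sup>2 * cnj ((?D q)\<^sup>2) = of_real ((cmod (?D q))^4)" by (simp add: norm_power)
  have "(mob a b c d z - mob a b c d q) * (cnj (mob a b c d z) - mob a b c d q) *
     cnj ((mob a b c d q' - mob a b c d q) * (cnj (mob a b c d q') - mob a b c d q))
     = (z - q) * (cnj z - q) * cnj ((q' - q) * (cnj q' - q)) / (of_real ((cmod (?D z))\<^sup>2) * of_real ((cmod (?D q'))\<^sup>2) * ((?D q)\<^sup>2 * cnj ((?D q)\<^sup>2)))"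
    unfolding E[OF assms(3)] E[OF assms(2)] by (simp add: mult_ac)
  also have "\<dots> = (z - q) * (cnj z - q) * cnj ((q' - q) * (cnj q' - q)) / of_real ?N"
    unfolding D4 by simp
  finally have "side (mob a b c d q) (mob a b c d q') (mob a b c d z) = side q q' z / ?N"
    unfolding side_def by (metis Im_divide_of_real)
  moreover have "?N > 0" using nz by simp
  ultimately show ?thesis by (simp add: zero_less_divide_iff)
qed

lemma side_isometry:
  "g \<in> hyp_isometries \<Longrightarrow> q \<in> upper_half \<Longrightarrow> q' \<in> upper_half \<Longrightarrow> z \<in> upper_half \<Longrightarrow>
    0 < side (g q) (g q') (g z) \<longleftrightarrow> 0 < side q q' z"
  using hyp_isometries_mob side_mob by auto

lemma side_axis:
  assumes "s < t" shows "0 < side (\<i> * of_real (exp s)) (\<i> * of_real (exp t)) z \<longleftrightarrow> Re z < 0"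
proof -
  have "side (\<i> * of_real (exp s)) (\<i> * of_real (exp t)) z = - (2 * exp s * ((exp t)\<^sup>2 - (exp s)\<^sup>2)) * Re z"
    by (simp add: side_def power2_eq_square algebra_simps)
  moreover have "(exp t)\<^sup>2 - (exp s)\<^sup>2 > 0" using assms by (simp add: power_strict_mono)
  ultimately show ?thesis by (simp add: mult_less_0_iff zero_less_mult_iff)
qed

text \<open>With \<open>geod A\<close> directed upwards along the imaginary axis for the identity \<open>A\<close>, the left side is where
  the real part is negative.\<close>

definition left_side :: "(complex \<Rightarrow> complex) \<Rightarrow> complex set" where
  "left_side A = A ` {w \<in> upper_half. Re w < 0}"

lemma left_side_iff:
  assumes "A \<in> hyp_isometries" "s < t" "z \<in> upper_half"
  shows "z \<in> left_side A \<longleftrightarrow> 0 < side (geod A s) (geod A t) z"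
proof -
  obtain h where h: "h \<in> hyp_isometries" "A \<circ> h = id" "h \<circ> A = id" by (rule isometry_inverse[OF assms(1)])
  have Ah: "A (h z) = z" and hA: "\<And>w. h (A w) = w" using h by (auto simp: fun_eq_iff)
  have hz: "h z \<in> upper_half" by (rule isometry_upper_half[OF h(1) assms(3)])
  have "z \<in> left_side A \<longleftrightarrow> Re (h z) < 0"
    unfolding left_side_def using Ah hA hz by (auto simp: image_iff)
  also have "\<dots> \<longleftrightarrow> 0 < side (\<i> * of_real (exp s)) (\<i> * of_real (exp t)) (h z)"
    using side_axis[OF assms(2)] by simp
  also have "\<dots> \<longleftrightarrow> 0 < side (geod A s) (geod A t) (A (h z))"
    unfolding geod_def by (rule side_isometry[OF assms(1) _ _ hz, symmetric]) simp_all
  finally show ?thesis using Ah by simp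
qed

text \<open>When the geodesic is moved to the imaginary axis, the real part changes sign along the segment.\<close>

lemma segment_crosses_geod:
  assumes A: "A \<in> hyp_isometries" and yz: "closed_segment y z \<subseteq> upper_half" "y \<in> left_side A" "z \<notin> left_side A"
  obtains t where "geod A t \<in> closed_segment y z"
proof -
  obtain h where h: "h \<in> hyp_isometries" "A \<circ> h = id" "h \<circ> A = id" by (rule isometry_inverse[OF A])
  have Ah: "\<And>w. A (h w) = w" using h by (auto simp: fun_eq_iff)
  have "Re (h y) < 0" using yz(2) h by (auto simp: left_side_def fun_eq_iff)
  moreover have "Re (h z) \<ge> 0"
    using yz(1,3) Ah isometry_upper_half[OF h(1), of z] unfolding left_side_def image_iff by (smt (verit) ends_in_segment(2) mem_Collect_eq subsetD)
  moreover have "connected ((\<lambda>w. Re (h w)) ` closed_segment y z)"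
    by (rule connected_continuous_image[OF continuous_on_Re[OF isometry_continuous_on[OF h(1) yz(1)]]]) simp
  ultimately have "0 \<in> (\<lambda>w. Re (h w)) ` closed_segment y z"
    unfolding connected_iff_interval
    using imageI[OF ends_in_segment(1)[of y z], of "\<lambda>w. Re (h w)"] imageI[OF ends_in_segment(2)[of z y], of "\<lambda>w. Re (h w)"]
    by (meson less_imp_le)
  then obtain w where w: "w \<in> closed_segment y z" "Re (h w) = 0" by auto
  then have "Im (h w) > 0" using yz(1) isometry_upper_half[OF h(1), of w] by (auto simp: upper_half_def)
  then have "h w = \<i> * of_real (exp (ln (Im (h w))))" using w by (simp add: complex_eq_iff)
  then have "geod A (ln (Im (h w))) = w" using Ah unfolding geod_def by metis
  then show ?thesis using that w by metis
qed

lemma geod_has_vector_derivative: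
  assumes "A \<in> hyp_isometries"
  shows "(geod A has_vector_derivative deriv A (\<i> * of_real (exp t)) * (\<i> * of_real (exp t))) (at t within S)"
proof -
  have 1: "((\<lambda>t. \<i> * of_real (exp t)) has_vector_derivative \<i> * of_real (exp t)) (at t within S)"
    unfolding has_vector_derivative_def
    by (auto intro!: derivative_eq_intros simp: scaleR_conv_of_real fun_eq_iff)
  show ?thesis
    using field_vector_diff_chain_within[OF 1 DERIV_subset[OF isometry_has_deriv[OF assms axis_upper_half] subset_UNIV]]
    by (simp add: geod_def[abs_def] o_def mult.commute)
qed

section \<open>Integration over the half-plane and Stokes' formula on one side of a geodesic\<close>

lemma lborel_complex_prod: "distr (lborel \<Otimes>\<^sub>M lborel) borel (\<lambda>(x, y). Complex x y) = (lborel :: complex measure)"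
proof (rule lborel_eqI[symmetric])
  fix l u :: complex assume lu: "\<And>b. b \<in> Basis \<Longrightarrow> l \<bullet> b \<le> u \<bullet> b"
  have le: "Re l \<le> Re u" "Im l \<le> Im u" using lu[of 1] lu[of \<i>] by (simp_all add: Basis_complex_def inner_complex_def)
  have m: "(\<lambda>(x, y). Complex x y) \<in> borel_measurable borel"
    unfolding Complex_eq split_beta by (intro borel_measurable_continuous_onI continuous_intros)
  have v: "(\<lambda>(x, y). Complex x y) -` box l u = {Re l<..<Re u} \<times> {Im l<..<Im u}"
    by (auto simp: box_def Basis_complex_def)
  have "emeasure (distr lborel borel (\<lambda>(x, y). Complex x y)) (box l u) = emeasure lborel ({Re l<..<Re u} \<times> {Im l<..<Im u})"
    using m v by (subst emeasure_distr) auto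
  also have "\<dots> = ennreal (Re u - Re l) * ennreal (Im u - Im l)"
    using le by (subst lborel_prod[symmetric], subst lborel.emeasure_pair_measure_Times) auto
  also have "\<dots> = (\<Prod>b\<in>Basis. (u - l) \<bullet> b)"
    using le by (simp add: Basis_complex_def ennreal_mult'')
  finally show "emeasure (distr (lborel \<Otimes>\<^sub>M lborel) borel (\<lambda>(x, y). Complex x y)) (box l u) = (\<Prod>b\<in>Basis. (u - l) \<bullet> b)"
    by (simp add: lborel_prod)
qed simp

text \<open>Change of variables is available for Cartesian powers of the reals; this identification transports
  it to the complex plane.\<close>

lemma lborel_complex_vec: "distr lborel borel (\<lambda>x::real^2. Complex (x$1) (x$2)) = (lborel :: complex measure)"
proof (rule lborel_eqI[symmetric])
  fix l u :: complex assume lu: "\<And>b. b \<in> Basis \<Longrightarrow> l \<bullet> b \<le> u \<bullet> b"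
  have le: "Re l \<le> Re u" "Im l \<le> Im u" using lu[of 1] lu[of \<i>] by (simp_all add: Basis_complex_def inner_complex_def)
  have m: "(\<lambda>x::real^2. Complex (x$1) (x$2)) \<in> borel_measurable borel"
    unfolding Complex_eq by (intro borel_measurable_continuous_onI continuous_intros)
  have B: "(Basis :: (real^2) set) = {axis 1 1, axis 2 1}"
    by (auto simp: Basis_vec_def UNIV_2)
  have ne: "axis 1 1 \<noteq> (axis 2 1 :: real^2)" by (simp add: axis_eq_axis)
  have v: "(\<lambda>x::real^2. Complex (x$1) (x$2)) -` box l u = box (vector [Re l, Im l]) (vector [Re u, Im u])"
    by (auto simp: box_def Basis_complex_def B inner_axis)
  have "emeasure (distr lborel borel (\<lambda>x::real^2. Complex (x$1) (x$2))) (box l u) = emeasure lborel (box (vector [Re l, Im l]) (vector [Re u, Im u]) :: (real^2) set)"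
    using m v by (subst emeasure_distr) auto
  also have "\<dots> = (\<Prod>b\<in>Basis. ((vector [Re u, Im u] :: real^2) - vector [Re l, Im l]) \<bullet> b)"
    using le by (intro emeasure_lborel_box) (auto simp: B inner_axis)
  also have "\<dots> = (\<Prod>b\<in>Basis. (u - l) \<bullet> b)"
    using ne by (simp add: Basis_complex_def B inner_axis inner_diff_left)
  finally show "emeasure (distr lborel borel (\<lambda>x::real^2. Complex (x$1) (x$2))) (box l u) = (\<Prod>b\<in>Basis. (u - l) \<bullet> b)" .
qed simp

lemma integral_complex_iterated:
  fixes f :: "complex \<Rightarrow> real"
  assumes "integrable lborel f"
  shows "(LINT z|lborel. f z) = (LINT x|lborel. LINT y|lborel. f (Complex x y))"
    "(LINT z|lborel. f z) = (LINT y|lborel. LINT x|lborel. f (Complex x y))"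
proof -
  let ?C = "\<lambda>(x, y). Complex x y"
  have "?C \<in> borel_measurable borel"
    unfolding Complex_eq split_beta by (intro borel_measurable_continuous_onI continuous_intros)
  then have m: "?C \<in> borel_measurable (lborel \<Otimes>\<^sub>M lborel)" by (simp add: lborel_prod)
  have fm: "f \<in> borel_measurable borel" using borel_measurable_integrable[OF assms] by simp
  have i: "integrable (lborel \<Otimes>\<^sub>M lborel) (\<lambda>(x, y). f (Complex x y))"
    using assms integrable_distr_eq[OF m fm] unfolding lborel_complex_prod by (simp add: split_beta')
  have e: "(LINT z|lborel. f z) = integral\<^sup>L (lborel \<Otimes>\<^sub>M lborel) (\<lambda>(x, y). f (Complex x y))"
    using integral_distr[OF m fm] unfolding lborel_complex_prod by (simp add: split_beta')
  show "(LINT z|lborel. f z) = (LINT x|lborel. LINT y|lborel. f (Complex x y))"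
    using lborel_pair.integral_fst'[OF i] e by simp
  show "(LINT z|lborel. f z) = (LINT y|lborel. LINT x|lborel. f (Complex x y))"
    using lborel_pair.integral_snd[OF i] e by simp
qed

lemma isometry_borel_measurable: "g \<in> hyp_isometries \<Longrightarrow> g \<in> borel_measurable borel"
proof -
  assume g: "g \<in> hyp_isometries"
  have eq: "g = (\<lambda>z. if z \<in> upper_half then g z else z)" using isometry_off_upper_half[OF g] by auto
  show ?thesis
    by (subst eq, rule borel_measurable_continuous_on_if)
      (auto simp: open_upper_half isometry_continuous_on[OF g])
qed

lemma deriv_isometry_continuous_on:
  "g \<in> hyp_isometries \<Longrightarrow> continuous_on upper_half (deriv g)"
proof -
  assume g: "g \<in> hyp_isometries"
  have "continuous_on upper_half (\<lambda>z. Complex (Re (deriv g z)) (Im (deriv g z)))"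
    unfolding Complex_eq
    by (intro continuous_intros smooth_continuous_on[OF smooth_isometry_deriv(1)[OF g]] smooth_continuous_on[OF smooth_isometry_deriv(2)[OF g]])
  then show ?thesis by simp
qed

text \<open>Substitution of an isometry in an integral over the half-plane; the Jacobian determinant of a
  holomorphic map is the squared modulus of its derivative.\<close>

lemma integral_isometry:
  fixes f :: "complex \<Rightarrow> real"
  assumes g: "g \<in> hyp_isometries" and f: "set_integrable lborel upper_half f"
  shows "(LINT z:upper_half|lborel. (cmod (deriv g z))\<^sup>2 * f (g z)) = (LINT z:upper_half|lborel. f z)"
proof -
  let ?T = "\<lambda>x::real^2. Complex (x$1) (x$2)" and ?U = "\<lambda>z. vector [Re z, Im z] :: real^2"
  let ?S = "?T -` upper_half"
  let ?G = "\<lambda>x. ?U (g (?T x))" and ?D = "\<lambda>x h. ?U (deriv g (?T x) * ?T h)"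
  have TU: "?T (?U z) = z" for z by simp
  have UT: "?U (?T x) = x" for x by (simp add: vec_eq_iff forall_2)
  have T: "bounded_linear ?T"
    by (rule linear_conv_bounded_linear[THEN iffD1]) (simp add: linear_iff complex_eq_iff)
  have U: "bounded_linear ?U"
    by (rule linear_conv_bounded_linear[THEN iffD1]) (simp add: linear_iff vec_eq_iff forall_2)
  have Tm: "?T \<in> borel_measurable borel"
    by (intro borel_measurable_continuous_onI bounded_linear.continuous_on[OF T] continuous_on_id)
  have Hb: "upper_half \<in> sets borel" using open_upper_half by simp
  have transport: "(integrable lborel h \<longleftrightarrow> integrable lborel (\<lambda>x. h (?T x))) \<and> (LINT z|lborel. h z) = (LINT x|lborel. h (?T x))"
    if h: "h \<in> borel_measurable borel" for h :: "complex \<Rightarrow> real"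
    using integrable_distr_eq[of ?T lborel borel h] integral_distr[of ?T lborel borel h] Tm h
    unfolding lborel_complex_vec by simp
  have Sm: "?S \<in> sets borel" using measurable_sets[OF Tm Hb] by simp
  define F where "F = (\<lambda>z. indicator upper_half z * f z)"
  have Fm: "F \<in> borel_measurable borel" and Fi: "integrable lborel F"
    using f borel_measurable_integrable[OF f[unfolded set_integrable_def]] by (auto simp: set_integrable_def F_def)
  define Fg where "Fg = (\<lambda>z. indicator upper_half z * ((cmod (deriv g z))\<^sup>2 * f (g z)))"
  have Fg_eq: "Fg z = (if z \<in> upper_half then (cmod (deriv g z))\<^sup>2 else 0) * F (g z)" for z
    using isometry_upper_half_iff[OF g] by (auto simp: Fg_def F_def)
  have Fgm: "Fg \<in> borel_measurable borel"
    unfolding Fg_eq[abs_def]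
    by (intro borel_measurable_times measurable_compose[OF isometry_borel_measurable[OF g] Fm]
        borel_measurable_continuous_on_if Hb continuous_intros deriv_isometry_continuous_on[OF g])
  have der: "(?G has_derivative ?D x) (at x within ?S)" if "x \<in> ?S" for x
  proof -
    have "((\<lambda>x. g (?T x)) has_derivative (\<lambda>h. deriv g (?T x) * ?T h)) (at x within ?S)"
      using has_derivative_compose[OF bounded_linear_imp_has_derivative[OF T]]
        isometry_has_deriv[OF g, of "?T x"] that unfolding has_field_derivative_def by fastforce
    then show ?thesis by (rule bounded_linear.has_derivative[OF U])
  qed
  have inj: "inj_on ?G ?S"
  proof (rule inj_onI)
    fix x y assume "?G x = ?G y"
    then have "g (?T x) = g (?T y)" by (metis TU)
    then have "?T x = ?T y" using isometry_bij[OF g] by (meson bij_is_inj injD)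
    then show "x = y" by (metis UT)
  qed
  have img: "?G ` ?S = ?S"
  proof (intro set_eqI iffI)
    fix x assume "x \<in> ?G ` ?S" then show "x \<in> ?S" using isometry_upper_half[OF g] TU by auto
  next
    fix x assume x: "x \<in> ?S"
    obtain h where h: "h \<in> hyp_isometries" "g \<circ> h = id" "h \<circ> g = id" by (rule isometry_inverse[OF g])
    have "?G (?U (h (?T x))) = x" using h(2) UT TU by (simp add: fun_eq_iff)
    moreover have "?U (h (?T x)) \<in> ?S" using x isometry_upper_half[OF h(1)] by simp
    ultimately show "x \<in> ?G ` ?S" by (metis (no_types, lifting) image_eqI)
  qed
  define D where "D = ?D"
  have "det (matrix (D x)) = (Re (deriv g (?T x)))\<^sup>2 + (Im (deriv g (?T x)))\<^sup>2" for x
    by (simp add: D_def det_2 matrix_def axis_def power2_eq_square)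
  then have det: "\<bar>det (matrix (D x))\<bar> = (cmod (deriv g (?T x)))\<^sup>2" for x
    by (simp only: cmod_power2) simp
  let ?f = "\<lambda>x. vec (f (?T x)) :: real^1"
  have Fi': "integrable lborel (\<lambda>x. F (?T x))" using transport[OF Fm] Fi by simp
  have absint: "(\<lambda>x. f (?T x)) absolutely_integrable_on ?S"
    using integrable_completion[of "\<lambda>x. F (?T x)" lborel] Fi' measurable_compose[OF Tm Fm]
    by (simp add: set_integrable_def F_def indicator_def vimage_def)
  have int_eq: "integral ?S (\<lambda>x. f (?T x)) = (LINT x|lborel. F (?T x))"
    using set_lebesgue_integral_eq_integral(2)[OF absint] integral_completion[of "\<lambda>x. F (?T x)" lborel] measurable_compose[OF Tm Fm]
    by (simp add: set_lebesgue_integral_def F_def indicator_def vimage_def)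
  have "?f absolutely_integrable_on ?S \<and> integral ?S ?f = vec (LINT x|lborel. F (?T x))"
    using absint int_eq by (simp add: absolutely_integrable_on_1_iff integral_on_1_eq)
  then have b: "?f absolutely_integrable_on ?G ` ?S \<and> integral (?G ` ?S) ?f = vec (LINT x|lborel. F (?T x))"
    unfolding img .
  define f1 G1 where "f1 = ?f" and "G1 = ?G"
  have "(\<lambda>x. \<bar>det (matrix (D x))\<bar> *\<^sub>R f1 (G1 x)) absolutely_integrable_on ?S \<and>
      integral ?S (\<lambda>x. \<bar>det (matrix (D x))\<bar> *\<^sub>R f1 (G1 x)) = vec (LINT x|lborel. F (?T x))"
  proof (subst has_absolute_integral_change_of_variables)
    show "?S \<in> sets lebesgue" using Sm by (simp add: sets_completionI_sets)
    show "(G1 has_derivative D x) (at x within ?S)" if "x \<in> ?S" for x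
      using der[OF that] by (simp only: D_def G1_def)
    show "inj_on G1 ?S" using inj by (simp only: G1_def)
    show "f1 absolutely_integrable_on G1 ` ?S \<and> integral (G1 ` ?S) f1 = vec (LINT x|lborel. F (?T x))"
      using b by (simp only: f1_def G1_def)
  qed
  then have "(\<lambda>x. \<bar>det (matrix (D x))\<bar> *\<^sub>R ?f (?G x)) absolutely_integrable_on ?S \<and>
      integral ?S (\<lambda>x. \<bar>det (matrix (D x))\<bar> *\<^sub>R ?f (?G x)) = vec (LINT x|lborel. F (?T x))"
    by (simp only: f1_def G1_def)
  then have R: "(\<lambda>x. (cmod (deriv g (?T x)))\<^sup>2 * f (g (?T x))) absolutely_integrable_on ?S"
     "integral ?S (\<lambda>x. (cmod (deriv g (?T x)))\<^sup>2 * f (g (?T x))) = (LINT x|lborel. F (?T x))"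
    by (simp_all add: det absolutely_integrable_on_1_iff integral_on_1_eq)
  have "(LINT x|lborel. Fg (?T x)) = (LINT x|lborel. F (?T x))"
    using R(2) set_lebesgue_integral_eq_integral(2)[OF R(1)] integral_completion[of "\<lambda>x. Fg (?T x)" lborel] measurable_compose[OF Tm Fgm]
    by (simp add: set_lebesgue_integral_def Fg_def indicator_def vimage_def)
  then show ?thesis
    using transport[OF Fm] transport[OF Fgm] by (simp add: set_lebesgue_integral_def F_def Fg_def)
qed

subsection \<open>Compactly supported 1-forms on the half-plane\<close>

text \<open>Compactly supported 1-forms on the half-plane, extended by zero to the plane so that derivatives and
  integrals need no restriction.\<close>

definition test_form :: "complex set \<Rightarrow> one_form \<Rightarrow> bool" where
  "test_form S \<theta> \<longleftrightarrow> compact S \<and> S \<subseteq> upper_half \<and> (\<forall>z. linear (\<theta> z)) \<and>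
     (\<forall>v. smooth UNIV (\<lambda>z. \<theta> z v)) \<and> (\<forall>z v. z \<notin> S \<longrightarrow> \<theta> z v = 0)"

lemma linear_complex_real:
  assumes "linear (f :: complex \<Rightarrow> real)" shows "f v = Re v * f 1 + Im v * f \<i>"
proof -
  have "f v = f (Re v *\<^sub>R 1 + Im v *\<^sub>R \<i>)" by (rule arg_cong[of _ _ f]) (simp add: complex_eq_iff)
  then show ?thesis using assms by (simp add: linear_add linear_scale)
qed

lemma test_form_smooth: "test_form S \<theta> \<Longrightarrow> smooth UNIV (\<lambda>z. \<theta> z v)"
  by (simp add: test_form_def)

lemma test_form_zero: "test_form S \<theta> \<Longrightarrow> z \<notin> S \<Longrightarrow> \<theta> z v = 0"
  by (simp add: test_form_def)

lemma test_form_linear: "test_form S \<theta> \<Longrightarrow> linear (\<theta> z)"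
  by (simp add: test_form_def)

lemma test_form_subset: "test_form S \<theta> \<Longrightarrow> S \<subseteq> S' \<Longrightarrow> compact S' \<Longrightarrow> S' \<subseteq> upper_half \<Longrightarrow> test_form S' \<theta>"
  unfolding test_form_def by blast

lemma test_form_has_derivative:
  "test_form S \<theta> \<Longrightarrow> ((\<lambda>z. \<theta> z v) has_derivative frechet_derivative (\<lambda>z. \<theta> z v) (at z)) (at z)"
  using differentiable_has_frechet[OF smooth_differentiable[OF test_form_smooth] open_UNIV] by blast

lemma test_form_differentiable: "test_form S \<theta> \<Longrightarrow> (\<lambda>z. \<theta> z v) differentiable (at z)"
  unfolding differentiable_def using test_form_has_derivative[of S \<theta> v z] by blast

lemma test_form_derivative_continuous:
  "test_form S \<theta> \<Longrightarrow> continuous_on UNIV (\<lambda>z. frechet_derivative (\<lambda>z. \<theta> z v) (at z) u)"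
  by (rule smooth_continuous_on[OF smooth_derivative[OF test_form_smooth]])

lemma test_form_derivative_zero:
  assumes "test_form S \<theta>" "z \<notin> S" shows "frechet_derivative (\<lambda>z. \<theta> z v) (at z) u = 0"
proof -
  have "open (- S)" using assms(1) by (auto simp: test_form_def compact_imp_closed)
  from frechet_derivative_cong_open[OF this, of z "\<lambda>z. \<theta> z v" "\<lambda>_. 0"]
  show ?thesis using assms by (simp add: test_form_zero frechet_derivative_const)
qed

lemma d1_zero: "test_form S \<theta> \<Longrightarrow> z \<notin> S \<Longrightarrow> d1 \<theta> z = 0"
  by (simp add: d1_def test_form_derivative_zero)

lemma d1_continuous: "test_form S \<theta> \<Longrightarrow> continuous_on UNIV (d1 \<theta>)"
  unfolding d1_def by (intro continuous_on_diff test_form_derivative_continuous)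

lemma integrable_compact_support:
  fixes f :: "'a::euclidean_space \<Rightarrow> real"
  assumes "compact S" "continuous_on UNIV f" "\<And>z. z \<notin> S \<Longrightarrow> f z = 0"
  shows "integrable lborel f"
proof -
  have "integrable lborel (\<lambda>x. indicator S x *\<^sub>R f x)"
    by (rule borel_integrable_compact[OF assms(1) continuous_on_subset[OF assms(2) subset_UNIV]])
  moreover have "(\<lambda>x. indicator S x *\<^sub>R f x) = f" using assms(3) by (auto simp: fun_eq_iff indicator_def)
  ultimately show ?thesis by simp
qed

lemma d1_integrable: "test_form S \<theta> \<Longrightarrow> integrable lborel (d1 \<theta>)"
  using integrable_compact_support[OF _ d1_continuous d1_zero] by (auto simp: test_form_def)

lemma FTC_compact_support:
  assumes G: "\<And>x. (G has_real_derivative g x) (at x)" and g: "continuous_on UNIV g"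
    and z: "\<And>x. R \<le> \<bar>x\<bar> \<Longrightarrow> G x = 0" "\<And>x. R \<le> \<bar>x\<bar> \<Longrightarrow> g x = 0"
  shows "(LINT x|lborel. g x) = 0" "(LINT x|lborel. indicator {..<0} x * g x) = G 0"
proof -
  define Q where "Q = max R 1"
  have Q: "Q \<ge> R" "Q > 0" by (auto simp: Q_def)
  have I: "(LINT x|lborel. indicator {a..b} x *\<^sub>R g x) = G b - G a" if "a \<le> b" for a b
    by (rule integral_FTC_Icc[OF that]) (use G g in \<open>auto intro: has_vector_derivative_at_within continuous_on_subset simp: has_real_derivative_iff_has_vector_derivative\<close>)
  have "(\<lambda>x. indicator {-Q..Q} x *\<^sub>R g x) = g" using z Q by (force simp: fun_eq_iff indicator_def)
  then show "(LINT x|lborel. g x) = 0" using I[of "-Q" Q] z(1)[of Q] z(1)[of "-Q"] Q by simp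
  have "(LINT x|lborel. indicator {..<0} x * g x) = (LINT x|lborel. indicator {-Q..0} x *\<^sub>R g x)"
  proof (rule integral_cong_AE)
    show "AE x in lborel. indicator {..<0} x * g x = indicator {-Q..0} x *\<^sub>R g x"
      using AE_lborel_singleton[of "0::real"] by eventually_elim (use z Q in \<open>force simp: indicator_def\<close>)
  qed (use borel_measurable_continuous_onI[OF g] in \<open>auto intro!: borel_measurable_times borel_measurable_indicator\<close>)
  then show "(LINT x|lborel. indicator {..<0} x * g x) = G 0" using I[of "-Q" 0] z(1)[of "-Q"] Q by simp
qed

lemma test_form_bounded: "test_form S \<theta> \<Longrightarrow> \<exists>R. \<forall>z. R \<le> cmod z \<longrightarrow> z \<notin> S"
proof -
  assume "test_form S \<theta>"
  then have "bounded S" by (simp add: test_form_def compact_imp_bounded)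
  then obtain R where "\<forall>z\<in>S. cmod z \<le> R" by (auto simp: bounded_iff)
  then show ?thesis by (intro exI[of _ "R + 1"]) force
qed

text \<open>Integrals of the exterior derivative over the plane and over a coordinate half-plane, by Fubini
  and the fundamental theorem of calculus.\<close>

lemma integral_d1:
  assumes \<theta>: "test_form S \<theta>"
  shows "(LINT z|lborel. d1 \<theta> z) = 0"
    and "(LINT z|lborel. indicator {z. Re z < 0} z * d1 \<theta> z) = (LINT y|lborel. \<theta> (Complex 0 y) \<i>)"
proof -
  obtain R where R: "\<And>z. R \<le> cmod z \<Longrightarrow> z \<notin> S" using test_form_bounded[OF \<theta>] by blast
  have Rx: "Complex x y \<notin> S" if "R \<le> \<bar>x\<bar> \<or> R \<le> \<bar>y\<bar>" for x y
    using R[of "Complex x y"] that abs_Re_le_cmod[of "Complex x y"] abs_Im_le_cmod[of "Complex x y"] by auto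
  let ?Q = "\<lambda>z. frechet_derivative (\<lambda>w. \<theta> w \<i>) (at z) 1" and ?P = "\<lambda>z. frechet_derivative (\<lambda>w. \<theta> w 1) (at z) \<i>"
  have S: "compact S" using \<theta> by (simp add: test_form_def)
  have Qi: "integrable lborel ?Q" and Pi: "integrable lborel ?P"
    by (auto intro!: integrable_compact_support[OF S] test_form_derivative_continuous[OF \<theta>] test_form_derivative_zero[OF \<theta>])
  have meas: "{z. Re z < 0} \<in> sets (borel :: complex measure)" by (simp add: open_halfspace_Re_lt)
  have ind: "integrable lborel (\<lambda>z. indicator {z. Re z < 0} z * h z)" if "integrable lborel h" for h :: "complex \<Rightarrow> real"
    using integrable_mult_indicator[OF _ that, of "{z. Re z < 0}"] meas by simp
  have dx: "((\<lambda>x. \<theta> (Complex x y) v) has_real_derivative frechet_derivative (\<lambda>w. \<theta> w v) (at (Complex x y)) 1) (at x)" for x y v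
  proof -
    have 1: "((\<lambda>x. Complex x y) has_derivative (\<lambda>h. of_real h)) (at x)"
      unfolding Complex_eq by (auto intro!: derivative_eq_intros)
    have "((\<lambda>x. \<theta> (Complex x y) v) has_derivative (\<lambda>h. frechet_derivative (\<lambda>w. \<theta> w v) (at (Complex x y)) (of_real h))) (at x)"
      by (rule has_derivative_compose[OF 1 test_form_has_derivative[OF \<theta>]])
    moreover have "frechet_derivative (\<lambda>w. \<theta> w v) (at (Complex x y)) (of_real h) = frechet_derivative (\<lambda>w. \<theta> w v) (at (Complex x y)) 1 * h" for h
      using frechet_derivative_complex[OF test_form_differentiable[OF \<theta>], of v "Complex x y" "of_real h"]
      by (simp add: mult.commute)
    ultimately show ?thesis by (simp add: has_field_derivative_def)
  qed
  have dy: "((\<lambda>y. \<theta> (Complex x y) v) has_real_derivative frechet_derivative (\<lambda>w. \<theta> w v) (at (Complex x y)) \<i>) (at y)" for x y v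
  proof -
    have 1: "((\<lambda>y. Complex x y) has_derivative (\<lambda>h. \<i> * of_real h)) (at y)"
      unfolding Complex_eq by (auto intro!: derivative_eq_intros)
    have "((\<lambda>y. \<theta> (Complex x y) v) has_derivative (\<lambda>h. frechet_derivative (\<lambda>w. \<theta> w v) (at (Complex x y)) (\<i> * of_real h))) (at y)"
      by (rule has_derivative_compose[OF 1 test_form_has_derivative[OF \<theta>]])
    moreover have "frechet_derivative (\<lambda>w. \<theta> w v) (at (Complex x y)) (\<i> * of_real h) = frechet_derivative (\<lambda>w. \<theta> w v) (at (Complex x y)) \<i> * h" for h
      using frechet_derivative_complex[OF test_form_differentiable[OF \<theta>], of v "Complex x y" "\<i> * of_real h"]
      by (simp add: mult.commute)
    ultimately show ?thesis by (simp add: has_field_derivative_def)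
  qed
  have cC: "continuous_on UNIV (\<lambda>x. Complex x y)" "continuous_on UNIV (\<lambda>y. Complex x y)" for x y
    unfolding Complex_eq by (intro continuous_intros)+
  have cx: "continuous_on UNIV (\<lambda>x. frechet_derivative (\<lambda>w. \<theta> w v) (at (Complex x y)) u)" for y v u
    using continuous_on_compose2[OF test_form_derivative_continuous[OF \<theta>] cC(1)] by auto
  have cy: "continuous_on UNIV (\<lambda>y. frechet_derivative (\<lambda>w. \<theta> w v) (at (Complex x y)) u)" for x v u
    using continuous_on_compose2[OF test_form_derivative_continuous[OF \<theta>] cC(2)] by auto
  have zx: "\<theta> (Complex x y) v = 0" "frechet_derivative (\<lambda>w. \<theta> w v) (at (Complex x y)) u = 0"
    if "R \<le> \<bar>x\<bar> \<or> R \<le> \<bar>y\<bar>" for x y v u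
    using test_form_zero[OF \<theta> Rx[OF that]] test_form_derivative_zero[OF \<theta> Rx[OF that]] by auto
  have Q0: "(LINT x|lborel. ?Q (Complex x y)) = 0" for y
    by (rule FTC_compact_support(1)[OF dx cx, of R]) (use zx in auto)
  have P0: "(LINT y|lborel. ?P (Complex x y)) = 0" for x
    by (rule FTC_compact_support(1)[OF dy cy, of R]) (use zx in auto)
  have Qh: "(LINT x|lborel. indicator {..<0} x * ?Q (Complex x y)) = \<theta> (Complex 0 y) \<i>" for y
    by (rule FTC_compact_support(2)[OF dx cx, of R]) (use zx in auto)
  have "(LINT z|lborel. ?Q z) = 0" using integral_complex_iterated(2)[OF Qi] by (simp add: Q0)
  moreover have "(LINT z|lborel. ?P z) = 0" using integral_complex_iterated(1)[OF Pi] by (simp add: P0)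
  ultimately show "(LINT z|lborel. d1 \<theta> z) = 0" unfolding d1_def using Qi Pi by simp
  have "(LINT z|lborel. indicator {z. Re z < 0} z * ?Q z) = (LINT y|lborel. LINT x|lborel. indicator {..<0} x * ?Q (Complex x y))"
    using integral_complex_iterated(2)[OF ind[OF Qi]] by (simp add: indicator_def)
  then have "(LINT z|lborel. indicator {z. Re z < 0} z * ?Q z) = (LINT y|lborel. \<theta> (Complex 0 y) \<i>)" by (simp add: Qh)
  moreover have "(LINT z|lborel. indicator {z. Re z < 0} z * ?P z) = (LINT x|lborel. LINT y|lborel. indicator {..<0} x * ?P (Complex x y))"
    using integral_complex_iterated(1)[OF ind[OF Pi]] by (simp add: indicator_def)
  then have "(LINT z|lborel. indicator {z. Re z < 0} z * ?P z) = 0" by (simp add: P0)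
  ultimately show "(LINT z|lborel. indicator {z. Re z < 0} z * d1 \<theta> z) = (LINT y|lborel. \<theta> (Complex 0 y) \<i>)"
    unfolding d1_def right_diff_distrib using ind[OF Qi] ind[OF Pi] by simp
qed

subsection \<open>Pullback of forms under isometries\<close>

text \<open>The value 0 off the half-plane makes the pullback of a test form a test form.\<close>

definition pull :: "(complex \<Rightarrow> complex) \<Rightarrow> one_form \<Rightarrow> one_form" where
  "pull g \<theta> = (\<lambda>z v. if z \<in> upper_half then \<theta> (g z) (deriv g z * v) else 0)"

lemma isometry_image_compact: "g \<in> hyp_isometries \<Longrightarrow> compact S \<Longrightarrow> S \<subseteq> upper_half \<Longrightarrow> compact (g ` S)"
  by (simp add: compact_continuous_image isometry_continuous_on)

lemma test_form_pull:
  assumes g: "g \<in> hyp_isometries" "h \<in> hyp_isometries" "h \<circ> g = id" and \<theta>: "test_form S \<theta>"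
  shows "test_form (h ` S) (pull g \<theta>)"
proof -
  have S: "compact S" "S \<subseteq> upper_half" using \<theta> by (auto simp: test_form_def)
  have hS: "compact (h ` S)" "h ` S \<subseteq> upper_half"
    using isometry_image_compact[OF g(2) S] S isometry_upper_half[OF g(2)] by auto
  have zero: "pull g \<theta> z v = 0" if "z \<notin> h ` S" for z v
    using that g(3) test_form_zero[OF \<theta>, of "g z"] by (auto simp: pull_def fun_eq_iff image_iff) (metis)
  have lin: "linear (pull g \<theta> z)" for z
  proof -
    have "linear (\<lambda>v. \<theta> (g z) (deriv g z * v))"
      using linear_compose[OF _ test_form_linear[OF \<theta>, of "g z"], of "\<lambda>v. deriv g z * v"] by (simp add: o_def linear_times)
    then show ?thesis by (cases "z \<in> upper_half") (auto simp: pull_def linear_iff)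
  qed
  have sm: "smooth UNIV (\<lambda>z. pull g \<theta> z v)" for v
  proof -
    have T: "smooth upper_half (\<lambda>z. \<theta> (g z) u)" for u
      by (rule smooth_compose_isometry[OF g(1) smooth_subset[OF test_form_smooth[OF \<theta>]]]) simp
    have "smooth upper_half (\<lambda>z. (Re (deriv g z) * Re v - Im (deriv g z) * Im v) * \<theta> (g z) 1
       + (Re (deriv g z) * Im v + Im (deriv g z) * Re v) * \<theta> (g z) \<i>)"
      by (intro smooth_add smooth_mult smooth_diff smooth_const T smooth_isometry_deriv[OF g(1)] open_upper_half)
    then have 1: "smooth upper_half (\<lambda>z. pull g \<theta> z v)"
    proof (rule smooth_cong[OF open_upper_half, rotated])
      fix z assume "z \<in> upper_half"
      then show "(Re (deriv g z) * Re v - Im (deriv g z) * Im v) * \<theta> (g z) 1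
       + (Re (deriv g z) * Im v + Im (deriv g z) * Re v) * \<theta> (g z) \<i> = pull g \<theta> z v"
        using linear_complex_real[OF test_form_linear[OF \<theta>], of "g z" "deriv g z * v"] by (simp add: pull_def)
    qed
    show ?thesis by (rule smooth_extend[OF open_upper_half 1 hS zero])
  qed
  show ?thesis unfolding test_form_def using hS lin sm zero by auto
qed

text \<open>The exterior derivative commutes with pullback; the terms with second derivatives of the
  isometry cancel by the Cauchy--Riemann equations.\<close>

lemma d1_pull:
  assumes g: "g \<in> hyp_isometries" and z: "z \<in> upper_half"
    and lin: "\<And>w. w \<in> upper_half \<Longrightarrow> linear (\<theta> w)"
    and diff: "\<And>v. (\<lambda>w. \<theta> w v) differentiable (at (g z))"
  shows "d1 (pull g \<theta>) z = (cmod (deriv g z))\<^sup>2 * d1 \<theta> (g z)"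
proof -
  obtain a b c d where gm: "g = mob a b c d" "a * d - b * c = 1" using g hyp_isometries_mob by blast
  define e where "e = - (2 * of_real c) / (of_real c * z + of_real d) ^ 3"
  have nz: "of_real c * z + of_real d \<noteq> 0" by (rule mob_denom_nonzero[OF z gm(2)])
  have "((\<lambda>w. 1 / (of_real c * w + of_real d)\<^sup>2) has_field_derivative e) (at z)"
  proof -
    define q where "q = of_real c * z + of_real d"
    have l: "((\<lambda>w. of_real c * w + of_real d) has_field_derivative of_real c) (at z)"
      by (auto intro!: derivative_eq_intros)
    have "((\<lambda>w. 1 / (of_real c * w + of_real d)\<^sup>2) has_field_derivative
        (0 * q\<^sup>2 - 1 * (of_nat 2 * (of_real c * q ^ (2 - Suc 0)))) / (q\<^sup>2 * q\<^sup>2)) (at z)"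
      using nz unfolding q_def by (intro DERIV_divide DERIV_const DERIV_power l) simp
    moreover have "(0 * q\<^sup>2 - 1 * (of_nat 2 * (of_real c * q ^ (2 - Suc 0)))) / (q\<^sup>2 * q\<^sup>2) = e"
      using nz unfolding e_def q_def[symmetric] by (simp add: divide_simps power2_eq_square power3_eq_cube)
    ultimately show ?thesis by simp
  qed
  then have D2: "(deriv g has_field_derivative e) (at z)"
    by (rule has_field_derivative_transform_within_open[OF _ open_upper_half z]) (simp add: gm deriv_mob[OF _ gm(2)])
  have R: "((\<lambda>w. Re (deriv g w)) has_derivative (\<lambda>v. Re (e * v))) (at z)"
    "((\<lambda>w. Im (deriv g w)) has_derivative (\<lambda>v. Im (e * v))) (at z)"
    using bounded_linear.has_derivative[OF bounded_linear_Re D2[unfolded has_field_derivative_def]]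
      bounded_linear.has_derivative[OF bounded_linear_Im D2[unfolded has_field_derivative_def]] by auto
  define Dv where "Dv v = frechet_derivative (\<lambda>w. \<theta> w v) (at (g z))" for v
  have Dv: "((\<lambda>w. \<theta> w v) has_derivative Dv v) (at (g z))" for v
    using diff frechet_derivative_works by (auto simp: Dv_def)
  have comp: "((\<lambda>w. \<theta> (g w) v) has_derivative (\<lambda>u. Dv v (deriv g z * u))) (at z)" for v
    using has_derivative_compose[OF isometry_has_deriv[OF g z, unfolded has_field_derivative_def] Dv] by simp
  have Dl: "Dv v u = Re u * Dv v 1 + Im u * Dv v \<i>" for u v
    unfolding Dv_def by (rule frechet_derivative_complex[OF diff])
  \<comment> \<open>In real coordinates the derivative of the pullback is given by the product rule.  The terms with \<open>e\<close>,
    the second derivative of \<open>g\<close>, cancel in the exterior derivative.\<close>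
  have pull_eq: "pull g \<theta> w v = (Re (deriv g w) * Re v - Im (deriv g w) * Im v) * \<theta> (g w) 1
       + (Re (deriv g w) * Im v + Im (deriv g w) * Re v) * \<theta> (g w) \<i>" if "w \<in> upper_half" for w v
    using linear_complex_real[OF lin[OF isometry_upper_half[OF g that]], of "deriv g w * v"] that by (simp add: pull_def)
  have P: "frechet_derivative (\<lambda>w. pull g \<theta> w v) (at z) u =
      (Re (deriv g z) * Re v - Im (deriv g z) * Im v) * Dv 1 (deriv g z * u) + (Re (e * u) * Re v - Im (e * u) * Im v) * \<theta> (g z) 1
    + ((Re (deriv g z) * Im v + Im (deriv g z) * Re v) * Dv \<i> (deriv g z * u) + (Re (e * u) * Im v + Im (e * u) * Re v) * \<theta> (g z) \<i>)" for u v
  proof -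
    have "((\<lambda>w. (Re (deriv g w) * Re v - Im (deriv g w) * Im v) * \<theta> (g w) 1
       + (Re (deriv g w) * Im v + Im (deriv g w) * Re v) * \<theta> (g w) \<i>) has_derivative
      (\<lambda>u. (Re (deriv g z) * Re v - Im (deriv g z) * Im v) * Dv 1 (deriv g z * u) + (Re (e * u) * Re v - Im (e * u) * Im v) * \<theta> (g z) 1
    + ((Re (deriv g z) * Im v + Im (deriv g z) * Re v) * Dv \<i> (deriv g z * u) + (Re (e * u) * Im v + Im (e * u) * Re v) * \<theta> (g z) \<i>))) (at z)"
      by (intro has_derivative_add has_derivative_mult has_derivative_diff has_derivative_mult_left R comp)
    then have "((\<lambda>w. pull g \<theta> w v) has_derivative
      (\<lambda>u. (Re (deriv g z) * Re v - Im (deriv g z) * Im v) * Dv 1 (deriv g z * u) + (Re (e * u) * Re v - Im (e * u) * Im v) * \<theta> (g z) 1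
    + ((Re (deriv g z) * Im v + Im (deriv g z) * Re v) * Dv \<i> (deriv g z * u) + (Re (e * u) * Im v + Im (e * u) * Re v) * \<theta> (g z) \<i>))) (at z)"
      by (rule has_derivative_transform_within_open[OF _ open_upper_half z]) (simp add: pull_eq)
    from fun_cong[OF frechet_derivative_at[OF this], of u] show ?thesis by (simp only:)
  qed
  have D: "d1 \<theta> (g z) = Dv \<i> 1 - Dv 1 \<i>" by (simp add: d1_def Dv_def)
  define A B where "A = Re (deriv g z)" and "B = Im (deriv g z)"
  have U: "Dv v (deriv g z * 1) = A * Dv v 1 + B * Dv v \<i>" "Dv v (deriv g z * \<i>) = - B * Dv v 1 + A * Dv v \<i>" for v
    using Dl[of v "deriv g z * 1"] Dl[of v "deriv g z * \<i>"] by (simp_all add: A_def B_def)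
  show ?thesis
    unfolding d1_def[of "pull g \<theta>"] P U D cmod_power2
    by (simp add: A_def[symmetric] B_def[symmetric] power2_eq_square algebra_simps)
qed

lemma d1_pull_test_form:
  assumes "g \<in> hyp_isometries" "test_form S \<theta>" "z \<in> upper_half"
  shows "d1 (pull g \<theta>) z = (cmod (deriv g z))\<^sup>2 * d1 \<theta> (g z)"
  by (rule d1_pull[OF assms(1,3) test_form_linear[OF assms(2)]])
    (use test_form_has_derivative[OF assms(2)] in \<open>auto simp: differentiable_def\<close>)

subsection \<open>Integrals along geodesics\<close>

text \<open>The velocity vector of the geodesic.\<close>

definition gvel :: "(complex \<Rightarrow> complex) \<Rightarrow> real \<Rightarrow> complex" where
  "gvel A t = deriv A (\<i> * of_real (exp t)) * (\<i> * of_real (exp t))"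

lemma geod_derivative: "A \<in> hyp_isometries \<Longrightarrow> (geod A has_vector_derivative gvel A t) (at t within S)"
  using geod_has_vector_derivative by (simp add: gvel_def)

definition geod_integral :: "(complex \<Rightarrow> complex) \<Rightarrow> one_form \<Rightarrow> real" where
  "geod_integral A \<theta> = (LINT t|lborel. \<theta> (geod A t) (gvel A t))"

lemma pull_geod: "A \<in> hyp_isometries \<Longrightarrow> pull A \<theta> (\<i> * of_real (exp t)) (\<i> * of_real (exp t)) = \<theta> (geod A t) (gvel A t)"
  by (simp add: pull_def geod_def gvel_def)

lemma continuous_on_form:
  assumes "test_form S \<theta>" "continuous_on X a" "continuous_on X b"
  shows "continuous_on X (\<lambda>x. \<theta> (a x) (b x))"
proof -
  have c: "continuous_on X (\<lambda>x. \<theta> (a x) v)" for v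
    using continuous_on_compose2[OF smooth_continuous_on[OF test_form_smooth[OF assms(1)]] assms(2)] by auto
  have "continuous_on X (\<lambda>x. Re (b x) * \<theta> (a x) 1 + Im (b x) * \<theta> (a x) \<i>)"
    by (intro continuous_intros c assms(3))
  moreover have "(\<lambda>x. \<theta> (a x) (b x)) = (\<lambda>x. Re (b x) * \<theta> (a x) 1 + Im (b x) * \<theta> (a x) \<i>)"
    by (rule ext) (rule linear_complex_real[OF test_form_linear[OF assms(1)]])
  ultimately show ?thesis by (simp only:)
qed

text \<open>Substitution of \<open>y = exp t\<close>; the support of the form stays away from the real axis, so that only
  compact intervals matter.\<close>

lemma axis_integral:
  assumes \<theta>: "test_form S \<theta>"
  shows "integrable lborel (\<lambda>t. \<theta> (\<i> * of_real (exp t)) (\<i> * of_real (exp t)))"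
    "(LINT t|lborel. \<theta> (\<i> * of_real (exp t)) (\<i> * of_real (exp t))) = (LINT y|lborel. \<theta> (Complex 0 y) \<i>)"
proof -
  have S: "compact S" "S \<subseteq> upper_half" using \<theta> by (auto simp: test_form_def)
  have "compact (Im ` S)" using S(1) by (intro compact_continuous_image continuous_intros)
  have "\<exists>a>0. \<forall>z\<in>S. a \<le> Im z"
  proof (cases "S = {}")
    case False
    have "continuous_on S Im" by (intro continuous_intros)
    then obtain z where "z \<in> S" "\<forall>w\<in>S. Im z \<le> Im w"
      using continuous_attains_inf[OF S(1) False] by blast
    then show ?thesis using S(2) by (auto simp: upper_half_def)
  qed (auto intro: exI[of _ 1])
  then obtain a where a: "a > 0" "\<forall>z\<in>S. a \<le> Im z" by blast
  obtain R where R: "\<And>z. R \<le> cmod z \<Longrightarrow> z \<notin> S" using test_form_bounded[OF \<theta>] by blast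
  define b where "b = max a R"
  have b: "a \<le> b" "\<forall>z\<in>S. Im z \<le> b"
    using R abs_Im_le_cmod by (auto simp: b_def) (smt (verit) R abs_Im_le_cmod)
  let ?q = "\<lambda>y. \<theta> (Complex 0 y) \<i>"
  have q0: "?q y = 0" if "y \<notin> {a..b}" for y using that a b test_form_zero[OF \<theta>] by force
  have e: "\<theta> (\<i> * of_real (exp t)) (\<i> * of_real (exp t)) = ?q (exp t) * exp t" for t
    using linear_complex_real[OF test_form_linear[OF \<theta>], of "\<i> * of_real (exp t)" "\<i> * of_real (exp t)"]
    by (simp add: Complex_eq mult.commute)
  have cq: "continuous_on UNIV ?q"
    by (rule continuous_on_form[OF \<theta>]) (auto simp: Complex_eq intro!: continuous_intros)
  have t0: "?q (exp t) * exp t = 0" if "t \<notin> {ln a..ln b}" for t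
  proof -
    have "exp t \<notin> {a..b}"
    proof
      assume "exp t \<in> {a..b}"
      then have "ln a \<le> ln (exp t)" "ln (exp t) \<le> ln b" using a(1) by (simp_all only: ln_mono atLeastAtMost_iff exp_gt_zero)
      then show False using that by simp
    qed
    then show ?thesis using q0 by simp
  qed
  have ct: "continuous_on UNIV (\<lambda>t. ?q (exp t) * exp t)"
    by (intro continuous_on_mult continuous_on_compose2[OF cq] continuous_on_exp continuous_on_id) auto
  show "integrable lborel (\<lambda>t. \<theta> (\<i> * of_real (exp t)) (\<i> * of_real (exp t)))"
    unfolding e by (rule integrable_compact_support[OF compact_Icc[of "ln a" "ln b"] ct t0])
  have "set_integrable lborel {exp (ln a)..exp (ln b)} ?q"
    by (rule borel_integrable_atLeastAtMost'[OF continuous_on_subset[OF cq]]) simp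
  then have "(LBINT x. ?q x * indicator {exp (ln a)..exp (ln b)} x) = (LBINT x. ?q (exp x) * exp x * indicator {ln a..ln b} x)"
    using a b by (intro integral_substitution(2)) (auto intro!: derivative_eq_intros continuous_intros)
  moreover have "(\<lambda>x. ?q x * indicator {exp (ln a)..exp (ln b)} x) = ?q" using q0 a b by (auto simp: fun_eq_iff indicator_def)
  moreover have "(\<lambda>x. ?q (exp x) * exp x * indicator {ln a..ln b} x) = (\<lambda>x. ?q (exp x) * exp x)" using t0 by (auto simp: fun_eq_iff indicator_def)
  ultimately show "(LINT t|lborel. \<theta> (\<i> * of_real (exp t)) (\<i> * of_real (exp t))) = (LINT y|lborel. \<theta> (Complex 0 y) \<i>)"
    unfolding e by simp
qed

text \<open>After pullback by the isometry the geodesic is the imaginary axis and its left side a coordinate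
  half-plane.  The positive sign is that of a boundary with the region on its left.\<close>

theorem stokes_left_side:
  assumes A: "A \<in> hyp_isometries" and \<theta>: "test_form S \<theta>"
  shows "geod_integral A \<theta> = (LINT z|lborel. indicator (left_side A) z * d1 \<theta> z)"
proof -
  obtain h where h: "h \<in> hyp_isometries" "A \<circ> h = id" "h \<circ> A = id" by (rule isometry_inverse[OF A])
  let ?L = "\<lambda>z. indicator (left_side A) z * d1 \<theta> z"
  have p: "test_form (h ` S) (pull A \<theta>)" by (rule test_form_pull[OF A h(1) h(3) \<theta>])
  have lb: "left_side A \<subseteq> upper_half" using isometry_upper_half[OF A] by (auto simp: left_side_def)
  have lo: "open {w \<in> upper_half. Re w < 0}"
    using open_Int[OF open_upper_half open_halfspace_Re_lt[of 0]] by (simp add: Int_def)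
  have lm: "left_side A \<in> sets borel"
    unfolding left_side_def using isometry_open_image[OF A lo] by (simp add: subset_iff)
  have int: "integrable lborel ?L"
    using integrable_mult_indicator[OF _ d1_integrable[OF \<theta>], of "left_side A"] lm by simp
  have e0: "(\<lambda>z. indicator upper_half z * ?L z) = ?L" using lb by (auto simp: indicator_def fun_eq_iff)
  then have int': "set_integrable lborel upper_half ?L" and e1: "(LINT z:upper_half|lborel. ?L z) = (LINT z|lborel. ?L z)"
    unfolding set_integrable_def set_lebesgue_integral_def real_scaleR_def e0 using int by auto
  have le: "A w \<in> left_side A \<longleftrightarrow> Re w < 0" if "w \<in> upper_half" for w
    using that h(3) unfolding left_side_def by (auto simp: fun_eq_iff image_iff) (metis)
  have "(LINT z|lborel. ?L z) = (LINT z:upper_half|lborel. (cmod (deriv A z))\<^sup>2 * ?L (A z))"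
    using integral_isometry[OF A int'] e1 by simp
  also have "\<dots> = (LINT z|lborel. indicator {z. Re z < 0} z * d1 (pull A \<theta>) z)"
    unfolding set_lebesgue_integral_def
  proof (rule Bochner_Integration.integral_cong[OF refl])
    fix z :: complex
    show "indicator upper_half z *\<^sub>R ((cmod (deriv A z))\<^sup>2 * ?L (A z)) = indicator {z. Re z < 0} z * d1 (pull A \<theta>) z"
    proof (cases "z \<in> upper_half")
      case True then show ?thesis using d1_pull_test_form[OF A \<theta> True] le[OF True] by (simp add: indicator_def)
    next
      case False
      then have "z \<notin> h ` S" using p by (auto simp: test_form_def)
      then show ?thesis using False d1_zero[OF p] by simp
    qed
  qed
  also have "\<dots> = (LINT y|lborel. pull A \<theta> (Complex 0 y) \<i>)" by (rule integral_d1(2)[OF p])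
  also have "\<dots> = (LINT t|lborel. pull A \<theta> (\<i> * of_real (exp t)) (\<i> * of_real (exp t)))" by (rule axis_integral(2)[OF p, symmetric])
  finally show ?thesis by (simp add: geod_integral_def pull_geod[OF A])
qed

section \<open>The universal covering and its deck group\<close>

text \<open>Along a sequence that stays bounded, \<open>hyp_delta\<close> controls the Euclidean distance.\<close>

lemma hyp_delta_tendsto:
  assumes b: "b \<longlonglongrightarrow> y" and ab: "\<And>n. a n \<in> upper_half" "\<And>n. b n \<in> upper_half"
    and d: "(\<lambda>n. hyp_delta (a n) (b n)) \<longlonglongrightarrow> 0"
  shows "a \<longlonglongrightarrow> y"
proof -
  have "Bseq b" using b by (simp add: convergentI convergent_imp_Bseq)
  then obtain m where m: "m > 0" "\<And>n. cmod (b n) \<le> m" by (auto simp: Bseq_def)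
  have bound: "(cmod (a n - b n))\<^sup>2 \<le> 4 * m\<^sup>2 * (hyp_delta (a n) (b n) + (hyp_delta (a n) (b n))\<^sup>2)" for n
  proof -
    define r \<delta> where "r = cmod (a n - b n)" and "\<delta> = hyp_delta (a n) (b n)"
    have p: "0 < Im (a n)" "0 < Im (b n)" using ab by (auto simp: upper_half_def)
    have \<delta>: "0 \<le> \<delta>" unfolding \<delta>_def by (rule hyp_delta_nonneg[OF ab])
    have "Im (b n) \<le> m" using abs_Im_le_cmod[of "b n"] m(2)[of n] by linarith
    moreover have "Im (a n) \<le> m + r"
      using abs_Im_le_cmod[of "a n - b n"] \<open>Im (b n) \<le> m\<close> by (simp add: r_def)
    ultimately have "Im (a n) * Im (b n) \<le> (m + r) * m" using p by (intro mult_mono) (auto simp: r_def m(1) less_imp_le)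
    then have "2 * \<delta> * (Im (a n) * Im (b n)) \<le> 2 * \<delta> * ((m + r) * m)" using \<delta> by (intro mult_left_mono) auto
    moreover have "r\<^sup>2 = 2 * \<delta> * (Im (a n) * Im (b n))" using p by (simp add: r_def \<delta>_def hyp_delta_def)
    ultimately have "r\<^sup>2 \<le> 2 * \<delta> * ((m + r) * m)" by simp
    moreover have "0 \<le> (r - 2 * \<delta> * m)\<^sup>2" by simp
    moreover have "2 * \<delta> * ((m + r) * m) = 2 * (\<delta> * m\<^sup>2) + 2 * (\<delta> * m * r)"
      "(r - 2 * \<delta> * m)\<^sup>2 = r\<^sup>2 - 4 * (\<delta> * m * r) + 4 * (\<delta>\<^sup>2 * m\<^sup>2)"
      "4 * m\<^sup>2 * (\<delta> + \<delta>\<^sup>2) = 4 * (\<delta> * m\<^sup>2) + 4 * (\<delta>\<^sup>2 * m\<^sup>2)"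
      by (simp_all add: power2_eq_square algebra_simps)
    ultimately have "r\<^sup>2 \<le> 4 * m\<^sup>2 * (\<delta> + \<delta>\<^sup>2)" by linarith
    then show ?thesis by (simp add: r_def \<delta>_def)
  qed
  have "(\<lambda>n. 4 * m\<^sup>2 * (hyp_delta (a n) (b n) + (hyp_delta (a n) (b n))\<^sup>2)) \<longlonglongrightarrow> 4 * m\<^sup>2 * (0 + 0\<^sup>2)"
    by (rule tendsto_mult[OF tendsto_const tendsto_add[OF d tendsto_power[OF d]]])
  then have "(\<lambda>n. 4 * m\<^sup>2 * (hyp_delta (a n) (b n) + (hyp_delta (a n) (b n))\<^sup>2)) \<longlonglongrightarrow> 0" by simp
  then have "(\<lambda>n. (cmod (a n - b n))\<^sup>2) \<longlonglongrightarrow> 0"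
    by (rule tendsto_sandwich[OF _ _ tendsto_const, rotated 2]) (use bound in auto)
  then have "(\<lambda>n. cmod (a n - b n)) \<longlonglongrightarrow> 0" using tendsto_real_sqrt[of "\<lambda>n. (cmod (a n - b n))\<^sup>2" 0] by simp
  then have "(\<lambda>n. a n - b n) \<longlonglongrightarrow> 0" by (rule tendsto_norm_zero_cancel)
  from tendsto_add[OF this b] show ?thesis by simp
qed

lemma compact_neighbourhood:
  fixes C :: "complex set"
  assumes "compact C" "C \<subseteq> Q" "open Q"
  obtains N where "compact N" "C \<subseteq> interior N" "N \<subseteq> Q"
proof -
  have "\<forall>z\<in>C. \<exists>r>0. cball z r \<subseteq> Q" using assms open_contains_cball by (metis subsetD)
  then obtain r where r: "\<And>z. z \<in> C \<Longrightarrow> r z > 0" "\<And>z. z \<in> C \<Longrightarrow> cball z (r z) \<subseteq> Q" by metis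
  have "C \<subseteq> (\<Union>z\<in>C. ball z (r z))" using r by auto
  then obtain D where D: "D \<subseteq> C" "finite D" "C \<subseteq> (\<Union>z\<in>D. ball z (r z))"
    using compactE_image[OF assms(1), of C "\<lambda>z. ball z (r z)"] by auto
  show thesis
  proof (rule that[of "\<Union>z\<in>D. cball z (r z)"])
    show "compact (\<Union>z\<in>D. cball z (r z))" using D by (intro compact_UN) auto
    have "(\<Union>z\<in>D. ball z (r z)) \<subseteq> interior (\<Union>z\<in>D. cball z (r z))"
      by (intro interior_maximal) (auto intro: UN_mono)
    then show "C \<subseteq> interior (\<Union>z\<in>D. cball z (r z))" using D by blast
    show "(\<Union>z\<in>D. cball z (r z)) \<subseteq> Q" using r D by blast
  qed
qed

locale hyp_surface =
  fixes M :: "'m::metric_space set" and p :: "complex \<Rightarrow> 'm"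
  assumes surface: "closed_oriented_hyperbolic_surface M p"
begin

lemma cov: "covering_space upper_half p M"
  using surface by (simp add: closed_oriented_hyperbolic_surface_def)

lemma compact_M: "compact M"
  using surface by (simp add: closed_oriented_hyperbolic_surface_def)

lemma p_continuous: "continuous_on upper_half p"
  using cov by (rule covering_space_imp_continuous)

lemma p_image: "p ` upper_half = M"
  using cov by (rule covering_space_imp_surjective)

lemma p_in_M: "z \<in> upper_half \<Longrightarrow> p z \<in> M"
  using p_image by blast

lemma local_isometry:
  assumes "z \<in> upper_half"
  obtains r where "r > 0" "ball z r \<subseteq> upper_half"
    "\<And>w w'. w \<in> ball z r \<Longrightarrow> w' \<in> ball z r \<Longrightarrow> dist (p w) (p w') = hyp_dist w w'"
proof -
  obtain e where e: "e > 0" "\<And>w w'. w \<in> upper_half \<Longrightarrow> w' \<in> upper_half \<Longrightarrow> hyp_dist z w < e \<Longrightarrow> hyp_dist z w' < e \<Longrightarrow>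
      dist (p w) (p w') = hyp_dist w w'"
    using surface assms unfolding closed_oriented_hyperbolic_surface_def by meson
  have "continuous_on upper_half (\<lambda>w. hyp_dist z w)"
    using assms by (intro continuous_on_hyp_dist continuous_intros) auto
  then have "open (upper_half \<inter> (\<lambda>w. hyp_dist z w) -` {..<e})"
    by (rule continuous_open_preimage[OF _ open_upper_half]) simp
  moreover have "z \<in> upper_half \<inter> (\<lambda>w. hyp_dist z w) -` {..<e}"
    using assms e(1) hyp_dist_eq_0[OF assms assms] by auto
  ultimately obtain r where "r > 0" "ball z r \<subseteq> upper_half \<inter> (\<lambda>w. hyp_dist z w) -` {..<e}"
    by (meson open_contains_ball)
  then show thesis using that[of r] e(2) by blast
qed

lemma local_injective:
  assumes "z \<in> upper_half"
  obtains r where "r > 0" "ball z r \<subseteq> upper_half" "inj_on p (ball z r)"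
proof -
  obtain r where r: "r > 0" "ball z r \<subseteq> upper_half"
    "\<And>w w'. w \<in> ball z r \<Longrightarrow> w' \<in> ball z r \<Longrightarrow> dist (p w) (p w') = hyp_dist w w'"
    using local_isometry[OF assms] by blast
  have "inj_on p (ball z r)"
    using r(2,3) hyp_dist_eq_0 by (intro inj_onI) (metis dist_self subsetD)
  then show thesis using that r by blast
qed

lemma deck_isometry: "g \<in> deck_group p \<Longrightarrow> g \<in> hyp_isometries"
  by (simp add: deck_group_def)

lemma deck_p: "g \<in> deck_group p \<Longrightarrow> z \<in> upper_half \<Longrightarrow> p (g z) = p z"
  by (simp add: deck_group_def)

lemma deck_upper_half: "g \<in> deck_group p \<Longrightarrow> z \<in> upper_half \<Longrightarrow> g z \<in> upper_half"
  using deck_isometry isometry_upper_half by blast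

lemma deck_transitive:
  "z \<in> upper_half \<Longrightarrow> w \<in> upper_half \<Longrightarrow> p z = p w \<Longrightarrow> \<exists>g\<in>deck_group p. g z = w"
  using surface unfolding closed_oriented_hyperbolic_surface_def by blast

lemma deck_id: "id \<in> deck_group p"
  by (simp add: deck_group_def isometry_id)

lemma deck_compose: "g \<in> deck_group p \<Longrightarrow> h \<in> deck_group p \<Longrightarrow> g \<circ> h \<in> deck_group p"
  using isometry_compose deck_upper_half by (auto simp: deck_group_def isometry_upper_half)

lemma deck_inverse:
  assumes "g \<in> deck_group p" obtains h where "h \<in> deck_group p" "g \<circ> h = id" "h \<circ> g = id"
proof -
  obtain h where h: "h \<in> hyp_isometries" "g \<circ> h = id" "h \<circ> g = id" by (rule isometry_inverse[OF deck_isometry[OF assms]])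
  have "p (h z) = p z" if "z \<in> upper_half" for z
    using deck_p[OF assms isometry_upper_half[OF h(1) that]] h(2) by (simp add: fun_eq_iff)
  then have "h \<in> deck_group p" using h(1) by (simp add: deck_group_def)
  then show thesis using that h(2,3) by blast
qed

lemma lift_unique:
  assumes "is_lift p S f g1" "is_lift p S f g2" "connected S" "a \<in> S" "g1 a = g2 a" "x \<in> S"
  shows "g1 x = g2 x"
proof -
  have g: "continuous_on S g1" "g1 \<in> S \<rightarrow> upper_half" "continuous_on S g2" "g2 \<in> S \<rightarrow> upper_half"
    "\<And>x. x \<in> S \<Longrightarrow> f x = p (g1 x)" "\<And>x. x \<in> S \<Longrightarrow> f x = p (g2 x)"
    using assms(1,2) by (auto simp: is_lift_def)
  have "continuous_on S (\<lambda>x. p (g1 x))"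
    by (rule continuous_on_compose2[OF p_continuous g(1)]) (use g(2) in auto)
  then have f: "continuous_on S f" using g(5) by (simp cong: continuous_on_cong)
  have "f \<in> S \<rightarrow> M" using g(2,5) p_in_M by (simp add: Pi_iff)
  show ?thesis
    by (rule covering_space_lift_unique[OF cov assms(5) f \<open>f \<in> S \<rightarrow> M\<close> g(1,2) g(5) g(3,4) g(6) assms(3,4,6)])
qed

text \<open>Deck transformations are lifts of \<open>p\<close> along itself, and lifts are determined by one value.\<close>

lemma deck_unique:
  assumes "g \<in> deck_group p" "h \<in> deck_group p" "z \<in> upper_half" "g z = h z" shows "g = h"
proof
  fix w
  have l: "is_lift p upper_half p k" if "k \<in> deck_group p" for k
    using that deck_p[OF that] deck_upper_half[OF that] isometry_continuous_on[OF deck_isometry[OF that] order_refl]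
    by (auto simp: is_lift_def)
  show "g w = h w"
  proof (cases "w \<in> upper_half")
    case True then show ?thesis
      using lift_unique[OF l[OF assms(1)] l[OF assms(2)] convex_connected[OF convex_upper_half] assms(3,4)] by blast
  next
    case False then show ?thesis using isometry_off_upper_half deck_isometry assms by metis
  qed
qed

lemma is_lift_deck: "is_lift p S f g \<Longrightarrow> h \<in> deck_group p \<Longrightarrow> is_lift p S f (h \<circ> g)"
  using continuous_on_compose[of S g h] isometry_continuous_on[OF deck_isometry]
  by (auto simp: is_lift_def deck_p deck_upper_half image_subset_iff)

lemma lifts_differ_by_deck:
  assumes "is_lift p S f g1" "is_lift p S f g2" "connected S" "a \<in> S"
  obtains h where "h \<in> deck_group p" "\<And>x. x \<in> S \<Longrightarrow> g2 x = h (g1 x)"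
proof -
  have "g1 a \<in> upper_half" "g2 a \<in> upper_half" "p (g1 a) = p (g2 a)"
    using assms by (auto simp: is_lift_def)
  then obtain h where h: "h \<in> deck_group p" "h (g1 a) = g2 a" using deck_transitive by blast
  have "(h \<circ> g1) x = g2 x" if "x \<in> S" for x
    by (rule lift_unique[OF is_lift_deck[OF assms(1) h(1)] assms(2-4) _ that]) (simp add: h(2))
  then show thesis using that[OF h(1)] by simp
qed

text \<open>Proper discontinuity.  Infinitely many elements moving one compact set to another would, in the
  limit, give infinitely many elements with the same value at one point.\<close>

lemma deck_finite:
  assumes K: "compact K1" "K1 \<subseteq> upper_half" "compact K2" "K2 \<subseteq> upper_half"
  shows "finite {g \<in> deck_group p. g ` K1 \<inter> K2 \<noteq> {}}"
proof (rule ccontr)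
  assume "infinite {g \<in> deck_group p. g ` K1 \<inter> K2 \<noteq> {}}"
  then obtain g :: "nat \<Rightarrow> complex \<Rightarrow> complex" where g: "inj g" "range g \<subseteq> {g \<in> deck_group p. g ` K1 \<inter> K2 \<noteq> {}}"
    using infinite_countable_subset by blast
  then have gd: "g n \<in> deck_group p" and "\<exists>x\<in>K1. g n x \<in> K2" for n by blast+
  then obtain x where x: "\<And>n. x n \<in> K1" "\<And>n. g n (x n) \<in> K2" by metis
  have "compact (K1 \<times> K2)" using K by (intro compact_Times)
  then obtain l r where l: "l \<in> K1 \<times> K2" "strict_mono r" "((\<lambda>n. (x n, g n (x n))) \<circ> r) \<longlonglongrightarrow> l"
    using x unfolding compact_def by (metis (no_types, lifting) mem_Sigma_iff)
  define x0 y0 where "x0 = fst l" and "y0 = snd l"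
  have xy: "x0 \<in> K1" "y0 \<in> K2" "(\<lambda>n. x (r n)) \<longlonglongrightarrow> x0" "(\<lambda>n. g (r n) (x (r n))) \<longlonglongrightarrow> y0"
    using l(1) tendsto_fst[OF l(3)] tendsto_snd[OF l(3)] by (auto simp: x0_def y0_def o_def)
  have up: "x0 \<in> upper_half" "y0 \<in> upper_half" "x n \<in> upper_half" "g n (x n) \<in> upper_half" "g n x0 \<in> upper_half" for n
    using xy x K deck_upper_half[OF gd] by blast+
  have "(\<lambda>n. hyp_delta x0 (x (r n))) \<longlonglongrightarrow> hyp_delta x0 x0"
    unfolding hyp_delta_def
    by (rule tendsto_divide[OF tendsto_power[OF tendsto_norm[OF tendsto_diff[OF tendsto_const xy(3)]]]
          tendsto_mult[OF tendsto_const tendsto_Im[OF xy(3)]]]) (use up(1) in \<open>auto simp: upper_half_def\<close>)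
  then have "(\<lambda>n. hyp_delta (g (r n) x0) (g (r n) (x (r n)))) \<longlonglongrightarrow> 0"
    using isometry_hyp_delta[OF deck_isometry[OF gd] up(1,3)] by (simp add: hyp_delta_def)
  from hyp_delta_tendsto[OF xy(4) up(5) up(4) this] have lim: "(\<lambda>n. g (r n) x0) \<longlonglongrightarrow> y0" .
  have "(\<lambda>n. p (g (r n) (x (r n)))) \<longlonglongrightarrow> p y0"
    by (rule continuous_on_tendsto_compose[OF p_continuous xy(4) up(2)]) (use up in auto)
  moreover have "(\<lambda>n. p (g (r n) (x (r n)))) \<longlonglongrightarrow> p x0"
    unfolding deck_p[OF gd up(3)]
    by (rule continuous_on_tendsto_compose[OF p_continuous xy(3) up(1)]) (use up in auto)
  ultimately have pxy: "p x0 = p y0" using LIMSEQ_unique by blast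
  obtain e where e: "e > 0" "ball y0 e \<subseteq> upper_half" "inj_on p (ball y0 e)" using local_injective[OF up(2)] by blast
  obtain N where N: "\<And>n. n \<ge> N \<Longrightarrow> g (r n) x0 \<in> ball y0 e"
    using lim e(1) unfolding lim_sequentially by (auto simp: dist_commute)
  have "g (r n) x0 = y0" if "n \<ge> N" for n
    using inj_onD[OF e(3), of "g (r n) x0" y0] N[OF that] e(1) deck_p[OF gd up(1)] pxy by simp
  then have "g (r N) = g (r (Suc N))" using deck_unique[OF gd gd up(1)] by simp
  then have "r N = r (Suc N)" using g(1) by (simp add: inj_eq)
  then show False using l(2) by (simp add: strict_mono_eq)
qed

text \<open>Translates of \<open>C\<close> by nontrivial deck transformations are disjoint from \<open>C\<close>, and only finitely many
  come near it, so that they can be removed from a neighbourhood.\<close>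

lemma injective_compact_neighbourhood:
  assumes C: "compact C" "C \<subseteq> upper_half" "inj_on p C"
  obtains Q where "open Q" "C \<subseteq> Q" "Q \<subseteq> upper_half" "\<And>z. z \<in> Q \<Longrightarrow> p z \<in> p ` C \<Longrightarrow> z \<in> C"
proof -
  obtain N where N: "compact N" "C \<subseteq> interior N" "N \<subseteq> upper_half"
    using compact_neighbourhood[OF C(1,2) open_upper_half] .
  let ?F = "{g \<in> deck_group p. g ` C \<inter> N \<noteq> {}} - {id}"
  have fin: "finite ?F" using deck_finite[OF C(1,2) N(1,3)] by simp
  have cl: "closed (\<Union>g\<in>?F. g ` C)"
    using fin C deck_isometry isometry_image_compact by (intro closed_UN compact_imp_closed) auto
  have disj: "g ` C \<inter> C = {}" if g: "g \<in> deck_group p" "g \<noteq> id" for g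
  proof (rule ccontr)
    assume "g ` C \<inter> C \<noteq> {}"
    then obtain z where z: "z \<in> C" "g z \<in> C" by auto
    then have "g z = z" using inj_onD[OF C(3)] deck_p[OF g(1)] C(2) by blast
    then show False using deck_unique[OF g(1) deck_id, of z] z C(2) g(2) by auto
  qed
  show thesis
  proof (rule that[of "interior N - (\<Union>g\<in>?F. g ` C)"])
    show "open (interior N - (\<Union>g\<in>?F. g ` C))" using cl by (intro open_Diff) auto
    show "C \<subseteq> interior N - (\<Union>g\<in>?F. g ` C)" using N(2) disj by blast
    show "interior N - (\<Union>g\<in>?F. g ` C) \<subseteq> upper_half" using N(3) interior_subset by blast
    fix z assume z: "z \<in> interior N - (\<Union>g\<in>?F. g ` C)" "p z \<in> p ` C"
    then obtain w where w: "w \<in> C" "p w = p z" by auto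
    have zN: "z \<in> N" using z interior_subset by blast
    then obtain g where g: "g \<in> deck_group p" "g w = z" using deck_transitive[of w z] w C(2) N(3) by blast
    have "g = id" using z(1) g w(1) zN by blast
    then show "z \<in> C" using g w by simp
  qed
qed

subsection \<open>Lifting paths\<close>

text \<open>Short paths lift into an evenly covered set; bisection concatenates their lifts.\<close>

lemma path_lift_interval:
  fixes a b :: real
  assumes "a \<le> b" "continuous_on {a..b} c" "c ` {a..b} \<subseteq> M"
  shows "\<forall>z\<in>upper_half. p z = c a \<longrightarrow> (\<exists>g. is_lift p {a..b} c g \<and> g a = z)"
proof -
  define P where "P x y \<longleftrightarrow> (a \<le> x \<longrightarrow> y \<le> b \<longrightarrow> x \<le> y \<longrightarrow> (\<forall>z\<in>upper_half. p z = c x \<longrightarrow> (\<exists>g. is_lift p {x..y} c g \<and> g x = z)))" for x y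
  have "P a b"
  proof (rule Bolzano[of a b P, OF assms(1)])
    fix u v w assume trans: "P u v" "P v w" "u \<le> v" "v \<le> w"
    show "P u w" unfolding P_def
    proof (intro impI ballI)
      fix z assume z: "a \<le> u" "w \<le> b" "u \<le> w" "z \<in> upper_half" "p z = c u"
      obtain g1 where g1: "is_lift p {u..v} c g1" "g1 u = z" using trans z by (auto simp: P_def)
      have "g1 v \<in> upper_half" "p (g1 v) = c v" using g1(1) trans by (auto simp: is_lift_def)
      then obtain g2 where g2: "is_lift p {v..w} c g2" "g2 v = g1 v" using trans z unfolding P_def by fastforce
      let ?g = "\<lambda>t. if t \<le> v then g1 t else g2 t"
      have "continuous_on ({u..v} \<union> {v..w}) ?g"
        using g1 g2 by (intro continuous_on_If) (auto simp: is_lift_def)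
      moreover have "{u..v} \<union> {v..w} = {u..w}" using trans by auto
      ultimately have "continuous_on {u..w} ?g" by simp
      moreover have "?g t \<in> upper_half \<and> p (?g t) = c t" if "t \<in> {u..w}" for t
        using g1(1) g2(1) that by (auto simp: is_lift_def)
      ultimately have "is_lift p {u..w} c ?g" unfolding is_lift_def image_subset_iff by blast
      moreover have "?g u = z" using g1 trans by simp
      ultimately show "\<exists>g. is_lift p {u..w} c g \<and> g u = z" by blast
    qed
  next
    fix t assume "a \<le> t" "t \<le> b"
    show "\<exists>d>0. \<forall>u v. u \<le> t \<and> t \<le> v \<and> v - u < d \<longrightarrow> P u v"
    proof (cases "a \<le> t \<and> t \<le> b")
      case False
      have "\<exists>d>0. \<forall>x y. x \<le> t \<and> t \<le> y \<and> y - x < d \<longrightarrow> \<not> (a \<le> x \<and> y \<le> b)" using False by (intro exI[of _ 1]) auto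
      then show ?thesis unfolding P_def by meson
    next
      case True
      then have "c t \<in> M" using assms(3) by auto
      then obtain T V where T: "c t \<in> T" "openin (top_of_set M) T" "\<Union>V = upper_half \<inter> p -` T"
         "\<forall>u\<in>V. openin (top_of_set upper_half) u" "\<forall>u\<in>V. \<exists>q. homeomorphism u T p q"
        using cov unfolding covering_space_def by metis
      obtain T' where T': "open T'" "T = M \<inter> T'" using T(2) by (auto simp: openin_open)
      obtain d where d: "d > 0" "\<And>s. s \<in> {a..b} \<Longrightarrow> \<bar>s - t\<bar> < d \<Longrightarrow> c s \<in> T'"
      proof -
        have "openin (top_of_set {a..b}) ({a..b} \<inter> c -` T')" by (rule continuous_openin_preimage_gen[OF assms(2) T'(1)])
        then obtain e where "e > 0" "\<forall>s\<in>{a..b}. dist s t < e \<longrightarrow> s \<in> {a..b} \<inter> c -` T'"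
          using True T(1) T'(2) unfolding openin_euclidean_subtopology_iff by (metis IntI Int_iff atLeastAtMost_iff vimageI)
        then show thesis using that[of e] by (auto simp: dist_real_def)
      qed
      have dT: "c s \<in> T" if "s \<in> {a..b}" "\<bar>s - t\<bar> < d" for s using d(2)[OF that] T'(2) assms(3) that by auto
      show ?thesis unfolding P_def
      proof (intro exI[of _ d] conjI allI impI ballI d(1))
        fix x y z assume xy: "x \<le> t \<and> t \<le> y \<and> y - x < d" "a \<le> x" "y \<le> b" "x \<le> y" "z \<in> upper_half" "p z = c x"
        have near: "c s \<in> T" if "s \<in> {x..y}" for s using dT[of s] that xy by auto
        then have "z \<in> \<Union>V" using T(3) xy by auto
        then obtain u q where u: "u \<in> V" "z \<in> u" "homeomorphism u T p q" using T(5) by blast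
        have cq: "continuous_on T q" "q ` T = u" "\<And>m. m \<in> T \<Longrightarrow> p (q m) = m" "\<And>w. w \<in> u \<Longrightarrow> q (p w) = w"
          using u(3) by (auto simp: homeomorphism_def)
        have uH: "u \<subseteq> upper_half" using u(1) T(3) by blast
        have "continuous_on {x..y} (\<lambda>s. q (c s))"
          by (rule continuous_on_compose2[OF cq(1) continuous_on_subset[OF assms(2)]]) (use near xy in auto)
        then have "is_lift p {x..y} c (\<lambda>s. q (c s))"
          using near cq uH by (auto simp: is_lift_def)
        moreover have "q (c x) = z" using cq(4)[OF u(2)] xy by simp
        ultimately show "\<exists>g. is_lift p {x..y} c g \<and> g x = z" by (intro exI[of _ "\<lambda>s. q (c s)"]) simp
      qed
    qed
  qed
  then show ?thesis using assms(1) by (simp add: P_def)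
qed

text \<open>Lifts over symmetric intervals with the prescribed value at 0 extend each other by uniqueness.\<close>

lemma path_lift_line:
  assumes "continuous_on UNIV c" "range c \<subseteq> M" "z \<in> upper_half" "p z = c 0"
  obtains g where "is_lift p UNIV c g" "g (0::real) = z"
proof -
  have ex: "\<exists>g. is_lift p {- of_nat (Suc n)..of_nat (Suc n)} c g \<and> g 0 = z" for n
  proof -
    let ?a = "- real (Suc n)" and ?b = "real (Suc n)"
    have cc: "continuous_on {?a..?b} c" "c ` {?a..?b} \<subseteq> M"
      using continuous_on_subset[OF assms(1) subset_UNIV] assms(2) by auto
    have "c ?a \<in> M" using assms by auto
    then obtain w where "w \<in> upper_half" "p w = c ?a" using p_image by (metis imageE)
    then obtain h where h: "is_lift p {?a..?b} c h" using path_lift_interval[OF _ cc] by auto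
    have "h 0 \<in> upper_half" "p (h 0) = p z" using h assms by (auto simp: is_lift_def)
    then obtain k where k: "k \<in> deck_group p" "k (h 0) = z" using deck_transitive assms by blast
    show ?thesis using is_lift_deck[OF h k(1)] k(2) by (intro exI[of _ "k \<circ> h"]) simp
  qed
  then obtain G where G: "\<And>n. is_lift p {- real (Suc n)..real (Suc n)} c (G n)" "\<And>n. G n 0 = z" by metis
  have sub: "is_lift p {- real (Suc n)..real (Suc n)} c (G m)" if "n \<le> m" for n m
    using G(1)[of m] that unfolding is_lift_def by (auto intro: continuous_on_subset)
  have agree: "G n t = G m t" if "n \<le> m" "\<bar>t\<bar> \<le> real (Suc n)" for n m t
    by (rule lift_unique[OF G(1) sub[OF that(1)], of 0]) (use that G(2) in \<open>auto simp: abs_le_iff\<close>)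
  define g where "g t = G (nat \<lceil>\<bar>t\<bar>\<rceil>) t" for t
  have gG: "g t = G n t" if "\<bar>t\<bar> < real (Suc n)" for n t
  proof -
    have "nat \<lceil>\<bar>t\<bar>\<rceil> \<le> Suc n" "\<bar>t\<bar> \<le> Suc (nat \<lceil>\<bar>t\<bar>\<rceil>)" using that by linarith+
    then have "g t = G (Suc n) t" unfolding g_def by (intro agree) auto
    also have "\<dots> = G n t" using agree[of n "Suc n" t] that by simp
    finally show ?thesis .
  qed
  have "isCont g t" for t
  proof -
    obtain n where n: "\<bar>t\<bar> < real (Suc n)" using reals_Archimedean2 less_Suc_eq by (meson lessI of_nat_less_iff order.strict_trans)
    have "continuous_on {- real (Suc n)<..<real (Suc n)} (G n)"
      by (rule continuous_on_subset[of "{- real (Suc n)..real (Suc n)}"]) (use G(1)[of n] in \<open>auto simp: is_lift_def\<close>)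
    then have "continuous_on {- real (Suc n)<..<real (Suc n)} g"
    proof (rule continuous_on_eq)
      fix s assume "s \<in> {- real (Suc n)<..<real (Suc n)}"
      then have "\<bar>s\<bar> < real (Suc n)" by auto
      then show "G n s = g s" by (rule gG[symmetric])
    qed
    then show ?thesis using n by (auto simp: continuous_on_eq_continuous_at abs_less_iff)
  qed
  then have "continuous_on UNIV g" by (simp add: continuous_on_eq_continuous_at)
  moreover have "g t \<in> upper_half \<and> p (g t) = c t" for t
  proof -
    obtain n where n: "\<bar>t\<bar> < real (Suc n)" using reals_Archimedean2 less_Suc_eq by (meson lessI of_nat_less_iff order.strict_trans)
    then show ?thesis using gG[OF n] G(1)[of n] by (auto simp: is_lift_def abs_less_iff)
  qed
  ultimately have "is_lift p UNIV c g" by (auto simp: is_lift_def)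
  moreover have "g 0 = z" using gG[of 0 0] G(2) by simp
  ultimately show thesis using that by blast
qed

text \<open>As \<open>p\<close> preserves distances locally, so does the lift of a geodesic, which makes it a geodesic of the
  half-plane.\<close>

lemma lift_geodesic:
  assumes c: "complete_geodesic M c" and z: "z \<in> upper_half" "p z = c r0"
  obtains A where "A \<in> hyp_isometries" "geod A 0 = z" "\<And>t. p (geod A t) = c (r0 + t)"
proof -
  define b where "b t = c (r0 + t)" for t
  have bl: "\<exists>e>0. \<forall>s s'. \<bar>s - t\<bar> < e \<and> \<bar>s' - t\<bar> < e \<longrightarrow> dist (b s) (b s') = \<bar>s - s'\<bar>" for t
  proof -
    obtain e where "e > 0" "\<forall>s s'. \<bar>s - (r0 + t)\<bar> < e \<and> \<bar>s' - (r0 + t)\<bar> < e \<longrightarrow> dist (c s) (c s') = \<bar>s - s'\<bar>"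
      using c unfolding complete_geodesic_def by meson
    then show ?thesis unfolding b_def by (intro exI[of _ e]) auto
  qed
  have "isCont b t" for t
  proof -
    obtain e where e: "e > 0" "\<And>s s'. \<bar>s - t\<bar> < e \<Longrightarrow> \<bar>s' - t\<bar> < e \<Longrightarrow> dist (b s) (b s') = \<bar>s - s'\<bar>" using bl by blast
    show ?thesis unfolding continuous_at_eps_delta
    proof (intro allI impI)
      fix r :: real assume "r > 0"
      then show "\<exists>d>0. \<forall>x'. dist x' t < d \<longrightarrow> dist (b x') (b t) < r"
        using e by (intro exI[of _ "min e r"]) (auto simp: dist_real_def)
    qed
  qed
  then have bc: "continuous_on UNIV b" by (simp add: continuous_on_eq_continuous_at)
  have "range b \<subseteq> M" using c by (auto simp: complete_geodesic_def b_def)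
  then obtain g where g: "is_lift p UNIV b g" "g 0 = z"
    using path_lift_line[OF bc _ z(1)] z(2) by (auto simp: b_def)
  have gc: "continuous_on UNIV g" "range g \<subseteq> upper_half" "\<And>t. p (g t) = b t" using g(1) by (auto simp: is_lift_def)
  have "\<exists>e>0. \<forall>s s'. \<bar>s - t\<bar> < e \<and> \<bar>s' - t\<bar> < e \<longrightarrow> hyp_dist (g s) (g s') = \<bar>s - s'\<bar>" for t
  proof -
    obtain e where e: "e > 0" "\<And>s s'. \<bar>s - t\<bar> < e \<Longrightarrow> \<bar>s' - t\<bar> < e \<Longrightarrow> dist (b s) (b s') = \<bar>s - s'\<bar>" using bl by blast
    obtain r where r: "r > 0" "ball (g t) r \<subseteq> upper_half"
      "\<And>w w'. w \<in> ball (g t) r \<Longrightarrow> w' \<in> ball (g t) r \<Longrightarrow> dist (p w) (p w') = hyp_dist w w'"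
      using local_isometry[of "g t"] gc(2) by blast
    have "isCont g t" using gc(1) by (simp add: continuous_on_eq_continuous_at)
    then obtain d where d: "d > 0" "\<And>s. \<bar>s - t\<bar> < d \<Longrightarrow> dist (g s) (g t) < r"
      unfolding continuous_at_eps_delta using r(1) by (auto simp: dist_real_def)
    show ?thesis
    proof (intro exI[of _ "min d e"] conjI allI impI)
      fix s s' assume "\<bar>s - t\<bar> < min d e \<and> \<bar>s' - t\<bar> < min d e"
      then show "hyp_dist (g s) (g s') = \<bar>s - s'\<bar>"
        using r(3)[of "g s" "g s'"] d(2)[of s] d(2)[of s'] e(2)[of s s'] gc(3) by (auto simp: dist_commute)
    qed (use d e in auto)
  qed
  then obtain A where A: "A \<in> hyp_isometries" "g = geod A" using local_isometry_is_geod[OF gc(2)] by blast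
  show thesis using that[OF A(1)] A(2) g(2) gc(3) by (simp add: b_def)
qed

subsection \<open>Forms on the surface and their restrictions to a sheet\<close>

lemma one_form_linear: "\<phi> \<in> one_forms p \<Longrightarrow> z \<in> upper_half \<Longrightarrow> linear (\<phi> z)"
  by (simp add: one_forms_def)

lemma one_form_smooth: "\<phi> \<in> one_forms p \<Longrightarrow> smooth upper_half (\<lambda>z. \<phi> z v)"
  by (simp add: one_forms_def)

lemma one_form_deck:
  "\<phi> \<in> one_forms p \<Longrightarrow> g \<in> deck_group p \<Longrightarrow> z \<in> upper_half \<Longrightarrow> \<phi> (g z) (deriv g z * v) = \<phi> z v"
  by (simp add: one_forms_def)

lemma outside_form_support:
  assumes "z \<in> upper_half" "p z \<notin> form_support M p \<phi>" shows "\<phi> z v = 0"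
proof (rule ccontr)
  assume "\<phi> z v \<noteq> 0"
  then have "p z \<in> {p z | z. z \<in> upper_half \<and> (\<exists>v. \<phi> z v \<noteq> 0)}" using assms(1) by blast
  then have "p z \<in> closure {p z | z. z \<in> upper_half \<and> (\<exists>v. \<phi> z v \<noteq> 0)}" by (rule subsetD[OF closure_subset])
  then show False using assms p_in_M unfolding form_support_def by blast
qed

lemma compact_form_support: "compact (form_support M p \<phi>)"
  unfolding form_support_def by (rule compact_Int_closed[OF compact_M closed_closure])

definition sheet_form :: "complex set \<Rightarrow> one_form \<Rightarrow> one_form" where
  "sheet_form C \<phi> = (\<lambda>z v. if z \<in> C then \<phi> z v else 0)"

text \<open>Extension by zero from one sheet is smooth, since the other sheets keep away from it.\<close>

lemma test_form_sheet:
  assumes C: "compact C" "C \<subseteq> upper_half" "inj_on p C" and \<phi>: "\<phi> \<in> one_forms p"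
    and zero: "\<And>z v. z \<in> upper_half \<Longrightarrow> p z \<notin> p ` C \<Longrightarrow> \<phi> z v = 0"
  shows "test_form C (sheet_form C \<phi>)"
proof -
  obtain Q where Q: "open Q" "C \<subseteq> Q" "Q \<subseteq> upper_half" "\<And>z. z \<in> Q \<Longrightarrow> p z \<in> p ` C \<Longrightarrow> z \<in> C"
    using injective_compact_neighbourhood[OF C] by blast
  have "smooth UNIV (\<lambda>z. sheet_form C \<phi> z v)" for v
  proof -
    have 1: "smooth Q (\<lambda>z. sheet_form C \<phi> z v)"
    proof (rule smooth_cong[OF Q(1) _ smooth_subset[OF one_form_smooth[OF \<phi>, of v] Q(3)]])
      fix w assume w: "w \<in> Q"
      then have "w \<in> C" if "\<phi> w v \<noteq> 0" using Q(3) Q(4)[OF w] zero[of w v] that by blast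
      then show "\<phi> w v = sheet_form C \<phi> w v" by (auto simp: sheet_form_def)
    qed
    show ?thesis by (rule smooth_extend[OF Q(1) 1 C(1) Q(2)]) (simp add: sheet_form_def)
  qed
  moreover have "linear (sheet_form C \<phi> z)" for z
    using one_form_linear[OF \<phi>, of z] C(2) by (auto simp: sheet_form_def linear_iff)
  ultimately show ?thesis using C by (simp add: test_form_def sheet_form_def)
qed

text \<open>Covering maps are open, so that the inverse of \<open>p\<close> on \<open>p ` W\<close> is continuous.\<close>

lemma injective_open_compact_part:
  assumes W: "open W" "W \<subseteq> upper_half" "inj_on p W" and S: "compact S" "S \<subseteq> p ` W"
  shows "compact (W \<inter> p -` S)" "p ` (W \<inter> p -` S) = S"
proof -
  let ?q = "inv_into W p"
  have q: "?q (p w) = w" if "w \<in> W" for w using W(3) that by simp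
  have cont: "continuous_on (p ` W) ?q"
  proof (subst continuous_on_open, intro allI impI)
    fix X assume X: "openin (top_of_set (?q ` p ` W)) X"
    have "?q ` p ` W = W" using q by force
    then have XW: "openin (top_of_set W) X" using X by simp
    then have "open X" "X \<subseteq> W" using W(1) openin_open_eq openin_imp_subset by blast+
    have "p ` W \<inter> ?q -` X = p ` X" using q \<open>X \<subseteq> W\<close> by force
    moreover have "openin (top_of_set M) (p ` X)"
      by (rule covering_space_open_map[OF cov]) (use \<open>open X\<close> \<open>X \<subseteq> W\<close> W(2) open_upper_half in \<open>auto simp: openin_open_eq\<close>)
    then have "openin (top_of_set (p ` W)) (p ` X)"
      by (rule openin_subset_trans) (use \<open>X \<subseteq> W\<close> W(2) p_in_M in auto)
    ultimately show "openin (top_of_set (p ` W)) (p ` W \<inter> ?q -` X)" by simp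
  qed
  have "W \<inter> p -` S = ?q ` S" using q S(2) by (auto simp: image_iff) (metis f_inv_into_f imageI subsetD)+
  then show "compact (W \<inter> p -` S)" using compact_continuous_image[OF continuous_on_subset[OF cont S(2)] S(1)] by simp
  show "p ` (W \<inter> p -` S) = S" using S(2) by auto
qed

end

section \<open>Gluing local primitives\<close>

text \<open>Functions on convex sets covering a convex set, any two of which differ by a constant where both
  are defined, come from one function.  It is built by continuation along the segments from a base
  point: continuation along a path exists by bisection, is unique because two continuations have a
  locally constant difference, and is transported from one segment to a nearby one by means of the
  Lebesgue number of the cover.\<close>

context
  fixes X :: "complex set" and \<U> :: "(complex set \<times> (complex \<Rightarrow> real)) set"
  assumes X: "convex X"
    and \<U>: "\<And>W u. (W, u) \<in> \<U> \<Longrightarrow> open W \<and> convex W \<and> W \<subseteq> X"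
    and cover: "\<And>x. x \<in> X \<Longrightarrow> \<exists>W u. (W, u) \<in> \<U> \<and> x \<in> W"
    and compat: "\<And>W u W' u' y z. (W, u) \<in> \<U> \<Longrightarrow> (W', u') \<in> \<U> \<Longrightarrow> y \<in> W \<inter> W' \<Longrightarrow> z \<in> W \<inter> W' \<Longrightarrow>
       u z - u y = u' z - u' y"
begin

definition continuation :: "(real \<Rightarrow> complex) \<Rightarrow> (real \<Rightarrow> real) \<Rightarrow> real set \<Rightarrow> bool" where
  "continuation c f S \<longleftrightarrow> (\<forall>t\<in>S. \<exists>W u e. (W, u) \<in> \<U> \<and> e > 0 \<and>
     (\<forall>s\<in>S. \<bar>s - t\<bar> < e \<longrightarrow> c s \<in> W \<and> f s - f t = u (c s) - u (c t)))"

lemma path_near: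
  assumes "continuous_on {0..1} c" "t \<in> {0..1}" "open W" "c t \<in> W"
  obtains d where "d > (0::real)" "\<And>s. s \<in> {0..1} \<Longrightarrow> \<bar>s - t\<bar> < d \<Longrightarrow> c s \<in> W"
proof -
  have "openin (top_of_set {0..1}) ({0..1} \<inter> c -` W)" by (rule continuous_openin_preimage_gen[OF assms(1,3)])
  then obtain e where "e > 0" "\<forall>s\<in>{0..1}. dist s t < e \<longrightarrow> s \<in> {0..1} \<inter> c -` W"
    using assms(2,4) unfolding openin_euclidean_subtopology_iff by (metis IntI vimageI)
  then show thesis using that[of e] by (auto simp: dist_real_def)
qed

lemma continuation_exists:
  assumes c: "continuous_on {0..1} c" "c ` {0..1} \<subseteq> X"
  shows "\<exists>f. continuation c f {0..1}"
proof -
  define P where "P x y \<longleftrightarrow> (0 \<le> x \<longrightarrow> y \<le> 1 \<longrightarrow> (\<exists>f. continuation c f {x..y}))" for x y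
  have "P 0 1"
  proof (rule Bolzano[of 0 1 P])
    fix x y z :: real assume t: "P x y" "P y z" "x \<le> y" "y \<le> z"
    show "P x z" unfolding P_def
    proof (intro impI)
      assume xz: "0 \<le> x" "z \<le> 1"
      obtain f1 f2 where f: "continuation c f1 {x..y}" "continuation c f2 {y..z}" using t xz by (auto simp: P_def)
      define f where "f s = (if s \<le> y then f1 s else f2 s - f2 y + f1 y)" for s
      have "continuation c f {x..z}" unfolding continuation_def
      proof
        fix r assume r: "r \<in> {x..z}"
        consider "r < y" | "r > y" | "r = y" by linarith
        then show "\<exists>W u e. (W, u) \<in> \<U> \<and> e > 0 \<and> (\<forall>s\<in>{x..z}. \<bar>s - r\<bar> < e \<longrightarrow> c s \<in> W \<and> f s - f r = u (c s) - u (c r))"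
        proof cases
          case 1
          then obtain W u e where "(W, u) \<in> \<U>" "e > 0" "\<forall>s\<in>{x..y}. \<bar>s - r\<bar> < e \<longrightarrow> c s \<in> W \<and> f1 s - f1 r = u (c s) - u (c r)"
            using f(1) r unfolding continuation_def by (meson atLeastAtMost_iff less_imp_le)
          then show ?thesis using 1 by (intro exI[of _ W] exI[of _ u] exI[of _ "min e (y - r)"]) (auto simp: f_def)
        next
          case 2
          then obtain W u e where "(W, u) \<in> \<U>" "e > 0" "\<forall>s\<in>{y..z}. \<bar>s - r\<bar> < e \<longrightarrow> c s \<in> W \<and> f2 s - f2 r = u (c s) - u (c r)"
            using f(2) r unfolding continuation_def by (meson atLeastAtMost_iff less_imp_le)
          then show ?thesis using 2 by (intro exI[of _ W] exI[of _ u] exI[of _ "min e (r - y)"]) (auto simp: f_def)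
        next
          case 3
          obtain W1 u1 e1 where 1: "(W1, u1) \<in> \<U>" "e1 > 0" "\<And>s. s \<in> {x..y} \<Longrightarrow> \<bar>s - y\<bar> < e1 \<Longrightarrow> c s \<in> W1 \<and> f1 s - f1 y = u1 (c s) - u1 (c y)"
            using f(1) r 3 t unfolding continuation_def by (metis atLeastAtMost_iff order_refl)
          obtain W2 u2 e2 where 2: "(W2, u2) \<in> \<U>" "e2 > 0" "\<And>s. s \<in> {y..z} \<Longrightarrow> \<bar>s - y\<bar> < e2 \<Longrightarrow> c s \<in> W2 \<and> f2 s - f2 y = u2 (c s) - u2 (c y)"
            using f(2) r 3 t unfolding continuation_def by (metis atLeastAtMost_iff order_refl)
          have y: "c y \<in> W1" "c y \<in> W2" using 1(2) 1(3)[of y] 2(2) 2(3)[of y] t by auto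
          obtain d where d: "d > 0" "\<And>s. s \<in> {0..1} \<Longrightarrow> \<bar>s - y\<bar> < d \<Longrightarrow> c s \<in> W1"
            using path_near[OF c(1) _ _ y(1)] \<U>[OF 1(1)] xz t by auto
          show ?thesis
          proof (intro exI[of _ W1] exI[of _ u1] exI[of _ "min d (min e1 e2)"] conjI ballI impI 1(1))
            fix s assume s: "s \<in> {x..z}" "\<bar>s - r\<bar> < min d (min e1 e2)"
            show W1: "c s \<in> W1" using d(2)[of s] s xz 3 by auto
            show "f s - f r = u1 (c s) - u1 (c r)"
            proof (cases "s \<le> y")
              case True then show ?thesis using 1(3)[of s] s 3 by (auto simp: f_def)
            next
              case False
              then have "c s \<in> W2" "f2 s - f2 y = u2 (c s) - u2 (c y)" using 2(3)[of s] s 3 by auto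
              then show ?thesis using compat[OF 1(1) 2(1), of "c y" "c s"] y W1 3 False by (auto simp: f_def)
            qed
          qed (use d 1 2 in auto)
        qed
      qed
      then show "\<exists>f. continuation c f {x..z}" by blast
    qed
  next
    fix t :: real assume t: "0 \<le> t" "t \<le> 1"
    then have "c t \<in> X" using c(2) by (auto simp: image_subset_iff)
    then obtain W u where W: "(W, u) \<in> \<U>" "c t \<in> W" using cover by blast
    obtain d where d: "d > 0" "\<And>s. s \<in> {0..1} \<Longrightarrow> \<bar>s - t\<bar> < d \<Longrightarrow> c s \<in> W"
      using path_near[OF c(1) _ _ W(2)] \<U>[OF W(1)] t by auto
    show "\<exists>d>0. \<forall>a b. a \<le> t \<and> t \<le> b \<and> b - a < d \<longrightarrow> P a b"
    proof (intro exI[of _ d] conjI d(1) allI impI)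
      fix a b assume ab: "a \<le> t \<and> t \<le> b \<and> b - a < d"
      show "P a b" unfolding P_def
      proof (intro impI)
        assume "0 \<le> a" "b \<le> 1"
        then have "c s \<in> W" if "s \<in> {a..b}" for s using d(2)[of s] ab that by auto
        then have "continuation c (\<lambda>s. u (c s)) {a..b}"
          unfolding continuation_def using W(1) by (intro ballI exI[of _ W] exI[of _ u] exI[of _ 1]) auto
        then show "\<exists>f. continuation c f {a..b}" by blast
      qed
    qed
  qed simp
  then show ?thesis by (simp add: P_def)
qed

lemma continuation_unique:
  assumes "continuation c f {0..1}" "continuation c g {0..1}" "t \<in> {0..1}"
  shows "f t - g t = f 0 - g 0"
proof (rule connected_local_const[where A = "{0..1::real}" and f = "\<lambda>t. f t - g t"])
  show "connected {0..1::real}" by simp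
  show "\<forall>a\<in>{0..1}. \<forall>\<^sub>F b in at a within {0..1}. f a - g a = f b - g b"
  proof
    fix a :: real assume a: "a \<in> {0..1}"
    obtain W u e where 1: "(W, u) \<in> \<U>" "e > 0" "\<And>s. s \<in> {0..1} \<Longrightarrow> \<bar>s - a\<bar> < e \<Longrightarrow> c s \<in> W \<and> f s - f a = u (c s) - u (c a)"
      using assms(1) a unfolding continuation_def by meson
    obtain W' u' e' where 2: "(W', u') \<in> \<U>" "e' > 0" "\<And>s. s \<in> {0..1} \<Longrightarrow> \<bar>s - a\<bar> < e' \<Longrightarrow> c s \<in> W' \<and> g s - g a = u' (c s) - u' (c a)"
      using assms(2) a unfolding continuation_def by meson
    show "\<forall>\<^sub>F b in at a within {0..1}. f a - g a = f b - g b"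
      unfolding eventually_at
    proof (intro exI[of _ "min e e'"] conjI ballI impI)
      fix b assume b: "b \<in> {0..1}" "b \<noteq> a \<and> dist b a < min e e'"
      have "c a \<in> W \<inter> W'" using 1(2) 1(3)[of a] 2(2) 2(3)[of a] a by auto
      moreover have "c b \<in> W \<inter> W'" "f b - f a = u (c b) - u (c a)" "g b - g a = u' (c b) - u' (c a)"
        using 1(3)[of b] 2(3)[of b] b by (auto simp: dist_real_def)
      ultimately show "f a - g a = f b - g b" using compat[OF 1(1) 2(1), of "c a" "c b"] by auto
    qed (use 1 2 in auto)
  qed
qed (use assms in auto)

theorem glue_primitives: "\<exists>v. \<forall>(W, u)\<in>\<U>. \<forall>y\<in>W. \<forall>z\<in>W. v z - v y = u z - u y"
proof (cases "X = {}")
  case True then show ?thesis using \<U> by fastforce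
next
  case False
  then obtain z0 where z0: "z0 \<in> X" by blast
  define c where "c x t = z0 + of_real t * (x - z0)" for x :: complex and t :: real
  have cc: "continuous_on S (c x)" for S x unfolding c_def by (intro continuous_intros)
  have cX: "c x ` {0..1} \<subseteq> X" if "x \<in> X" for x
  proof
    fix w assume "w \<in> c x ` {0..1}"
    then obtain t where t: "t \<in> {0..1}" "w = c x t" by auto
    have "w = (1 - t) *\<^sub>R z0 + t *\<^sub>R x" by (simp add: t(2) c_def scaleR_conv_of_real algebra_simps)
    then show "w \<in> X" using convexD_alt[OF X z0 that, of t] t(1) by auto
  qed
  have "\<exists>f. continuation (c x) f {0..1} \<and> f 0 = 0" if x: "x \<in> X" for x
  proof -
    obtain f where "continuation (c x) f {0..1}" using continuation_exists[OF cc cX[OF x]] by blast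
    then have "continuation (c x) (\<lambda>t. f t - f 0) {0..1}" by (simp add: continuation_def)
    then show ?thesis by (intro exI[of _ "\<lambda>t. f t - f 0"]) simp
  qed
  then obtain f where f: "\<And>x. x \<in> X \<Longrightarrow> continuation (c x) (f x) {0..1}" "\<And>x. x \<in> X \<Longrightarrow> f x 0 = 0" by metis
  define v where "v x = f x 1" for x
  have near: "\<exists>W u e. (W, u) \<in> \<U> \<and> x \<in> W \<and> e > 0 \<and> (\<forall>y. dist x y < e \<longrightarrow> v y - v x = u y - u x)" if x: "x \<in> X" for x
  proof -
    have 1: "compact (c x ` {0..1})" by (intro compact_continuous_image cc compact_Icc)
    have 2: "c x ` {0..1} \<subseteq> \<Union> (fst ` \<U>)"
    proof
      fix w assume "w \<in> c x ` {0..1}"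
      then obtain W u where "(W, u) \<in> \<U>" "w \<in> W" using cX[OF x] cover by blast
      then show "w \<in> \<Union> (fst ` \<U>)" by (metis UnionI fst_conv imageI)
    qed
    have 3: "open G" if "G \<in> fst ` \<U>" for G using that \<U> by auto
    obtain e where e: "e > 0" "\<forall>w\<in>c x ` {0..1}. \<exists>G\<in>fst ` \<U>. ball w e \<subseteq> G"
      using Heine_Borel_lemma[OF 1 2 3] by metis
    then have "\<forall>t\<in>{0..1}. \<exists>W u. (W, u) \<in> \<U> \<and> ball (c x t) e \<subseteq> W" by force
    then obtain W u where Wu: "\<And>t. t \<in> {0..1} \<Longrightarrow> (W t, u t) \<in> \<U>" "\<And>t. t \<in> {0..1} \<Longrightarrow> ball (c x t) e \<subseteq> W t" by metis
    have "v y - v x = u 1 y - u 1 x" if y: "dist x y < e" for y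
    proof -
      have cxy: "dist (c x t) (c y t) < e" if "t \<in> {0..1}" for t
      proof -
        have "c x t - c y t = of_real t * (x - y)" by (simp add: c_def algebra_simps)
        then have "dist (c x t) (c y t) = \<bar>t\<bar> * dist x y" by (simp add: dist_norm norm_mult)
        also have "\<dots> \<le> 1 * dist x y" using that by (intro mult_right_mono) auto
        finally show ?thesis using y by simp
      qed
      have xW: "c x t \<in> W t" and yW: "c y t \<in> W t" if "t \<in> {0..1}" for t
        using Wu(2)[OF that] cxy[OF that] e(1) by auto
      have yX: "y \<in> X" using yW[of 1] \<U>[OF Wu(1)[of 1]] by (auto simp: c_def)
      \<comment> \<open>The continuation along the segment to \<open>x\<close>, transported to the segment to \<open>y\<close>.\<close>
      define g where "g t = f x t + (u t (c y t) - u t (c x t))" for t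
      have "continuation (c y) g {0..1}" unfolding continuation_def
      proof
        fix t :: real assume t: "t \<in> {0..1}"
        obtain W' u' e' where 1: "(W', u') \<in> \<U>" "e' > 0" "\<And>s. s \<in> {0..1} \<Longrightarrow> \<bar>s - t\<bar> < e' \<Longrightarrow> c x s \<in> W' \<and> f x s - f x t = u' (c x s) - u' (c x t)"
          using f(1)[OF x] t unfolding continuation_def by meson
        have oW: "open (W t)" using \<U>[OF Wu(1)[OF t]] by blast
        obtain d1 where d1: "d1 > 0" "\<And>s. s \<in> {0..1} \<Longrightarrow> \<bar>s - t\<bar> < d1 \<Longrightarrow> c x s \<in> W t"
          using path_near[OF cc t oW xW[OF t]] by blast
        obtain d2 where d2: "d2 > 0" "\<And>s. s \<in> {0..1} \<Longrightarrow> \<bar>s - t\<bar> < d2 \<Longrightarrow> c y s \<in> W t"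
          using path_near[OF cc t oW yW[OF t]] by blast
        show "\<exists>W u e. (W, u) \<in> \<U> \<and> e > 0 \<and> (\<forall>s\<in>{0..1}. \<bar>s - t\<bar> < e \<longrightarrow> c y s \<in> W \<and> g s - g t = u (c y s) - u (c y t))"
        proof (intro exI[of _ "W t"] exI[of _ "u t"] exI[of _ "min e' (min d1 d2)"] conjI ballI impI Wu(1)[OF t])
          fix s :: real assume s: "s \<in> {0..1}" "\<bar>s - t\<bar> < min e' (min d1 d2)"
          show "c y s \<in> W t" using d2(2) s by auto
          have "u s (c y s) - u s (c x s) = u t (c y s) - u t (c x s)"
            using compat[OF Wu(1)[OF s(1)] Wu(1)[OF t]] xW[OF s(1)] yW[OF s(1)] d1(2)[OF s(1)] d2(2)[OF s(1)] s(2) by auto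
          moreover have "u' (c x s) - u' (c x t) = u t (c x s) - u t (c x t)"
            using compat[OF 1(1) Wu(1)[OF t]] 1(3)[OF s(1)] 1(3)[OF t] 1(2) s(2) xW[OF t] d1(2)[OF s(1)] by auto
          moreover have "f x s - f x t = u' (c x s) - u' (c x t)" using 1(3)[OF s(1)] s(2) by auto
          ultimately show "g s - g t = u t (c y s) - u t (c y t)" by (simp add: g_def)
        qed (use 1 d1 d2 in auto)
      qed
      from continuation_unique[OF f(1)[OF yX] this, of 1] have "f y 1 - g 1 = f y 0 - g 0" by simp
      then show ?thesis using f(2)[OF yX] f(2)[OF x] by (simp add: v_def g_def c_def)
    qed
    moreover have "x \<in> W 1" using Wu(2)[of 1] e(1) by (auto simp: c_def)
    ultimately show ?thesis using Wu(1)[of 1] e(1) by (intro exI[of _ "W 1"] exI[of _ "u 1"] exI[of _ e]) auto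
  qed
  have "v z - v y = u z - u y" if W: "(W, u) \<in> \<U>" "y \<in> W" "z \<in> W" for W u y z
  proof -
    have "v y - u y = v z - u z"
    proof (rule connected_local_const[where A = W and f = "\<lambda>x. v x - u x"])
      show "connected W" using \<U>[OF W(1)] convex_connected by blast
      show "\<forall>a\<in>W. \<forall>\<^sub>F b in at a within W. v a - u a = v b - u b"
      proof
        fix a assume a: "a \<in> W"
        obtain W' u' e where 1: "(W', u') \<in> \<U>" "a \<in> W'" "e > 0" "\<And>b. dist a b < e \<Longrightarrow> v b - v a = u' b - u' a"
          using near[of a] \<U>[OF W(1)] a by blast
        obtain d where d: "d > 0" "ball a d \<subseteq> W'" using \<U>[OF 1(1)] 1(2) open_contains_ball by blast
        show "\<forall>\<^sub>F b in at a within W. v a - u a = v b - u b"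
          unfolding eventually_at
        proof (intro exI[of _ "min e d"] conjI ballI impI)
          fix b assume b: "b \<in> W" "b \<noteq> a \<and> dist b a < min e d"
          then have "b \<in> W'" using d(2) by (auto simp: dist_commute)
          moreover have "v b - v a = u' b - u' a" using 1(4)[of b] b by (simp add: dist_commute)
          ultimately show "v a - u a = v b - u b"
            using compat[OF W(1) 1(1), of a b] a b 1(2) by simp
        qed (use 1 d in auto)
      qed
    qed (use W in auto)
    then show ?thesis by simp
  qed
  then show ?thesis by blast
qed

end

section \<open>Leaves and plaques in the universal covering\<close>

lemma rect_compact: "compact (rect B)"
  unfolding rect_def by (intro compact_Times compact_Icc)

locale lamination = hyp_surface M p for M :: "'m::metric_space set" and p +
  fixes lam :: "'m set" and G :: "(real \<Rightarrow> 'm) set" and \<nu> :: "'m box \<Rightarrow> real measure"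
  assumes oriented: "oriented_lamination M p lam G"
    and transverse: "transverse_measure M p lam \<nu>"
begin

lemma geodesic_lam: "geodesic_lamination M lam G"
  using oriented by (simp add: oriented_lamination_def)

lemma lam_eq: "lam = (\<Union>c\<in>G. range c)"
  using geodesic_lam by (simp add: geodesic_lamination_def)

lemma leaf_geodesic: "c \<in> G \<Longrightarrow> complete_geodesic M c"
  using geodesic_lam by (simp add: geodesic_lamination_def simple_geodesic_def)

lemma leaf_simple: "c \<in> G \<Longrightarrow> c s = c t \<Longrightarrow> c (s + u) = c (t + u)"
  using geodesic_lam unfolding geodesic_lamination_def simple_geodesic_def by blast

lemma leaf_shift: "c \<in> G \<Longrightarrow> c' \<in> G \<Longrightarrow> c s = c' s' \<Longrightarrow> \<exists>u. \<forall>t. c' t = c (t + u)"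
  using geodesic_lam unfolding geodesic_lamination_def by (metis IntI empty_iff rangeI)

definition lift_lam :: "complex set" where
  "lift_lam = {z \<in> upper_half. p z \<in> lam}"

text \<open>A lifted leaf with its direction.  The isometry also fixes an initial point on it, so that one lifted
  leaf has many such \<open>A\<close>, which differ by time shifts.\<close>

definition leaf :: "(complex \<Rightarrow> complex) \<Rightarrow> bool" where
  "leaf A \<longleftrightarrow> A \<in> hyp_isometries \<and> (\<exists>c\<in>G. \<exists>u. \<forall>t. p (geod A t) = c (t + u))"

lemma leaf_isometry: "leaf A \<Longrightarrow> A \<in> hyp_isometries"
  by (simp add: leaf_def)

lemma leaf_in_lift_lam: "leaf A \<Longrightarrow> geod A t \<in> lift_lam"
  using lam_eq geod_upper_half unfolding leaf_def lift_lam_def by blast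

lemma leaf_deck: "leaf A \<Longrightarrow> g \<in> deck_group p \<Longrightarrow> leaf (g \<circ> A)"
  using isometry_compose[OF deck_isometry] deck_p geod_upper_half by (auto simp: leaf_def geod_compose)

lemma leaf_lift:
  assumes "c \<in> G" "z \<in> upper_half" "p z = c r"
  obtains A where "leaf A" "geod A 0 = z" "\<And>t. p (geod A t) = c (r + t)"
proof -
  obtain A where A: "A \<in> hyp_isometries" "geod A 0 = z" "\<And>t. p (geod A t) = c (r + t)"
    using lift_geodesic[OF leaf_geodesic[OF assms(1)] assms(2,3)] by blast
  then have "leaf A" unfolding leaf_def using assms(1) by (metis add.commute)
  then show thesis using that A by blast
qed

lemma leaf_through:
  assumes "z \<in> lift_lam" obtains A where "leaf A" "geod A 0 = z"
proof -
  obtain c r where "c \<in> G" "p z = c r" using assms lam_eq unfolding lift_lam_def by blast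
  then show thesis using leaf_lift[of c z r] assms that unfolding lift_lam_def by blast
qed

text \<open>Members of \<open>G\<close> that meet are shifts of each other, and simplicity makes a leaf that returns to a point
  do so in the same direction; hence both geodesics lift the same path, with a common value.\<close>

lemma leaf_unique:
  assumes "leaf A" "leaf B" "geod A s = geod B t"
  shows "geod A (s + x) = geod B (t + x)"
proof -
  obtain c u where c: "c \<in> G" "\<And>t. p (geod A t) = c (t + u)" using assms(1) by (auto simp: leaf_def)
  obtain c' u' where c': "c' \<in> G" "\<And>t. p (geod B t) = c' (t + u')" using assms(2) by (auto simp: leaf_def)
  have "c (s + u) = c' (t + u')" using assms(3) c(2)[of s] c'(2)[of t] by simp
  then obtain w where w: "\<And>t. c' t = c (t + w)" using leaf_shift[OF c(1) c'(1)] by blast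
  have "c (s + u) = c (t + u' + w)" using \<open>c (s + u) = c' (t + u')\<close> w by simp
  then have *: "p (geod A (s + y)) = p (geod B (t + y))" for y
    using leaf_simple[OF c(1), of "s + u" "t + u' + w" y] c(2) c'(2) w by (simp add: algebra_simps)
  have l: "is_lift p UNIV (\<lambda>y. p (geod A (s + y))) (\<lambda>y. geod A (s + y))"
     "is_lift p UNIV (\<lambda>y. p (geod A (s + y))) (\<lambda>y. geod B (t + y))"
    using * geod_upper_half leaf_isometry assms(1,2) unfolding is_lift_def
    by (auto intro!: continuous_on_compose2[OF continuous_on_geod[of _ UNIV]] continuous_intros)
  show ?thesis using lift_unique[OF l, of 0 x] assms(3) by simp
qed

lemma leaf_left_side:
  assumes "leaf A" "leaf B" "geod A s = geod B t" shows "left_side A = left_side B"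
proof -
  have "z \<in> left_side A \<longleftrightarrow> z \<in> left_side B" if "z \<in> upper_half" for z
    using left_side_iff[OF leaf_isometry[OF assms(1)], of s "s + 1" z] left_side_iff[OF leaf_isometry[OF assms(2)], of t "t + 1" z]
      leaf_unique[OF assms, of 1] assms(3) that by simp
  moreover have "left_side C \<subseteq> upper_half" if "leaf C" for C
    using isometry_upper_half[OF leaf_isometry[OF that]] by (auto simp: left_side_def)
  ultimately show ?thesis using assms(1,2) by blast
qed

definition same_leaf :: "complex \<Rightarrow> complex \<Rightarrow> bool" where
  "same_leaf z w \<longleftrightarrow> (\<exists>A x y. leaf A \<and> geod A x = z \<and> geod A y = w)"

lemma same_leaf_sym: "same_leaf z w \<Longrightarrow> same_leaf w z"
  by (auto simp: same_leaf_def)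

lemma same_leafI: "leaf A \<Longrightarrow> same_leaf (geod A x) (geod A y)"
  by (auto simp: same_leaf_def)

lemma same_leaf_param: "leaf A \<Longrightarrow> same_leaf (geod A x) w \<Longrightarrow> \<exists>y. w = geod A y"
  unfolding same_leaf_def using leaf_unique by (metis add_diff_cancel_left' add_diff_eq diff_add_cancel)

lemma same_leaf_trans: "same_leaf z w \<Longrightarrow> same_leaf w x \<Longrightarrow> same_leaf z x"
  using same_leaf_param by (auto simp: same_leaf_def) (metis same_leaf_def)

subsection \<open>Flow boxes\<close>

abbreviation K where "K B \<equiv> leaf_space lam B"

definition lifted_box :: "'m box \<Rightarrow> (real \<times> real \<Rightarrow> complex) \<Rightarrow> bool" where
  "lifted_box B F \<longleftrightarrow> oriented_flow_box M p lam G B \<and> is_lift p (rect B) (box_map B) F"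

lemma lifted_box_flow_box: "lifted_box B F \<Longrightarrow> flow_box M p lam B"
  by (simp add: lifted_box_def oriented_flow_box_def)

lemma box_order: "lifted_box B F \<Longrightarrow> t0 B < t1 B \<and> s0 B < s1 B"
  using lifted_box_flow_box by (simp add: flow_box_def)

lemma lifted_box_continuous: "lifted_box B F \<Longrightarrow> continuous_on (rect B) F"
  by (simp add: lifted_box_def is_lift_def)

lemma lifted_box_upper_half: "lifted_box B F \<Longrightarrow> x \<in> rect B \<Longrightarrow> F x \<in> upper_half"
  by (auto simp: lifted_box_def is_lift_def)

lemma lifted_box_p: "lifted_box B F \<Longrightarrow> x \<in> rect B \<Longrightarrow> p (F x) = box_map B x"
  by (auto simp: lifted_box_def is_lift_def)

lemma lifted_box_inj_p: "lifted_box B F \<Longrightarrow> inj_on p (F ` rect B)"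
  using lifted_box_flow_box lifted_box_p unfolding flow_box_def inj_on_def by (smt (verit) imageE)

lemma lifted_box_inj: "lifted_box B F \<Longrightarrow> inj_on F (rect B)"
  using lifted_box_flow_box lifted_box_p unfolding flow_box_def inj_on_def by metis

lemma lifted_box_compact: "lifted_box B F \<Longrightarrow> compact (F ` rect B)"
  by (intro compact_continuous_image lifted_box_continuous rect_compact)

lemma lifted_box_image: "lifted_box B F \<Longrightarrow> p ` F ` rect B = box_image B"
  using lifted_box_p by (force simp: box_image_def image_iff)

lemma lifted_box_deck: "lifted_box B F \<Longrightarrow> g \<in> deck_group p \<Longrightarrow> lifted_box B (g \<circ> F)"
  using is_lift_deck by (auto simp: lifted_box_def)

lemma K_subset: "lifted_box B F \<Longrightarrow> s \<in> K B \<Longrightarrow> s0 B < s \<and> s < s1 B"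
  using lifted_box_flow_box[of B F] unfolding flow_box_def by (meson greaterThanLessThan_iff subsetD)

lemma K_rect: "lifted_box B F \<Longrightarrow> s \<in> K B \<Longrightarrow> t \<in> {t0 B..t1 B} \<Longrightarrow> (t, s) \<in> rect B"
  using K_subset by (fastforce simp: rect_def)

lemma K_closed: "lifted_box B F \<Longrightarrow> closed (K B)"
  using lifted_box_flow_box by (auto simp: flow_box_def)

lemma K_compact: "lifted_box B F \<Longrightarrow> compact (K B)"
proof -
  assume B: "lifted_box B F"
  have "K B = {s0 B..s1 B} \<inter> K B" using K_subset[OF B] by force
  then show ?thesis using compact_Int_closed[OF compact_Icc K_closed[OF B]] by metis
qed

lemma in_lift_lam_iff: "lifted_box B F \<Longrightarrow> (t, s) \<in> rect B \<Longrightarrow> F (t, s) \<in> lift_lam \<longleftrightarrow> s \<in> K B"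
proof -
  assume B: "lifted_box B F" and ts: "(t, s) \<in> rect B"
  have e: "{x \<in> rect B. box_map B x \<in> lam} = {t0 B..t1 B} \<times> K B"
    using lifted_box_flow_box[OF B] by (simp add: flow_box_def)
  have "F (t, s) \<in> lift_lam \<longleftrightarrow> (t, s) \<in> {x \<in> rect B. box_map B x \<in> lam}"
    using lifted_box_upper_half[OF B ts] lifted_box_p[OF B ts] ts by (simp add: lift_lam_def)
  then show ?thesis unfolding e using ts by (auto simp: rect_def)
qed

lemma nu_sets: "lifted_box B F \<Longrightarrow> sets (\<nu> B) = sets borel"
  and nu_finite: "lifted_box B F \<Longrightarrow> finite_measure (\<nu> B)"
  and nu_null: "lifted_box B F \<Longrightarrow> emeasure (\<nu> B) (- K B) = 0"
  using transverse lifted_box_flow_box unfolding transverse_measure_def by blast+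

definition plaque :: "'m box \<Rightarrow> (real \<times> real \<Rightarrow> complex) \<Rightarrow> real \<Rightarrow> (complex \<Rightarrow> complex) \<Rightarrow> (real \<Rightarrow> real) \<Rightarrow> bool" where
  "plaque B F s A \<theta> \<longleftrightarrow> leaf A \<and> continuous_on {t0 B..t1 B} \<theta> \<and> strict_mono_on {t0 B..t1 B} \<theta> \<and>
     (\<forall>t\<in>{t0 B..t1 B}. F (t, s) = geod A (\<theta> t))"

lemma plaque_exists:
  assumes B: "lifted_box B F" and s: "s \<in> K B"
  obtains A \<theta> where "plaque B F s A \<theta>"
proof -
  obtain c \<theta> where c: "c \<in> G" "continuous_on {t0 B..t1 B} \<theta>" "strict_mono_on {t0 B..t1 B} \<theta>"
    "\<And>t. t \<in> {t0 B..t1 B} \<Longrightarrow> box_map B (t, s) = c (\<theta> t)"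
    using B s unfolding lifted_box_def oriented_flow_box_def by meson
  have t: "t0 B \<in> {t0 B..t1 B}" using box_order[OF B] by simp
  have r: "(t, s) \<in> rect B" if "t \<in> {t0 B..t1 B}" for t by (rule K_rect[OF B s that])
  have "p (F (t0 B, s)) = c (\<theta> (t0 B))" using lifted_box_p[OF B r[OF t]] c(4)[OF t] by simp
  then obtain A where A: "leaf A" "geod A 0 = F (t0 B, s)" "\<And>t. p (geod A t) = c (\<theta> (t0 B) + t)"
    using leaf_lift[OF c(1) lifted_box_upper_half[OF B r[OF t]]] by blast
  have l1: "is_lift p {t0 B..t1 B} (\<lambda>t. box_map B (t, s)) (\<lambda>t. F (t, s))"
    using lifted_box_upper_half[OF B r] lifted_box_p[OF B r] r
    by (auto simp: is_lift_def intro!: continuous_on_compose2[OF lifted_box_continuous[OF B]] continuous_intros)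
  have l2: "is_lift p {t0 B..t1 B} (\<lambda>t. box_map B (t, s)) (\<lambda>t. geod A (\<theta> t - \<theta> (t0 B)))"
    using A(1,3) c(2,4) geod_upper_half[OF leaf_isometry[OF A(1)]]
    by (auto simp: is_lift_def intro!: continuous_on_compose2[OF continuous_on_geod[of _ UNIV]] continuous_intros leaf_isometry)
  have "F (t, s) = geod A (\<theta> t - \<theta> (t0 B))" if "t \<in> {t0 B..t1 B}" for t
    using lift_unique[OF l1 l2 _ t _ that] A(2) by simp
  then have "plaque B F s A (\<lambda>t. \<theta> t - \<theta> (t0 B))"
    unfolding plaque_def using A(1) c(2,3) by (auto simp: strict_mono_on_def intro!: continuous_intros)
  then show thesis using that by blast
qed

lemma plaque_same_leaf:
  assumes "lifted_box B F" "s \<in> K B" "t \<in> {t0 B..t1 B}" "t' \<in> {t0 B..t1 B}"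
  shows "same_leaf (F (t, s)) (F (t', s))"
proof -
  obtain A \<theta> where "plaque B F s A \<theta>" using plaque_exists[OF assms(1,2)] by blast
  then show ?thesis using assms(3,4) by (auto simp: plaque_def intro: same_leafI)
qed

lemma plaque_left_side:
  assumes B: "lifted_box B F" and s: "s \<in> K B" and A: "leaf A" "geod A x = F (t, s)" "t \<in> {t0 B..t1 B}"
    and z: "z \<in> upper_half"
  shows "z \<in> left_side A \<longleftrightarrow> 0 < side (F (t0 B, s)) (F (t1 B, s)) z"
proof -
  obtain C \<theta> where C: "plaque B F s C \<theta>" using plaque_exists[OF B s] by blast
  have o: "t0 B < t1 B" using box_order[OF B] by simp
  have "geod A x = geod C (\<theta> t)" using A C by (simp add: plaque_def)
  then have "left_side A = left_side C" using leaf_left_side[OF A(1)] C unfolding plaque_def by blast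
  moreover have "\<theta> (t0 B) < \<theta> (t1 B)" using C o by (auto simp: plaque_def strict_mono_on_def)
  moreover have "F (t0 B, s) = geod C (\<theta> (t0 B))" "F (t1 B, s) = geod C (\<theta> (t1 B))" using C o by (auto simp: plaque_def)
  ultimately show ?thesis using left_side_iff[OF leaf_isometry _ z] C by (auto simp: plaque_def)
qed

text \<open>Nearby plaques of one box lie on different lifted leaves.  Two plaques of one leaf are disjoint
  segments of a geodesic, traversed in the same direction and no shorter than a positive constant,
  so that their starting points are at least that constant apart.\<close>

lemma nearby_plaques:
  assumes B: "lifted_box B F"
  obtains \<epsilon> where "\<epsilon> > 0" "\<And>s s'. s \<in> K B \<Longrightarrow> s' \<in> K B \<Longrightarrow> \<bar>s - s'\<bar> < \<epsilon> \<Longrightarrow>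
    same_leaf (F (t0 B, s)) (F (t0 B, s')) \<Longrightarrow> s = s'"
proof -
  let ?I = "{s0 B..s1 B}"
  have o: "t0 B < t1 B" "s0 B < s1 B" using box_order[OF B] by auto
  have r: "(t, s) \<in> rect B" if "t \<in> {t0 B..t1 B}" "s \<in> ?I" for t s using that by (simp add: rect_def)
  have cF: "continuous_on S (\<lambda>x. F (t, f x))" if "continuous_on S f" "f ` S \<subseteq> ?I" "t \<in> {t0 B..t1 B}" for S t and f :: "'z::topological_space \<Rightarrow> real"
    using that r by (intro continuous_on_compose2[OF lifted_box_continuous[OF B]] continuous_intros) auto
  have uF: "F (t, s) \<in> upper_half" if "t \<in> {t0 B..t1 B}" "s \<in> ?I" for t s by (rule lifted_box_upper_half[OF B r[OF that]])
  define len where "len s = hyp_dist (F (t0 B, s)) (F (t1 B, s))" for s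
  have "continuous_on ?I len" unfolding len_def
    using o uF by (intro continuous_on_hyp_dist cF continuous_intros) auto
  then obtain sm where sm: "sm \<in> ?I" "\<And>s. s \<in> ?I \<Longrightarrow> len sm \<le> len s"
    using continuous_attains_inf[of ?I len] o by auto
  define m where "m = len sm"
  have "F (t0 B, sm) \<noteq> F (t1 B, sm)"
    using inj_onD[OF lifted_box_inj[OF B], of "(t0 B, sm)" "(t1 B, sm)"] r sm(1) o by auto
  then have m: "m > 0" using hyp_dist_eq_0[OF uF uF, of "t0 B" sm "t1 B" sm] hyp_dist_nonneg[OF uF uF, of "t0 B" sm "t1 B" sm] sm(1) o
    by (auto simp: m_def len_def)
  define D where "D x = hyp_dist (F (t0 B, fst x)) (F (t0 B, snd x))" for x
  have "continuous_on (?I \<times> ?I) D" unfolding D_def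
    using o uF by (intro continuous_on_hyp_dist cF continuous_intros) auto
  then have "uniformly_continuous_on (?I \<times> ?I) D" by (intro compact_uniformly_continuous compact_Times compact_Icc)
  then obtain \<epsilon> where e: "\<epsilon> > 0" "\<And>x y. x \<in> ?I \<times> ?I \<Longrightarrow> y \<in> ?I \<times> ?I \<Longrightarrow> dist y x < \<epsilon> \<Longrightarrow> dist (D y) (D x) < m"
    using m unfolding uniformly_continuous_on_def by metis
  show thesis
  proof (rule that[OF e(1)])
    fix s s' assume s: "s \<in> K B" "s' \<in> K B" "\<bar>s - s'\<bar> < \<epsilon>" "same_leaf (F (t0 B, s)) (F (t0 B, s'))"
    have sI: "s \<in> ?I" "s' \<in> ?I" using K_subset[OF B] s by (auto simp: less_imp_le)
    have T: "t0 B \<in> {t0 B..t1 B}" "t1 B \<in> {t0 B..t1 B}" using o by auto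
    obtain A \<theta> where A: "plaque B F s A \<theta>" using plaque_exists[OF B s(1)] by blast
    obtain A' \<theta>' where A': "plaque B F s' A' \<theta>'" using plaque_exists[OF B s(2)] by blast
    have lA: "leaf A" "leaf A'" using A A' by (auto simp: plaque_def)
    have FA: "F (t, s) = geod A (\<theta> t)" and FA': "F (t, s') = geod A' (\<theta>' t)" if "t \<in> {t0 B..t1 B}" for t
      using A A' that by (auto simp: plaque_def)
    obtain y where y: "F (t0 B, s') = geod A y" using same_leaf_param[OF lA(1)] s(4) FA[OF T(1)] by metis
    define k where "k = y - \<theta>' (t0 B)"
    have F': "F (t, s') = geod A (\<theta>' t + k)" if "t \<in> {t0 B..t1 B}" for t
      using leaf_unique[OF lA(1) lA(2), of y "\<theta>' (t0 B)" "\<theta>' t - \<theta>' (t0 B)"] y FA'[OF T(1)] FA'[OF that] by (simp add: k_def algebra_simps)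
    have hA: "hyp_dist (geod A a) (geod A b) = \<bar>a - b\<bar>" for a b by (rule hyp_dist_geod[OF leaf_isometry[OF lA(1)]])
    have mono: "\<theta> (t0 B) < \<theta> (t1 B)" "\<theta>' (t0 B) < \<theta>' (t1 B)" using A A' o by (auto simp: plaque_def strict_mono_on_def)
    have "m \<le> len s" "m \<le> len s'" using sm(2) sI by (auto simp: m_def)
    then have L: "m \<le> \<theta> (t1 B) - \<theta> (t0 B)" "m \<le> \<theta>' (t1 B) - \<theta>' (t0 B)"
      using FA[OF T(1)] FA[OF T(2)] F'[OF T(1)] F'[OF T(2)] hA mono by (auto simp: len_def)
    have "dist (D (s, s')) (D (s, s)) < m"
      using sI s(3) by (intro e(2)) (auto simp: dist_Pair_Pair dist_real_def)
    moreover have "D (s, s) = 0" using hyp_dist_eq_0[OF uF uF] sI T by (simp add: D_def)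
    ultimately have near: "\<bar>\<theta> (t0 B) - (\<theta>' (t0 B) + k)\<bar> < m"
      using FA[OF T(1)] F'[OF T(1)] hA by (simp add: D_def)
    have ivt: "\<exists>t\<in>{t0 B..t1 B}. \<theta> t = x" if "\<theta> (t0 B) \<le> x" "x \<le> \<theta> (t1 B)" for x
      using IVT'[of \<theta> "t0 B" x "t1 B"] that o A by (auto simp: plaque_def)
    have ivt': "\<exists>t\<in>{t0 B..t1 B}. \<theta>' t = x" if "\<theta>' (t0 B) \<le> x" "x \<le> \<theta>' (t1 B)" for x
      using IVT'[of \<theta>' "t0 B" x "t1 B"] that o A' by (auto simp: plaque_def)
    have "\<exists>t\<in>{t0 B..t1 B}. \<exists>t'\<in>{t0 B..t1 B}. \<theta> t = \<theta>' t' + k"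
    proof (cases "\<theta> (t0 B) \<le> \<theta>' (t0 B) + k")
      case True
      then obtain t where "t \<in> {t0 B..t1 B}" "\<theta> t = \<theta>' (t0 B) + k" using ivt[of "\<theta>' (t0 B) + k"] near L by auto
      then show ?thesis using T(1) by blast
    next
      case False
      then obtain t where "t \<in> {t0 B..t1 B}" "\<theta>' t = \<theta> (t0 B) - k" using ivt'[of "\<theta> (t0 B) - k"] near L by auto
      then have "\<theta> (t0 B) = \<theta>' t + k" by simp
      then show ?thesis using T(1) \<open>t \<in> {t0 B..t1 B}\<close> by blast
    qed
    then obtain t t' where t: "t \<in> {t0 B..t1 B}" "t' \<in> {t0 B..t1 B}" "\<theta> t = \<theta>' t' + k" by blast
    then have "F (t, s) = F (t', s')" using FA F' by simp
    then show "s = s'" using inj_onD[OF lifted_box_inj[OF B], of "(t, s)" "(t', s')"] r t sI by auto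
  qed
qed

end

section \<open>Local primitives counted by the transverse measure\<close>

lemma borel_continuous_preimage:
  fixes f :: "'a::topological_space \<Rightarrow> 'b::topological_space"
  assumes "continuous_on E f" "E \<in> sets borel" "X \<in> sets borel"
  shows "E \<inter> f -` X \<in> sets borel"
proof -
  have "f \<in> measurable (restrict_space borel E) borel"
    by (rule borel_measurable_continuous_on_restrict[OF assms(1)])
  from measurable_sets[OF this assms(3)] have "f -` X \<inter> E \<in> sets (restrict_space borel E)"
    by (simp add: space_restrict_space)
  then have "f -` X \<inter> E \<in> sets borel" using assms(2) by (simp add: sets_restrict_space_iff)
  then show ?thesis by (simp add: Int_commute)
qed

lemma borel_compact_injective_image:
  fixes f :: "'a::t2_space \<Rightarrow> 'b::t2_space"
  assumes "compact E" "continuous_on E f" "inj_on f E" "R \<subseteq> E" "R \<in> sets borel"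
  shows "f ` R \<in> sets borel"
proof -
  have "continuous_on (f ` E) (inv_into E f)"
    by (rule continuous_on_inv[OF assms(2,1)]) (simp add: assms(3))
  moreover have "f ` E \<in> sets borel"
    by (rule borel_closed[OF compact_imp_closed[OF compact_continuous_image[OF assms(2,1)]]])
  ultimately have "f ` E \<inter> inv_into E f -` R \<in> sets borel" by (rule borel_continuous_preimage[OF _ _ assms(5)])
  moreover have "f ` E \<inter> inv_into E f -` R = f ` R"
    using assms(3,4) by (auto simp: inv_into_f_f subset_iff)
  ultimately show ?thesis by simp
qed

context lamination begin

text \<open>This holds for the plaques in a short interval (\<open>nearby_plaques\<close>), and makes the passage from the
  plaques of one box to those of another along the leaves injective.\<close>

definition thin :: "'m box \<Rightarrow> (real \<times> real \<Rightarrow> complex) \<Rightarrow> real set \<Rightarrow> bool" where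
  "thin B F D \<longleftrightarrow> (\<forall>s\<in>D. \<forall>s'\<in>D. same_leaf (F (t0 B, s)) (F (t0 B, s')) \<longrightarrow> s = s')"

text \<open>The plaques overlap in a segment as soon as they lie on one leaf near a common point, so a meeting at
  a rational time can be asked for; thus countably many transversals see all links.\<close>

definition linked where
  "linked B F s B' F' s' \<longleftrightarrow> (\<exists>q\<in>\<rat> \<inter> {t0 B..t1 B}. \<exists>t\<in>{t0 B'..t1 B'}. F (q, s) = F' (t, s'))"

lemma meet_same_leaf:
  assumes "lifted_box B F" "lifted_box B' F'" "s \<in> K B" "s' \<in> K B'" "t \<in> {t0 B..t1 B}" "t' \<in> {t0 B'..t1 B'}"
    "same_leaf (F (t, s)) (F' (t', s'))" "u \<in> {t0 B..t1 B}" "u' \<in> {t0 B'..t1 B'}"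
  shows "same_leaf (F (u, s)) (F' (u', s'))"
  using plaque_same_leaf[OF assms(1,3) assms(8,5)] plaque_same_leaf[OF assms(2,4) assms(6,9)] assms(7) same_leaf_trans by blast

lemma same_leaf_refl: "z \<in> lift_lam \<Longrightarrow> same_leaf z z"
  using leaf_through same_leafI by metis

text \<open>The transverse measure agrees on two sets of plaques that lie on the same lifted leaves.  The
  invariance hypothesis compares boxes along one transversal at a time; since the plaques overlap in
  segments, countably many transversals, at rational times, suffice.\<close>

lemma emeasure_matching:
  assumes B: "lifted_box B F" and B': "lifted_box B' F'"
    and thin: "thin B F (K B \<inter> {a..b})" and thin': "thin B' F' (K B' \<inter> {a'..b'})"
    and P: "P \<subseteq> K B \<inter> {a..b}" "P \<in> sets borel" and P': "P' \<subseteq> K B' \<inter> {a'..b'}" "P' \<in> sets borel"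
    and fwd: "\<And>s. s \<in> P \<Longrightarrow> \<exists>s'\<in>P'. linked B F s B' F' s'"
    and bwd: "\<And>s'. s' \<in> P' \<Longrightarrow> \<exists>s\<in>P. linked B F s B' F' s'"
  shows "emeasure (\<nu> B) P = emeasure (\<nu> B') P'"
proof -
  define D D' where "D = K B \<inter> {a..b}" and "D' = K B' \<inter> {a'..b'}"
  define I where "I = inv_into (rect B') F'"
  define \<sigma> where "\<sigma> q s = snd (I (F (q, s)))" for q s
  define E1 where "E1 q = D \<inter> (\<lambda>s. F (q, s)) -` (F' ` rect B')" for q
  define E where "E q = E1 q \<inter> \<sigma> q -` {a'..b'}" for q
  have T: "t0 B \<in> {t0 B..t1 B}" "t0 B' \<in> {t0 B'..t1 B'}" using box_order[OF B] box_order[OF B'] by auto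
  have Icont: "continuous_on (F' ` rect B') I"
    unfolding I_def
    by (rule continuous_on_inv[OF lifted_box_continuous[OF B'] rect_compact]) (simp add: lifted_box_inj[OF B'])
  have I: "I (F (q, s)) \<in> rect B' \<and> F' (I (F (q, s))) = F (q, s)" if "s \<in> E1 q" for q s
    using that unfolding E1_def I_def by (simp add: inv_into_into f_inv_into_f)
  have cD: "compact D" unfolding D_def by (rule compact_Int_closed[OF K_compact[OF B] closed_atLeastAtMost])
  have cF: "continuous_on D (\<lambda>s. F (q, s))" if "q \<in> {t0 B..t1 B}" for q
    by (rule continuous_on_compose2[OF lifted_box_continuous[OF B]])
      (use K_rect[OF B _ that] in \<open>auto simp: D_def intro!: continuous_intros\<close>)
  have E1closed: "closed (E1 q)" if "q \<in> {t0 B..t1 B}" for q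
    unfolding E1_def
    by (rule continuous_closed_preimage[OF cF[OF that] compact_imp_closed[OF cD] compact_imp_closed[OF lifted_box_compact[OF B']]])
  have c\<sigma>: "continuous_on (E1 q) (\<sigma> q)" if "q \<in> {t0 B..t1 B}" for q
    unfolding \<sigma>_def
    by (intro continuous_on_snd continuous_on_compose2[OF Icont] continuous_on_subset[OF cF[OF that]]) (auto simp: E1_def)
  have cE: "compact (E q)" if "q \<in> {t0 B..t1 B}" for q
  proof -
    have "closed (E q)" unfolding E_def by (rule continuous_closed_preimage[OF c\<sigma>[OF that] E1closed[OF that]]) simp
    moreover have "E q = D \<inter> E q" by (auto simp: E_def E1_def)
    ultimately show ?thesis using compact_Int_closed[OF cD] by metis
  qed
  have \<sigma>: "\<exists>t\<in>{t0 B'..t1 B'}. F (q, s) = F' (t, \<sigma> q s)" "\<sigma> q s \<in> D'" "s \<in> D" if q: "q \<in> {t0 B..t1 B}" and s: "s \<in> E q" for q s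
  proof -
    have s1: "s \<in> E1 q" using s by (simp add: E_def)
    show "s \<in> D" using s1 by (simp add: E1_def)
    have ie: "I (F (q, s)) = (fst (I (F (q, s))), \<sigma> q s)" by (simp add: \<sigma>_def)
    have r: "(fst (I (F (q, s))), \<sigma> q s) \<in> rect B'" "F' (fst (I (F (q, s))), \<sigma> q s) = F (q, s)"
      using I[OF s1] ie by auto
    then show "\<exists>t\<in>{t0 B'..t1 B'}. F (q, s) = F' (t, \<sigma> q s)"
      by (intro bexI[of _ "fst (I (F (q, s)))"]) (auto simp: rect_def)
    have "F (q, s) \<in> lift_lam" using in_lift_lam_iff[OF B K_rect[OF B _ q]] \<open>s \<in> D\<close> by (auto simp: D_def)
    then have "\<sigma> q s \<in> K B'" using in_lift_lam_iff[OF B' r(1)] r(2) by simp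
    then show "\<sigma> q s \<in> D'" using s by (simp add: D'_def E_def)
  qed
  have conv: "s \<in> E q \<and> \<sigma> q s = s'"
    if q: "q \<in> {t0 B..t1 B}" and s: "s \<in> D" "s' \<in> D'" "t \<in> {t0 B'..t1 B'}" "F (q, s) = F' (t, s')" for q s s' t
  proof -
    have r: "(t, s') \<in> rect B'" using K_rect[OF B'] s by (auto simp: D'_def)
    then have "I (F (q, s)) = (t, s')" unfolding s(4) I_def by (rule inv_into_f_f[OF lifted_box_inj[OF B']])
    then show ?thesis using s r by (auto simp: E_def E1_def \<sigma>_def D'_def)
  qed
  have eqD: "s = s2" if "s \<in> D" "s2 \<in> D" "same_leaf (F (t0 B, s)) (F (t0 B, s2))" for s s2
    using thin that unfolding thin_def D_def by blast
  have eqD': "s = s2" if "s \<in> D'" "s2 \<in> D'" "same_leaf (F' (t0 B', s)) (F' (t0 B', s2))" for s s2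
    using thin' that unfolding thin_def D'_def by blast
  have leaf\<sigma>: "same_leaf (F (t0 B, s)) (F' (t0 B', \<sigma> q s))" if q: "q \<in> {t0 B..t1 B}" and s: "s \<in> E q" for q s
  proof -
    obtain t where t: "t \<in> {t0 B'..t1 B'}" "F (q, s) = F' (t, \<sigma> q s)" using \<sigma>(1)[OF q s] by blast
    have sK: "s \<in> K B" "\<sigma> q s \<in> K B'" using \<sigma>(2,3)[OF q s] by (auto simp: D_def D'_def)
    have "F (q, s) \<in> lift_lam" using in_lift_lam_iff[OF B K_rect[OF B sK(1) q]] sK by simp
    then have "same_leaf (F (q, s)) (F' (t, \<sigma> q s))" using same_leaf_refl t(2) by simp
    from meet_same_leaf[OF B B' sK q t(1) this T] show ?thesis .
  qed
  have \<sigma>_inj: "s = s2" if "q \<in> {t0 B..t1 B}" "s \<in> E q" "q2 \<in> {t0 B..t1 B}" "s2 \<in> E q2" "\<sigma> q s = \<sigma> q2 s2" for q s q2 s2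
    using leaf\<sigma>[OF that(1,2)] leaf\<sigma>[OF that(3,4)] that(5) same_leaf_trans same_leaf_sym eqD \<sigma>(3)[OF that(1,2)] \<sigma>(3)[OF that(3,4)] by metis
  have \<sigma>_eq: "\<sigma> q s = \<sigma> q2 s" if "q \<in> {t0 B..t1 B}" "s \<in> E q" "q2 \<in> {t0 B..t1 B}" "s \<in> E q2" for q s q2
    using leaf\<sigma>[OF that(1,2)] leaf\<sigma>[OF that(3,4)] same_leaf_trans same_leaf_sym eqD' \<sigma>(2)[OF that(1,2)] \<sigma>(2)[OF that(3,4)] by metis
  define Q where "Q = \<rat> \<inter> {t0 B..t1 B}"
  have "Q \<noteq> {}" using Rats_dense_in_real[of "t0 B" "t1 B"] box_order[OF B] by (auto simp: Q_def intro: less_imp_le)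
  moreover have "countable Q" unfolding Q_def using countable_rat by (rule countable_Int1)
  ultimately have rQ: "range (from_nat_into Q) = Q" by simp
  define qs where "qs = from_nat_into Q"
  have qs: "qs n \<in> {t0 B..t1 B}" for n using rQ unfolding qs_def Q_def by blast
  define Pq where "Pq n = P \<inter> (E (qs n) \<inter> \<sigma> (qs n) -` P')" for n
  \<comment> \<open>Each plaque is assigned to the first transversal on which its link is seen.\<close>
  define R where "R = disjointed Pq"
  have Pqb: "Pq n \<in> sets borel" for n
    unfolding Pq_def
    by (intro sets.Int P(2) borel_continuous_preimage[OF continuous_on_subset[OF c\<sigma>[OF qs]]] P'(2) borel_closed compact_imp_closed cE qs)
      (auto simp: E_def)
  then have Rb: "R n \<in> sets borel" for n
    unfolding R_def using sets.range_disjointed_sets[of Pq borel] by blast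
  have RP: "R n \<subseteq> Pq n" for n unfolding R_def by (rule disjointed_subset)
  have UR: "(\<Union>n. R n) = P"
  proof -
    have "(\<Union>n. Pq n) = P"
    proof (intro set_eqI iffI)
      fix s assume s: "s \<in> P"
      obtain s' q t where 1: "s' \<in> P'" "q \<in> Q" "t \<in> {t0 B'..t1 B'}" "F (q, s) = F' (t, s')"
        using fwd[OF s] unfolding linked_def Q_def by blast
      then obtain n where n: "q = qs n" using rQ unfolding qs_def by blast
      have "s \<in> D" "s' \<in> D'" using s 1(1) P(1) P'(1) unfolding D_def D'_def by blast+
      then have "s \<in> E q \<and> \<sigma> q s = s'" using conv[of q s s' t] 1 by (auto simp: Q_def)
      then show "s \<in> (\<Union>n. Pq n)" using s 1 n by (auto simp: Pq_def)
    qed (auto simp: Pq_def)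
    then show ?thesis by (simp add: R_def UN_disjointed_eq)
  qed
  define R' where "R' n = \<sigma> (qs n) ` R n" for n
  have RE: "R n \<subseteq> E (qs n)" for n using RP[of n] by (auto simp: Pq_def)
  have injR: "inj_on (\<sigma> (qs n)) (E (qs n))" for n
    using \<sigma>_inj[OF qs _ qs] by (intro inj_onI) blast
  have R'b: "R' n \<in> sets borel" for n
    unfolding R'_def
    by (rule borel_compact_injective_image[OF cE[OF qs] continuous_on_subset[OF c\<sigma>[OF qs]] injR RE Rb]) (auto simp: E_def)
  have m: "emeasure (\<nu> B) (R n) = emeasure (\<nu> B') (R' n)" for n
  proof -
    have 1: "R n \<subseteq> K B" using RE[of n] \<sigma>(3)[OF qs] unfolding D_def by blast
    have 2: "\<forall>s\<in>R n. \<exists>t'. (t', \<sigma> (qs n) s) \<in> rect B' \<and> box_map B (qs n, s) = box_map B' (t', \<sigma> (qs n) s)"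
    proof
      fix s assume s: "s \<in> R n"
      then have sE: "s \<in> E (qs n)" using RE by blast
      obtain t where t: "t \<in> {t0 B'..t1 B'}" "F (qs n, s) = F' (t, \<sigma> (qs n) s)" using \<sigma>(1)[OF qs sE] by blast
      have r: "(t, \<sigma> (qs n) s) \<in> rect B'" using K_rect[OF B' _ t(1)] \<sigma>(2)[OF qs sE] by (auto simp: D'_def)
      have r2: "(qs n, s) \<in> rect B" using K_rect[OF B _ qs] 1 s by blast
      show "\<exists>t'. (t', \<sigma> (qs n) s) \<in> rect B' \<and> box_map B (qs n, s) = box_map B' (t', \<sigma> (qs n) s)"
        using lifted_box_p[OF B r2] lifted_box_p[OF B' r] t(2) r by metis
    qed
    show ?thesis
      using transverse lifted_box_flow_box[OF B] lifted_box_flow_box[OF B'] qs[of n] 1 Rb[of n] 2 inj_on_subset[OF injR RE] R'b[of n]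
      unfolding transverse_measure_def R'_def by blast
  qed
  have UR': "(\<Union>n. R' n) = P'"
  proof (intro set_eqI iffI)
    fix s' assume s': "s' \<in> P'"
    obtain s q t where 1: "s \<in> P" "q \<in> Q" "t \<in> {t0 B'..t1 B'}" "F (q, s) = F' (t, s')"
      using bwd[OF s'] unfolding linked_def Q_def by blast
    have "s \<in> D" "s' \<in> D'" using s' 1(1) P(1) P'(1) unfolding D_def D'_def by blast+
    then have 2: "s \<in> E q" "\<sigma> q s = s'" using conv[of q s s' t] 1 by (auto simp: Q_def)
    obtain n where n: "s \<in> R n" using 1(1) UR by blast
    have "\<sigma> (qs n) s = s'" using \<sigma>_eq[OF qs, of s n q] RE n 2 1(2) by (auto simp: Q_def)
    then show "s' \<in> (\<Union>n. R' n)" using n by (auto simp: R'_def)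
  next
    fix s' assume "s' \<in> (\<Union>n. R' n)"
    then show "s' \<in> P'" using RP unfolding R'_def Pq_def by blast
  qed
  have dR: "disjoint_family R" unfolding R_def by (rule disjoint_family_disjointed)
  have "disjoint_family R'"
    unfolding disjoint_family_on_def
  proof (intro ballI impI, rule ccontr)
    fix n k :: nat assume nk: "n \<noteq> k" "R' n \<inter> R' k \<noteq> {}"
    then obtain s s2 where s: "s \<in> R n" "s2 \<in> R k" "\<sigma> (qs n) s = \<sigma> (qs k) s2" by (auto simp: R'_def)
    then have "s = s2" using \<sigma>_inj[OF qs _ qs, of s n s2 k] RE by blast
    then show False using dR s nk(1) by (auto simp: disjoint_family_on_def)
  qed
  then have "emeasure (\<nu> B') P' = (\<Sum>n. emeasure (\<nu> B') (R' n))"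
    using suminf_emeasure[of R' "\<nu> B'"] image_subsetI[of UNIV R' "sets borel", OF R'b] UR' by (simp add: nu_sets[OF B'])
  moreover have "emeasure (\<nu> B) P = (\<Sum>n. emeasure (\<nu> B) (R n))"
    using suminf_emeasure[of R "\<nu> B"] image_subsetI[of UNIV R "sets borel", OF Rb] UR dR by (simp add: nu_sets[OF B])
  ultimately show ?thesis using m by simp
qed

subsection \<open>Charts\<close>

text \<open>A chart is a convex region in which every leaf is seen as one of the plaques \<open>s \<in> [a, b]\<close> of a
  box, different plaques belonging to different leaves.  Its primitive measures the set of the plaques
  that pass to the right of a point.\<close>

definition chart :: "'m box \<Rightarrow> (real \<times> real \<Rightarrow> complex) \<Rightarrow> real \<Rightarrow> real \<Rightarrow> complex set \<Rightarrow> bool" where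
  "chart B F a b W \<longleftrightarrow> lifted_box B F \<and> thin B F (K B \<inter> {a..b}) \<and> open W \<and> convex W \<and> W \<subseteq> upper_half \<and>
     (\<forall>z\<in>W \<inter> lift_lam. \<exists>t\<in>{t0 B..t1 B}. \<exists>s\<in>K B \<inter> {a..b}. z = F (t, s))"

definition plaques_right_of :: "'m box \<Rightarrow> (real \<times> real \<Rightarrow> complex) \<Rightarrow> real \<Rightarrow> real \<Rightarrow> complex \<Rightarrow> real set" where
  "plaques_right_of B F a b z = {s \<in> K B \<inter> {a..b}. 0 < side (F (t0 B, s)) (F (t1 B, s)) z}"

definition chart_primitive :: "'m box \<Rightarrow> (real \<times> real \<Rightarrow> complex) \<Rightarrow> real \<Rightarrow> real \<Rightarrow> complex \<Rightarrow> real" where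
  "chart_primitive B F a b z = measure (\<nu> B) (plaques_right_of B F a b z)"

lemma continuous_on_plaque_side:
  assumes B: "lifted_box B F"
  shows "continuous_on (K B \<times> UNIV) (\<lambda>x. side (F (t0 B, fst x)) (F (t1 B, fst x)) (snd x))"
proof -
  have "continuous_on (K B \<times> UNIV) (\<lambda>x. F (t, fst x))" if "t \<in> {t0 B..t1 B}" for t
    by (rule continuous_on_compose2[OF lifted_box_continuous[OF B]])
      (use K_rect[OF B _ that] in \<open>auto intro!: continuous_intros\<close>)
  from this[of "t0 B"] this[of "t1 B"] show ?thesis
    unfolding side_def using box_order[OF B] by (intro continuous_intros) auto
qed

lemma plaques_right_of_borel:
  assumes B: "lifted_box B F" shows "plaques_right_of B F a b z \<in> sets borel"
proof -
  have "continuous_on (K B \<inter> {a..b}) (\<lambda>s. side (F (t0 B, s)) (F (t1 B, s)) z)"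
    by (rule continuous_on_compose2[OF continuous_on_plaque_side[OF B], of _ "\<lambda>s. (s, z)", simplified]) (auto intro!: continuous_intros)
  from borel_continuous_preimage[OF this, of "{0<..}"]
  have "(K B \<inter> {a..b}) \<inter> (\<lambda>s. side (F (t0 B, s)) (F (t1 B, s)) z) -` {0<..} \<in> sets borel"
    using K_closed[OF B] by auto
  moreover have "(K B \<inter> {a..b}) \<inter> (\<lambda>s. side (F (t0 B, s)) (F (t1 B, s)) z) -` {0<..} = plaques_right_of B F a b z"
    by (auto simp: plaques_right_of_def)
  ultimately show ?thesis by simp
qed

lemma plaque_leaf:
  assumes B: "lifted_box B F" and s: "s \<in> K B"
  obtains A x where "leaf A" "geod A x = F (t0 B, s)"
    "\<And>z. z \<in> upper_half \<Longrightarrow> z \<in> left_side A \<longleftrightarrow> 0 < side (F (t0 B, s)) (F (t1 B, s)) z"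
proof -
  obtain A \<theta> where A: "plaque B F s A \<theta>" using plaque_exists[OF B s] by blast
  have T: "t0 B \<in> {t0 B..t1 B}" using box_order[OF B] by auto
  have 1: "leaf A" "geod A (\<theta> (t0 B)) = F (t0 B, s)" using A T by (auto simp: plaque_def)
  show thesis using that[OF 1 plaque_left_side[OF B s 1 T]] .
qed

text \<open>By thinness a leaf stays on one plaque as long as it stays in the chart.\<close>

lemma chart_plaque_interval:
  assumes c: "chart B F a b W" and A: "leaf A" "geod A x \<in> W"
  obtains s e where "s \<in> K B \<inter> {a..b}" "e > 0" "\<And>y. \<bar>y - x\<bar> < e \<Longrightarrow> \<exists>t\<in>{t0 B..t1 B}. geod A y = F (t, s)"
proof -
  have B: "lifted_box B F" and W: "open W" using c by (auto simp: chart_def)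
  have T: "t0 B \<in> {t0 B..t1 B}" using box_order[OF B] by auto
  have ex: "\<exists>t\<in>{t0 B..t1 B}. \<exists>s\<in>K B \<inter> {a..b}. geod A y = F (t, s)" if "geod A y \<in> W" for y
    using c that leaf_in_lift_lam[OF A(1)] unfolding chart_def by blast
  obtain t s where s: "t \<in> {t0 B..t1 B}" "s \<in> K B \<inter> {a..b}" "geod A x = F (t, s)" using ex[OF A(2)] by blast
  have "isCont (geod A) x" using continuous_on_geod[OF leaf_isometry[OF A(1)], of UNIV] by (simp add: continuous_on_eq_continuous_at)
  then have "\<forall>\<^sub>F y in nhds x. geod A y \<in> W" using W A(2)
    by (metis continuous_at_imp_continuous_at_within isCont_def tendsto_at_iff_tendsto_nhds topological_tendstoD)
  then obtain e where e: "e > 0" "\<And>y. dist y x < e \<Longrightarrow> geod A y \<in> W" unfolding eventually_nhds_metric by blast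
  show thesis
  proof (rule that[OF s(2) e(1)])
    fix y assume "\<bar>y - x\<bar> < e"
    then have "geod A y \<in> W" using e(2) by (simp add: dist_real_def)
    then obtain t' s' where s': "t' \<in> {t0 B..t1 B}" "s' \<in> K B \<inter> {a..b}" "geod A y = F (t', s')"
      using ex by blast
    have "same_leaf (F (t, s)) (F (t', s'))" using same_leafI[OF A(1), of x y] s(3) s'(3) by simp
    then have "same_leaf (F (t0 B, s)) (F (t0 B, s'))"
      using meet_same_leaf[OF B B _ _ s(1) s'(1) _ T T] s(2) s'(2) by blast
    then have "s = s'" using c s(2) s'(2) unfolding chart_def thin_def by blast
    then show "\<exists>t\<in>{t0 B..t1 B}. geod A y = F (t, s)" using s' by blast
  qed
qed

text \<open>Near \<open>geod A x\<close> the leaf runs along one plaque in each chart, and the common segment contains a point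
  that has a rational time in \<open>B\<close>.\<close>

lemma chart_linked:
  assumes c: "chart B F a b W" and c': "chart B' F' a' b' W'" and A: "leaf A" "geod A x \<in> W \<inter> W'"
  obtains s s' y y' where "s \<in> K B \<inter> {a..b}" "s' \<in> K B' \<inter> {a'..b'}" "linked B F s B' F' s'"
    "geod A y = F (t0 B, s)" "geod A y' = F' (t0 B', s')"
proof -
  have B: "lifted_box B F" and B': "lifted_box B' F'" using c c' by (auto simp: chart_def)
  have T: "t0 B \<in> {t0 B..t1 B}" "t0 B' \<in> {t0 B'..t1 B'}" using box_order[OF B] box_order[OF B'] by auto
  obtain s e where s: "s \<in> K B \<inter> {a..b}" "e > 0" "\<And>y. \<bar>y - x\<bar> < e \<Longrightarrow> \<exists>t\<in>{t0 B..t1 B}. geod A y = F (t, s)"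
    using chart_plaque_interval[OF c A(1)] A(2) by blast
  obtain s' e' where s': "s' \<in> K B' \<inter> {a'..b'}" "e' > 0" "\<And>y. \<bar>y - x\<bar> < e' \<Longrightarrow> \<exists>t\<in>{t0 B'..t1 B'}. geod A y = F' (t, s')"
    using chart_plaque_interval[OF c' A(1)] A(2) by blast
  define d where "d = min e e' / 2"
  have d: "d > 0" "d < e" "d < e'" using s(2) s'(2) by (auto simp: d_def min_def)
  obtain t1 t2 where t: "t1 \<in> {t0 B..box.t1 B}" "geod A x = F (t1, s)" "t2 \<in> {t0 B..box.t1 B}" "geod A (x + d) = F (t2, s)"
    using s(3)[of x] s(3)[of "x + d"] s(2) d by auto
  obtain C \<theta> where C: "plaque B F s C \<theta>" using plaque_exists[OF B] s(1) by blast
  have lC: "leaf C" and FC: "\<And>t. t \<in> {t0 B..box.t1 B} \<Longrightarrow> F (t, s) = geod C (\<theta> t)"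
    and mono: "strict_mono_on {t0 B..box.t1 B} \<theta>" using C by (auto simp: plaque_def)
  have AC: "geod A (x + y) = geod C (\<theta> t1 + y)" for y
    by (rule leaf_unique[OF A(1) lC]) (use t FC in simp)
  have "geod C (\<theta> t1 + d) = geod C (\<theta> t2)" using AC[of d] t(4) FC[OF t(3)] by simp
  then have th: "\<theta> t2 = \<theta> t1 + d" using geod_inj[OF leaf_isometry[OF lC]] by simp
  have "t1 < t2"
  proof (rule ccontr)
    assume "\<not> t1 < t2"
    then have "\<theta> t2 \<le> \<theta> t1" using mono t(1,3) by (cases "t2 = t1") (auto simp: strict_mono_on_def intro: less_imp_le)
    then show False using th d(1) by simp
  qed
  then obtain q where q: "q \<in> \<rat>" "t1 < q" "q < t2" using Rats_dense_in_real by blast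
  have qT: "q \<in> {t0 B..box.t1 B}" using q t by auto
  have "\<theta> t1 < \<theta> q" "\<theta> q < \<theta> t2" using mono t q qT by (auto simp: strict_mono_on_def)
  then have "\<bar>(x + (\<theta> q - \<theta> t1)) - x\<bar> < e'" using th d by auto
  then obtain t' where t': "t' \<in> {t0 B'..box.t1 B'}" "geod A (x + (\<theta> q - \<theta> t1)) = F' (t', s')" using s'(3) by blast
  have "F (q, s) = F' (t', s')" using AC[of "\<theta> q - \<theta> t1"] FC[OF qT] t'(2) by simp
  then have "linked B F s B' F' s'" unfolding linked_def using q(1) qT t'(1) by blast
  moreover have "\<exists>y. F (t0 B, s) = geod A y"
    using same_leaf_param[OF A(1), of x "F (t0 B, s)"] plaque_same_leaf[OF B _ t(1) T(1)] s(1) t(2) by simp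
  moreover obtain t3 where t3: "t3 \<in> {t0 B'..box.t1 B'}" "geod A x = F' (t3, s')" using s'(3)[of x] s'(2) by auto
  have "\<exists>y. F' (t0 B', s') = geod A y"
    using same_leaf_param[OF A(1), of x "F' (t0 B', s')"] plaque_same_leaf[OF B' _ t3(1) T(2)] s'(1) t3(2) by simp
  ultimately show thesis using that[OF s(1) s'(1)] by metis
qed

text \<open>Leaves that separate two points cross the segment between them, so that any two charts containing
  the segment see the same separating leaves.\<close>

lemma chart_separating_linked:
  assumes c: "chart B F a b W" and c': "chart B' F' a' b' W'" and yz: "y \<in> W \<inter> W'" "z \<in> W \<inter> W'"
    and A: "leaf A" "z \<in> left_side A" "y \<notin> left_side A"
  obtains s s' x x' where "s \<in> plaques_right_of B F a b z - plaques_right_of B F a b y"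
    "s' \<in> plaques_right_of B' F' a' b' z - plaques_right_of B' F' a' b' y" "linked B F s B' F' s'"
    "geod A x = F (t0 B, s)" "geod A x' = F' (t0 B', s')"
proof -
  have B: "lifted_box B F" and B': "lifted_box B' F'" and W: "convex W" "convex W'" "W \<subseteq> upper_half"
    using c c' by (auto simp: chart_def)
  have T: "t0 B \<in> {t0 B..t1 B}" "t0 B' \<in> {t0 B'..t1 B'}" using box_order[OF B] box_order[OF B'] by auto
  have seg: "closed_segment z y \<subseteq> W \<inter> W'" using yz W by (simp add: closed_segment_subset)
  then obtain r where "geod A r \<in> W \<inter> W'"
    using segment_crosses_geod[OF leaf_isometry[OF A(1)] _ A(2,3)] W(3) by blast
  then obtain s s' x x' where s: "s \<in> K B \<inter> {a..b}" "s' \<in> K B' \<inter> {a'..b'}" "linked B F s B' F' s'"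
    "geod A x = F (t0 B, s)" "geod A x' = F' (t0 B', s')" using chart_linked[OF c c' A(1)] by blast
  have u: "y \<in> upper_half" "z \<in> upper_half" using yz W by auto
  have "s \<in> plaques_right_of B F a b z - plaques_right_of B F a b y"
    using plaque_left_side[OF B _ A(1) s(4) T(1)] s(1) u A(2,3) by (auto simp: plaques_right_of_def)
  moreover have "s' \<in> plaques_right_of B' F' a' b' z - plaques_right_of B' F' a' b' y"
    using plaque_left_side[OF B' _ A(1) s(5) T(2)] s(2) u A(2,3) by (auto simp: plaques_right_of_def)
  ultimately show thesis using that s by blast
qed

lemma chart_same_separating:
  assumes c: "chart B F a b W" and c': "chart B' F' a' b' W'" and yz: "y \<in> W \<inter> W'" "z \<in> W \<inter> W'"
  shows "emeasure (\<nu> B) (plaques_right_of B F a b z - plaques_right_of B F a b y) =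
    emeasure (\<nu> B') (plaques_right_of B' F' a' b' z - plaques_right_of B' F' a' b' y)"
proof -
  let ?P = "plaques_right_of B F a b z - plaques_right_of B F a b y"
  let ?P' = "plaques_right_of B' F' a' b' z - plaques_right_of B' F' a' b' y"
  have B: "lifted_box B F" and B': "lifted_box B' F'" and th: "thin B F (K B \<inter> {a..b})" "thin B' F' (K B' \<inter> {a'..b'})"
    and u: "y \<in> upper_half" "z \<in> upper_half"
    using c c' yz by (auto simp: chart_def)
  show ?thesis
  proof (rule emeasure_matching[OF B B' th])
    show "?P \<subseteq> K B \<inter> {a..b}" "?P' \<subseteq> K B' \<inter> {a'..b'}" by (auto simp: plaques_right_of_def)
    show "?P \<in> sets borel" "?P' \<in> sets borel"
      using plaques_right_of_borel[OF B] plaques_right_of_borel[OF B'] by auto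
    show "\<exists>s'\<in>?P'. linked B F s B' F' s'" if s: "s \<in> ?P" for s
    proof -
      have sK: "s \<in> K B" using s by (auto simp: plaques_right_of_def)
      obtain A x where A: "leaf A" "geod A x = F (t0 B, s)"
        "\<And>w. w \<in> upper_half \<Longrightarrow> w \<in> left_side A \<longleftrightarrow> 0 < side (F (t0 B, s)) (F (t1 B, s)) w"
        using plaque_leaf[OF B sK] by blast
      have "z \<in> left_side A" "y \<notin> left_side A" using A(3) u s by (auto simp: plaques_right_of_def)
      then obtain s2 s' x2 x' where s2: "s2 \<in> ?P" "s' \<in> ?P'" "linked B F s2 B' F' s'" "geod A x2 = F (t0 B, s2)"
        using chart_separating_linked[OF c c' yz A(1)] by metis
      have "same_leaf (F (t0 B, s)) (F (t0 B, s2))" using same_leafI[OF A(1), of x x2] A(2) s2(4) by simp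
      then have "s = s2" using th(1) s s2(1) unfolding thin_def plaques_right_of_def by blast
      then show ?thesis using s2 by blast
    qed
    show "\<exists>s\<in>?P. linked B F s B' F' s'" if s: "s' \<in> ?P'" for s'
    proof -
      have sK: "s' \<in> K B'" using s by (auto simp: plaques_right_of_def)
      obtain A x where A: "leaf A" "geod A x = F' (t0 B', s')"
        "\<And>w. w \<in> upper_half \<Longrightarrow> w \<in> left_side A \<longleftrightarrow> 0 < side (F' (t0 B', s')) (F' (t1 B', s')) w"
        using plaque_leaf[OF B' sK] by blast
      have "z \<in> left_side A" "y \<notin> left_side A" using A(3) u s by (auto simp: plaques_right_of_def)
      then obtain s2 s'' x2 x' where s2: "s2 \<in> ?P" "s'' \<in> ?P'" "linked B F s2 B' F' s''" "geod A x' = F' (t0 B', s'')"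
        using chart_separating_linked[OF c c' yz A(1)] by metis
      have "same_leaf (F' (t0 B', s')) (F' (t0 B', s''))" using same_leafI[OF A(1), of x x'] A(2) s2(4) by simp
      then have "s' = s''" using th(2) s s2(2) unfolding thin_def plaques_right_of_def by blast
      then show ?thesis using s2 by blast
    qed
  qed
qed

lemma chart_primitive_diff:
  assumes B: "lifted_box B F"
  shows "chart_primitive B F a b z - chart_primitive B F a b y =
    measure (\<nu> B) (plaques_right_of B F a b z - plaques_right_of B F a b y) -
    measure (\<nu> B) (plaques_right_of B F a b y - plaques_right_of B F a b z)"
proof -
  interpret finite_measure "\<nu> B" by (rule nu_finite[OF B])
  have m: "plaques_right_of B F a b w \<in> sets (\<nu> B)" for w
    using plaques_right_of_borel[OF B] by (simp add: nu_sets[OF B])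
  have "measure (\<nu> B) (plaques_right_of B F a b z) = measure (\<nu> B) (plaques_right_of B F a b z - plaques_right_of B F a b y)
     + measure (\<nu> B) (plaques_right_of B F a b z \<inter> plaques_right_of B F a b y)" for z y
    using finite_measure_Diff'[OF m m] by simp
  from this[of z y] this[of y z] show ?thesis by (simp add: chart_primitive_def Int_commute)
qed

text \<open>Off the lamination nothing is counted; the zero functions there complete the charts to a cover of the
  half-plane.\<close>

definition local_primitives :: "(complex set \<times> (complex \<Rightarrow> real)) set" where
  "local_primitives = {(W, u). open W \<and> convex W \<and> W \<subseteq> upper_half \<and> W \<inter> lift_lam = {} \<and> u = (\<lambda>_. 0)} \<union>
     {(W, u). \<exists>B F a b. chart B F a b W \<and> u = chart_primitive B F a b}"

lemma chart_primitive_constant: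
  assumes c: "chart B F a b W" and W': "convex W'" "W' \<inter> lift_lam = {}" "y \<in> W \<inter> W'" "z \<in> W \<inter> W'"
  shows "chart_primitive B F a b z = chart_primitive B F a b y"
proof -
  have B: "lifted_box B F" and W: "convex W" "W \<subseteq> upper_half" using c by (auto simp: chart_def)
  have e: "plaques_right_of B F a b z - plaques_right_of B F a b y = {}" if yz: "y \<in> W \<inter> W'" "z \<in> W \<inter> W'" for y z
  proof (rule ccontr)
    assume "plaques_right_of B F a b z - plaques_right_of B F a b y \<noteq> {}"
    then obtain s where s: "s \<in> plaques_right_of B F a b z - plaques_right_of B F a b y" by blast
    have sK: "s \<in> K B" using s by (auto simp: plaques_right_of_def)
    obtain A x where A: "leaf A" "geod A x = F (t0 B, s)"
        "\<And>w. w \<in> upper_half \<Longrightarrow> w \<in> left_side A \<longleftrightarrow> 0 < side (F (t0 B, s)) (F (t1 B, s)) w"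
      using plaque_leaf[OF B sK] by blast
    have lr: "z \<in> left_side A" "y \<notin> left_side A" using A(3) yz W(2) s by (auto simp: plaques_right_of_def)
    have seg: "closed_segment z y \<subseteq> W \<inter> W'" using yz W W'(1) by (simp add: closed_segment_subset)
    then obtain r where "geod A r \<in> W \<inter> W'"
      using segment_crosses_geod[OF leaf_isometry[OF A(1)] _ lr] W(2) by blast
    then show False using leaf_in_lift_lam[OF A(1)] W'(2) by blast
  qed
  show ?thesis using chart_primitive_diff[OF B, of a b z y] e[OF W'(3,4)] e[OF W'(4,3)] by simp
qed

lemma local_primitives_compatible:
  assumes "(W, u) \<in> local_primitives" "(W', u') \<in> local_primitives" "y \<in> W \<inter> W'" "z \<in> W \<inter> W'"
  shows "u z - u y = u' z - u' y"
proof -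
  consider (t) "W \<inter> lift_lam = {}" "convex W" "u = (\<lambda>_. 0)"
    | (c) B F a b where "chart B F a b W" "u = chart_primitive B F a b"
    using assms(1) by (auto simp: local_primitives_def)
  then show ?thesis
  proof cases
    case t
    consider "u' = (\<lambda>_. 0)" | B F a b where "chart B F a b W'" "u' = chart_primitive B F a b"
      using assms(2) by (auto simp: local_primitives_def)
    then show ?thesis
    proof cases
      case 1 then show ?thesis using t(3) by simp
    next
      case 2
      have "chart_primitive B F a b z = chart_primitive B F a b y"
        by (rule chart_primitive_constant[OF 2(1) t(2,1)]) (use assms(3,4) in auto)
      then show ?thesis using t(3) 2(2) by simp
    qed
  next
    case c
    consider (t') "W' \<inter> lift_lam = {}" "convex W'" "u' = (\<lambda>_. 0)"
      | (c') B' F' a' b' where "chart B' F' a' b' W'" "u' = chart_primitive B' F' a' b'"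
      using assms(2) by (auto simp: local_primitives_def)
    then show ?thesis
    proof cases
      case t'
      have "chart_primitive B F a b z = chart_primitive B F a b y"
        by (rule chart_primitive_constant[OF c(1) t'(2,1) assms(3,4)])
      then show ?thesis using c(2) t'(3) by simp
    next
      case c'
      have B: "lifted_box B F" "lifted_box B' F'" using c(1) c'(1) by (auto simp: chart_def)
      show ?thesis unfolding c(2) c'(2) chart_primitive_diff[OF B(1)] chart_primitive_diff[OF B(2)]
        using chart_same_separating[OF c(1) c'(1) assms(3,4)] chart_same_separating[OF c(1) c'(1) assms(4,3)]
        by (simp add: measure_def)
    qed
  qed
qed

lemma lam_closedin: "closedin (top_of_set M) lam"
  using geodesic_lam unfolding geodesic_lamination_def by blast

lemma open_complement_lift_lam: "open (upper_half - lift_lam)"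
proof -
  obtain C where C: "closed C" "lam = M \<inter> C" using lam_closedin by (auto simp: closedin_closed)
  have "upper_half - lift_lam = upper_half \<inter> p -` (- C)"
  proof (rule set_eqI)
    fix x show "x \<in> upper_half - lift_lam \<longleftrightarrow> x \<in> upper_half \<inter> p -` (- C)"
      using p_in_M[of x] C(2) unfolding lift_lam_def by blast
  qed
  then show ?thesis using continuous_open_preimage[OF p_continuous open_upper_half open_Compl[OF C(1)]] by simp
qed

text \<open>The part of the box with parameters away from that of \<open>x\<close> is compact and does not contain \<open>x\<close>, so
  that a small ball about \<open>x\<close> meets nearby plaques only.\<close>

lemma chart_exists:
  assumes B: "lifted_box B F" and x: "x \<in> lift_lam" "x \<in> interior (F ` rect B)" and V: "open V" "x \<in> V"
  obtains a b r where "r > 0" "ball x r \<subseteq> V" "chart B F a b (ball x r)"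
proof -
  obtain \<epsilon> where e: "\<epsilon> > 0" "\<And>s s'. s \<in> K B \<Longrightarrow> s' \<in> K B \<Longrightarrow> \<bar>s - s'\<bar> < \<epsilon> \<Longrightarrow>
    same_leaf (F (t0 B, s)) (F (t0 B, s')) \<Longrightarrow> s = s'" using nearby_plaques[OF B] by blast
  obtain t s where ts: "(t, s) \<in> rect B" "x = F (t, s)" using x(2) interior_subset by fastforce
  define a b where "a = s - \<epsilon>/3" and "b = s + \<epsilon>/3"
  define C where "C = F ` (rect B \<inter> UNIV \<times> - {a<..<b})"
  have "compact C" unfolding C_def
    by (intro compact_continuous_image continuous_on_subset[OF lifted_box_continuous[OF B]] compact_Int_closed[OF rect_compact] closed_Times) auto
  moreover have "x \<notin> C"
  proof
    assume "x \<in> C"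
    then obtain t' s' where "(t', s') \<in> rect B" "s' \<notin> {a<..<b}" "F (t, s) = F (t', s')" using ts(2) by (auto simp: C_def)
    then show False using inj_onD[OF lifted_box_inj[OF B], of "(t, s)" "(t', s')"] ts(1) e(1) by (auto simp: a_def b_def)
  qed
  ultimately have "open (interior (F ` rect B) \<inter> V - C)" "x \<in> interior (F ` rect B) \<inter> V - C"
    using x(2) V by (auto intro!: open_Diff compact_imp_closed)
  then obtain r where r: "r > 0" "ball x r \<subseteq> interior (F ` rect B) \<inter> V - C" using open_contains_ball by blast
  have W: "ball x r \<subseteq> F ` rect B - C" using r(2) interior_subset by blast
  have "thin B F (K B \<inter> {a..b})" unfolding thin_def
  proof (intro ballI impI)
    fix s1 s2 assume "s1 \<in> K B \<inter> {a..b}" "s2 \<in> K B \<inter> {a..b}" "same_leaf (F (t0 B, s1)) (F (t0 B, s2))"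
    moreover from this have "\<bar>s1 - s2\<bar> < \<epsilon>" using e(1) unfolding a_def b_def by (auto simp: abs_less_iff)
    ultimately show "s1 = s2" using e(2) by blast
  qed
  moreover have "\<exists>t\<in>{t0 B..t1 B}. \<exists>s\<in>K B \<inter> {a..b}. z = F (t, s)" if z: "z \<in> ball x r \<inter> lift_lam" for z
  proof -
    obtain w where w: "w \<in> rect B" "z = F w" using z W by blast
    obtain t' s' where "w = (t', s')" by fastforce
    with w have t': "(t', s') \<in> rect B" "z = F (t', s')" by auto
    then have "s' \<in> {a<..<b}" using z W unfolding C_def by blast
    moreover have "s' \<in> K B" using in_lift_lam_iff[OF B t'(1)] t'(2) z by simp
    moreover have "t' \<in> {t0 B..t1 B}" using t'(1) by (simp add: rect_def)
    moreover from \<open>s' \<in> {a<..<b}\<close> \<open>s' \<in> K B\<close> have "s' \<in> K B \<inter> {a..b}" by auto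
    ultimately show ?thesis using t'(2) by blast
  qed
  moreover have "ball x r \<subseteq> upper_half" using W lifted_box_upper_half[OF B] by blast
  ultimately have "chart B F a b (ball x r)" using B by (simp add: chart_def)
  then show thesis using that r by blast
qed

text \<open>Near a lifted box, only points of the box are mapped into its image.\<close>

lemma interior_lifted_box:
  assumes B: "lifted_box B F" and x: "x \<in> F ` rect B" "p x \<in> top_of_set M interior_of box_image B"
  shows "x \<in> interior (F ` rect B)"
proof -
  let ?C = "F ` rect B"
  have C: "compact ?C" "?C \<subseteq> upper_half" "inj_on p ?C"
    using lifted_box_compact[OF B] lifted_box_upper_half[OF B] lifted_box_inj_p[OF B] by auto
  obtain Q where Q: "open Q" "?C \<subseteq> Q" "Q \<subseteq> upper_half" "\<And>z. z \<in> Q \<Longrightarrow> p z \<in> p ` ?C \<Longrightarrow> z \<in> ?C"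
    using injective_compact_neighbourhood[OF C] by blast
  obtain N where N: "open N" "top_of_set M interior_of box_image B = M \<inter> N"
    using openin_interior_of[of "top_of_set M" "box_image B"] unfolding openin_open by blast
  have "open (Q \<inter> p -` N)" by (rule continuous_open_preimage[OF continuous_on_subset[OF p_continuous Q(3)] Q(1) N(1)])
  moreover have "Q \<inter> p -` N \<subseteq> ?C"
  proof
    fix z assume z: "z \<in> Q \<inter> p -` N"
    then have "p z \<in> M \<inter> N" using p_in_M Q(3) by auto
    then have "p z \<in> box_image B" using N(2) interior_of_subset by (metis subsetD)
    then show "z \<in> ?C" using Q(4)[of z] z lifted_box_image[OF B] by simp
  qed
  moreover have "x \<in> Q \<inter> p -` N" using x N(2) Q(2) by auto
  ultimately show ?thesis by (meson interiorI)
qed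

lemma lifted_box_at:
  assumes B: "oriented_flow_box M p lam G B" and x: "x \<in> upper_half" "p x \<in> box_image B"
  obtains F where "lifted_box B F" "x \<in> F ` rect B"
proof -
  obtain F0 where F0: "is_lift p (rect B) (box_map B) F0" using B unfolding oriented_flow_box_def flow_box_def by blast
  obtain y where y: "y \<in> rect B" "p x = box_map B y" using x(2) by (auto simp: box_image_def)
  have "F0 y \<in> upper_half" "p (F0 y) = p x" using F0 y by (auto simp: is_lift_def)
  then obtain g where g: "g \<in> deck_group p" "g (F0 y) = x" using deck_transitive x(1) by blast
  have "lifted_box B (g \<circ> F0)" using B is_lift_deck[OF F0 g(1)] by (simp add: lifted_box_def)
  moreover have "x \<in> (g \<circ> F0) ` rect B" using g(2) y(1) by (auto simp: image_iff)
  ultimately show thesis using that by blast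
qed

lemma box_at_lift_lam:
  assumes x: "x \<in> lift_lam"
  obtains B where "oriented_flow_box M p lam G B" "p x \<in> top_of_set M interior_of box_image B"
  using oriented x unfolding oriented_lamination_def lift_lam_def by blast

lemma chart_at:
  assumes x: "x \<in> lift_lam" and V: "open V" "x \<in> V"
  obtains B F a b r where "r > 0" "ball x r \<subseteq> V" "chart B F a b (ball x r)"
proof -
  obtain B where B: "oriented_flow_box M p lam G B" "p x \<in> top_of_set M interior_of box_image B"
    using box_at_lift_lam[OF x] by blast
  have "p x \<in> box_image B" using B(2) interior_of_subset by fastforce
  then obtain F where F: "lifted_box B F" "x \<in> F ` rect B" using lifted_box_at[OF B(1)] x by (auto simp: lift_lam_def)
  obtain a b r where "r > 0" "ball x r \<subseteq> V" "chart B F a b (ball x r)"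
    using chart_exists[OF F(1) x interior_lifted_box[OF F B(2)] V] .
  then show thesis by (rule that)
qed

lemma local_primitives_cover:
  assumes x: "x \<in> upper_half" and V: "open V" "x \<in> V"
  obtains r u where "r > 0" "ball x r \<subseteq> V" "(ball x r, u) \<in> local_primitives"
proof (cases "x \<in> lift_lam")
  case True
  show thesis
  proof (rule chart_at[OF True V])
    fix B F a b r assume *: "r > 0" "ball x r \<subseteq> V" "chart B F a b (ball x r)"
    then have "(ball x r, chart_primitive B F a b) \<in> local_primitives" unfolding local_primitives_def by blast
    then show thesis using that * by blast
  qed
next
  case False
  then obtain r where "r > 0" "ball x r \<subseteq> (upper_half - lift_lam) \<inter> V"
    using open_contains_ball[of "(upper_half - lift_lam) \<inter> V"] open_complement_lift_lam x V by (metis DiffI IntI open_Int)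
  moreover from this have "(ball x r, \<lambda>_. 0) \<in> local_primitives" unfolding local_primitives_def by auto
  ultimately show thesis using that by blast
qed

lemma local_primitives_props: "(W, u) \<in> local_primitives \<Longrightarrow> open W \<and> convex W \<and> W \<subseteq> upper_half"
  by (auto simp: local_primitives_def chart_def)

definition is_primitive :: "(complex \<Rightarrow> real) \<Rightarrow> bool" where
  "is_primitive v \<longleftrightarrow> (\<forall>(W, u)\<in>local_primitives. \<forall>y\<in>W. \<forall>z\<in>W. v z - v y = u z - u y)"

lemma is_primitiveD: "is_primitive v \<Longrightarrow> (W, u) \<in> local_primitives \<Longrightarrow> y \<in> W \<Longrightarrow> z \<in> W \<Longrightarrow> v z - v y = u z - u y"
  unfolding is_primitive_def by blast

lemma primitive_exists: "\<exists>v. is_primitive v"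
  unfolding is_primitive_def
proof (rule glue_primitives[OF convex_upper_half])
  show "open W \<and> convex W \<and> W \<subseteq> upper_half" if "(W, u) \<in> local_primitives" for W u
    by (rule local_primitives_props[OF that])
  show "\<exists>W u. (W, u) \<in> local_primitives \<and> x \<in> W" if "x \<in> upper_half" for x
    using local_primitives_cover[OF that open_UNIV UNIV_I] centre_in_ball by metis
qed (rule local_primitives_compatible)

lemma chart_deck:
  assumes c: "chart B F a b W" and g: "g \<in> deck_group p" and W': "open W'" "convex W'" "W' \<subseteq> g ` W"
  shows "chart B (g \<circ> F) a b W'"
proof -
  have B: "lifted_box B F" and W: "W \<subseteq> upper_half" using c by (auto simp: chart_def)
  obtain h where h: "h \<in> deck_group p" "g \<circ> h = id" "h \<circ> g = id" using deck_inverse[OF g] by blast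
  have sl: "same_leaf (h z) (h w)" if "same_leaf z w" for z w
    using that leaf_deck[OF _ h(1)] unfolding same_leaf_def by (metis geod_compose)
  have hg: "h (g z) = z" for z using h(3) by (simp add: fun_eq_iff)
  have "thin B (g \<circ> F) (K B \<inter> {a..b})"
    using c sl unfolding chart_def thin_def by (metis comp_apply hg)
  moreover have "\<exists>t\<in>{t0 B..t1 B}. \<exists>s\<in>K B \<inter> {a..b}. z = (g \<circ> F) (t, s)" if z: "z \<in> W' \<inter> lift_lam" for z
  proof -
    obtain w where w: "w \<in> W" "z = g w" using z W'(3) by blast
    then have "w \<in> lift_lam" using z W deck_p[OF g] by (auto simp: lift_lam_def)
    then obtain t s where "t \<in> {t0 B..t1 B}" "s \<in> K B \<inter> {a..b}" "w = F (t, s)" using c w unfolding chart_def by blast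
    then show ?thesis using w(2) by (metis comp_apply)
  qed
  moreover have "W' \<subseteq> upper_half" using W'(3) W deck_upper_half[OF g] by blast
  ultimately show ?thesis using lifted_box_deck[OF B g] W' by (simp add: chart_def)
qed

lemma chart_primitive_deck:
  assumes B: "lifted_box B F" and g: "g \<in> deck_group p" and z: "z \<in> upper_half"
  shows "chart_primitive B (g \<circ> F) a b (g z) = chart_primitive B F a b z"
proof -
  have "0 < side (g (F (t0 B, s))) (g (F (t1 B, s))) (g z) \<longleftrightarrow> 0 < side (F (t0 B, s)) (F (t1 B, s)) z" if "s \<in> K B" for s
    using side_isometry[OF deck_isometry[OF g] _ _ z] lifted_box_upper_half[OF B K_rect[OF B that]] box_order[OF B] by auto
  then have "plaques_right_of B (g \<circ> F) a b (g z) = plaques_right_of B F a b z" by (auto simp: plaques_right_of_def)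
  then show ?thesis by (simp add: chart_primitive_def)
qed

text \<open>A deck transformation carries charts to charts and preserves their primitives, so that \<open>v \<circ> g - v\<close> is
  locally constant.\<close>

lemma primitive_deck:
  assumes v: "is_primitive v" and g: "g \<in> deck_group p"
  shows "\<exists>c. \<forall>z\<in>upper_half. v (g z) = v z + c"
proof -
  have "v (g x) - v x = v (g y) - v y" if xy: "x \<in> upper_half" "y \<in> upper_half" for x y
  proof (rule connected_local_const[where A = upper_half and f = "\<lambda>x. v (g x) - v x"])
    show "connected upper_half" by (rule convex_connected[OF convex_upper_half])
    show "\<forall>x\<in>upper_half. \<forall>\<^sub>F y in at x within upper_half. v (g x) - v x = v (g y) - v y"
    proof
      fix x assume x: "x \<in> upper_half"
      obtain r u where r: "r > 0" "(ball x r, u) \<in> local_primitives" using local_primitives_cover[OF x open_UNIV UNIV_I] by blast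
      have H: "ball x r \<subseteq> upper_half" using local_primitives_props[OF r(2)] by blast
      have "open (g ` ball x r)" by (rule isometry_open_image[OF deck_isometry[OF g] open_ball H])
      moreover have "g x \<in> g ` ball x r" using r(1) by auto
      ultimately obtain r' where r': "r' > 0" "ball (g x) r' \<subseteq> g ` ball x r" by (meson open_contains_ball)
      have "\<exists>u'. (ball (g x) r', u') \<in> local_primitives \<and> (\<forall>z\<in>ball x r. u' (g z) = u z)"
      proof -
        consider "ball x r \<inter> lift_lam = {}" "u = (\<lambda>_. 0)" | B F a b where "chart B F a b (ball x r)" "u = chart_primitive B F a b"
          using r(2) by (auto simp: local_primitives_def)
        then show ?thesis
        proof cases
          case 1
          have "ball (g x) r' \<inter> lift_lam = {}"
          proof (rule ccontr)
            assume "ball (g x) r' \<inter> lift_lam \<noteq> {}"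
            then obtain w where "w \<in> ball x r" "g w \<in> lift_lam" using r'(2) by blast
            then have "w \<in> lift_lam" using H deck_p[OF g] by (auto simp: lift_lam_def)
            then show False using 1 \<open>w \<in> ball x r\<close> by blast
          qed
          moreover have "ball (g x) r' \<subseteq> upper_half" using r'(2) H deck_upper_half[OF g] by blast
          ultimately show ?thesis using 1 by (intro exI[of _ "\<lambda>_. 0"]) (auto simp: local_primitives_def)
        next
          case 2
          have B: "lifted_box B F" using 2(1) by (simp add: chart_def)
          have "chart B (g \<circ> F) a b (ball (g x) r')" by (rule chart_deck[OF 2(1) g _ _ r'(2)]) simp_all
          moreover have "\<forall>z\<in>ball x r. chart_primitive B (g \<circ> F) a b (g z) = u z"
            using chart_primitive_deck[OF B g] H 2(2) by auto
          ultimately show ?thesis unfolding local_primitives_def by blast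
        qed
      qed
      then obtain u' where u': "(ball (g x) r', u') \<in> local_primitives" "\<And>z. z \<in> ball x r \<Longrightarrow> u' (g z) = u z" by blast
      have "open (ball x r \<inter> g -` ball (g x) r')"
        by (rule continuous_open_preimage[OF isometry_continuous_on[OF deck_isometry[OF g] H]]) simp_all
      then have "\<forall>\<^sub>F y in at x within upper_half. y \<in> ball x r \<inter> g -` ball (g x) r'"
        using r r' by (intro eventually_at_in_open'[THEN filter_leD[OF at_le[OF subset_UNIV]]]) auto
      then show "\<forall>\<^sub>F y in at x within upper_half. v (g x) - v x = v (g y) - v y"
      proof eventually_elim
        case (elim y)
        have "v y - v x = u y - u x" by (rule is_primitiveD[OF v r(2)]) (use elim r in auto)
        moreover have "v (g y) - v (g x) = u' (g y) - u' (g x)" by (rule is_primitiveD[OF v u'(1)]) (use elim r' in auto)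
        ultimately show ?case using u'(2)[of x] u'(2)[of y] elim r(1) by auto
      qed
    qed
  qed (use xy in auto)
  then show ?thesis
    by (metis add.commute diff_add_cancel)
qed

end

section \<open>The pairing of the primitive with compactly supported forms\<close>

lemma test_form_mult:
  assumes \<theta>: "test_form S \<theta>" and f: "open Q" "S \<subseteq> Q" "smooth Q f" and C: "closed C" "\<And>z. z \<notin> C \<Longrightarrow> f z = 0"
  shows "test_form (S \<inter> C) (\<lambda>z v. f z * \<theta> z v)"
proof -
  have S: "compact S" "S \<subseteq> upper_half" using \<theta> by (auto simp: test_form_def)
  have "smooth UNIV (\<lambda>z. f z * \<theta> z v)" for v
  proof (rule smooth_extend[OF f(1) _ S(1) f(2)])
    show "smooth Q (\<lambda>z. f z * \<theta> z v)"
      by (intro smooth_mult f smooth_subset[OF test_form_smooth[OF \<theta>] subset_UNIV])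
  qed (simp add: test_form_zero[OF \<theta>])
  moreover have "linear (\<lambda>v. f z * \<theta> z v)" for z
    using test_form_linear[OF \<theta>, of z] by (simp add: linear_iff algebra_simps)
  moreover have "compact (S \<inter> C)" by (rule compact_Int_closed[OF S(1) C(1)])
  moreover have "f z * \<theta> z v = 0" if "z \<notin> S \<inter> C" for z v
    using that C(2)[of z] test_form_zero[OF \<theta>, of z v] by auto
  ultimately show ?thesis unfolding test_form_def using S(2) by blast
qed

text \<open>The functions are quotients by a sum of bumps, whence the neighbourhood \<open>Q\<close> on which they are smooth;
  the halved radii keep compact supports inside the open balls.\<close>

definition unity_partition where
  "unity_partition S r I \<rho> Q \<longleftrightarrow> finite I \<and> I \<subseteq> S \<and> open Q \<and> S \<subseteq> Q \<and> (\<forall>x\<in>I. smooth Q (\<rho> x)) \<and>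
     (\<forall>x z. 0 \<le> \<rho> x z \<and> \<rho> x z \<le> 1) \<and> (\<forall>x\<in>I. \<forall>z. z \<notin> cball x (r x / 2) \<longrightarrow> \<rho> x z = 0) \<and>
     (\<forall>z\<in>S. (\<Sum>x\<in>I. \<rho> x z) = 1)"

lemma partition_of_unity:
  fixes r :: "complex \<Rightarrow> real"
  assumes S: "compact S" and r: "\<And>x. x \<in> S \<Longrightarrow> r x > 0"
  shows "\<exists>I \<rho> Q. unity_partition S r I \<rho> Q"
proof -
  have "S \<subseteq> (\<Union>x\<in>S. ball x (r x / 2))" using r by force
  then obtain I where I: "I \<subseteq> S" "finite I" "S \<subseteq> (\<Union>x\<in>I. ball x (r x / 2))"
    using compactE_image[OF S, of S "\<lambda>x. ball x (r x / 2)"] by auto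
  have r2: "r x / 2 > 0" if "x \<in> I" for x using r I(1) that by auto
  define s where "s z = (\<Sum>x\<in>I. bump x (r x / 2) z)" for z
  define \<rho> where "\<rho> x z = (if x \<in> I then bump x (r x / 2) z / s z else 0)" for x z
  have ss: "smooth UNIV s" unfolding s_def by (intro smooth_sum smooth_bump open_UNIV)
  define Q where "Q = {z. s z > 0}"
  have Q: "open Q" unfolding Q_def using open_Collect_less[of "\<lambda>_. 0" s] smooth_continuous_on[OF ss] by simp
  have nn: "0 \<le> s z" for z unfolding s_def by (intro sum_nonneg bump_pos)
  have SQ: "S \<subseteq> Q"
    proof
      fix z assume "z \<in> S"
      then obtain x where x: "x \<in> I" "z \<in> ball x (r x / 2)" using I(3) by blast
      then have "0 < bump x (r x / 2) z" using bump_pos(2)[OF r2] by blast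
      also have "\<dots> \<le> s z" unfolding s_def using x I(2) by (intro member_le_sum bump_pos) auto
      finally show "z \<in> Q" by (simp add: Q_def)
    qed
  have sum: "(\<Sum>x\<in>I. \<rho> x z) = 1" if "z \<in> S" for z
      using that SQ by (auto simp: \<rho>_def Q_def sum_divide_distrib[symmetric] s_def[symmetric])
  have sm: "smooth Q (\<rho> x)" if "x \<in> I" for x
      unfolding \<rho>_def using that
      by (simp, intro smooth_divide Q smooth_bump smooth_subset[OF ss]) (auto simp: Q_def)
  have bd: "0 \<le> \<rho> x z \<and> \<rho> x z \<le> 1" for x z
    proof -
      have "bump x (r x / 2) z \<le> s z" if "x \<in> I" unfolding s_def using that I(2) by (intro member_le_sum bump_pos) auto
      then show ?thesis using nn[of z] bump_pos(1)[of x "r x / 2" z] by (auto simp: \<rho>_def divide_le_eq_1)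
    qed
  have zero: "\<rho> x z = 0" if "x \<in> I" "z \<notin> cball x (r x / 2)" for x z
    using bump_pos(3)[OF r2[OF that(1)]] that by (auto simp: \<rho>_def)
  have "unity_partition S r I \<rho> Q" unfolding unity_partition_def using I Q SQ sum sm bd zero by blast
  then show ?thesis by blast
qed

lemma test_form_add: "test_form S \<theta> \<Longrightarrow> test_form S \<eta> \<Longrightarrow> test_form S (\<lambda>z v. \<theta> z v + \<eta> z v)"
  unfolding test_form_def by (auto intro: smooth_add linear_compose_add)

lemma test_form_0: "compact S \<Longrightarrow> S \<subseteq> upper_half \<Longrightarrow> test_form S (\<lambda>z v. 0)"
  unfolding test_form_def by (simp add: linear_iff)

lemma test_form_scale: "test_form S \<theta> \<Longrightarrow> test_form S (\<lambda>z v. c * \<theta> z v)"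
  unfolding test_form_def by (auto intro: smooth_mult smooth_const simp: linear_iff algebra_simps)

lemma test_form_sum:
  "compact S \<Longrightarrow> S \<subseteq> upper_half \<Longrightarrow> (\<And>i. i \<in> I \<Longrightarrow> test_form S (\<theta> i)) \<Longrightarrow> test_form S (\<lambda>z v. \<Sum>i\<in>I. \<theta> i z v)"
  by (induction I rule: infinite_finite_induct) (auto intro: test_form_0 test_form_add)

lemma d1_add:
  assumes "\<And>v. (\<lambda>z. \<theta> z v) differentiable (at z)" "\<And>v. (\<lambda>z. \<eta> z v) differentiable (at z)"
  shows "d1 (\<lambda>z v. \<theta> z v + \<eta> z v) z = d1 \<theta> z + d1 \<eta> z"
proof -
  have "frechet_derivative (\<lambda>z. \<theta> z v + \<eta> z v) (at z) = (\<lambda>u. frechet_derivative (\<lambda>z. \<theta> z v) (at z) u + frechet_derivative (\<lambda>z. \<eta> z v) (at z) u)" for v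
    by (rule frechet_derivative_at[symmetric], rule has_derivative_add) (use assms frechet_derivative_works in blast)+
  then show ?thesis by (simp add: d1_def)
qed

lemma d1_scale:
  assumes "\<And>v. (\<lambda>z. \<theta> z v) differentiable (at z)"
  shows "d1 (\<lambda>z v. c * \<theta> z v) z = c * d1 \<theta> z"
proof -
  have "frechet_derivative (\<lambda>z. c * \<theta> z v) (at z) = (\<lambda>u. c * frechet_derivative (\<lambda>z. \<theta> z v) (at z) u)" for v
    by (rule frechet_derivative_at[symmetric], rule has_derivative_mult_right) (use assms frechet_derivative_works in blast)
  then show ?thesis by (simp add: d1_def algebra_simps)
qed

text \<open>The geodesic has unit hyperbolic speed.\<close>

lemma gvel_norm:
  assumes "A \<in> hyp_isometries" shows "cmod (gvel A t) = Im (geod A t)"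
proof -
  obtain a b c d where A: "A = mob a b c d" "a * d - b * c = 1" using assms hyp_isometries_mob by blast
  have "cmod (gvel A t) = cmod (1 / (of_real c * (\<i> * of_real (exp t)) + of_real d)\<^sup>2) * exp t"
    unfolding gvel_def A(1) deriv_mob[OF axis_upper_half A(2)] by (simp add: norm_mult norm_divide)
  also have "\<dots> = Im (geod A t)"
    unfolding geod_def A(1) Im_mob[OF axis_upper_half A(2)] by (simp add: norm_divide norm_power)
  finally show ?thesis .
qed

context lamination begin

definition leaf_at :: "complex \<Rightarrow> complex \<Rightarrow> complex" where
  "leaf_at z = (THE A. leaf A \<and> geod A 0 = z)"

lemma leaf_at_unique: "leaf A \<Longrightarrow> geod A 0 = z \<Longrightarrow> leaf_at z = A"
  unfolding leaf_at_def
proof (rule the_equality)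
  fix C assume A: "leaf A" "geod A 0 = z" and C: "leaf C \<and> geod C 0 = z"
  then have "geod C (0 + x) = geod A (0 + x)" for x by (intro leaf_unique) auto
  from this[of 0] this[of 1] show "C = A"
    using geod_unique[OF leaf_isometry leaf_isometry, of C A 0 1] A C by simp
qed simp

lemma leaf_at: "z \<in> lift_lam \<Longrightarrow> leaf (leaf_at z) \<and> geod (leaf_at z) 0 = z"
  using leaf_through leaf_at_unique by metis

definition plaque_length :: "'m box \<Rightarrow> (real \<times> real \<Rightarrow> complex) \<Rightarrow> real \<Rightarrow> real" where
  "plaque_length B F s = hyp_dist (F (t0 B, s)) (F (t1 B, s))"

definition plaque_leaf_at :: "'m box \<Rightarrow> (real \<times> real \<Rightarrow> complex) \<Rightarrow> real \<Rightarrow> complex \<Rightarrow> complex" where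
  "plaque_leaf_at B F s = leaf_at (F (t0 B, s))"

lemma plaque_at:
  assumes B: "lifted_box B F" and s: "s \<in> K B"
  shows "plaque B F s (plaque_leaf_at B F s) (\<lambda>t. hyp_dist (F (t0 B, s)) (F (t, s)))"
proof -
  obtain A \<theta> where A: "plaque B F s A \<theta>" using plaque_exists[OF B s] by blast
  have T: "t0 B \<in> {t0 B..t1 B}" using box_order[OF B] by auto
  define L where "L = plaque_leaf_at B F s"
  have "F (t0 B, s) \<in> lift_lam" using in_lift_lam_iff[OF B K_rect[OF B s T]] s by simp
  then have L: "leaf L" "geod L 0 = F (t0 B, s)" using leaf_at by (auto simp: L_def plaque_leaf_at_def)
  have lA: "leaf A" and FA: "\<And>t. t \<in> {t0 B..t1 B} \<Longrightarrow> F (t, s) = geod A (\<theta> t)"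
    and mono: "strict_mono_on {t0 B..t1 B} \<theta>" and cont: "continuous_on {t0 B..t1 B} \<theta>" using A by (auto simp: plaque_def)
  have AL: "geod L (0 + x) = geod A (\<theta> (t0 B) + x)" for x
    by (rule leaf_unique[OF L(1) lA]) (use L FA[OF T] in simp)
  have h: "hyp_dist (F (t0 B, s)) (F (t, s)) = \<theta> t - \<theta> (t0 B)" if t: "t \<in> {t0 B..t1 B}" for t
  proof -
    have "\<theta> (t0 B) \<le> \<theta> t" using mono T t by (cases "t = t0 B") (auto simp: strict_mono_on_def intro: less_imp_le)
    then show ?thesis using FA[OF T] FA[OF t] hyp_dist_geod[OF leaf_isometry[OF lA]] by simp
  qed
  have "F (t, s) = geod L (hyp_dist (F (t0 B, s)) (F (t, s)))" if t: "t \<in> {t0 B..t1 B}" for t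
    using AL[of "\<theta> t - \<theta> (t0 B)"] h[OF t] FA[OF t] by simp
  moreover have "continuous_on {t0 B..t1 B} (\<lambda>t. hyp_dist (F (t0 B, s)) (F (t, s)))"
    by (rule continuous_on_eq[of _ "\<lambda>t. \<theta> t - \<theta> (t0 B)"]) (use h cont in \<open>auto intro!: continuous_intros\<close>)
  moreover have "strict_mono_on {t0 B..t1 B} (\<lambda>t. hyp_dist (F (t0 B, s)) (F (t, s)))"
    using mono h by (auto simp: strict_mono_on_def)
  ultimately show ?thesis using L(1) by (simp add: plaque_def L_def)
qed

lemma plaque_param:
  assumes B: "lifted_box B F" and s: "s \<in> K B"
  shows "leaf (plaque_leaf_at B F s)" "0 \<le> plaque_length B F s"
    "\<And>t. t \<in> {t0 B..t1 B} \<Longrightarrow> \<exists>x\<in>{0..plaque_length B F s}. F (t, s) = geod (plaque_leaf_at B F s) x"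
    "\<And>x. x \<in> {0..plaque_length B F s} \<Longrightarrow> \<exists>t\<in>{t0 B..t1 B}. F (t, s) = geod (plaque_leaf_at B F s) x"
proof -
  let ?th = "\<lambda>t. hyp_dist (F (t0 B, s)) (F (t, s))"
  have P: "leaf (plaque_leaf_at B F s)" "\<And>t. t \<in> {t0 B..t1 B} \<Longrightarrow> F (t, s) = geod (plaque_leaf_at B F s) (?th t)"
    "continuous_on {t0 B..t1 B} ?th" "strict_mono_on {t0 B..t1 B} ?th"
    using plaque_at[OF B s] by (auto simp: plaque_def)
  have o: "t0 B < t1 B" using box_order[OF B] by simp
  have u: "F (t, s) \<in> upper_half" if "t \<in> {t0 B..t1 B}" for t by (rule lifted_box_upper_half[OF B K_rect[OF B s that]])
  have T: "t0 B \<in> {t0 B..t1 B}" "t1 B \<in> {t0 B..t1 B}" using o by auto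
  have z: "?th (t0 B) = 0" using hyp_dist_eq_0[OF u u] T by simp
  show "leaf (plaque_leaf_at B F s)" by (rule P(1))
  show "0 \<le> plaque_length B F s" unfolding plaque_length_def by (rule hyp_dist_nonneg[OF u u]) (rule T)+
  show "\<exists>x\<in>{0..plaque_length B F s}. F (t, s) = geod (plaque_leaf_at B F s) x" if t: "t \<in> {t0 B..t1 B}" for t
  proof (rule bexI[of _ "?th t"])
    show "F (t, s) = geod (plaque_leaf_at B F s) (?th t)" by (rule P(2)[OF t])
    have "?th t \<le> ?th (t1 B)"
      using P(4) T t by (cases "t = t1 B") (auto simp: strict_mono_on_def intro: less_imp_le)
    then show "?th t \<in> {0..plaque_length B F s}" using hyp_dist_nonneg[OF u u] T t by (simp add: plaque_length_def)
  qed
  show "\<exists>t\<in>{t0 B..t1 B}. F (t, s) = geod (plaque_leaf_at B F s) x" if x: "x \<in> {0..plaque_length B F s}" for x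
  proof -
    obtain t where t: "t \<in> {t0 B..t1 B}" "?th t = x"
      using IVT'[of ?th "t0 B" x "t1 B"] x z P(3) o unfolding plaque_length_def by auto
    show ?thesis using P(2)[OF t(1)] t by auto
  qed
qed

text \<open>The plaque is parametrized by arc length instead of the time of the box, which gives a description
  for all boxes alike.\<close>

definition plaque_integral :: "'m box \<Rightarrow> (real \<times> real \<Rightarrow> complex) \<Rightarrow> one_form \<Rightarrow> real \<Rightarrow> real" where
  "plaque_integral B F \<theta> s = (if s \<in> K B then
     integral {0..plaque_length B F s} (\<lambda>x. \<theta> (geod (plaque_leaf_at B F s) x) (gvel (plaque_leaf_at B F s) x)) else 0)"

definition box_integral :: "'m box \<Rightarrow> (real \<times> real \<Rightarrow> complex) \<Rightarrow> one_form \<Rightarrow> real" where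
  "box_integral B F \<theta> = (LINT s|\<nu> B. plaque_integral B F \<theta> s)"

text \<open>The value on \<open>\<theta>\<close> of the current \<open>dv\<close>.\<close>

definition pairing :: "(complex \<Rightarrow> real) \<Rightarrow> one_form \<Rightarrow> real" where
  "pairing v \<theta> = (LINT z|lborel. v z * d1 \<theta> z)"

lemma continuous_on_gvel: "A \<in> hyp_isometries \<Longrightarrow> continuous_on X (gvel A)"
  unfolding gvel_def
  by (intro continuous_intros continuous_on_compose2[OF deriv_isometry_continuous_on]) auto

lemma continuous_on_along_geod:
  assumes "test_form S \<theta>" "A \<in> hyp_isometries"
  shows "continuous_on X (\<lambda>x. \<theta> (geod A x) (gvel A x))"
  by (intro continuous_on_form[OF assms(1)] continuous_on_geod continuous_on_gvel assms)

text \<open>In a chart, the form does not see the part of a leaf outside its plaque.\<close>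

lemma plaque_integral_geod:
  assumes c: "chart B F a b W" and \<theta>: "test_form S \<theta>" and S: "S \<subseteq> W"
  shows "s \<in> K B \<inter> {a..b} \<Longrightarrow> plaque_integral B F \<theta> s = geod_integral (plaque_leaf_at B F s) \<theta>"
    "s \<notin> K B \<inter> {a..b} \<Longrightarrow> plaque_integral B F \<theta> s = 0"
proof -
  have B: "lifted_box B F" using c by (simp add: chart_def)
  define L where "L = plaque_leaf_at B F s"
  have T: "t0 B \<in> {t0 B..t1 B}" using box_order[OF B] by auto
  let ?f = "\<lambda>x. \<theta> (geod L x) (gvel L x)"
  have inS: "\<exists>t\<in>{t0 B..t1 B}. \<exists>s'\<in>K B \<inter> {a..b}. geod L x = F (t, s')" if "leaf L" "?f x \<noteq> 0" for x
    using that test_form_zero[OF \<theta>] S c leaf_in_lift_lam unfolding chart_def by blast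
  have pi: "plaque_integral B F \<theta> s = integral {0..plaque_length B F s} ?f" if "s \<in> K B" using that by (simp add: plaque_integral_def L_def)
  show "plaque_integral B F \<theta> s = geod_integral (plaque_leaf_at B F s) \<theta>" if s: "s \<in> K B \<inter> {a..b}"
  proof -
    have sK: "s \<in> K B" using s by simp
    have L: "leaf L" using plaque_param[OF B sK] by (auto simp: L_def)
    have cf: "continuous_on X ?f" for X by (rule continuous_on_along_geod[OF \<theta> leaf_isometry[OF L]])
    have zero: "?f x = 0" if x: "x \<notin> {0..plaque_length B F s}" for x
    proof (rule ccontr)
      assume "?f x \<noteq> 0"
      then obtain t s' where s': "t \<in> {t0 B..t1 B}" "s' \<in> K B \<inter> {a..b}" "geod L x = F (t, s')" using inS[OF L] by blast
      obtain y where y: "F (t, s) = geod L y" using plaque_param(3)[OF B sK s'(1)] by (auto simp: L_def)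
      have "same_leaf (F (t, s)) (F (t, s'))" using same_leafI[OF L, of y x] y s'(3) by simp
      from meet_same_leaf[OF B B sK _ s'(1) s'(1) this T T] have "same_leaf (F (t0 B, s)) (F (t0 B, s'))" using s'(2) by blast
      then have "s = s'" using c s s'(2) unfolding chart_def thin_def by blast
      then obtain x' where "x' \<in> {0..plaque_length B F s}" "geod L x = geod L x'"
        using plaque_param(3)[OF B sK s'(1)] s'(3) by (auto simp: L_def)
      then show False using x geod_inj[OF leaf_isometry[OF L]] by simp
    qed
    have "integral {0..plaque_length B F s} ?f = (LINT x:{0..plaque_length B F s}|lborel. ?f x)"
      by (rule set_borel_integral_eq_integral(2)[symmetric, OF borel_integrable_atLeastAtMost'[OF cf]])
    also have "\<dots> = (LINT x|lborel. ?f x)"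
      unfolding set_lebesgue_integral_def using zero by (intro Bochner_Integration.integral_cong) (auto simp: indicator_def)
    finally show ?thesis unfolding pi[OF sK] by (simp add: geod_integral_def L_def)
  qed
  show "plaque_integral B F \<theta> s = 0" if ns: "s \<notin> K B \<inter> {a..b}"
  proof (cases "s \<in> K B")
    case False then show ?thesis by (simp add: plaque_integral_def)
  next
    case s: True
    have L: "leaf L" using plaque_param[OF B s] by (auto simp: L_def)
    have "?f x = 0" if x: "x \<in> {0..plaque_length B F s}" for x
    proof (rule ccontr)
      assume "?f x \<noteq> 0"
      then obtain t s' where s': "t \<in> {t0 B..t1 B}" "s' \<in> K B \<inter> {a..b}" "geod L x = F (t, s')" using inS[OF L] by blast
      obtain t' where t': "t' \<in> {t0 B..t1 B}" "F (t', s) = geod L x" using plaque_param(4)[OF B s x] by (auto simp: L_def)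
      have "(t', s) = (t, s')"
        using inj_onD[OF lifted_box_inj[OF B], of "(t', s)" "(t, s')"] K_rect[OF B] s s' t' by auto
      then show False using ns s'(2) by simp
    qed
    then have "integral {0..plaque_length B F s} ?f = integral {0..plaque_length B F s} (\<lambda>_. 0)"
      by (intro Henstock_Kurzweil_Integration.integral_cong) simp
    then show ?thesis unfolding pi[OF s] by simp
  qed
qed

text \<open>By Stokes' formula the integral over a plaque is that of the exterior derivative over the left
  side of its leaf.\<close>

lemma plaque_integral_chart:
  assumes c: "chart B F a b W" and \<theta>: "test_form S \<theta>" and S: "S \<subseteq> W"
  shows "plaque_integral B F \<theta> s = (LINT z|lborel. indicator {s \<in> K B \<inter> {a..b}. 0 < side (F (t0 B, s)) (F (t1 B, s)) z} s * d1 \<theta> z)"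
proof (cases "s \<in> K B \<inter> {a..b}")
  case True
  have B: "lifted_box B F" using c by (simp add: chart_def)
  have s: "s \<in> K B" using True by simp
  have T: "t0 B \<in> {t0 B..t1 B}" using box_order[OF B] by auto
  let ?L = "plaque_leaf_at B F s"
  have L: "leaf ?L" using plaque_param[OF B s] by auto
  have "plaque_integral B F \<theta> s = (LINT z|lborel. indicator (left_side ?L) z * d1 \<theta> z)"
    unfolding plaque_integral_geod(1)[OF c \<theta> S True] by (rule stokes_left_side[OF leaf_isometry[OF L] \<theta>])
  also have "\<dots> = (LINT z|lborel. indicator {s \<in> K B \<inter> {a..b}. 0 < side (F (t0 B, s)) (F (t1 B, s)) z} s * d1 \<theta> z)"
  proof (rule Bochner_Integration.integral_cong[OF refl])
    fix z
    show "indicator (left_side ?L) z * d1 \<theta> z = indicator {s \<in> K B \<inter> {a..b}. 0 < side (F (t0 B, s)) (F (t1 B, s)) z} s * d1 \<theta> z"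
    proof (cases "z \<in> S")
      case zS: True
      then have "z \<in> upper_half" using \<theta> by (auto simp: test_form_def)
      obtain y where y: "geod ?L y = F (t0 B, s)" using plaque_param(3)[OF B s T] by auto
      from plaque_left_side[OF B s L this T \<open>z \<in> upper_half\<close>] show ?thesis
        using True by (simp add: indicator_def)
    qed (simp add: d1_zero[OF \<theta>])
  qed
  finally show ?thesis .
next
  case False
  then have "indicator {s \<in> K B \<inter> {a..b}. 0 < side (F (t0 B, s)) (F (t1 B, s)) z} s = (0::real)" for z by auto
  then show ?thesis unfolding plaque_integral_geod(2)[OF c \<theta> S False] by simp
qed

lemma plaques_right_of_measurable:
  assumes B: "lifted_box B F"
  shows "{x. fst x \<in> K B \<inter> {a..b} \<and> 0 < side (F (t0 B, fst x)) (F (t1 B, fst x)) (snd x)} \<in> sets (\<nu> B \<Otimes>\<^sub>M (lborel :: complex measure))"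
proof -
  let ?E = "(K B \<inter> {a..b}) \<times> (UNIV :: complex set)"
  have "continuous_on ?E (\<lambda>x. side (F (t0 B, fst x)) (F (t1 B, fst x)) (snd x))"
    by (rule continuous_on_subset[OF continuous_on_plaque_side[OF B]]) auto
  moreover have "closed ?E" using K_closed[OF B] by (intro closed_Times) auto
  ultimately have "?E \<inter> (\<lambda>x. side (F (t0 B, fst x)) (F (t1 B, fst x)) (snd x)) -` {0<..} \<in> sets borel"
    by (intro borel_continuous_preimage) auto
  moreover have "?E \<inter> (\<lambda>x. side (F (t0 B, fst x)) (F (t1 B, fst x)) (snd x)) -` {0<..} =
     {x. fst x \<in> K B \<inter> {a..b} \<and> 0 < side (F (t0 B, fst x)) (F (t1 B, fst x)) (snd x)}" by auto
  moreover have "sets (\<nu> B \<Otimes>\<^sub>M (lborel :: complex measure)) = sets borel"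
    by (metis borel_prod sets_pair_measure_cong nu_sets[OF B] sets_lborel)
  ultimately show ?thesis by simp
qed

lemma chart_primitive_measurable:
  assumes B: "lifted_box B F"
  shows "chart_primitive B F a b \<in> borel_measurable borel"
    "chart_primitive B F a b z = (LINT s|\<nu> B. indicator {s \<in> K B \<inter> {a..b}. 0 < side (F (t0 B, s)) (F (t1 B, s)) z} s)"
    "0 \<le> chart_primitive B F a b z \<and> chart_primitive B F a b z \<le> measure (\<nu> B) (space (\<nu> B))"
proof -
  interpret finite_measure "\<nu> B" by (rule nu_finite[OF B])
  have m: "plaques_right_of B F a b w \<in> sets (\<nu> B)" for w
    using plaques_right_of_borel[OF B] by (simp add: nu_sets[OF B])
  show e: "chart_primitive B F a b z = (LINT s|\<nu> B. indicator {s \<in> K B \<inter> {a..b}. 0 < side (F (t0 B, s)) (F (t1 B, s)) z} s)" for z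
    using m[of z] unfolding chart_primitive_def plaques_right_of_def by (simp add: sets.Int_space_eq2)
  show "0 \<le> chart_primitive B F a b z \<and> chart_primitive B F a b z \<le> measure (\<nu> B) (space (\<nu> B))"
    unfolding chart_primitive_def by (simp add: bounded_measure)
  let ?G = "{x. fst x \<in> K B \<inter> {a..b} \<and> 0 < side (F (t0 B, fst x)) (F (t1 B, fst x)) (snd x)}"
  have "(\<lambda>x. indicator ?G x :: real) \<in> borel_measurable (\<nu> B \<Otimes>\<^sub>M lborel)"
    using plaques_right_of_measurable[OF B] by (rule borel_measurable_indicator)
  then have "(\<lambda>(z, s). indicator ?G (s, z) :: real) \<in> borel_measurable (lborel \<Otimes>\<^sub>M \<nu> B)"
    using measurable_compose[OF measurable_pair_swap'] by (simp add: split_beta')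
  from borel_measurable_lebesgue_integral[OF this]
  have "(\<lambda>z. LINT s|\<nu> B. indicator ?G (s, z) :: real) \<in> borel_measurable borel" by simp
  moreover have "chart_primitive B F a b = (\<lambda>z. LINT s|\<nu> B. indicator ?G (s, z) :: real)"
    by (rule ext, subst e, rule Bochner_Integration.integral_cong) (auto simp: indicator_def)
  ultimately show "chart_primitive B F a b \<in> borel_measurable borel" by simp
qed

text \<open>Fubini: a point \<open>z\<close> is counted by the plaques whose leaves have it on their left, and these have
  measure \<open>chart_primitive B F a b z\<close>.\<close>

lemma box_integral_chart:
  assumes c: "chart B F a b W" and \<theta>: "test_form S \<theta>" and S: "S \<subseteq> W"
  shows "integrable (\<nu> B) (plaque_integral B F \<theta>)" "box_integral B F \<theta> = (LINT z|lborel. chart_primitive B F a b z * d1 \<theta> z)"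
proof -
  have B: "lifted_box B F" using c by (simp add: chart_def)
  interpret finite_measure "\<nu> B" by (rule nu_finite[OF B])
  interpret pair_sigma_finite "\<nu> B" "lborel :: complex measure" ..
  let ?G = "{x. fst x \<in> K B \<inter> {a..b} \<and> 0 < side (F (t0 B, fst x)) (F (t1 B, fst x)) (snd x)}"
  define f where "f s z = indicator ?G (s, z) * d1 \<theta> z" for s z
  have d1m: "d1 \<theta> \<in> borel_measurable lborel" using borel_measurable_integrable[OF d1_integrable[OF \<theta>]] .
  have fm: "case_prod f \<in> borel_measurable (\<nu> B \<Otimes>\<^sub>M lborel)"
    unfolding f_def split_beta'
    using borel_measurable_indicator[OF plaques_right_of_measurable[OF B]] d1m
    by (intro borel_measurable_times measurable_compose[OF measurable_snd d1m]) auto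
  have fs: "f s \<in> borel_measurable lborel" for s
    using measurable_compose[OF measurable_Pair1'[of s "\<nu> B"] fm] by (simp add: nu_sets[OF B, THEN sets_eq_imp_space_eq])
  have fi: "integrable lborel (f s)" for s
    by (rule Bochner_Integration.integrable_bound[OF d1_integrable[OF \<theta>] fs]) (auto simp: f_def indicator_def)
  define N where "N = (LINT z|lborel. norm (d1 \<theta> z))"
  have Nb: "(LINT z|lborel. norm (f s z)) \<le> N" for s
    unfolding N_def by (intro integral_mono integrable_norm fi d1_integrable[OF \<theta>]) (auto simp: f_def indicator_def)
  have "integrable (\<nu> B) (\<lambda>s. LINT z|lborel. norm (f s z))"
  proof (rule integrable_const_bound[of _ N])
    show "(\<lambda>s. LINT z|lborel. norm (f s z)) \<in> borel_measurable (\<nu> B)"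
      using lborel.borel_measurable_lebesgue_integral[of "\<lambda>s z. norm (f s z)" "\<nu> B"] measurable_compose[OF fm borel_measurable_norm] by (simp add: split_beta')
    show "AE s in \<nu> B. norm (LINT z|lborel. norm (f s z)) \<le> N" using Nb by (auto simp: abs_of_nonneg)
  qed
  then have pi: "integrable (\<nu> B \<Otimes>\<^sub>M lborel) (case_prod f)"
    by (intro Fubini_integrable fm) (use fi in auto)
  have e: "plaque_integral B F \<theta> s = (LINT z|lborel. f s z)" for s
    unfolding plaque_integral_chart[OF c \<theta> S] f_def by (simp add: indicator_def)
  show "integrable (\<nu> B) (plaque_integral B F \<theta>)"
    unfolding e[abs_def] using integrable_fst'[OF pi] by simp
  have "box_integral B F \<theta> = (LINT s|\<nu> B. LINT z|lborel. f s z)" by (simp add: box_integral_def e)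
  also have "\<dots> = (LINT z|lborel. LINT s|\<nu> B. f s z)" by (rule Fubini_integral[OF pi, symmetric])
  also have "\<dots> = (LINT z|lborel. chart_primitive B F a b z * d1 \<theta> z)"
  proof (rule Bochner_Integration.integral_cong[OF refl])
    fix z
    have "indicator ?G (s, z) = (indicator {s \<in> K B \<inter> {a..b}. 0 < side (F (t0 B, s)) (F (t1 B, s)) z} s :: real)" for s
      by (simp add: indicator_def)
    then show "(LINT s|\<nu> B. f s z) = chart_primitive B F a b z * d1 \<theta> z"
      unfolding f_def chart_primitive_measurable(2)[OF B] by (simp only: Bochner_Integration.integral_mult_left_zero)
  qed
  finally show "box_integral B F \<theta> = (LINT z|lborel. chart_primitive B F a b z * d1 \<theta> z)" .
qed

lemma local_primitive_measurable:
  assumes "(W, u) \<in> local_primitives"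
  shows "u \<in> borel_measurable borel" "\<exists>C. \<forall>z. \<bar>u z\<bar> \<le> C"
proof -
  consider "u = (\<lambda>_. 0)" | B F a b where "lifted_box B F" "u = chart_primitive B F a b"
    using assms by (auto simp: local_primitives_def chart_def)
  then have "u \<in> borel_measurable borel \<and> (\<exists>C. \<forall>z. \<bar>u z\<bar> \<le> C)"
  proof cases
    case 2
    then show ?thesis using chart_primitive_measurable[OF 2(1), of a b] by (auto intro!: exI[of _ "measure (\<nu> B) (space (\<nu> B))"])
  qed auto
  then show "u \<in> borel_measurable borel" "\<exists>C. \<forall>z. \<bar>u z\<bar> \<le> C" by auto
qed

lemma primitive_set_integrable:
  assumes v: "is_primitive v" and C: "compact C" "C \<subseteq> upper_half"
  shows "set_integrable lborel C v"
proof -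
  have "\<exists>r u. r > 0 \<and> (ball x r, u) \<in> local_primitives" if "x \<in> C" for x
    using local_primitives_cover[OF subsetD[OF C(2) that] open_UNIV UNIV_I] by blast
  then obtain r u where ru: "\<And>x. x \<in> C \<Longrightarrow> r x > 0" "\<And>x. x \<in> C \<Longrightarrow> (ball x (r x), u x) \<in> local_primitives" by metis
  have "C \<subseteq> (\<Union>x\<in>C. ball x (r x))" using ru(1) by force
  then obtain D where D: "D \<subseteq> C" "finite D" "C \<subseteq> (\<Union>x\<in>D. ball x (r x))"
    using compactE_image[OF C(1), of C "\<lambda>x. ball x (r x)"] by auto
  have "set_integrable lborel (ball x (r x)) v" if x: "x \<in> D" for x
  proof -
    have x: "x \<in> C" using x D(1) by blast
    note lp = ru(2)[OF x]
    obtain k where k: "\<And>z. \<bar>u x z\<bar> \<le> k" using local_primitive_measurable(2)[OF lp] by blast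
    define w where "w z = u x z + (v x - u x x)" for z
    have wm: "w \<in> borel_measurable borel" unfolding w_def using local_primitive_measurable(1)[OF lp] by simp
    have "set_integrable lborel (ball x (r x)) w" unfolding set_integrable_def
    proof (rule integrableI_bounded_set_indicator[of _ _ _ "k + \<bar>v x - u x x\<bar>"])
      show "emeasure lborel (ball x (r x)) < \<infinity>" by (rule emeasure_bounded_finite) simp
      show "AE z in lborel. z \<in> ball x (r x) \<longrightarrow> norm (w z) \<le> k + \<bar>v x - u x x\<bar>"
      proof (rule AE_I2, rule impI)
        fix z show "norm (w z) \<le> k + \<bar>v x - u x x\<bar>"
          using k[of z] abs_triangle_ineq[of "u x z" "v x - u x x"] unfolding w_def real_norm_def by linarith
      qed
    qed (use wm in auto)
    moreover have "(\<lambda>z. indicator (ball x (r x)) z *\<^sub>R v z) = (\<lambda>z. indicator (ball x (r x)) z *\<^sub>R w z)"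
    proof
      fix z show "indicator (ball x (r x)) z *\<^sub>R v z = indicator (ball x (r x)) z *\<^sub>R w z"
        using is_primitiveD[OF v lp, of x z] ru(1)[OF x] by (cases "z \<in> ball x (r x)") (simp_all add: w_def)
    qed
    ultimately show ?thesis unfolding set_integrable_def by (simp only:)
  qed
  then have "set_integrable lborel (\<Union>x\<in>D. ball x (r x)) v"
    using D(2) by (intro set_integrable_UN) auto
  then show ?thesis
    by (rule set_integrable_subset) (use D(3) C(1) in \<open>auto simp: compact_imp_closed\<close>)
qed

lemma primitive_times_integrable:
  assumes v: "is_primitive v" and S: "compact S" "S \<subseteq> upper_half" and f: "continuous_on UNIV f" "\<And>z. z \<notin> S \<Longrightarrow> f z = 0"
  shows "integrable lborel (\<lambda>z. v z * (f z :: real))"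
proof -
  have si: "integrable lborel (\<lambda>z. indicator S z *\<^sub>R v z)"
    using primitive_set_integrable[OF v S] by (simp add: set_integrable_def)
  have "compact (f ` S)" by (intro compact_continuous_image continuous_on_subset[OF f(1)] S(1)) simp
  then obtain k where k: "\<And>z. z \<in> S \<Longrightarrow> \<bar>f z\<bar> \<le> k" using compact_imp_bounded[of "f ` S"] by (auto simp: bounded_iff)
  have e: "v z * f z = f z * (indicator S z *\<^sub>R v z)" for z using f(2)[of z] by (auto simp: indicator_def)
  show ?thesis
  proof (rule Bochner_Integration.integrable_bound[of _ "\<lambda>z. k * (indicator S z *\<^sub>R v z)"])
    show "integrable lborel (\<lambda>z. k * (indicator S z *\<^sub>R v z))" using si by simp
    show "(\<lambda>z. v z * f z) \<in> borel_measurable lborel"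
      unfolding e using borel_measurable_integrable[OF si] borel_measurable_continuous_onI[OF f(1)] by simp
    show "AE z in lborel. norm (v z * f z) \<le> norm (k * (indicator S z *\<^sub>R v z))"
    proof (rule AE_I2)
      fix z show "norm (v z * f z) \<le> norm (k * (indicator S z *\<^sub>R v z))"
      proof (cases "z \<in> S")
        case True
        then have "\<bar>f z\<bar> \<le> \<bar>k\<bar>" using k by force
        then show ?thesis using True by (simp add: abs_mult mult.commute mult_right_mono)
      qed (use f(2) in simp)
    qed
  qed
qed

lemma pairing_integrable:
  "is_primitive v \<Longrightarrow> test_form S \<theta> \<Longrightarrow> integrable lborel (\<lambda>z. v z * d1 \<theta> z)"
  by (rule primitive_times_integrable[OF _ _ _ d1_continuous d1_zero]) (auto simp: test_form_def)

lemma pairing_add: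
  assumes "is_primitive v" "test_form S \<theta>" "test_form S' \<eta>"
  shows "pairing v (\<lambda>z w. \<theta> z w + \<eta> z w) = pairing v \<theta> + pairing v \<eta>"
  using d1_add[OF test_form_differentiable[OF assms(2)] test_form_differentiable[OF assms(3)]]
    pairing_integrable[OF assms(1,2)] pairing_integrable[OF assms(1,3)]
  by (simp add: pairing_def distrib_left)

lemma pairing_scale:
  assumes "test_form S \<theta>" shows "pairing v (\<lambda>z w. c * \<theta> z w) = c * pairing v \<theta>"
  using d1_scale[OF test_form_differentiable[OF assms]] by (simp add: pairing_def mult.left_commute)

lemma pairing_0: "pairing v (\<lambda>z w. 0) = 0"
  by (simp add: pairing_def d1_def frechet_derivative_const)

lemma pairing_sum:
  assumes v: "is_primitive v" and S: "compact S" "S \<subseteq> upper_half" and \<theta>: "\<And>i. i \<in> I \<Longrightarrow> test_form S (\<theta> i)"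
  shows "pairing v (\<lambda>z w. \<Sum>i\<in>I. \<theta> i z w) = (\<Sum>i\<in>I. pairing v (\<theta> i))"
  using \<theta>
proof (induction I rule: infinite_finite_induct)
  case (insert i I)
  then have "test_form S (\<lambda>z w. \<Sum>i\<in>I. \<theta> i z w)" by (intro test_form_sum S) auto
  then show ?case using insert pairing_add[OF v, of S "\<theta> i" S] by simp
qed (simp_all add: pairing_0)

text \<open>A primitive and a local primitive differ by a constant, which drops out because the exterior
  derivative of a test form has integral zero.\<close>

lemma pairing_local:
  assumes v: "is_primitive v" and W: "(W, u) \<in> local_primitives" and \<theta>: "test_form S \<theta>" "S \<subseteq> W"
  shows "pairing v \<theta> = (LINT z|lborel. u z * d1 \<theta> z)"
proof (cases "S = {}")
  case True
  then show ?thesis using d1_zero[OF \<theta>(1)] by (simp add: pairing_def)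
next
  case False
  then obtain x where x: "x \<in> S" by blast
  have e: "v z * d1 \<theta> z = u z * d1 \<theta> z + (v x - u x) * d1 \<theta> z" for z
  proof (cases "z \<in> S")
    case True
    then have "z \<in> W" "x \<in> W" using x \<theta>(2) by blast+
    then have "v z = u z + (v x - u x)" using is_primitiveD[OF v W, of x z] by linarith
    then show ?thesis by (simp only: distrib_right)
  qed (simp add: d1_zero[OF \<theta>(1)])
  have i: "integrable lborel (\<lambda>z. (v x - u x) * d1 \<theta> z)" using d1_integrable[OF \<theta>(1)] by simp
  have "integrable lborel (\<lambda>z. v z * d1 \<theta> z - (v x - u x) * d1 \<theta> z)"
    by (rule Bochner_Integration.integrable_diff[OF pairing_integrable[OF v \<theta>(1)] i])
  then have iu: "integrable lborel (\<lambda>z. u z * d1 \<theta> z)" by (simp add: e)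
  show ?thesis unfolding pairing_def e using iu i integral_d1(1)[OF \<theta>(1)] by simp
qed

lemma pairing_chart:
  assumes v: "is_primitive v" and c: "chart B F a b W" and \<theta>: "test_form S \<theta>" "S \<subseteq> W"
  shows "pairing v \<theta> = box_integral B F \<theta>"
proof -
  have "(W, chart_primitive B F a b) \<in> local_primitives" using c unfolding local_primitives_def by blast
  from pairing_local[OF v this \<theta>] show ?thesis using box_integral_chart(2)[OF c \<theta>] by simp
qed

lemma pairing_split:
  assumes v: "is_primitive v" and \<theta>: "test_form S \<theta>"
    and up: "unity_partition S r I \<rho> Q"
  shows "\<And>x. x \<in> I \<Longrightarrow> test_form (S \<inter> cball x (r x / 2)) (\<lambda>z w. \<rho> x z * \<theta> z w)"
    "pairing v \<theta> = (\<Sum>x\<in>I. pairing v (\<lambda>z w. \<rho> x z * \<theta> z w))"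
    "\<theta> = (\<lambda>z w. \<Sum>x\<in>I. \<rho> x z * \<theta> z w)"
proof -
  have S: "compact S" "S \<subseteq> upper_half" using \<theta> by (auto simp: test_form_def)
  have \<rho>: "finite I" "open Q" "S \<subseteq> Q" "\<And>x. x \<in> I \<Longrightarrow> smooth Q (\<rho> x)" "\<And>x z. x \<in> I \<Longrightarrow> z \<notin> cball x (r x / 2) \<Longrightarrow> \<rho> x z = 0"
      "\<And>z. z \<in> S \<Longrightarrow> (\<Sum>x\<in>I. \<rho> x z) = 1"
    using up unfolding unity_partition_def by blast+
  show t: "test_form (S \<inter> cball x (r x / 2)) (\<lambda>z w. \<rho> x z * \<theta> z w)" if "x \<in> I" for x
    by (rule test_form_mult[OF \<theta> \<rho>(2,3) \<rho>(4)[OF that]]) (use \<rho>(5)[OF that] in auto)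
  show e: "\<theta> = (\<lambda>z w. \<Sum>x\<in>I. \<rho> x z * \<theta> z w)"
  proof (intro ext)
    fix z w
    show "\<theta> z w = (\<Sum>x\<in>I. \<rho> x z * \<theta> z w)"
      using \<rho>(6)[of z] test_form_zero[OF \<theta>, of z w] by (cases "z \<in> S") (auto simp: sum_distrib_right[symmetric])
  qed
  have "pairing v (\<lambda>z w. \<Sum>x\<in>I. \<rho> x z * \<theta> z w) = (\<Sum>x\<in>I. pairing v (\<lambda>z w. \<rho> x z * \<theta> z w))"
    by (rule pairing_sum[OF v S]) (use t S in \<open>auto intro: test_form_subset\<close>)
  then show "pairing v \<theta> = (\<Sum>x\<in>I. pairing v (\<lambda>z w. \<rho> x z * \<theta> z w))" using e by simp
qed

lemma pairing_off_lamination: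
  assumes v: "is_primitive v" and \<theta>: "test_form S \<theta>" and off: "S \<inter> lift_lam = {}"
  shows "pairing v \<theta> = 0"
proof -
  have S: "compact S" "S \<subseteq> upper_half" using \<theta> by (auto simp: test_form_def)
  have "\<exists>r>0. ball x r \<subseteq> upper_half - lift_lam" if "x \<in> S" for x
    using open_complement_lift_lam that S(2) off open_contains_ball by (metis DiffI IntI emptyE subsetD)
  then obtain r where r: "\<And>x. x \<in> S \<Longrightarrow> r x > 0" "\<And>x. x \<in> S \<Longrightarrow> ball x (r x) \<subseteq> upper_half - lift_lam" by metis
  obtain I \<rho> Q where up: "unity_partition S r I \<rho> Q" using partition_of_unity[of S r] S(1) r(1) by blast
  then have IS: "I \<subseteq> S" by (simp add: unity_partition_def)
  note sp = pairing_split[OF v \<theta> up]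
  have "pairing v (\<lambda>z w. \<rho> x z * \<theta> z w) = 0" if x: "x \<in> I" for x
  proof -
    have xS: "x \<in> S" using x IS by blast
    have "(ball x (r x), \<lambda>_. 0) \<in> local_primitives" using r(2)[OF xS] by (auto simp: local_primitives_def)
    from pairing_local[OF v this sp(1)[OF x]] show ?thesis using r(1)[OF xS] by force
  qed
  then show ?thesis using sp(2) by simp
qed

end

section \<open>Estimates, invariance and the formula in a flow box\<close>

text \<open>The Euclidean norm of the covector \<open>\<theta> z\<close>.\<close>

definition form_size :: "one_form \<Rightarrow> complex \<Rightarrow> real" where
  "form_size \<theta> z = sqrt ((\<theta> z 1)\<^sup>2 + (\<theta> z \<i>)\<^sup>2)"

lemma form_size_bound:
  assumes "linear (\<theta> z)" shows "\<bar>\<theta> z v\<bar> \<le> form_size \<theta> z * cmod v"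
proof -
  have "(Re v * \<theta> z 1 + Im v * \<theta> z \<i>)\<^sup>2 \<le> ((\<theta> z 1)\<^sup>2 + (\<theta> z \<i>)\<^sup>2) * ((Re v)\<^sup>2 + (Im v)\<^sup>2)"
    using zero_le_power2[of "Re v * \<theta> z \<i> - Im v * \<theta> z 1"] by (simp add: power2_eq_square algebra_simps)
  then have "\<bar>Re v * \<theta> z 1 + Im v * \<theta> z \<i>\<bar> \<le> sqrt (((\<theta> z 1)\<^sup>2 + (\<theta> z \<i>)\<^sup>2) * ((Re v)\<^sup>2 + (Im v)\<^sup>2))"
    by (intro real_le_rsqrt) simp
  then show ?thesis using linear_complex_real[OF assms, of v] by (simp add: form_size_def cmod_def real_sqrt_mult)
qed

lemma form_size_mult: "form_size (\<lambda>z v. f z * \<theta> z v) z = \<bar>f z\<bar> * form_size \<theta> z"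
  by (simp add: form_size_def power_mult_distrib distrib_left[symmetric] real_sqrt_mult)

lemma form_size_nonneg: "0 \<le> form_size \<theta> z"
  by (simp add: form_size_def)

context lamination begin

text \<open>The plaques of a box have bounded length and stay in a compact set.\<close>

lemma plaque_integral_bound:
  assumes B: "lifted_box B F"
  obtains C where "C \<ge> 0" "\<And>\<theta> S N s. test_form S \<theta> \<Longrightarrow> (\<And>z. form_size \<theta> z \<le> N) \<Longrightarrow> \<bar>plaque_integral B F \<theta> s\<bar> \<le> C * N"
proof -
  let ?I = "{s0 B..s1 B}"
  have o: "t0 B < t1 B" "s0 B < s1 B" using box_order[OF B] by auto
  have r: "(t, s) \<in> rect B" if "t \<in> {t0 B..t1 B}" "s \<in> ?I" for t s using that by (simp add: rect_def)
  have "continuous_on ?I (plaque_length B F)" unfolding plaque_length_def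
    using o lifted_box_upper_half[OF B r]
    by (intro continuous_on_hyp_dist continuous_on_compose2[OF lifted_box_continuous[OF B]] continuous_intros) (auto intro: r)
  then have "compact (plaque_length B F ` ?I)" by (intro compact_continuous_image compact_Icc)
  then have "\<exists>l. \<forall>s\<in>?I. \<bar>plaque_length B F s\<bar> \<le> l"
    using compact_imp_bounded[of "plaque_length B F ` ?I"] by (simp add: bounded_iff)
  then obtain l where l: "\<And>s. s \<in> ?I \<Longrightarrow> \<bar>plaque_length B F s\<bar> \<le> l" by blast
  obtain m where m: "\<And>x. x \<in> rect B \<Longrightarrow> cmod (F x) \<le> m"
    using compact_imp_bounded[OF lifted_box_compact[OF B]] by (auto simp: bounded_iff)
  have m0: "m \<ge> 0" by (rule order_trans[OF norm_ge_zero m[OF r[of "t0 B" "s0 B"]]]) (use o in auto)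
  have l0: "l \<ge> 0" using l[of "s0 B"] o by auto
  have "\<bar>plaque_integral B F \<theta> s\<bar> \<le> m * l * N" if \<theta>: "test_form S \<theta>" and N: "\<And>z. form_size \<theta> z \<le> N" for \<theta> S N s
  proof (cases "s \<in> K B")
    case False
    have "N \<ge> 0" using N[of 0] form_size_nonneg[of \<theta> 0] by linarith
    then show ?thesis using False m0 l0 by (simp add: plaque_integral_def)
  next
    case s: True
    let ?L = "plaque_leaf_at B F s"
    have L: "leaf ?L" "0 \<le> plaque_length B F s" using plaque_param[OF B s] by auto
    have N0: "N \<ge> 0" using N[of 0] form_size_nonneg[of \<theta> 0] by linarith
    have b: "norm (\<theta> (geod ?L x) (gvel ?L x)) \<le> N * m" if x: "x \<in> {0..plaque_length B F s}" for x
    proof -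
      obtain t where t: "t \<in> {t0 B..t1 B}" "F (t, s) = geod ?L x" using plaque_param(4)[OF B s x] by blast
      have "cmod (gvel ?L x) = Im (geod ?L x)" by (rule gvel_norm[OF leaf_isometry[OF L(1)]])
      also have "\<dots> \<le> m" using m[OF K_rect[OF B s t(1)]] t(2) abs_Im_le_cmod[of "geod ?L x"] by simp
      finally have "form_size \<theta> (geod ?L x) * cmod (gvel ?L x) \<le> N * m"
        using N N0 by (intro mult_mono) auto
      then show ?thesis using form_size_bound[of \<theta> "geod ?L x" "gvel ?L x", OF test_form_linear[OF \<theta>]] by simp
    qed
    have "norm (integral {0..plaque_length B F s} (\<lambda>x. \<theta> (geod ?L x) (gvel ?L x))) \<le> N * m * (plaque_length B F s - 0)"
      by (rule integral_bound[OF L(2) continuous_on_along_geod[OF \<theta> leaf_isometry[OF L(1)]] b])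
    also have "\<dots> \<le> N * m * l" using l[of s] K_subset[OF B s] N0 m0 by (intro mult_left_mono) auto
    finally show ?thesis using s by (simp add: plaque_integral_def mult_ac)
  qed
  then show thesis using that[of "m * l"] m0 l0 by simp
qed

lemma pairing_bound_local:
  assumes v: "is_primitive v" and W: "(W, u) \<in> local_primitives"
  shows "\<exists>C\<ge>0. \<forall>\<theta> S N. test_form S \<theta> \<longrightarrow> S \<subseteq> W \<longrightarrow> (\<forall>z. form_size \<theta> z \<le> N) \<longrightarrow> \<bar>pairing v \<theta>\<bar> \<le> C * N"
proof -
  consider "u = (\<lambda>_. 0)" | B F a b where "chart B F a b W"
    using W by (auto simp: local_primitives_def)
  then show ?thesis
  proof cases
    case 1
    then show ?thesis using pairing_local[OF v W] by (intro exI[of _ 0]) auto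
  next
    case 2
    then have B: "lifted_box B F" by (simp add: chart_def)
    interpret finite_measure "\<nu> B" by (rule nu_finite[OF B])
    obtain C where C: "C \<ge> 0" "\<And>\<theta> S N s. test_form S \<theta> \<Longrightarrow> (\<And>z. form_size \<theta> z \<le> N) \<Longrightarrow> \<bar>plaque_integral B F \<theta> s\<bar> \<le> C * N"
      using plaque_integral_bound[OF B] by blast
    have "\<bar>pairing v \<theta>\<bar> \<le> (C * measure (\<nu> B) (space (\<nu> B))) * N"
      if \<theta>: "test_form S \<theta>" "S \<subseteq> W" and N: "\<forall>z. form_size \<theta> z \<le> N" for \<theta> S N
    proof -
      have "\<bar>box_integral B F \<theta>\<bar> \<le> (LINT s|\<nu> B. \<bar>plaque_integral B F \<theta> s\<bar>)" unfolding box_integral_def by simp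
      also have "\<dots> \<le> (LINT s|\<nu> B. C * N)"
        using box_integral_chart(1)[OF 2 \<theta>] C(2)[OF \<theta>(1)] N by (intro integral_mono) auto
      finally show ?thesis using pairing_chart[OF v 2 \<theta>] by (simp add: mult_ac)
    qed
    then show ?thesis using C(1) by (intro exI[of _ "C * measure (\<nu> B) (space (\<nu> B))"]) auto
  qed
qed

text \<open>In a chart the pairing is an integral of plaque integrals, which involve the values of the form only
  and not its derivatives; in general, a partition of unity distributes the form over charts.\<close>

lemma pairing_bound:
  assumes v: "is_primitive v" and S: "compact S" "S \<subseteq> upper_half"
  obtains C where "C \<ge> 0" "\<And>\<theta> N. test_form S \<theta> \<Longrightarrow> (\<And>z. form_size \<theta> z \<le> N) \<Longrightarrow> \<bar>pairing v \<theta>\<bar> \<le> C * N"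
proof -
  have "\<exists>r C. r > 0 \<and> C \<ge> 0 \<and> (\<forall>\<theta> S N. test_form S \<theta> \<longrightarrow> S \<subseteq> ball x r \<longrightarrow> (\<forall>z. form_size \<theta> z \<le> N) \<longrightarrow> \<bar>pairing v \<theta>\<bar> \<le> C * N)"
    if x: "x \<in> S" for x
  proof -
    obtain r u where "r > 0" "(ball x r, u) \<in> local_primitives"
      using local_primitives_cover[OF subsetD[OF S(2) x] open_UNIV UNIV_I] by blast
    then show ?thesis using pairing_bound_local[OF v] by blast
  qed
  then obtain r C where rC: "\<And>x. x \<in> S \<Longrightarrow> r x > 0" "\<And>x. x \<in> S \<Longrightarrow> C x \<ge> 0"
    "\<And>x \<theta> S' N. x \<in> S \<Longrightarrow> test_form S' \<theta> \<Longrightarrow> S' \<subseteq> ball x (r x) \<Longrightarrow> (\<forall>z. form_size \<theta> z \<le> N) \<Longrightarrow> \<bar>pairing v \<theta>\<bar> \<le> C x * N"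
    by metis
  obtain I \<rho> Q where up: "unity_partition S r I \<rho> Q" using partition_of_unity[of S r] S(1) rC(1) by blast
  then have I: "finite I" "I \<subseteq> S" and \<rho>: "\<And>x z. 0 \<le> \<rho> x z \<and> \<rho> x z \<le> 1" by (auto simp: unity_partition_def)
  have "\<bar>pairing v \<theta>\<bar> \<le> (\<Sum>x\<in>I. C x) * N" if \<theta>: "test_form S \<theta>" and N: "\<And>z. form_size \<theta> z \<le> N" for \<theta> N
  proof -
    note sp = pairing_split[OF v \<theta> up]
    have "\<bar>pairing v (\<lambda>z w. \<rho> x z * \<theta> z w)\<bar> \<le> C x * N" if x: "x \<in> I" for x
    proof (rule rC(3)[OF subsetD[OF I(2) x] sp(1)[OF x]])
      show "S \<inter> cball x (r x / 2) \<subseteq> ball x (r x)" using rC(1) x I(2) by force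
      show "\<forall>z. form_size (\<lambda>z w. \<rho> x z * \<theta> z w) z \<le> N"
      proof
        fix z
        have "\<bar>\<rho> x z\<bar> * form_size \<theta> z \<le> 1 * form_size \<theta> z" using \<rho>[of x z] by (intro mult_right_mono form_size_nonneg) auto
        then show "form_size (\<lambda>z w. \<rho> x z * \<theta> z w) z \<le> N" using N[of z] by (simp add: form_size_mult)
      qed
    qed
    then have "(\<Sum>x\<in>I. \<bar>pairing v (\<lambda>z w. \<rho> x z * \<theta> z w)\<bar>) \<le> (\<Sum>x\<in>I. C x * N)" by (rule sum_mono)
    then show ?thesis unfolding sp(2) sum_distrib_right using sum_abs[of "\<lambda>x. pairing v (\<lambda>z w. \<rho> x z * \<theta> z w)" I] by linarith
  qed
  moreover have "(\<Sum>x\<in>I. C x) \<ge> 0" using rC(2) I by (intro sum_nonneg) auto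
  ultimately show thesis using that by blast
qed

text \<open>The constant by which \<open>g\<close> changes the primitive drops out, because exterior derivatives of test forms
  have integral zero.\<close>

lemma pairing_pull:
  assumes v: "is_primitive v" and g: "g \<in> deck_group p" and \<theta>: "test_form S \<theta>"
  shows "pairing v (pull g \<theta>) = pairing v \<theta>"
proof -
  note gi = deck_isometry[OF g]
  obtain c where c: "\<And>z. z \<in> upper_half \<Longrightarrow> v (g z) = v z + c" using primitive_deck[OF v g] by blast
  have S: "S \<subseteq> upper_half" using \<theta> by (simp add: test_form_def)
  let ?f = "\<lambda>w. (v w - c) * d1 \<theta> w"
  have i1: "integrable lborel (\<lambda>w. v w * d1 \<theta> w)" by (rule pairing_integrable[OF v \<theta>])
  have i2: "integrable lborel (\<lambda>w. c * d1 \<theta> w)" using d1_integrable[OF \<theta>] by simp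
  have fe: "?f w = v w * d1 \<theta> w - c * d1 \<theta> w" for w by (simp add: algebra_simps)
  have fi: "integrable lborel ?f" unfolding fe using i1 i2 by simp
  have f0: "(\<lambda>w. indicator upper_half w *\<^sub>R ?f w) = ?f"
  proof
    fix w show "indicator upper_half w *\<^sub>R ?f w = ?f w"
      using d1_zero[OF \<theta>, of w] S by (cases "w \<in> S") (auto simp: indicator_def)
  qed
  have si: "set_integrable lborel upper_half ?f" unfolding set_integrable_def f0 by (rule fi)
  obtain h where h: "h \<in> deck_group p" "g \<circ> h = id" "h \<circ> g = id" using deck_inverse[OF g] by blast
  have tp: "test_form (h ` S) (pull g \<theta>)" by (rule test_form_pull[OF gi deck_isometry[OF h(1)] h(3) \<theta>])
  have "pairing v (pull g \<theta>) = (LINT z:upper_half|lborel. (cmod (deriv g z))\<^sup>2 * ?f (g z))"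
    unfolding pairing_def set_lebesgue_integral_def
  proof (rule Bochner_Integration.integral_cong[OF refl])
    fix z
    show "v z * d1 (pull g \<theta>) z = indicator upper_half z *\<^sub>R ((cmod (deriv g z))\<^sup>2 * ?f (g z))"
    proof (cases "z \<in> upper_half")
      case True
      then show ?thesis using d1_pull_test_form[OF gi \<theta> True] c[OF True] by simp
    next
      case False
      then have "z \<notin> h ` S" using tp by (auto simp: test_form_def)
      then show ?thesis using d1_zero[OF tp] False by simp
    qed
  qed
  also have "\<dots> = (LINT z:upper_half|lborel. ?f z)" by (rule integral_isometry[OF gi si])
  also have "\<dots> = (LINT z|lborel. ?f z)" unfolding set_lebesgue_integral_def f0 ..
  also have "\<dots> = pairing v \<theta> - c * (LINT z|lborel. d1 \<theta> z)" unfolding fe pairing_def using i1 i2 by simp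
  finally show ?thesis using integral_d1(1)[OF \<theta>] by simp
qed

lemma plaque_integral_sum:
  assumes B: "lifted_box B F" and I: "finite I" and \<theta>: "\<And>i. i \<in> I \<Longrightarrow> test_form (S i) (\<theta> i)"
  shows "plaque_integral B F (\<lambda>z w. \<Sum>i\<in>I. \<theta> i z w) s = (\<Sum>i\<in>I. plaque_integral B F (\<theta> i) s)"
proof (cases "s \<in> K B")
  case True
  have "(\<lambda>x. \<theta> i (geod (plaque_leaf_at B F s) x) (gvel (plaque_leaf_at B F s) x)) integrable_on {0..plaque_length B F s}" if "i \<in> I" for i
    by (rule integrable_continuous_real[OF continuous_on_along_geod[OF \<theta>[OF that] leaf_isometry]]) (rule plaque_param(1)[OF B True])
  then show ?thesis using True by (simp add: plaque_integral_def Henstock_Kurzweil_Integration.integral_sum[OF I])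
qed (simp add: plaque_integral_def)

lemma plaque_integral_off:
  assumes B: "lifted_box B F" and \<theta>: "test_form S \<theta>" and off: "S \<inter> lift_lam = {}"
  shows "plaque_integral B F \<theta> s = 0"
proof (cases "s \<in> K B")
  case True
  have "\<theta> (geod (plaque_leaf_at B F s) x) w = 0" for x w
    using leaf_in_lift_lam[OF plaque_param(1)[OF B True], of x] off test_form_zero[OF \<theta>] by blast
  then show ?thesis by (simp add: plaque_integral_def)
qed (simp add: plaque_integral_def)

lemma pairing_box_interior:
  assumes v: "is_primitive v" and B: "lifted_box B F" and \<theta>: "test_form S \<theta>" and S: "S \<subseteq> interior (F ` rect B)"
  shows "integrable (\<nu> B) (plaque_integral B F \<theta>) \<and> pairing v \<theta> = box_integral B F \<theta>"
proof -
  have Sc: "compact S" "S \<subseteq> upper_half" using \<theta> by (auto simp: test_form_def)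
  have "\<exists>r>0. \<forall>S' \<eta>. test_form S' \<eta> \<longrightarrow> S' \<subseteq> ball x r \<longrightarrow> integrable (\<nu> B) (plaque_integral B F \<eta>) \<and> pairing v \<eta> = box_integral B F \<eta>"
    if x: "x \<in> S" for x
  proof (cases "x \<in> lift_lam")
    case True
    obtain r a b where r: "r > 0" "chart B F a b (ball x r)"
      by (rule chart_exists[OF B True subsetD[OF S x] open_UNIV UNIV_I]) blast
    then show ?thesis using box_integral_chart(1)[OF r(2)] pairing_chart[OF v r(2)] by blast
  next
    case False
    then obtain r where r: "r > 0" "ball x r \<subseteq> upper_half - lift_lam"
      using open_complement_lift_lam open_contains_ball x Sc(2) by (metis DiffI subsetD)
    have "integrable (\<nu> B) (plaque_integral B F \<eta>) \<and> pairing v \<eta> = box_integral B F \<eta>"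
      if \<eta>: "test_form S' \<eta>" "S' \<subseteq> ball x r" for S' \<eta>
    proof -
      have off: "S' \<inter> lift_lam = {}" using \<eta>(2) r(2) by blast
      have "plaque_integral B F \<eta> = (\<lambda>_. 0)" using plaque_integral_off[OF B \<eta>(1) off] by auto
      then show ?thesis using pairing_off_lamination[OF v \<eta>(1) off] by (simp add: box_integral_def)
    qed
    then show ?thesis using r(1) by blast
  qed
  then obtain r where r: "\<And>x. x \<in> S \<Longrightarrow> r x > 0" "\<And>x S' \<eta>. x \<in> S \<Longrightarrow> test_form S' \<eta> \<Longrightarrow> S' \<subseteq> ball x (r x) \<Longrightarrow>
      integrable (\<nu> B) (plaque_integral B F \<eta>) \<and> pairing v \<eta> = box_integral B F \<eta>" by metis
  obtain I \<rho> Q where up: "unity_partition S r I \<rho> Q" using partition_of_unity[of S r] Sc(1) r(1) by blast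
  then have I: "finite I" "I \<subseteq> S" by (auto simp: unity_partition_def)
  note sp = pairing_split[OF v \<theta> up]
  have each: "integrable (\<nu> B) (plaque_integral B F (\<lambda>z w. \<rho> x z * \<theta> z w)) \<and>
      pairing v (\<lambda>z w. \<rho> x z * \<theta> z w) = box_integral B F (\<lambda>z w. \<rho> x z * \<theta> z w)" if x: "x \<in> I" for x
    by (rule r(2)[OF subsetD[OF I(2) x] sp(1)[OF x]]) (use r(1) x I(2) in force)
  have "plaque_integral B F (\<lambda>z w. \<Sum>x\<in>I. \<rho> x z * \<theta> z w) s = (\<Sum>x\<in>I. plaque_integral B F (\<lambda>z w. \<rho> x z * \<theta> z w) s)" for s
    by (rule plaque_integral_sum[OF B I(1) sp(1)])
  then have e: "plaque_integral B F \<theta> = (\<lambda>s. \<Sum>x\<in>I. plaque_integral B F (\<lambda>z w. \<rho> x z * \<theta> z w) s)" using sp(3) by auto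
  have "integrable (\<nu> B) (plaque_integral B F \<theta>)" unfolding e using each by (intro Bochner_Integration.integrable_sum) blast
  moreover have "box_integral B F \<theta> = (\<Sum>x\<in>I. box_integral B F (\<lambda>z w. \<rho> x z * \<theta> z w))"
    unfolding box_integral_def e using each by (intro Bochner_Integration.integral_sum) blast
  ultimately show ?thesis using sp(2) each by simp
qed

lemma flat_tail: "0 < x \<Longrightarrow> 1 - flat x \<le> inverse x"
  using exp_ge_add_one_self[of "- inverse x"] by (simp add: flat_def)

text \<open>A form supported in the closed image of a box vanishes on its boundary.  Cutting off the values
  of square norm at most \<open>\<epsilon>\<close> leaves a form supported in the interior, and changes the form uniformly
  little.\<close>

lemma pairing_box:
  assumes v: "is_primitive v" and B: "lifted_box B F" and \<theta>: "test_form (F ` rect B) \<theta>"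
  shows "pairing v \<theta> = box_integral B F \<theta>"
proof -
  let ?S = "F ` rect B"
  have S: "compact ?S" "?S \<subseteq> upper_half" using \<theta> by (auto simp: test_form_def)
  interpret finite_measure "\<nu> B" by (rule nu_finite[OF B])
  define N where "N z = (\<theta> z 1)\<^sup>2 + (\<theta> z \<i>)\<^sup>2" for z
  have Ns: "smooth UNIV N"
    unfolding N_def power2_eq_square by (intro smooth_add smooth_mult test_form_smooth[OF \<theta>] open_UNIV)
  have Nc: "continuous_on UNIV N" by (rule smooth_continuous_on[OF Ns])
  have size: "form_size \<theta> z = sqrt (N z)" for z by (simp add: form_size_def N_def)
  have "compact (N ` ?S)" by (intro compact_continuous_image continuous_on_subset[OF Nc] S(1)) simp
  then obtain Mx where Mx: "\<And>z. z \<in> ?S \<Longrightarrow> \<bar>N z\<bar> \<le> Mx" using compact_imp_bounded[of "N ` ?S"] by (auto simp: bounded_iff)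
  define mx where "mx = sqrt (max Mx 0)"
  have mx: "form_size \<theta> z \<le> mx" for z
  proof (cases "z \<in> ?S")
    case True then show ?thesis using Mx[OF True] by (simp add: size mx_def)
  next
    case False then show ?thesis by (simp add: form_size_def mx_def test_form_zero[OF \<theta>])
  qed
  define e where "e n = inverse (real (Suc n))" for n
  have e: "e n > 0" for n by (simp add: e_def)
  have e0: "e \<longlonglongrightarrow> 0" unfolding e_def by (rule LIMSEQ_inverse_real_of_nat)
  \<comment> \<open>This cutoff is 0 where \<open>N z \<le> e n\<close> and differs from 1 by at most \<open>e n\<close> where \<open>N z \<ge> 2 * e n\<close>; in
    between, the form is small anyway.\<close>
  define \<kappa> where "\<kappa> n z = flat ((N z - e n) * inverse ((e n)\<^sup>2))" for n z
  define \<delta> where "\<delta> n = sqrt (2 * e n) + e n * mx" for n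
  have \<delta>0: "\<delta> \<longlonglongrightarrow> 0"
  proof -
    have "(\<lambda>n. sqrt (2 * e n) + e n * mx) \<longlonglongrightarrow> sqrt (2 * 0) + 0 * mx"
      by (intro tendsto_add tendsto_real_sqrt tendsto_mult e0 tendsto_const)
    then show ?thesis by (simp add: \<delta>_def[abs_def])
  qed
  have squeeze: "f \<longlonglongrightarrow> l" if "\<And>n. \<bar>f n - l\<bar> \<le> c * \<delta> n" for f :: "nat \<Rightarrow> real" and l c
  proof -
    have "(\<lambda>n. c * \<delta> n) \<longlonglongrightarrow> 0" by (rule tendsto_mult_right_zero[OF \<delta>0])
    then have "(\<lambda>n. f n - l) \<longlonglongrightarrow> 0" by (rule Lim_null_comparison[rotated]) (simp add: that)
    then show ?thesis by (rule LIM_zero_cancel)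
  qed
  have \<kappa>b: "0 \<le> \<kappa> n z" "\<kappa> n z \<le> 1" for n z by (auto simp: \<kappa>_def flat_bounds)
  have \<kappa>0: "\<kappa> n z = 0" if "N z \<le> e n" for n z
    using that e[of n] by (auto simp: \<kappa>_def flat_def mult_le_0_iff)
  define \<theta>n where "\<theta>n n z w = \<kappa> n z * \<theta> z w" for n z w
  define C where "C n = {z. e n \<le> N z}" for n
  have Cc: "closed (C n)" for n unfolding C_def using closed_Collect_le[of "\<lambda>_. e n" N] Nc by simp
  have tn: "test_form (?S \<inter> C n) (\<theta>n n)" for n
    unfolding \<theta>n_def
  proof (rule test_form_mult[OF \<theta> open_UNIV subset_UNIV _ Cc])
    show "smooth UNIV (\<kappa> n)" unfolding \<kappa>_def by (intro smooth_flat smooth_mult smooth_diff smooth_const Ns open_UNIV)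
    show "\<kappa> n z = 0" if "z \<notin> C n" for z by (rule \<kappa>0) (use that in \<open>simp add: C_def\<close>)
  qed
  have inter: "?S \<inter> C n \<subseteq> interior ?S" for n
  proof
    fix z assume z: "z \<in> ?S \<inter> C n"
    have "open {w. N w > 0}" using open_Collect_less[of "\<lambda>_. 0" N] Nc by simp
    moreover have "{w. N w > 0} \<subseteq> ?S" using test_form_zero[OF \<theta>] by (auto simp: N_def) (metis add_0 less_irrefl power_zero_numeral)
    moreover have "z \<in> {w. N w > 0}" using z e[of n] by (auto simp: C_def)
    ultimately show "z \<in> interior ?S" by (meson interiorI)
  qed
  have n: "integrable (\<nu> B) (plaque_integral B F (\<theta>n n))" "pairing v (\<theta>n n) = box_integral B F (\<theta>n n)" for n
    using pairing_box_interior[OF v B tn inter] by auto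
  define \<eta> where "\<eta> n z w = \<theta> z w + (-1) * \<theta>n n z w" for n z w
  have tn': "test_form ?S (\<theta>n n)" for n using test_form_subset[OF tn _ S] by blast
  have t\<eta>: "test_form ?S (\<eta> n)" for n unfolding \<eta>_def by (intro test_form_add \<theta> test_form_scale tn')
  have \<eta>e: "\<eta> n = (\<lambda>z w. (1 - \<kappa> n z) * \<theta> z w)" for n by (auto simp: \<eta>_def \<theta>n_def algebra_simps fun_eq_iff)
  have small: "form_size (\<eta> n) z \<le> \<delta> n" for n z
  proof -
    have fs: "form_size (\<eta> n) z = (1 - \<kappa> n z) * form_size \<theta> z" unfolding \<eta>e form_size_mult using \<kappa>b by simp
    have m0: "0 \<le> mx" using mx[of z] form_size_nonneg[of \<theta> z] by linarith
    show ?thesis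
    proof (cases "N z \<le> 2 * e n")
      case True
      have "(1 - \<kappa> n z) * form_size \<theta> z \<le> 1 * sqrt (2 * e n)"
        unfolding size using \<kappa>b[of n z] True by (intro mult_mono) (auto simp: N_def)
      then show ?thesis unfolding fs \<delta>_def using m0 e[of n] by (smt (verit) mult_nonneg_nonneg)
    next
      case False
      have "e n * inverse ((e n)\<^sup>2) \<le> (N z - e n) * inverse ((e n)\<^sup>2)" using False by (intro mult_right_mono) auto
      then have x: "inverse (e n) \<le> (N z - e n) * inverse ((e n)\<^sup>2)" using e[of n] by (simp add: power2_eq_square)
      then have p: "0 < (N z - e n) * inverse ((e n)\<^sup>2)" using e[of n] by (smt (verit) positive_imp_inverse_positive)
      have "1 - \<kappa> n z \<le> inverse ((N z - e n) * inverse ((e n)\<^sup>2))" unfolding \<kappa>_def by (rule flat_tail[OF p])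
      also have "\<dots> \<le> inverse (inverse (e n))" using x e[of n] by (intro le_imp_inverse_le) auto
      finally have "1 - \<kappa> n z \<le> e n" by simp
      then have "(1 - \<kappa> n z) * form_size \<theta> z \<le> e n * mx" using mx e[of n] m0 by (intro mult_mono form_size_nonneg) (auto simp: less_imp_le)
      then show ?thesis unfolding fs \<delta>_def using e[of n] by (smt (verit) real_sqrt_ge_zero)
    qed
  qed
  have \<theta>e: "\<theta> = (\<lambda>z w. \<theta>n n z w + \<eta> n z w)" for n by (auto simp: \<eta>_def fun_eq_iff)
  obtain Cv where Cv: "Cv \<ge> 0" "\<And>\<theta> N. test_form ?S \<theta> \<Longrightarrow> (\<And>z. form_size \<theta> z \<le> N) \<Longrightarrow> \<bar>pairing v \<theta>\<bar> \<le> Cv * N"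
    using pairing_bound[OF v S] by blast
  have "\<bar>pairing v (\<theta>n n) - pairing v \<theta>\<bar> \<le> Cv * \<delta> n" for n
    using Cv(2)[OF t\<eta> small, of n] pairing_add[OF v tn' t\<eta>, of n n] \<theta>e[of n] by simp
  then have "(\<lambda>n. pairing v (\<theta>n n)) \<longlonglongrightarrow> pairing v \<theta>"
    by (rule squeeze)
  moreover have "(\<lambda>n. box_integral B F (\<theta>n n)) \<longlonglongrightarrow> box_integral B F \<theta>"
    unfolding box_integral_def
  proof -
    obtain Cp where Cp: "Cp \<ge> 0" "\<And>\<theta> S N s. test_form S \<theta> \<Longrightarrow> (\<And>z. form_size \<theta> z \<le> N) \<Longrightarrow> \<bar>plaque_integral B F \<theta> s\<bar> \<le> Cp * N"
      using plaque_integral_bound[OF B] by blast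
    have add: "plaque_integral B F \<theta> s = plaque_integral B F (\<theta>n n) s + plaque_integral B F (\<eta> n) s" for n s
    proof -
      have "plaque_integral B F (\<lambda>z w. \<Sum>i\<in>UNIV. (if i then \<theta>n n else \<eta> n) z w) s = (\<Sum>i\<in>UNIV. plaque_integral B F (if i then \<theta>n n else \<eta> n) s)"
        by (rule plaque_integral_sum[OF B, of UNIV "\<lambda>_. ?S"]) (use tn' t\<eta> in auto)
      then show ?thesis using \<theta>e[of n] by (simp add: UNIV_bool add.commute)
    qed
    have lim: "(\<lambda>n. plaque_integral B F (\<theta>n n) s) \<longlonglongrightarrow> plaque_integral B F \<theta> s" for s
    proof -
      have "\<bar>plaque_integral B F (\<theta>n n) s - plaque_integral B F \<theta> s\<bar> \<le> Cp * \<delta> n" for n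
        using Cp(2)[OF t\<eta> small, of n s] add[of s n] by simp
      then show ?thesis
        by (rule squeeze)
    qed
    have meas: "plaque_integral B F (\<theta>n n) \<in> borel_measurable (\<nu> B)" for n
      using borel_measurable_integrable[OF n(1)] .
    show "(\<lambda>n. LINT s|\<nu> B. plaque_integral B F (\<theta>n n) s) \<longlonglongrightarrow> (LINT s|\<nu> B. plaque_integral B F \<theta> s)"
    proof (rule integral_dominated_convergence[of _ _ _ "\<lambda>_. Cp * mx"])
      show "plaque_integral B F \<theta> \<in> borel_measurable (\<nu> B)" by (rule borel_measurable_LIMSEQ_real[OF lim meas])
      have "form_size (\<theta>n n) z \<le> mx" for n z
      proof -
        have "\<bar>\<kappa> n z\<bar> * form_size \<theta> z \<le> 1 * mx" using \<kappa>b[of n z] mx[of z] by (intro mult_mono form_size_nonneg) auto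
        then show ?thesis unfolding \<theta>n_def form_size_mult by simp
      qed
      then show "AE s in \<nu> B. norm (plaque_integral B F (\<theta>n n) s) \<le> Cp * mx" for n
        using Cp(2)[OF tn] by auto
    qed (use meas lim in auto)
  qed
  ultimately show ?thesis using n(2) LIMSEQ_unique by simp
qed

text \<open>Exact forms in a chart pair to zero, because compactly supported functions integrate to zero
  along every leaf.\<close>

lemma pairing_exact:
  assumes v: "is_primitive v" and W: "(W, u) \<in> local_primitives" and \<theta>: "test_form S \<theta>" "S \<subseteq> W"
    and f: "\<And>z. (f has_derivative \<theta> z) (at z)" "\<And>z. z \<notin> S \<Longrightarrow> f z = 0"
  shows "pairing v \<theta> = 0"
proof -
  consider "u = (\<lambda>_. 0)" | B F a b where "chart B F a b W"
    using W by (auto simp: local_primitives_def)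
  then show ?thesis
  proof cases
    case 1 then show ?thesis using pairing_local[OF v W \<theta>] by simp
  next
    case 2
    then have B: "lifted_box B F" by (simp add: chart_def)
    have z: "geod_integral L \<theta> = 0" if L: "L \<in> hyp_isometries" for L
    proof -
      have S: "compact S" "S \<subseteq> upper_half" using \<theta> by (auto simp: test_form_def)
      have "continuous_on S (\<lambda>z. hyp_dist (geod L 0) z)"
        using S geod_upper_half[OF L] by (intro continuous_on_hyp_dist continuous_intros) auto
      then have "compact ((\<lambda>z. hyp_dist (geod L 0) z) ` S)" by (intro compact_continuous_image S(1))
      then obtain R where R: "\<And>z. z \<in> S \<Longrightarrow> \<bar>hyp_dist (geod L 0) z\<bar> \<le> R"
        using compact_imp_bounded[of "(\<lambda>z. hyp_dist (geod L 0) z) ` S"] by (auto simp: bounded_iff)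
      have off: "geod L x \<notin> S" if "R + 1 \<le> \<bar>x\<bar>" for x
        using R[of "geod L x"] hyp_dist_geod[OF L, of 0 x] that by auto
      have "((\<lambda>x. f (geod L x)) has_vector_derivative \<theta> (geod L x) (gvel L x)) (at x)" for x
        using vector_derivative_diff_chain_within[OF geod_derivative[OF L, of x UNIV] has_derivative_at_withinI[OF f(1)]] by (simp add: o_def)
      then have "((\<lambda>x. f (geod L x)) has_real_derivative \<theta> (geod L x) (gvel L x)) (at x)" for x
        by (simp add: has_real_derivative_iff_has_vector_derivative)
      then show ?thesis unfolding geod_integral_def
        by (rule FTC_compact_support(1)[OF _ continuous_on_along_geod[OF \<theta>(1) L], of _ "R + 1"])
          (use off f(2) test_form_zero[OF \<theta>(1)] in auto)
    qed
    have "plaque_integral B F \<theta> s = 0" for s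
    proof (cases "s \<in> K B \<inter> {a..b}")
      case True
      then show ?thesis using plaque_integral_geod(1)[OF 2 \<theta> True] z leaf_isometry plaque_param(1)[OF B] by auto
    qed (rule plaque_integral_geod(2)[OF 2 \<theta>])
    then show ?thesis using pairing_chart[OF v 2 \<theta>] by (simp add: box_integral_def)
  qed
qed

end

section \<open>Sums over the deck group\<close>

lemma test_form_cut:
  assumes C: "compact C" "C \<subseteq> upper_half" and f: "smooth upper_half f" "\<And>z. z \<notin> C \<Longrightarrow> f z = 0"
    and \<phi>: "\<And>z. z \<in> C \<Longrightarrow> linear (\<phi> z)" "\<And>w. smooth upper_half (\<lambda>z. \<phi> z w)"
  shows "test_form C (\<lambda>z w. f z * \<phi> z w)"
proof -
  have "linear (\<lambda>w. f z * \<phi> z w)" for z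
  proof (cases "z \<in> C")
    case True
    show ?thesis by (rule linearI) (simp_all add: linear_add[OF \<phi>(1)[OF True]] linear_scale[OF \<phi>(1)[OF True]] algebra_simps)
  next
    case False
    show ?thesis by (rule linearI) (simp_all add: f(2)[OF False])
  qed
  moreover have "smooth UNIV (\<lambda>z. f z * \<phi> z w)" for w
    by (rule smooth_extend[OF open_upper_half smooth_mult[OF open_upper_half f(1) \<phi>(2)] C]) (simp add: f(2))
  ultimately show ?thesis using C f(2) by (simp add: test_form_def)
qed

context hyp_surface begin

text \<open>The sum of \<open>f\<close> over an orbit.  Leaving out the zero terms makes it a finite sum when \<open>f\<close> has compact
  support.\<close>

definition deck_sum :: "(complex \<Rightarrow> real) \<Rightarrow> complex \<Rightarrow> real" where
  "deck_sum f z = (\<Sum>g | g \<in> deck_group p \<and> f (g z) \<noteq> 0. f (g z))"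

lemma deck_sum_eq:
  assumes "finite J" "J \<subseteq> deck_group p" "\<And>g. g \<in> deck_group p \<Longrightarrow> f (g z) \<noteq> 0 \<Longrightarrow> g \<in> J"
  shows "deck_sum f z = (\<Sum>g\<in>J. f (g z))"
  unfolding deck_sum_def by (rule sum.mono_neutral_left) (use assms in auto)

lemma deck_sum_on_compact:
  assumes C: "compact C" "C \<subseteq> upper_half" "\<And>z. z \<notin> C \<Longrightarrow> f z = 0" and N: "compact N" "N \<subseteq> upper_half"
  shows "finite {g \<in> deck_group p. g ` N \<inter> C \<noteq> {}}"
    "z \<in> N \<Longrightarrow> deck_sum f z = (\<Sum>g | g \<in> deck_group p \<and> g ` N \<inter> C \<noteq> {}. f (g z))"
proof -
  show fin: "finite {g \<in> deck_group p. g ` N \<inter> C \<noteq> {}}" by (rule deck_finite[OF N C(1,2)])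
  show "deck_sum f z = (\<Sum>g | g \<in> deck_group p \<and> g ` N \<inter> C \<noteq> {}. f (g z))" if "z \<in> N"
    by (rule deck_sum_eq[OF fin]) (use that C(3) in blast)+
qed

lemma deck_sum_nonneg: "(\<And>z. 0 \<le> f z) \<Longrightarrow> 0 \<le> deck_sum f z"
  unfolding deck_sum_def by (rule sum_nonneg)

lemma deck_sum_deck:
  assumes h: "h \<in> deck_group p" shows "deck_sum f (h z) = deck_sum f z"
proof -
  obtain h' where h': "h' \<in> deck_group p" "h \<circ> h' = id" "h' \<circ> h = id" using deck_inverse[OF h] by blast
  have e: "h (h' w) = w" "h' (h w) = w" for w using h'(2,3) by (metis comp_apply id_apply)+
  show ?thesis unfolding deck_sum_def
    by (rule sum.reindex_bij_witness[of _ "\<lambda>g. g \<circ> h'" "\<lambda>g. g \<circ> h"])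
      (auto simp: e deck_compose h h'(1) fun_eq_iff)
qed

lemma deck_sum_smooth:
  assumes C: "compact C" "C \<subseteq> upper_half" "\<And>z. z \<notin> C \<Longrightarrow> f z = 0" and f: "smooth upper_half f"
  shows "smooth upper_half (deck_sum f)"
proof (rule smooth_local)
  fix z assume "z \<in> upper_half"
  then obtain r where r: "r > 0" "cball z r \<subseteq> upper_half" using open_upper_half open_contains_cball by blast
  let ?J = "{g \<in> deck_group p. g ` cball z r \<inter> C \<noteq> {}}"
  have s: "smooth upper_half (\<lambda>w. \<Sum>g\<in>?J. f (g w))"
    by (rule smooth_sum[OF open_upper_half smooth_compose_isometry[OF _ f]]) (simp add: deck_isometry)
  have "smooth (ball z r) (deck_sum f)"
    by (rule smooth_cong[OF open_ball _ smooth_subset[OF s]])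
      (use deck_sum_on_compact(2)[OF C compact_cball r(2)] r(2) ball_subset_cball in auto)
  then show "\<exists>T. open T \<and> z \<in> T \<and> smooth T (deck_sum f)" using r(1) by (intro exI[of _ "ball z r"]) auto
qed

lemma deck_sum_sum:
  assumes C: "compact C" "C \<subseteq> upper_half" "\<And>x z. x \<in> I \<Longrightarrow> z \<notin> C \<Longrightarrow> f x z = 0" and z: "z \<in> upper_half"
  shows "deck_sum (\<lambda>z. \<Sum>x\<in>I. f x z) z = (\<Sum>x\<in>I. deck_sum (f x) z)"
proof -
  have zc: "compact {z}" "{z} \<subseteq> upper_half" using z by auto
  let ?J = "{g \<in> deck_group p. g ` {z} \<inter> C \<noteq> {}}"
  have "deck_sum (\<lambda>z. \<Sum>x\<in>I. f x z) z = (\<Sum>g\<in>?J. \<Sum>x\<in>I. f x (g z))"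
    by (rule deck_sum_on_compact(2)[OF C(1,2) _ zc]) (simp_all add: C(3))
  also have "\<dots> = (\<Sum>x\<in>I. \<Sum>g\<in>?J. f x (g z))" by (rule sum.swap)
  also have "\<dots> = (\<Sum>x\<in>I. deck_sum (f x) z)"
    by (rule sum.cong[OF refl], rule deck_sum_on_compact(2)[OF C(1,2) _ zc, symmetric]) (simp_all add: C(3))
  finally show ?thesis .
qed

lemma deck_sum_divide:
  assumes C: "compact C" "C \<subseteq> upper_half" "\<And>z. z \<notin> C \<Longrightarrow> f z = 0" and z: "z \<in> upper_half"
    and s: "\<And>g. g \<in> deck_group p \<Longrightarrow> s (g z) = s z"
  shows "deck_sum (\<lambda>z. f z / s z) z = deck_sum f z / s z"
proof -
  have zc: "compact {z}" "{z} \<subseteq> upper_half" using z by auto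
  let ?J = "{g \<in> deck_group p. g ` {z} \<inter> C \<noteq> {}}"
  have "deck_sum (\<lambda>z. f z / s z) z = (\<Sum>g\<in>?J. f (g z) / s (g z))"
    by (rule deck_sum_on_compact(2)[OF C(1,2) _ zc]) (simp_all add: C(3))
  also have "\<dots> = (\<Sum>g\<in>?J. f (g z)) / s z" unfolding sum_divide_distrib by (rule sum.cong) (auto simp: s)
  also have "(\<Sum>g\<in>?J. f (g z)) = deck_sum f z"
    by (rule deck_sum_on_compact(2)[OF C(1,2) _ zc, symmetric]) (simp_all add: C(3))
  finally show ?thesis .
qed

text \<open>Finitely many bumps on the half-plane cover the compact surface.  Dividing them by the sum of all
  their translates gives functions whose translates form a partition of unity.\<close>

lemma deck_partition:
  assumes R: "\<And>x. x \<in> upper_half \<Longrightarrow> R x > 0 \<and> cball x (R x) \<subseteq> upper_half"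
  obtains I \<kappa> where "finite I" "I \<subseteq> upper_half" "\<And>x. x \<in> I \<Longrightarrow> smooth upper_half (\<kappa> x)"
    "\<And>x z. x \<in> I \<Longrightarrow> 0 \<le> \<kappa> x z" "\<And>x z. x \<in> I \<Longrightarrow> z \<notin> cball x (R x) \<Longrightarrow> \<kappa> x z = 0"
    "\<And>z. z \<in> upper_half \<Longrightarrow> (\<Sum>x\<in>I. deck_sum (\<kappa> x) z) = 1"
proof -
  let ?P = "\<lambda>x. p ` ball x (R x)"
  have open_P: "openin (top_of_set M) (?P x)" if x: "x \<in> upper_half" for x
    using R[OF x] ball_subset_cball[of x "R x"]
    by (intro covering_space_open_map[OF cov] open_openin_trans open_upper_half openin_open_subtopology[THEN iffD2] conjI) auto
  have "M \<subseteq> \<Union> (?P ` upper_half)"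
  proof
    fix m assume "m \<in> M"
    then obtain x where "x \<in> upper_half" "m = p x" using p_image by blast
    then show "m \<in> \<Union> (?P ` upper_half)" using R[of x] by force
  qed
  then obtain \<D> where D: "\<D> \<subseteq> ?P ` upper_half" "finite \<D>" "M \<subseteq> \<Union> \<D>"
    using compact_M[unfolded compact_eq_openin_cover, rule_format, of "?P ` upper_half"] open_P by blast
  obtain I where I: "finite I" "I \<subseteq> upper_half" "\<D> = ?P ` I" using finite_subset_image[OF D(2,1)] by blast
  define b where "b z = (\<Sum>x\<in>I. bump x (R x) z)" for z
  define s where "s = deck_sum b"
  define C where "C = (\<Union>x\<in>I. cball x (R x))"
  have C: "compact C" "C \<subseteq> upper_half" using I R by (auto simp: C_def intro!: compact_UN)
  have bz: "bump x (R x) z = 0" if "x \<in> I" "z \<notin> ball x (R x)" for x z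
    using bump_pos(3) R I(2) that by blast
  have bC: "bump x (R x) z = 0" if "x \<in> I" "z \<notin> C" for x z
    using bz[OF that(1), of z] that(2) \<open>x \<in> I\<close> by (auto simp: C_def)
  have b0: "0 \<le> bump x (R x) z" for x z by (rule bump_pos(1))
  have s0: "0 \<le> s z" for z unfolding s_def b_def by (intro deck_sum_nonneg sum_nonneg b0)
  have sp: "s z > 0" if z: "z \<in> upper_half" for z
  proof -
    have "p z \<in> \<Union> \<D>" using D(3) p_in_M[OF z] by blast
    then obtain x w where x: "x \<in> I" "w \<in> ball x (R x)" "p z = p w" using I(3) by auto
    then have "w \<in> upper_half" using R I(2) ball_subset_cball by blast
    then obtain g where g: "g \<in> deck_group p" "g z = w" using deck_transitive[OF z _ x(3)] by blast
    have "0 < bump x (R x) (g z)" using bump_pos(2) R I(2) x(1,2) g(2) by blast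
    also have "\<dots> \<le> b (g z)" unfolding b_def by (rule member_le_sum[OF x(1)]) (simp_all add: b0 I(1))
    finally have bg: "0 < b (g z)" .
    have "finite {g \<in> deck_group p. g ` {z} \<inter> C \<noteq> {}}" by (rule deck_finite[OF _ _ C]) (use z in auto)
    then have "finite {g \<in> deck_group p. b (g z) \<noteq> 0}"
      by (rule finite_subset[rotated]) (auto simp: b_def intro!: sum.neutral bC)
    then have "b (g z) \<le> s z" unfolding s_def deck_sum_def
      by (intro member_le_sum[of g _ "\<lambda>g. b (g z)"]) (use g(1) bg in \<open>auto simp: b_def intro!: sum_nonneg b0\<close>)
    then show ?thesis using bg by linarith
  qed
  have ss: "smooth upper_half s" unfolding s_def
    by (rule deck_sum_smooth[OF C]) (auto simp: b_def[abs_def] bC intro!: sum.neutral smooth_sum open_upper_half smooth_bump)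
  show thesis
  proof (rule that[of I "\<lambda>x z. bump x (R x) z / s z"])
    show "finite I" "I \<subseteq> upper_half" by fact+
    show "smooth upper_half (\<lambda>z. bump x (R x) z / s z)" for x
      by (rule smooth_divide[OF open_upper_half smooth_bump[OF open_upper_half] ss]) (use sp in force)
    show "0 \<le> bump x (R x) z / s z" for x z by (intro divide_nonneg_nonneg b0 s0)
    show "bump x (R x) z / s z = 0" if "x \<in> I" "z \<notin> cball x (R x)" for x z
      using bz[OF that(1), of z] that(2) by auto
    show "(\<Sum>x\<in>I. deck_sum (\<lambda>z. bump x (R x) z / s z) z) = 1" if z: "z \<in> upper_half" for z
    proof -
      have "(\<Sum>x\<in>I. deck_sum (\<lambda>z. bump x (R x) z / s z) z) = (\<Sum>x\<in>I. deck_sum (bump x (R x)) z / s z)"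
        by (rule sum.cong[OF refl], rule deck_sum_divide[OF C bC z]) (simp_all add: s_def deck_sum_deck)
      also have "\<dots> = (\<Sum>x\<in>I. deck_sum (bump x (R x)) z) / s z" by (rule sum_divide_distrib[symmetric])
      also have "(\<Sum>x\<in>I. deck_sum (bump x (R x)) z) = s z"
        unfolding s_def b_def[abs_def] by (rule deck_sum_sum[OF C bC z, symmetric])
      finally show ?thesis using sp[OF z] by simp
    qed
  qed
qed

text \<open>A weight whose translates sum to one.  It turns an integral over the surface into one over the
  half-plane.\<close>

definition cutoff :: "complex set \<Rightarrow> (complex \<Rightarrow> real) \<Rightarrow> bool" where
  "cutoff C \<psi> \<longleftrightarrow> compact C \<and> C \<subseteq> upper_half \<and> smooth upper_half \<psi> \<and> (\<forall>z. 0 \<le> \<psi> z) \<and>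
     (\<forall>z. z \<notin> C \<longrightarrow> \<psi> z = 0) \<and> (\<forall>z\<in>upper_half. deck_sum \<psi> z = 1)"

lemma test_form_cutoff:
  assumes "cutoff C \<psi>" "\<And>z. z \<in> C \<Longrightarrow> linear (\<phi> z)" "\<And>w. smooth upper_half (\<lambda>z. \<phi> z w)"
  shows "test_form C (\<lambda>z w. \<psi> z * \<phi> z w)"
  using assms by (intro test_form_cut) (auto simp: cutoff_def)

lemma test_form_cutoff_one_form:
  assumes "cutoff C \<psi>" "\<phi> \<in> one_forms p" shows "test_form C (\<lambda>z w. \<psi> z * \<phi> z w)"
  by (rule test_form_cutoff[OF assms(1) one_form_linear[OF assms(2)] one_form_smooth[OF assms(2)]])
    (use assms(1) in \<open>auto simp: cutoff_def\<close>)

end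

section \<open>The current\<close>

context lamination begin

text \<open>The integral of \<open>v d\<phi>\<close> over the surface, so to speak, although \<open>v\<close> does not descend to it.  The result
  does not depend on the cutoff (\<open>current_deck_sum\<close>).\<close>

definition current :: "(complex \<Rightarrow> real) \<Rightarrow> (complex \<Rightarrow> real) \<Rightarrow> one_form \<Rightarrow> real" where
  "current v \<psi> \<phi> = pairing v (\<lambda>z w. \<psi> z * \<phi> z w)"

text \<open>Unfolding.  If \<open>\<Phi>\<close> is the sum of the translates of \<open>\<theta>\<close>, move each translate back to \<open>\<theta>\<close>; the cutoff is
  moved along, and the translates of the cutoff sum to one.\<close>

lemma current_deck_sum:
  assumes v: "is_primitive v" and \<psi>: "cutoff C \<psi>" and \<theta>: "test_form S \<theta>"
    and \<Phi>: "\<And>z w. z \<in> C \<Longrightarrow> \<Phi> z w = (\<Sum>g | g \<in> deck_group p \<and> g z \<in> S. \<theta> (g z) (deriv g z * w))"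
  shows "current v \<psi> \<Phi> = pairing v \<theta>"
proof -
  let ?J = "{g \<in> deck_group p. g ` C \<inter> S \<noteq> {}}"
  have C: "compact C" "C \<subseteq> upper_half" "smooth upper_half \<psi>" "\<And>z. z \<notin> C \<Longrightarrow> \<psi> z = 0"
    "\<And>z. z \<in> upper_half \<Longrightarrow> deck_sum \<psi> z = 1" using \<psi> by (auto simp: cutoff_def)
  have S: "compact S" "S \<subseteq> upper_half" using \<theta> by (auto simp: test_form_def)
  have fin: "finite ?J" by (rule deck_finite[OF C(1,2) S])
  have "\<forall>g\<in>?J. \<exists>h. h \<in> deck_group p \<and> g \<circ> h = id \<and> h \<circ> g = id" using deck_inverse by blast
  then obtain i where i: "\<And>g. g \<in> ?J \<Longrightarrow> i g \<in> deck_group p \<and> g \<circ> i g = id \<and> i g \<circ> g = id"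
    unfolding bchoice_iff by blast
  have tp: "test_form (i g ` S) (pull g \<theta>)" if g: "g \<in> ?J" for g
    by (rule test_form_pull[OF _ _ _ \<theta>]) (use g i[OF g] deck_isometry in blast)+
  have tc: "test_form C (\<lambda>z w. \<psi> z * pull g \<theta> z w)" if g: "g \<in> ?J" for g
    by (rule test_form_cutoff[OF \<psi> test_form_linear[OF tp[OF g]] smooth_subset[OF test_form_smooth[OF tp[OF g]] subset_UNIV]])
  have eq: "(\<lambda>z w. \<psi> z * \<Phi> z w) = (\<lambda>z w. \<Sum>g\<in>?J. \<psi> z * pull g \<theta> z w)"
  proof (intro ext)
    fix z w show "\<psi> z * \<Phi> z w = (\<Sum>g\<in>?J. \<psi> z * pull g \<theta> z w)"
    proof (cases "z \<in> C")
      case True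
      have "(\<Sum>g | g \<in> deck_group p \<and> g z \<in> S. \<theta> (g z) (deriv g z * w)) = (\<Sum>g\<in>?J. \<theta> (g z) (deriv g z * w))"
        by (rule sum.mono_neutral_left[OF fin]) (use True test_form_zero[OF \<theta>] in auto)
      then show ?thesis using \<Phi>[OF True] True C(2) by (simp add: pull_def sum_distrib_left subset_iff)
    qed (simp add: C(4))
  qed
  have move: "pairing v (\<lambda>z w. \<psi> z * pull g \<theta> z w) = pairing v (\<lambda>z w. \<psi> (i g z) * \<theta> z w)" if g: "g \<in> ?J" for g
  proof -
    have gi: "g \<in> hyp_isometries" "i g \<in> hyp_isometries" "i g \<in> deck_group p" using g i[OF g] deck_isometry by auto
    have "pull (i g) (\<lambda>z w. \<psi> z * pull g \<theta> z w) = (\<lambda>z w. \<psi> (i g z) * \<theta> z w)"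
    proof (intro ext)
      fix z w
      show "pull (i g) (\<lambda>z w. \<psi> z * pull g \<theta> z w) z w = \<psi> (i g z) * \<theta> z w"
      proof (cases "z \<in> upper_half")
        case True
        have "deriv g (i g z) * deriv (i g) z = 1"
          using deriv_isometry_compose[OF gi(1,2) True] i[OF g] by simp
        moreover have "g (i g z) = z" using i[OF g] by (metis comp_apply id_apply)
        ultimately show ?thesis using True isometry_upper_half[OF gi(2) True]
          by (simp add: pull_def mult.assoc[symmetric])
      next
        case False
        then show ?thesis using S(2) test_form_zero[OF \<theta>, of z] by (auto simp: pull_def)
      qed
    qed
    then show ?thesis using pairing_pull[OF v gi(3) tc[OF g]] by simp
  qed
  have ti: "test_form S (\<lambda>z w. \<psi> (i g z) * \<theta> z w)" if g: "g \<in> ?J" for g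
    using test_form_mult[OF \<theta> open_upper_half S(2) smooth_compose_isometry[OF deck_isometry C(3)] closed_UNIV, of "i g"] i[OF g] by simp
  have one: "(\<Sum>g\<in>?J. \<psi> (i g z)) = 1" if z: "z \<in> S" for z
  proof -
    have inj: "inj_on i ?J"
    proof (rule inj_onI)
      fix g g' assume g: "g \<in> ?J" "g' \<in> ?J" "i g = i g'"
      have "g = g \<circ> (i g' \<circ> g')" using i[OF g(2)] by simp
      also have "\<dots> = g'" using i[OF g(1)] g(3) by (simp add: comp_assoc[symmetric])
      finally show "g = g'" .
    qed
    have "deck_sum \<psi> z = (\<Sum>h\<in>i ` ?J. \<psi> (h z))"
    proof (rule deck_sum_eq)
      show "finite (i ` ?J)" using fin by simp
      show "i ` ?J \<subseteq> deck_group p" using i by blast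
      fix h assume h: "h \<in> deck_group p" "\<psi> (h z) \<noteq> 0"
      obtain g where g: "g \<in> deck_group p" "h \<circ> g = id" "g \<circ> h = id" using deck_inverse[OF h(1)] by blast
      have "g (h z) = z" using g(3) by (metis comp_apply id_apply)
      then have gJ: "g \<in> ?J" using g(1) z C(4)[of "h z"] h(2) imageI[of "h z" C g] by auto
      have "h = h \<circ> (g \<circ> i g)" using i[OF gJ] by simp
      also have "\<dots> = i g" using g(2) by (simp add: comp_assoc[symmetric])
      finally show "h \<in> i ` ?J" using gJ by blast
    qed
    then show ?thesis using C(5)[of z] z S(2) sum.reindex[OF inj, of "\<lambda>h. \<psi> (h z)"] by auto
  qed
  have "current v \<psi> \<Phi> = (\<Sum>g\<in>?J. pairing v (\<lambda>z w. \<psi> (i g z) * \<theta> z w))"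
    unfolding current_def eq by (rule trans[OF pairing_sum[OF v C(1,2) tc] sum.cong[OF refl move]])
  also have "\<dots> = pairing v (\<lambda>z w. \<Sum>g\<in>?J. \<psi> (i g z) * \<theta> z w)"
    by (rule pairing_sum[OF v S ti, symmetric])
  also have "(\<lambda>z w. \<Sum>g\<in>?J. \<psi> (i g z) * \<theta> z w) = \<theta>"
  proof (intro ext)
    fix z w show "(\<Sum>g\<in>?J. \<psi> (i g z) * \<theta> z w) = \<theta> z w"
      using one[of z] test_form_zero[OF \<theta>, of z w] by (cases "z \<in> S") (simp_all add: sum_distrib_right[symmetric])
  qed
  finally show ?thesis .
qed

text \<open>A form supported in the orbit of one sheet is the sum of the translates of its restriction to that
  sheet.\<close>

lemma current_sheet:
  assumes v: "is_primitive v" and \<psi>: "cutoff C \<psi>" and S: "compact S" "S \<subseteq> upper_half" "inj_on p S"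
    and \<phi>: "\<phi> \<in> one_forms p" "\<And>z w. z \<in> upper_half \<Longrightarrow> p z \<notin> p ` S \<Longrightarrow> \<phi> z w = 0"
  shows "current v \<psi> \<phi> = pairing v (sheet_form S \<phi>)"
proof (rule current_deck_sum[OF v \<psi> test_form_sheet[OF S \<phi>]])
  fix z w assume "z \<in> C"
  then have z: "z \<in> upper_half" using \<psi> by (auto simp: cutoff_def)
  show "\<phi> z w = (\<Sum>g | g \<in> deck_group p \<and> g z \<in> S. sheet_form S \<phi> (g z) (deriv g z * w))"
  proof (cases "p z \<in> p ` S")
    case True
    then obtain y where y: "y \<in> S" "p z = p y" by blast
    then obtain g where g: "g \<in> deck_group p" "g z = y" using deck_transitive[OF z _ y(2)] S(2) by blast
    have "h = g" if h: "h \<in> deck_group p" "h z \<in> S" for h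
    proof -
      have "p (h z) = p (g z)" using deck_p z h(1) g(1) by simp
      then have "h z = g z" using S(3) h(2) y(1) g(2) by (auto dest: inj_onD)
      then show ?thesis by (rule deck_unique[OF h(1) g(1) z])
    qed
    then have "{h. h \<in> deck_group p \<and> h z \<in> S} = {g}" using g y(1) by blast
    then show ?thesis using one_form_deck[OF \<phi>(1) g(1) z, of w] g(2) y(1) by (simp add: sheet_form_def)
  next
    case False
    have "h z \<notin> S" if "h \<in> deck_group p" for h using False deck_p[OF that z] image_eqI[of "p z" p "h z" S] by auto
    then have "{h. h \<in> deck_group p \<and> h z \<in> S} = {}" by blast
    then show ?thesis unfolding \<phi>(2)[OF z False] by (simp only: sum.empty)
  qed
qed

end

section \<open>Continuity, closedness and the primitive\<close>

lemma form_size_le: "form_size \<theta> z \<le> \<bar>\<theta> z 1\<bar> + \<bar>\<theta> z \<i>\<bar>"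
  by (simp add: form_size_def sqrt_sum_squares_le_sum_abs)

lemma test_form_exact:
  assumes f: "smooth UNIV f" and C: "compact C" "C \<subseteq> upper_half" "\<And>z. z \<notin> C \<Longrightarrow> f z = 0"
  shows "test_form C (\<lambda>z. frechet_derivative f (at z))"
    "(f has_derivative frechet_derivative f (at z)) (at z)"
proof -
  show d: "(f has_derivative frechet_derivative f (at z)) (at z)" for z
    by (rule differentiable_has_frechet[OF smooth_differentiable[OF f] open_UNIV UNIV_I])
  have "frechet_derivative f (at z) w = 0" if "z \<notin> C" for z w
  proof -
    have "frechet_derivative f (at z) = frechet_derivative (\<lambda>_. 0) (at z)"
      by (rule frechet_derivative_cong_open[of "- C"]) (use that C in \<open>auto simp: compact_imp_closed open_Compl\<close>)
    then show ?thesis by simp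
  qed
  moreover have "linear (frechet_derivative f (at z))" for z using has_derivative_linear[OF d] .
  ultimately show "test_form C (\<lambda>z. frechet_derivative f (at z))"
    using C(1,2) smooth_derivative[OF f] by (simp add: test_form_def)
qed

context lamination begin

text \<open>A partition of unity reduces this to functions supported in one chart.\<close>

lemma pairing_exact_compact:
  assumes v: "is_primitive v" and f: "smooth UNIV f" and C: "compact C" "C \<subseteq> upper_half" "\<And>z. z \<notin> C \<Longrightarrow> f z = 0"
  shows "pairing v (\<lambda>z. frechet_derivative f (at z)) = 0"
proof -
  have "\<exists>r u. r > 0 \<and> (ball x r, u) \<in> local_primitives" if "x \<in> C" for x
    using local_primitives_cover[OF subsetD[OF C(2) that] open_UNIV UNIV_I] by metis
  then obtain r u where r: "\<And>x. x \<in> C \<Longrightarrow> r x > 0" "\<And>x. x \<in> C \<Longrightarrow> (ball x (r x), u x) \<in> local_primitives" by metis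
  obtain I \<rho> Q where up: "unity_partition C r I \<rho> Q" using partition_of_unity[of C r] C(1) r(1) by blast
  then have I: "finite I" "I \<subseteq> C" and Q: "open Q" "C \<subseteq> Q" "\<And>x. x \<in> I \<Longrightarrow> smooth Q (\<rho> x)"
    and \<rho>0: "\<And>x z. x \<in> I \<Longrightarrow> z \<notin> cball x (r x / 2) \<Longrightarrow> \<rho> x z = 0" and one: "\<And>z. z \<in> C \<Longrightarrow> (\<Sum>x\<in>I. \<rho> x z) = 1"
    by (auto simp: unity_partition_def)
  define fx where "fx x z = \<rho> x z * f z" for x z
  have sm: "smooth UNIV (fx x)" if x: "x \<in> I" for x
    unfolding fx_def
    by (rule smooth_extend[OF Q(1) smooth_mult[OF Q(1) Q(3)[OF x] smooth_subset[OF f subset_UNIV]] C(1) Q(2)]) (simp add: C(3))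
  have z: "fx x z = 0" if "x \<in> I" "z \<notin> C \<inter> cball x (r x / 2)" for x z
    using that C(3) \<rho>0 by (auto simp: fx_def)
  have cc: "compact (C \<inter> cball x (r x / 2))" "C \<inter> cball x (r x / 2) \<subseteq> upper_half" for x
    using C by (auto intro: compact_Int_closed)
  have ex: "test_form (C \<inter> cball x (r x / 2)) (\<lambda>z. frechet_derivative (fx x) (at z))"
    "(fx x has_derivative frechet_derivative (fx x) (at y)) (at y)" if x: "x \<in> I" for x y
    by (rule test_form_exact[OF sm[OF x] cc z[OF x]]; assumption)+
  have feq: "f = (\<lambda>z. \<Sum>x\<in>I. fx x z)"
  proof
    fix z show "f z = (\<Sum>x\<in>I. fx x z)"
      using one[of z] C(3)[of z] by (cases "z \<in> C") (simp_all add: fx_def sum_distrib_right[symmetric])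
  qed
  have deq: "(\<lambda>z. frechet_derivative f (at z)) = (\<lambda>z w. \<Sum>x\<in>I. frechet_derivative (fx x) (at z) w)"
  proof
    fix z
    have "((\<lambda>z. \<Sum>x\<in>I. fx x z) has_derivative (\<lambda>w. \<Sum>x\<in>I. frechet_derivative (fx x) (at z) w)) (at z)"
      by (rule has_derivative_sum) (rule ex(2))
    then show "frechet_derivative f (at z) = (\<lambda>w. \<Sum>x\<in>I. frechet_derivative (fx x) (at z) w)"
      unfolding feq[symmetric] by (rule frechet_derivative_at[symmetric])
  qed
  have "pairing v (\<lambda>z. frechet_derivative (fx x) (at z)) = 0" if x: "x \<in> I" for x
  proof (rule pairing_exact[OF v r(2) ex(1)[OF x] _ ex(2)[OF x] z[OF x]])
    show "x \<in> C" using x I by blast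
    show "C \<inter> cball x (r x / 2) \<subseteq> ball x (r x)" using r(1)[of x] x I by force
  qed
  moreover have "test_form C (\<lambda>z. frechet_derivative (fx x) (at z))" if x: "x \<in> I" for x
    by (rule test_form_subset[OF ex(1)[OF x] _ C(1,2)]) blast
  ultimately show ?thesis unfolding deq using pairing_sum[OF v C(1,2), of I "\<lambda>x z. frechet_derivative (fx x) (at z)"] by simp
qed

end

context hyp_surface begin

lemma smooth_function_has_derivative:
  assumes "smooth_function p f" "z \<in> upper_half"
  shows "((f \<circ> p) has_derivative d0 p f z) (at z)"
  using differentiable_has_frechet[OF smooth_differentiable open_upper_half assms(2), of "f \<circ> p"] assms(1)
  by (simp add: smooth_function_def d0_def[abs_def])

lemma isometry_has_derivative:
  "g \<in> hyp_isometries \<Longrightarrow> z \<in> upper_half \<Longrightarrow> (g has_derivative (\<lambda>w. deriv g z * w)) (at z)"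
  using isometry_has_deriv by (simp add: has_field_derivative_def)

lemma d0_one_form:
  assumes f: "smooth_function p f" shows "d0 p f \<in> one_forms p"
proof -
  have "d0 p f (g z) (deriv g z * w) = d0 p f z w" if g: "g \<in> deck_group p" and z: "z \<in> upper_half" for g z w
  proof -
    have "((\<lambda>y. (f \<circ> p) (g y)) has_derivative (\<lambda>w. d0 p f (g z) (deriv g z * w))) (at z)"
      by (rule has_derivative_compose[OF isometry_has_derivative[OF deck_isometry[OF g] z]
        smooth_function_has_derivative[OF f deck_upper_half[OF g z]]])
    then have "frechet_derivative (\<lambda>y. (f \<circ> p) (g y)) (at z) = (\<lambda>w. d0 p f (g z) (deriv g z * w))"
      by (rule frechet_derivative_at[symmetric])
    moreover have "frechet_derivative (\<lambda>y. (f \<circ> p) (g y)) (at z) = d0 p f z"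
      unfolding d0_def by (rule frechet_derivative_cong_open[OF open_upper_half z]) (simp add: deck_p[OF g])
    ultimately show ?thesis by metis
  qed
  then show ?thesis using f smooth_derivative[of upper_half "f \<circ> p"] has_derivative_linear[OF smooth_function_has_derivative[OF f]]
    by (auto simp: one_forms_def smooth_function_def d0_def)
qed

end

context lamination begin

lemma current_cong:
  assumes "cutoff C \<psi>" "\<And>z w. z \<in> upper_half \<Longrightarrow> \<phi> z w = \<phi>' z w"
  shows "current v \<psi> \<phi> = current v \<psi> \<phi>'"
proof -
  have "(\<lambda>z w. \<psi> z * \<phi> z w) = (\<lambda>z w. \<psi> z * \<phi>' z w)"
    using assms unfolding cutoff_def fun_eq_iff by (metis mult_zero_left subsetD)
  then show ?thesis by (simp add: current_def)
qed

lemma current_linear: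
  assumes v: "is_primitive v" and \<psi>: "cutoff C \<psi>" and \<phi>: "\<phi> \<in> one_forms p" "\<phi>' \<in> one_forms p"
  shows "current v \<psi> (\<lambda>z w. a * \<phi> z w + b * \<phi>' z w) = a * current v \<psi> \<phi> + b * current v \<psi> \<phi>'"
proof -
  note t = test_form_cutoff_one_form[OF \<psi> \<phi>(1)] test_form_cutoff_one_form[OF \<psi> \<phi>(2)]
  have "(\<lambda>z w. \<psi> z * (a * \<phi> z w + b * \<phi>' z w)) = (\<lambda>z w. a * (\<psi> z * \<phi> z w) + b * (\<psi> z * \<phi>' z w))"
    by (simp add: algebra_simps)
  then show ?thesis
    using pairing_add[OF v test_form_scale[OF t(1), of a] test_form_scale[OF t(2), of b]] pairing_scale[OF t(1)] pairing_scale[OF t(2)]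
    by (simp add: current_def)
qed

lemma current_sum:
  assumes v: "is_primitive v" and \<psi>: "cutoff C \<psi>" and \<Phi>: "\<And>i. i \<in> I \<Longrightarrow> \<Phi> i \<in> one_forms p"
  shows "current v \<psi> (\<lambda>z w. \<Sum>i\<in>I. \<Phi> i z w) = (\<Sum>i\<in>I. current v \<psi> (\<Phi> i))"
  unfolding current_def sum_distrib_left
  by (rule pairing_sum[OF v]) (use \<psi> test_form_cutoff_one_form[OF \<psi> \<Phi>] in \<open>auto simp: cutoff_def\<close>)

text \<open>The current has order zero, so uniform convergence of the forms on the support of the cutoff is
  enough.\<close>

lemma current_continuous:
  assumes v: "is_primitive v" and \<psi>: "cutoff C \<psi>" and \<Phi>: "\<And>n. \<Phi> n \<in> one_forms p" and \<phi>: "\<phi> \<in> one_forms p"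
    and lim: "\<And>w. smooth_conv (\<lambda>n z. \<Phi> n z w) (\<lambda>z. \<phi> z w)"
  shows "(\<lambda>n. current v \<psi> (\<Phi> n)) \<longlonglongrightarrow> current v \<psi> \<phi>"
proof -
  have C: "compact C" "C \<subseteq> upper_half" and s: "smooth upper_half \<psi>" and z: "\<And>z. z \<notin> C \<Longrightarrow> \<psi> z = 0" and nn: "\<And>z. 0 \<le> \<psi> z"
    using \<psi> by (auto simp: cutoff_def)
  obtain k where k: "k \<ge> 0" "\<And>\<theta> N. test_form C \<theta> \<Longrightarrow> (\<And>z. form_size \<theta> z \<le> N) \<Longrightarrow> \<bar>pairing v \<theta>\<bar> \<le> k * N"
    using pairing_bound[OF v C] by blast
  have "compact (\<psi> ` C)" by (intro compact_continuous_image continuous_on_subset[OF smooth_continuous_on[OF s]] C)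
  then have "\<exists>m. \<forall>z\<in>C. \<psi> z \<le> m" using compact_imp_bounded[of "\<psi> ` C"] by (auto simp: bounded_iff abs_le_iff)
  then obtain m0 where m0: "\<And>z. z \<in> C \<Longrightarrow> \<psi> z \<le> m0" by blast
  define m where "m = max m0 0"
  have m: "m \<ge> 0" "\<And>z. \<psi> z \<le> m" using m0 z unfolding m_def by (simp, metis max.coboundedI1 max.cobounded2)
  have u: "\<forall>\<^sub>F n in sequentially. \<forall>z\<in>C. \<bar>\<Phi> n z w - \<phi> z w\<bar> < e" if "e > 0" for e w
  proof -
    have "\<forall>vs K. compact K \<and> K \<subseteq> upper_half \<longrightarrow>
      uniform_limit K (\<lambda>n. iter_deriv vs (\<lambda>z. \<Phi> n z w)) (iter_deriv vs (\<lambda>z. \<phi> z w)) sequentially"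
      using lim[of w] unfolding smooth_conv_def .
    then have "uniform_limit C (\<lambda>n. iter_deriv [] (\<lambda>z. \<Phi> n z w)) (iter_deriv [] (\<lambda>z. \<phi> z w)) sequentially" using C by blast
    then show ?thesis using that unfolding uniform_limit_iff dist_real_def by simp
  qed
  show ?thesis
  proof (rule tendstoI)
    fix e :: real assume e: "e > 0"
    define \<epsilon> where "\<epsilon> = e / (2 * (k * m) + 1)"
    have km: "0 \<le> k * m" using k(1) m(1) by simp
    have \<epsilon>: "\<epsilon> > 0" using e km unfolding \<epsilon>_def by (intro divide_pos_pos) auto
    have "(2 * (k * m) + 1) * \<epsilon> = e" using km unfolding \<epsilon>_def by simp
    then have small: "k * (m * (2 * \<epsilon>)) < e" using \<epsilon> by (simp add: algebra_simps)
    have "\<forall>\<^sub>F n in sequentially. (\<forall>z\<in>C. \<bar>\<Phi> n z 1 - \<phi> z 1\<bar> < \<epsilon>) \<and> (\<forall>z\<in>C. \<bar>\<Phi> n z \<i> - \<phi> z \<i>\<bar> < \<epsilon>)"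
      by (intro eventually_conj u \<epsilon>)
    then show "\<forall>\<^sub>F n in sequentially. dist (current v \<psi> (\<Phi> n)) (current v \<psi> \<phi>) < e"
    proof (rule eventually_mono)
      fix n assume n: "(\<forall>z\<in>C. \<bar>\<Phi> n z 1 - \<phi> z 1\<bar> < \<epsilon>) \<and> (\<forall>z\<in>C. \<bar>\<Phi> n z \<i> - \<phi> z \<i>\<bar> < \<epsilon>)"
      define \<eta> where "\<eta> z w = 1 * \<Phi> n z w + (-1) * \<phi> z w" for z w
      have t: "test_form C (\<lambda>z w. \<psi> z * \<eta> z w)"
        unfolding \<eta>_def
      proof (rule test_form_cutoff[OF \<psi>])
        show "linear (\<lambda>w. 1 * \<Phi> n z w + (-1) * \<phi> z w)" if "z \<in> C" for z
          using one_form_linear[OF \<Phi>, of z n] one_form_linear[OF \<phi>, of z] that C(2)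
          by (auto intro!: linear_compose_sub)
        show "smooth upper_half (\<lambda>z. 1 * \<Phi> n z w + (-1) * \<phi> z w)" for w
          by (intro smooth_add smooth_mult smooth_const open_upper_half one_form_smooth \<Phi> \<phi>)
      qed
      have "form_size (\<lambda>z w. \<psi> z * \<eta> z w) z \<le> m * (2 * \<epsilon>)" for z
      proof (cases "z \<in> C")
        case True
        have "form_size \<eta> z \<le> 2 * \<epsilon>" using form_size_le[of \<eta> z] n True by (force simp: \<eta>_def)
        then have "\<psi> z * form_size \<eta> z \<le> m * (2 * \<epsilon>)" using m nn form_size_nonneg by (intro mult_mono) auto
        then show ?thesis by (simp add: form_size_mult nn)
      next
        case False
        then show ?thesis using m(1) \<epsilon> by (simp add: form_size_mult z)
      qed
      then have "\<bar>current v \<psi> \<eta>\<bar> \<le> k * (m * (2 * \<epsilon>))" unfolding current_def by (rule k(2)[OF t])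
      moreover have "current v \<psi> \<eta> = current v \<psi> (\<Phi> n) - current v \<psi> \<phi>"
        unfolding \<eta>_def using current_linear[OF v \<psi> \<Phi> \<phi>, of 1 n "-1"] by simp
      ultimately show "dist (current v \<psi> (\<Phi> n)) (current v \<psi> \<phi>) < e" using small by (simp add: dist_real_def)
    qed
  qed
qed

lemma current_one_current:
  assumes "is_primitive v" "cutoff C \<psi>" shows "one_current p (current v \<psi>)"
  unfolding one_current_def using current_linear[OF assms] current_continuous[OF assms] by blast

lemma current_off_lamination:
  assumes v: "is_primitive v" and \<psi>: "cutoff C \<psi>" and \<phi>: "\<phi> \<in> one_forms p" "form_support M p \<phi> \<inter> lam = {}"
  shows "current v \<psi> \<phi> = 0"
proof -
  have C: "compact C" "C \<subseteq> upper_half" and z: "\<And>z. z \<notin> C \<Longrightarrow> \<psi> z = 0" using \<psi> by (auto simp: cutoff_def)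
  let ?S = "C \<inter> p -` form_support M p \<phi>"
  have "closed ?S"
    by (rule continuous_closed_preimage[OF continuous_on_subset[OF p_continuous C(2)] compact_imp_closed[OF C(1)] compact_imp_closed[OF compact_form_support]])
  then have S: "compact ?S" using C(1) by (metis compact_Int_closed inf.left_idem)
  have "\<psi> y * \<phi> y w = 0" if "y \<notin> ?S" for y w
    using z[of y] outside_form_support[of y \<phi> w] that C(2) by (cases "y \<in> C") auto
  then have "test_form ?S (\<lambda>z w. \<psi> z * \<phi> z w)"
    using test_form_cutoff_one_form[OF \<psi> \<phi>(1)] S C(2) unfolding test_form_def by blast
  then show ?thesis unfolding current_def by (rule pairing_off_lamination[OF v]) (use \<phi>(2) in \<open>auto simp: lift_lam_def\<close>)
qed

text \<open>With \<open>h\<close> the product of the cutoff and the lift of \<open>f\<close>, the lift is the sum of the translates of \<open>h\<close>,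
  so that \<open>df\<close> is the sum of the translates of the compactly supported exact form \<open>dh\<close>.\<close>

lemma current_closed:
  assumes v: "is_primitive v" and \<psi>: "cutoff C \<psi>" and f: "smooth_function p f"
  shows "current v \<psi> (d0 p f) = 0"
proof -
  have C: "compact C" "C \<subseteq> upper_half" and s: "smooth upper_half \<psi>" and z: "\<And>z. z \<notin> C \<Longrightarrow> \<psi> z = 0"
    and one: "\<And>z. z \<in> upper_half \<Longrightarrow> deck_sum \<psi> z = 1"
    using \<psi> by (auto simp: cutoff_def)
  define h where "h z = \<psi> z * (f \<circ> p) z" for z
  have h0: "h z = 0" if "z \<notin> C" for z using z[OF that] by (simp add: h_def)
  have "smooth upper_half h" unfolding h_def
    by (rule smooth_mult[OF open_upper_half s f[unfolded smooth_function_def]])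
  then have hs: "smooth UNIV h" by (rule smooth_extend[OF open_upper_half _ C h0])
  have ex: "test_form C (\<lambda>z. frechet_derivative h (at z))" "(h has_derivative frechet_derivative h (at y)) (at y)" for y
    by (rule test_form_exact[OF hs C h0]; assumption)+
  have "current v \<psi> (d0 p f) = pairing v (\<lambda>z. frechet_derivative h (at z))"
  proof (rule current_deck_sum[OF v \<psi> ex(1)])
    fix z w assume zC: "z \<in> C"
    then have zH: "z \<in> upper_half" using C by blast
    obtain r where r: "r > 0" "cball z r \<subseteq> upper_half" using zH open_upper_half open_contains_cball by blast
    let ?J = "{g \<in> deck_group p. g ` cball z r \<inter> C \<noteq> {}}"
    have fin: "finite ?J" by (rule deck_finite[OF compact_cball r(2) C])
    have loc: "(f \<circ> p) y = (\<Sum>g\<in>?J. h (g y))" if y: "y \<in> ball z r" for y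
    proof -
      have yc: "y \<in> cball z r" using y by auto
      have "(\<Sum>g\<in>?J. h (g y)) = (\<Sum>g\<in>?J. \<psi> (g y)) * (f \<circ> p) y"
        unfolding sum_distrib_right h_def by (rule sum.cong) (use deck_p yc r(2) in auto)
      also have "(\<Sum>g\<in>?J. \<psi> (g y)) = 1"
        using deck_sum_on_compact(2)[where f = \<psi>, OF C _ compact_cball r(2) yc] z one[of y] yc r(2) by auto
      finally show ?thesis by simp
    qed
    have "((\<lambda>y. \<Sum>g\<in>?J. h (g y)) has_derivative (\<lambda>w. \<Sum>g\<in>?J. frechet_derivative h (at (g z)) (deriv g z * w))) (at z)"
      by (rule has_derivative_sum, rule has_derivative_compose[OF isometry_has_derivative[OF deck_isometry zH] ex(2)]) blast
    then have "frechet_derivative (\<lambda>y. \<Sum>g\<in>?J. h (g y)) (at z) = (\<lambda>w. \<Sum>g\<in>?J. frechet_derivative h (at (g z)) (deriv g z * w))"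
      by (rule frechet_derivative_at[symmetric])
    moreover have "frechet_derivative (f \<circ> p) (at z) = frechet_derivative (\<lambda>y. \<Sum>g\<in>?J. h (g y)) (at z)"
      by (rule frechet_derivative_cong_open[OF open_ball _ loc]) (use r in auto)
    ultimately have "d0 p f z w = (\<Sum>g\<in>?J. frechet_derivative h (at (g z)) (deriv g z * w))" by (simp add: d0_def)
    also have "\<dots> = (\<Sum>g | g \<in> deck_group p \<and> g z \<in> C. frechet_derivative h (at (g z)) (deriv g z * w))"
    proof (rule sum.mono_neutral_right[OF fin])
      have "z \<in> cball z r" using r by simp
      then show "{g \<in> deck_group p. g z \<in> C} \<subseteq> ?J" by blast
      show "\<forall>g\<in>?J - {g \<in> deck_group p. g z \<in> C}. frechet_derivative h (at (g z)) (deriv g z * w) = 0"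
        using test_form_zero[OF ex(1)] by blast
    qed
    finally show "d0 p f z w = (\<Sum>g | g \<in> deck_group p \<and> g z \<in> C. frechet_derivative h (at (g z)) (deriv g z * w))" .
  qed
  then show ?thesis using pairing_exact_compact[OF v hs C h0] by simp
qed

lemma current_eq_d_primitive:
  assumes v: "is_primitive v" and \<psi>: "cutoff C \<psi>" shows "current_eq_d M p (current v \<psi>) v"
  unfolding current_eq_d_def
proof (intro allI impI)
  fix W \<phi>
  assume a: "open W \<and> W \<subseteq> upper_half \<and> inj_on p W \<and> \<phi> \<in> one_forms p \<and> form_support M p \<phi> \<subseteq> p ` W"
  then have W: "open W" "W \<subseteq> upper_half" "inj_on p W" and \<phi>: "\<phi> \<in> one_forms p" by auto
  let ?S = "W \<inter> p -` form_support M p \<phi>"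
  have cs: "compact ?S" "p ` ?S = form_support M p \<phi>"
    using injective_open_compact_part[OF W compact_form_support, of \<phi>] a by auto
  have S: "?S \<subseteq> upper_half" "inj_on p ?S" using W by (auto intro: inj_on_subset)
  have zero: "\<phi> z w = 0" if "z \<in> upper_half" "p z \<notin> p ` ?S" for z w
    using outside_form_support[OF that(1)] that(2) cs(2) by simp
  note t = test_form_sheet[OF cs(1) S \<phi> zero]
  have eqW: "sheet_form ?S \<phi> z w = \<phi> z w" if "z \<in> W" for z w
    using outside_form_support[of z \<phi> w] that W(2) by (auto simp: sheet_form_def)
  have "v z * d1 (sheet_form ?S \<phi>) z = indicator W z *\<^sub>R (v z * d1 \<phi> z)" for z
  proof (cases "z \<in> W")
    case True
    have "d1 (sheet_form ?S \<phi>) z = d1 \<phi> z" unfolding d1_def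
      using frechet_derivative_cong_open[OF W(1) True, of "\<lambda>w. sheet_form ?S \<phi> w \<i>" "\<lambda>w. \<phi> w \<i>"]
        frechet_derivative_cong_open[OF W(1) True, of "\<lambda>w. sheet_form ?S \<phi> w 1" "\<lambda>w. \<phi> w 1"] eqW by simp
    then show ?thesis using True by simp
  next
    case False
    then show ?thesis using d1_zero[OF t, of z] by simp
  qed
  then have "pairing v (sheet_form ?S \<phi>) = (LINT z:W|lborel. v z * d1 \<phi> z)"
    unfolding pairing_def set_lebesgue_integral_def by (rule Bochner_Integration.integral_cong[OF refl])
  moreover have "current v \<psi> \<phi> = pairing v (sheet_form ?S \<phi>)" by (rule current_sheet[OF v \<psi> cs(1) S \<phi> zero])
  ultimately show "current v \<psi> \<phi> = (LINT z:W|lborel. v z * d1 \<phi> z)" by simp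
qed

text \<open>The divergence of \<open>X\<close> is the exterior derivative of the form obtained from \<open>X\<close> by a quarter turn,
  which has the same norm; so the bound on the variation is \<open>pairing_bound\<close>.\<close>

lemma primitive_BV_loc:
  assumes v: "is_primitive v" shows "BV_loc v"
  unfolding BV_loc_def locally_integrable_def
proof (intro conjI allI impI)
  show "set_integrable lborel C v" if "compact C \<and> C \<subseteq> upper_half" for C
    using primitive_set_integrable[OF v] that by blast
  fix C :: "complex set" assume C: "compact C \<and> C \<subseteq> upper_half"
  obtain k where "k \<ge> 0" and k: "\<And>\<theta> N. test_form C \<theta> \<Longrightarrow> (\<And>z. form_size \<theta> z \<le> N) \<Longrightarrow> \<bar>pairing v \<theta>\<bar> \<le> k * N"
    by (rule pairing_bound[OF v conjunct1[OF C] conjunct2[OF C]]) blast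
  have "\<bar>LINT z:C|lborel. v z * (frechet_derivative (\<lambda>z. Re (X z)) (at z) 1 + frechet_derivative (\<lambda>z. Im (X z)) (at z) \<i>)\<bar> \<le> k"
    if X: "smooth UNIV (\<lambda>z. Re (X z))" "smooth UNIV (\<lambda>z. Im (X z))" "\<And>z. z \<notin> C \<Longrightarrow> X z = 0" "\<And>z. cmod (X z) \<le> 1" for X
  proof -
    define \<theta> where "\<theta> z w = Re (X z) * Im w - Im (X z) * Re w" for z w
    have t: "test_form C \<theta>" unfolding test_form_def
    proof (intro conjI allI impI)
      show "linear (\<theta> z)" for z by (rule linearI) (simp_all add: \<theta>_def algebra_simps)
      show "smooth UNIV (\<lambda>z. \<theta> z w)" for w unfolding \<theta>_def by (intro smooth_diff smooth_mult X smooth_const open_UNIV)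
    qed (use C X(3) in \<open>auto simp: \<theta>_def\<close>)
    have dm: "frechet_derivative (\<lambda>z. - Im (X z)) (at z) w = - frechet_derivative (\<lambda>z. Im (X z)) (at z) w" for z w
      using frechet_derivative_at[OF has_derivative_minus[OF differentiable_has_frechet[OF smooth_differentiable[OF X(2)] open_UNIV UNIV_I, of z]]]
      by metis
    have d: "d1 \<theta> z = frechet_derivative (\<lambda>z. Re (X z)) (at z) 1 + frechet_derivative (\<lambda>z. Im (X z)) (at z) \<i>" for z
      by (simp add: d1_def \<theta>_def dm)
    have "form_size \<theta> z \<le> 1" for z using X(4)[of z] by (simp add: form_size_def \<theta>_def cmod_def add.commute)
    then have "\<bar>pairing v \<theta>\<bar> \<le> k" using k[OF t, of 1] by simp
    moreover have "(\<lambda>z. indicator C z *\<^sub>R (v z * d1 \<theta> z)) = (\<lambda>z. v z * d1 \<theta> z)"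
    proof
      fix z show "indicator C z *\<^sub>R (v z * d1 \<theta> z) = v z * d1 \<theta> z"
        using d1_zero[OF t, of z] by (cases "z \<in> C") simp_all
    qed
    ultimately show ?thesis unfolding pairing_def set_lebesgue_integral_def d[symmetric] by simp
  qed
  then show "\<exists>k. \<forall>X. smooth UNIV (\<lambda>z. Re (X z)) \<and> smooth UNIV (\<lambda>z. Im (X z)) \<and> (\<forall>z. z \<notin> C \<longrightarrow> X z = 0) \<and> (\<forall>z. cmod (X z) \<le> 1) \<longrightarrow>
    \<bar>LINT z:C|lborel. v z * (frechet_derivative (\<lambda>z. Re (X z)) (at z) 1 + frechet_derivative (\<lambda>z. Im (X z)) (at z) \<i>)\<bar> \<le> k"
    by blast
qed

end

section \<open>The Ruelle--Sullivan formula\<close>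

context hyp_surface begin

lemma continuous_on_one_form:
  assumes \<phi>: "\<phi> \<in> one_forms p" and a: "continuous_on X a" "a ` X \<subseteq> upper_half" and b: "continuous_on X b"
  shows "continuous_on X (\<lambda>x. \<phi> (a x) (b x))"
proof -
  have "continuous_on X (\<lambda>x. Re (b x) * \<phi> (a x) 1 + Im (b x) * \<phi> (a x) \<i>)"
    by (intro continuous_intros b continuous_on_compose2[OF smooth_continuous_on[OF one_form_smooth[OF \<phi>]] a])
  then show ?thesis
    by (rule continuous_on_eq) (use a(2) in \<open>simp add: linear_complex_real[OF one_form_linear[OF \<phi>], symmetric] image_subset_iff\<close>)
qed

text \<open>Two lifts of the path differ by a deck transformation, under which the form is invariant.\<close>

lemma path_integral_lift:
  assumes ab: "a < b" and g: "is_lift p {a..b} c g" and \<phi>: "\<phi> \<in> one_forms p"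
    and d: "\<And>t. t \<in> {a..b} \<Longrightarrow> (g has_vector_derivative g' t) (at t within {a..b})"
  shows "path_integral p \<phi> c a b = integral {a..b} (\<lambda>t. \<phi> (g t) (g' t))"
proof -
  define k where "k = (SOME g. is_lift p {a..b} c g)"
  have k: "is_lift p {a..b} c k" unfolding k_def by (rule someI[of "is_lift p {a..b} c", OF g])
  obtain h where h: "h \<in> deck_group p" "\<And>t. t \<in> {a..b} \<Longrightarrow> k t = h (g t)"
    using lifts_differ_by_deck[OF g k connected_Icc, of a] ab by auto
  have "\<phi> (k t) (vector_derivative k (at t within {a..b})) = \<phi> (g t) (g' t)" if t: "t \<in> {a..b}" for t
  proof -
    have gt: "g t \<in> upper_half" using g t by (auto simp: is_lift_def)
    have "(h has_field_derivative deriv h (g t)) (at (g t) within g ` {a..b})"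
      by (rule has_field_derivative_at_within[OF isometry_has_deriv[OF deck_isometry[OF h(1)] gt]])
    then have "(h \<circ> g has_vector_derivative g' t * deriv h (g t)) (at t within {a..b})"
      by (rule field_vector_diff_chain_within[OF d[OF t]])
    then have "(k has_vector_derivative g' t * deriv h (g t)) (at t within {a..b})"
      by (rule has_vector_derivative_transform[rotated -1]) (use t h(2) in auto)
    then have "vector_derivative k (at t within {a..b}) = deriv h (g t) * g' t"
      using vector_derivative_within_closed_interval[OF ab t] by (simp add: mult.commute)
    then show ?thesis using one_form_deck[OF \<phi> h(1) gt] h(2)[OF t] by simp
  qed
  then show ?thesis unfolding path_integral_def Let_def k_def[symmetric] by (rule Henstock_Kurzweil_Integration.integral_cong)
qed

end

context lamination begin

lemma box_velocity:
  assumes B: "oriented_flow_box M p lam G B"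
  obtains F V where "lifted_box B F" "continuous_on (rect B) V"
    "\<And>t s. (t, s) \<in> rect B \<Longrightarrow> ((\<lambda>\<tau>. F (\<tau>, s)) has_vector_derivative V (t, s)) (at t within {t0 B..t1 B})"
proof -
  have "flow_box M p lam B" using B by (simp add: oriented_flow_box_def)
  then obtain F V C where F: "is_lift p (rect B) (box_map B) F"
    "\<And>t s. (t, s) \<in> rect B \<Longrightarrow> ((\<lambda>\<tau>. F (\<tau>, s)) has_vector_derivative V (t, s)) (at t within {t0 B..t1 B})"
    "C-lipschitz_on (rect B) V"
    unfolding flow_box_def by blast
  show thesis by (rule that[OF _ lipschitz_on_continuous_on[OF F(3)] F(2)]) (use B F(1) in \<open>simp_all add: lifted_box_def\<close>)
qed

text \<open>The arc length \<open>\<theta>\<close> is a differentiable function of the time of the box, being the logarithm of the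
  height after the leaf has been moved to the imaginary axis, so that it can be substituted.\<close>

lemma plaque_integral_along_box:
  assumes B: "lifted_box B F" and s: "s \<in> K B" and \<phi>: "\<phi> \<in> one_forms p"
    and V: "\<And>t. t \<in> {t0 B..t1 B} \<Longrightarrow> ((\<lambda>\<tau>. F (\<tau>, s)) has_vector_derivative V t) (at t within {t0 B..t1 B})"
  shows "integral {t0 B..t1 B} (\<lambda>t. \<phi> (F (t, s)) (V t)) = plaque_integral B F \<phi> s"
proof -
  let ?T = "{t0 B..t1 B}"
  define A where "A = plaque_leaf_at B F s"
  define \<theta> where "\<theta> t = hyp_dist (F (t0 B, s)) (F (t, s))" for t
  define k where "k x = \<phi> (geod A x) (gvel A x)" for x
  have o: "t0 B < t1 B" using box_order[OF B] by simp
  have pl: "plaque B F s A \<theta>" using plaque_at[OF B s] by (simp add: A_def \<theta>_def[abs_def])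
  then have A: "leaf A" and \<theta>c: "continuous_on ?T \<theta>" and \<theta>m: "strict_mono_on ?T \<theta>"
    and F: "\<And>t. t \<in> ?T \<Longrightarrow> F (t, s) = geod A (\<theta> t)" by (auto simp: plaque_def)
  note Ai = leaf_isometry[OF A]
  have FH: "F (t, s) \<in> upper_half" if "t \<in> ?T" for t using lifted_box_upper_half[OF B K_rect[OF B s that]] .
  obtain H where H: "H \<in> hyp_isometries" "A \<circ> H = id" "H \<circ> A = id" using isometry_inverse[OF Ai] by blast
  define u where "u t = H (F (t, s))" for t
  have u: "u t = \<i> * of_real (exp (\<theta> t))" if "t \<in> ?T" for t
    unfolding u_def F[OF that] geod_def using H(3) by (metis comp_apply id_apply)
  have \<theta>u: "\<theta> t = ln (Im (u t))" "Im (u t) > 0" if "t \<in> ?T" for t using u[OF that] by auto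
  define d where "d t = inverse (Im (u t)) * Im (V t * deriv H (F (t, s)))" for t
  have \<theta>d: "(\<theta> has_real_derivative d t) (at t within ?T)" if t: "t \<in> ?T" for t
  proof -
    have "(H has_field_derivative deriv H (F (t, s))) (at (F (t, s)) within (\<lambda>\<tau>. F (\<tau>, s)) ` ?T)"
      by (rule has_field_derivative_at_within[OF isometry_has_deriv[OF H(1) FH[OF t]]])
    then have "(H \<circ> (\<lambda>\<tau>. F (\<tau>, s)) has_vector_derivative V t * deriv H (F (t, s))) (at t within ?T)"
      by (rule field_vector_diff_chain_within[OF V[OF t]])
    then have "((\<lambda>\<tau>. Im (u \<tau>)) has_vector_derivative Im (V t * deriv H (F (t, s)))) (at t within ?T)"
      using bounded_linear.has_vector_derivative[OF bounded_linear_Im] by (fastforce simp: u_def[abs_def] o_def)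
    then have "((\<lambda>\<tau>. Im (u \<tau>)) has_real_derivative Im (V t * deriv H (F (t, s)))) (at t within ?T)"
      by (simp add: has_real_derivative_iff_has_vector_derivative)
    then have "((\<lambda>\<tau>. ln (Im (u \<tau>))) has_real_derivative d t) (at t within ?T)"
      unfolding d_def by (rule DERIV_chain2[where f = ln and g = "\<lambda>\<tau>. Im (u \<tau>)", OF DERIV_ln[OF \<theta>u(2)[OF t]]])
    then show ?thesis
      unfolding has_real_derivative_iff_has_vector_derivative
      by (rule has_vector_derivative_transform[rotated -1]) (use t \<theta>u in auto)
  qed
  have Vd: "V t = d t *\<^sub>R gvel A (\<theta> t)" if t: "t \<in> ?T" for t
  proof -
    have "(geod A \<circ> \<theta> has_vector_derivative d t *\<^sub>R gvel A (\<theta> t)) (at t within ?T)"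
      using \<theta>d[OF t] geod_derivative[OF Ai] unfolding has_real_derivative_iff_has_vector_derivative
      by (rule vector_diff_chain_within)
    then have "((\<lambda>\<tau>. F (\<tau>, s)) has_vector_derivative d t *\<^sub>R gvel A (\<theta> t)) (at t within ?T)"
      by (rule has_vector_derivative_transform[rotated -1]) (use t F in auto)
    then show ?thesis using vector_derivative_unique_within_closed_interval[OF o, of t] t V[OF t] by (metis box_real(2))
  qed
  have eq: "\<phi> (F (t, s)) (V t) = d t *\<^sub>R k (\<theta> t)" if t: "t \<in> ?T" for t
    using linear_scale[OF one_form_linear[OF \<phi> geod_upper_half[OF Ai, of "\<theta> t"]], of "d t" "gvel A (\<theta> t)"]
    by (simp add: k_def F[OF t] Vd[OF t])
  have kc: "continuous_on X k" for X
    unfolding k_def using geod_upper_half[OF Ai]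
    by (intro continuous_on_one_form[OF \<phi>] continuous_on_geod continuous_on_gvel Ai) auto
  have mono: "\<theta> t \<le> \<theta> t'" if "t \<in> ?T" "t' \<in> ?T" "t \<le> t'" for t t'
    using strict_mono_onD[OF \<theta>m that(1,2)] that(3) by (cases "t = t'") auto
  have "((\<lambda>t. d t *\<^sub>R k (\<theta> t)) has_integral integral {\<theta> (t0 B)..\<theta> (t1 B)} k) ?T"
    by (rule has_integral_substitution[of _ _ _ "\<theta> (t0 B)" "\<theta> (t1 B)"]) (use o mono kc \<theta>d in auto)
  then have "integral ?T (\<lambda>t. d t *\<^sub>R k (\<theta> t)) = integral {\<theta> (t0 B)..\<theta> (t1 B)} k" by (rule integral_unique)
  moreover have "integral ?T (\<lambda>t. \<phi> (F (t, s)) (V t)) = integral ?T (\<lambda>t. d t *\<^sub>R k (\<theta> t))"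
    by (rule Henstock_Kurzweil_Integration.integral_cong) (rule eq)
  moreover have "\<theta> (t0 B) = 0" "\<theta> (t1 B) = plaque_length B F s"
    using FH[of "t0 B"] o by (auto simp: \<theta>_def plaque_length_def hyp_dist_eq_0)
  ultimately show ?thesis using s by (simp add: plaque_integral_def k_def[abs_def] A_def)
qed

text \<open>By \<open>pairing_box\<close> this is a comparison of integrands in \<open>s\<close>, which agree on the leaf space, hence almost
  everywhere.\<close>

lemma current_box:
  assumes v: "is_primitive v" and \<psi>: "cutoff C \<psi>" and B: "oriented_flow_box M p lam G B"
    and \<phi>: "\<phi> \<in> one_forms p" "form_support M p \<phi> \<subseteq> box_image B"
  shows "current v \<psi> \<phi> =
    (LINT s:{s0 B<..<s1 B}|\<nu> B. path_integral p \<phi> (\<lambda>t. box_map B (t, s)) (t0 B) (t1 B))"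
proof -
  obtain F V where F: "lifted_box B F" and Vc: "continuous_on (rect B) V"
    and V: "\<And>t s. (t, s) \<in> rect B \<Longrightarrow> ((\<lambda>\<tau>. F (\<tau>, s)) has_vector_derivative V (t, s)) (at t within {t0 B..t1 B})"
    using box_velocity[OF B] by blast
  let ?S = "F ` rect B" and ?I = "{s0 B<..<s1 B}"
  have S: "compact ?S" "?S \<subseteq> upper_half" "inj_on p ?S"
    using lifted_box_compact[OF F] lifted_box_upper_half[OF F] lifted_box_inj_p[OF F] by auto
  have zero: "\<phi> z w = 0" if "z \<in> upper_half" "p z \<notin> p ` ?S" for z w
    using outside_form_support[OF that(1), of \<phi> w] that(2) \<phi>(2) unfolding lifted_box_image[OF F] by blast
  have o: "t0 B < t1 B" using box_order[OF F] by simp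
  define P where "P s = path_integral p \<phi> (\<lambda>t. box_map B (t, s)) (t0 B) (t1 B)" for s
  have Pe: "P s = integral {t0 B..t1 B} (\<lambda>t. \<phi> (F (t, s)) (V (t, s)))" if s: "s \<in> {s0 B..s1 B}" for s
    unfolding P_def
  proof (rule path_integral_lift[OF o _ \<phi>(1), of _ "\<lambda>t. F (t, s)" "\<lambda>t. V (t, s)"])
    have r: "(t, s) \<in> rect B" if "t \<in> {t0 B..t1 B}" for t using that s by (simp add: rect_def)
    show "is_lift p {t0 B..t1 B} (\<lambda>t. box_map B (t, s)) (\<lambda>t. F (t, s))"
      unfolding is_lift_def using lifted_box_upper_half[OF F r] lifted_box_p[OF F r]
      by (auto intro!: continuous_on_compose2[OF lifted_box_continuous[OF F]] continuous_intros r)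
    show "((\<lambda>t. F (t, s)) has_vector_derivative V (t, s)) (at t within {t0 B..t1 B})" if "t \<in> {t0 B..t1 B}" for t
      by (rule V[OF r[OF that]])
  qed
  have "continuous_on ({s0 B..s1 B} \<times> cbox (t0 B) (t1 B)) (\<lambda>(s, t). \<phi> (F (t, s)) (V (t, s)))"
    unfolding case_prod_beta
    by (rule continuous_on_one_form[OF \<phi>(1)])
      (auto simp: rect_def intro!: continuous_on_compose2[OF lifted_box_continuous[OF F]] continuous_on_compose2[OF Vc]
        continuous_intros lifted_box_upper_half[OF F])
  then have "continuous_on {s0 B..s1 B} (\<lambda>s. integral (cbox (t0 B) (t1 B)) (\<lambda>t. \<phi> (F (t, s)) (V (t, s))))"
    by (rule integral_continuous_on_param)
  then have "continuous_on {s0 B..s1 B} P"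
    by (rule continuous_on_eq) (simp add: Pe)
  then have Pm: "(\<lambda>s. indicator ?I s *\<^sub>R P s) \<in> borel_measurable borel"
    by (intro borel_measurable_continuous_on_indicator continuous_on_subset[of "{s0 B..s1 B}" P "?I"]) auto
  have Kb: "K B \<in> sets borel" using K_closed[OF F] by simp
  have pe: "plaque_integral B F (sheet_form ?S \<phi>) s = indicator (K B) s *\<^sub>R (indicator ?I s *\<^sub>R P s)" for s
  proof (cases "s \<in> K B")
    case True
    have "plaque_integral B F (sheet_form ?S \<phi>) s = plaque_integral B F \<phi> s"
    proof -
      have "sheet_form ?S \<phi> (geod (plaque_leaf_at B F s) x) w = \<phi> (geod (plaque_leaf_at B F s) x) w"
        if "x \<in> {0..plaque_length B F s}" for x w
        using plaque_param(4)[OF F True that] K_rect[OF F True] by (force simp: sheet_form_def)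
      then show ?thesis using True unfolding plaque_integral_def
        by (auto intro!: Henstock_Kurzweil_Integration.integral_cong)
    qed
    also have "\<dots> = P s"
      using plaque_integral_along_box[OF F True \<phi>(1), of "\<lambda>t. V (t, s)"] V[OF K_rect[OF F True]] Pe[of s] K_subset[OF F True] by simp
    finally show ?thesis using True K_subset[OF F True] by simp
  qed (simp add: plaque_integral_def)
  have "current v \<psi> \<phi> = box_integral B F (sheet_form ?S \<phi>)"
    using current_sheet[OF v \<psi> S \<phi>(1) zero] pairing_box[OF v F test_form_sheet[OF S \<phi>(1) zero]] by simp
  also have "\<dots> = (LINT s:?I|\<nu> B. P s)"
    unfolding box_integral_def set_lebesgue_integral_def pe
  proof (rule integral_cong_AE)
    show "(\<lambda>s. indicator ?I s *\<^sub>R P s) \<in> borel_measurable (\<nu> B)"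
      using Pm by (simp add: measurable_cong_sets[OF nu_sets[OF F] refl])
    show "(\<lambda>s. indicator (K B) s *\<^sub>R (indicator ?I s *\<^sub>R P s)) \<in> borel_measurable (\<nu> B)"
      unfolding measurable_cong_sets[OF nu_sets[OF F] refl]
      by (intro borel_measurable_scaleR borel_measurable_indicator Kb Pm)
    have "- K B \<in> null_sets (\<nu> B)" using nu_null[OF F] nu_sets[OF F] Kb by (auto simp: null_sets_def)
    then have "AE s in \<nu> B. s \<notin> - K B" by (rule AE_not_in)
    then show "AE s in \<nu> B. indicator (K B) s *\<^sub>R (indicator ?I s *\<^sub>R P s) = indicator ?I s *\<^sub>R P s" by eventually_elim simp
  qed
  finally show ?thesis by (simp add: P_def)
qed

lemma current_ruelle_sullivan:
  assumes v: "is_primitive v" and \<psi>: "cutoff C \<psi>"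
  shows "ruelle_sullivan_current M p lam G \<nu> (current v \<psi>)"
  unfolding ruelle_sullivan_current_def
proof (intro conjI ballI allI impI)
  show "one_current p (current v \<psi>)" by (rule current_one_current[OF v \<psi>])
  show "current v \<psi> \<phi> = 0" if "\<phi> \<in> one_forms p" "form_support M p \<phi> \<inter> lam = {}" for \<phi>
    by (rule current_off_lamination[OF v \<psi> that])
  fix U n B \<phi> \<Phi>
  assume a: "openin (top_of_set M) U \<and> lam \<subseteq> U \<and>
        (\<forall>i<n::nat. oriented_flow_box M p lam G (B i)) \<and> U \<subseteq> (\<Union>i<n. box_image (B i)) \<and>
        \<phi> \<in> one_forms p \<and> form_support M p \<phi> \<subseteq> U \<and>
        (\<forall>i<n. \<Phi> i \<in> one_forms p \<and> form_support M p (\<Phi> i) \<subseteq> box_image (B i)) \<and>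
        (\<forall>z\<in>upper_half. \<forall>v. \<phi> z v = (\<Sum>i<n. \<Phi> i z v))"
  have "current v \<psi> \<phi> = current v \<psi> (\<lambda>z w. \<Sum>i<n. \<Phi> i z w)" using a by (intro current_cong[OF \<psi>]) blast
  also have "\<dots> = (\<Sum>i<n. current v \<psi> (\<Phi> i))" using a by (intro current_sum[OF v \<psi>]) blast
  also have "\<dots> = (\<Sum>i<n. LINT s:{s0 (B i)<..<s1 (B i)}|\<nu> (B i).
                 path_integral p (\<Phi> i) (\<lambda>t. box_map (B i) (t, s)) (t0 (B i)) (t1 (B i)))"
    using a by (intro sum.cong[OF refl] current_box[OF v \<psi>]) auto
  finally show "current v \<psi> \<phi> = (\<Sum>i<n. LINT s:{s0 (B i)<..<s1 (B i)}|\<nu> (B i).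
                 path_integral p (\<Phi> i) (\<lambda>t. box_map (B i) (t, s)) (t0 (B i)) (t1 (B i)))" .
qed

end

section \<open>Uniqueness and the homology class\<close>

context hyp_surface begin

lemma one_form_mult:
  assumes \<phi>: "\<phi> \<in> one_forms p" and f: "smooth upper_half f" "\<And>g z. g \<in> deck_group p \<Longrightarrow> z \<in> upper_half \<Longrightarrow> f (g z) = f z"
  shows "(\<lambda>z w. f z * \<phi> z w) \<in> one_forms p"
proof -
  have "linear (\<lambda>w. f z * \<phi> z w)" if z: "z \<in> upper_half" for z
    by (rule linearI) (simp_all add: linear_add[OF one_form_linear[OF \<phi> z]] linear_scale[OF one_form_linear[OF \<phi> z]] algebra_simps)
  moreover have "smooth upper_half (\<lambda>z. f z * \<phi> z w)" for w
    by (rule smooth_mult[OF open_upper_half f(1) one_form_smooth[OF \<phi>]])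
  ultimately show ?thesis using one_form_deck[OF \<phi>] f(2) by (simp add: one_forms_def)
qed

lemma form_support_subset:
  assumes S: "closed S" "\<And>z w. z \<in> upper_half \<Longrightarrow> \<phi> z w \<noteq> 0 \<Longrightarrow> p z \<in> S" shows "form_support M p \<phi> \<subseteq> S"
proof -
  have "closure {p z | z. z \<in> upper_half \<and> (\<exists>w. \<phi> z w \<noteq> 0)} \<subseteq> S" by (rule closure_minimal[OF _ S(1)]) (use S(2) in blast)
  then show ?thesis by (auto simp: form_support_def)
qed

lemma deck_sum_supportD:
  assumes "deck_sum f z \<noteq> 0" "z \<in> upper_half" obtains g where "g \<in> deck_group p" "f (g z) \<noteq> 0"
  using assms that unfolding deck_sum_def by (metis (mono_tags, lifting) mem_Collect_eq sum.not_neutral_contains_not_neutral)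

lemma cutoff_exists: "\<exists>C \<psi>. cutoff C \<psi>"
proof -
  have "\<exists>r>0. cball x r \<subseteq> upper_half" if "x \<in> upper_half" for x using open_upper_half open_contains_cball that by blast
  then obtain R where R: "\<And>x. x \<in> upper_half \<Longrightarrow> R x > 0 \<and> cball x (R x) \<subseteq> upper_half" by metis
  obtain I \<kappa> where I: "finite I" "I \<subseteq> upper_half" "\<And>x. x \<in> I \<Longrightarrow> smooth upper_half (\<kappa> x)"
    "\<And>x z. x \<in> I \<Longrightarrow> 0 \<le> \<kappa> x z" "\<And>x z. x \<in> I \<Longrightarrow> z \<notin> cball x (R x) \<Longrightarrow> \<kappa> x z = 0"
    "\<And>z. z \<in> upper_half \<Longrightarrow> (\<Sum>x\<in>I. deck_sum (\<kappa> x) z) = 1"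
    using deck_partition[of R] R by blast
  let ?C = "\<Union>x\<in>I. cball x (R x)"
  have C: "compact ?C" "?C \<subseteq> upper_half" using I(1,2) R by (auto intro!: compact_UN)
  have z: "\<kappa> x z = 0" if "x \<in> I" "z \<notin> ?C" for x z using I(5) that by blast
  have "cutoff ?C (\<lambda>z. \<Sum>x\<in>I. \<kappa> x z)" unfolding cutoff_def
  proof (intro conjI allI impI ballI)
    show "smooth upper_half (\<lambda>z. \<Sum>x\<in>I. \<kappa> x z)" by (rule smooth_sum[OF open_upper_half I(3)])
    show "0 \<le> (\<Sum>x\<in>I. \<kappa> x z)" for z by (rule sum_nonneg[OF I(4)])
    show "(\<Sum>x\<in>I. \<kappa> x z) = 0" if "z \<notin> ?C" for z by (rule sum.neutral) (use z that in blast)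
    show "deck_sum (\<lambda>z. \<Sum>x\<in>I. \<kappa> x z) z = 1" if "z \<in> upper_half" for z
    proof -
      have "deck_sum (\<lambda>z. \<Sum>x\<in>I. \<kappa> x z) z = (\<Sum>x\<in>I. deck_sum (\<kappa> x) z)" by (rule deck_sum_sum[OF C z that])
      then show ?thesis using I(6)[OF that] by simp
    qed
  qed (use C in blast)+
  then show ?thesis by blast
qed

end

context lamination begin

lemma lamination_ball:
  assumes x: "x \<in> upper_half"
  shows "\<exists>r B. r > 0 \<and> cball x r \<subseteq> upper_half \<and>
    (cball x r \<inter> lift_lam \<noteq> {} \<longrightarrow> oriented_flow_box M p lam G B \<and> p ` cball x r \<subseteq> top_of_set M interior_of box_image B)"
proof (cases "x \<in> lift_lam")
  case True
  obtain B where B: "oriented_flow_box M p lam G B" "p x \<in> top_of_set M interior_of box_image B"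
    using box_at_lift_lam[OF True] by blast
  have "openin (top_of_set upper_half) (upper_half \<inter> p -` (top_of_set M interior_of box_image B))"
    by (rule continuous_openin_preimage[OF p_continuous, where T = M]) (use p_in_M openin_interior_of in auto)
  then have "open (upper_half \<inter> p -` (top_of_set M interior_of box_image B))" by (rule openin_open_trans[OF _ open_upper_half])
  then obtain r where "r > 0" "cball x r \<subseteq> upper_half \<inter> p -` (top_of_set M interior_of box_image B)"
    using B(2) x by (meson IntI open_contains_cball vimageI2)
  then show ?thesis using B(1) by blast
next
  case False
  then obtain r where "r > 0" "cball x r \<subseteq> upper_half - lift_lam"
    using open_complement_lift_lam x open_contains_cball by (metis DiffI)
  then show ?thesis by blast
qed

text \<open>The two defining conditions determine the current: a partition of unity splits every form into a
  part supported off the lamination and finitely many parts supported in flow boxes.\<close>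

lemma ruelle_sullivan_unique:
  assumes T: "ruelle_sullivan_current M p lam G \<nu> T" and T': "ruelle_sullivan_current M p lam G \<nu> T'" and \<phi>: "\<phi> \<in> one_forms p"
  shows "T \<phi> = T' \<phi>"
proof -
  obtain R Bx where R: "\<And>x. x \<in> upper_half \<Longrightarrow> R x > 0 \<and> cball x (R x) \<subseteq> upper_half \<and>
    (cball x (R x) \<inter> lift_lam \<noteq> {} \<longrightarrow> oriented_flow_box M p lam G (Bx x) \<and> p ` cball x (R x) \<subseteq> top_of_set M interior_of box_image (Bx x))"
    using lamination_ball by metis
  have R': "R x > 0 \<and> cball x (R x) \<subseteq> upper_half" if "x \<in> upper_half" for x using R[OF that] by blast
  obtain I \<kappa> where I: "finite I" "I \<subseteq> upper_half" and \<kappa>: "\<And>x. x \<in> I \<Longrightarrow> smooth upper_half (\<kappa> x)"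
    "\<And>x z. x \<in> I \<Longrightarrow> z \<notin> cball x (R x) \<Longrightarrow> \<kappa> x z = 0"
    and one: "\<And>z. z \<in> upper_half \<Longrightarrow> (\<Sum>x\<in>I. deck_sum (\<kappa> x) z) = 1"
    by (rule deck_partition[OF R'], assumption) blast
  have cb: "compact (cball x (R x))" "cball x (R x) \<subseteq> upper_half" if "x \<in> I" for x using R that I(2) by auto
  \<comment> \<open>The balls that meet the lamination lie in flow boxes; the other ones carry no mass.\<close>
  define J where "J = {x \<in> I. cball x (R x) \<inter> lift_lam \<noteq> {}}"
  have J: "finite J" "J \<subseteq> I" using I by (auto simp: J_def)
  have Jbox: "oriented_flow_box M p lam G (Bx x)" "p ` cball x (R x) \<subseteq> top_of_set M interior_of box_image (Bx x)" if "x \<in> J" for x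
    using R[of x] that I(2) by (auto simp: J_def)
  have inv: "deck_sum (\<kappa> x) (g z) = deck_sum (\<kappa> x) z" if "g \<in> deck_group p" for x g z by (rule deck_sum_deck[OF that])
  have sm: "smooth upper_half (deck_sum (\<kappa> x))" if x: "x \<in> I" for x
    by (rule deck_sum_smooth[OF cb[OF x] \<kappa>(2)[OF x] \<kappa>(1)[OF x]])
  have pc: "closed (p ` cball x (R x))" if "x \<in> I" for x
    using compact_continuous_image[OF continuous_on_subset[OF p_continuous cb(2)[OF that]] cb(1)[OF that]] by (rule compact_imp_closed)
  have hit: "p z \<in> p ` cball x (R x)" if x: "x \<in> I" and z: "z \<in> upper_half" "deck_sum (\<kappa> x) z \<noteq> 0" for x z
  proof -
    obtain g where "g \<in> deck_group p" "\<kappa> x (g z) \<noteq> 0" using deck_sum_supportD[OF z(2,1)] .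
    then show ?thesis using \<kappa>(2)[OF x, of "g z"] deck_p[of g z] z(1) by (metis imageI)
  qed
  define f where "f z = (\<Sum>x\<in>J. deck_sum (\<kappa> x) z)" for z
  have f: "smooth upper_half f" "\<And>g z. g \<in> deck_group p \<Longrightarrow> f (g z) = f z"
    unfolding f_def using J(2) inv by (auto intro!: smooth_sum open_upper_half sm)
  define \<phi>J where "\<phi>J z w = f z * \<phi> z w" for z w
  define \<phi>N where "\<phi>N z w = (1 - f z) * \<phi> z w" for z w
  have forms: "\<phi>J \<in> one_forms p" "\<phi>N \<in> one_forms p"
    unfolding \<phi>J_def \<phi>N_def by (intro one_form_mult \<phi> f smooth_diff smooth_const open_upper_half arg_cong2[of _ _ _ _ "(-)"] refl; assumption?)+
  have N0: "S \<phi>N = 0" if S: "ruelle_sullivan_current M p lam G \<nu> S" for S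
  proof -
    have "form_support M p \<phi>N \<subseteq> (\<Union>x\<in>I - J. p ` cball x (R x))"
    proof (rule form_support_subset)
      show "closed (\<Union>x\<in>I - J. p ` cball x (R x))" using I pc by (intro closed_UN) auto
      fix z w assume z: "z \<in> upper_half" "\<phi>N z w \<noteq> 0"
      have "(\<Sum>x\<in>I. deck_sum (\<kappa> x) z) = f z + (\<Sum>x\<in>I - J. deck_sum (\<kappa> x) z)"
        unfolding f_def by (rule sum.subset_diff[OF J(2) I(1), THEN trans]) simp
      then have "(\<Sum>x\<in>I - J. deck_sum (\<kappa> x) z) \<noteq> 0" using one[OF z(1)] z(2) by (auto simp: \<phi>N_def)
      then obtain x where "x \<in> I - J" "deck_sum (\<kappa> x) z \<noteq> 0" by (rule sum.not_neutral_contains_not_neutral)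
      then show "p z \<in> (\<Union>x\<in>I - J. p ` cball x (R x))" using hit[of x z] z(1) by blast
    qed
    moreover have "(\<Union>x\<in>I - J. p ` cball x (R x)) \<inter> lam = {}"
      using cb(2) by (fastforce simp: J_def lift_lam_def)
    ultimately show ?thesis using S forms(2) unfolding ruelle_sullivan_current_def by blast
  qed
  obtain e where e: "bij_betw e {0..<card J} J" using ex_bij_betw_nat_finite[OF J(1)] by blast
  then have eJ: "e i \<in> J" if "i < card J" for i using that by (auto simp: bij_betw_def)
  define \<Phi> where "\<Phi> i z w = deck_sum (\<kappa> (e i)) z * \<phi> z w" for i z w
  define U where "U = (\<Union>x\<in>J. top_of_set M interior_of box_image (Bx x))"
  have box: "S \<phi>J = (\<Sum>i<card J. LINT s:{s0 (Bx (e i))<..<s1 (Bx (e i))}|\<nu> (Bx (e i)).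
      path_integral p (\<Phi> i) (\<lambda>t. box_map (Bx (e i)) (t, s)) (t0 (Bx (e i))) (t1 (Bx (e i))))"
    if S: "ruelle_sullivan_current M p lam G \<nu> S" for S
  proof -
    have "openin (top_of_set M) U" unfolding U_def by (intro openin_Union) (auto simp: openin_interior_of)
    moreover have "lam \<subseteq> U"
    proof
      fix m assume m: "m \<in> lam"
      then have "m \<in> M" using lam_closedin closedin_subset by fastforce
      then obtain z where z: "z \<in> upper_half" "m = p z" using p_image by blast
      have "(\<Sum>x\<in>I. deck_sum (\<kappa> x) z) \<noteq> 0" using one[OF z(1)] by simp
      then obtain x where x: "x \<in> I" "deck_sum (\<kappa> x) z \<noteq> 0" by (rule sum.not_neutral_contains_not_neutral)
      then obtain y where y: "y \<in> cball x (R x)" "p y = p z" using hit[OF x(1) z(1)] by (metis imageE)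
      then have "y \<in> lift_lam" using m z cb(2)[OF x(1)] by (auto simp: lift_lam_def)
      then have "x \<in> J" using x(1) y(1) by (auto simp: J_def)
      then show "m \<in> U" using Jbox(2)[of x] y z(2) unfolding U_def by (metis UN_I imageI subsetD)
    qed
    moreover have "\<forall>i<card J. oriented_flow_box M p lam G (Bx (e i))" using Jbox(1) eJ by blast
    moreover have "U \<subseteq> (\<Union>i<card J. box_image (Bx (e i)))"
    proof -
      have "J = e ` {..<card J}" using e by (auto simp: bij_betw_def lessThan_atLeast0)
      then have "U = (\<Union>i<card J. top_of_set M interior_of box_image (Bx (e i)))" unfolding U_def by (metis image_image)
      then show ?thesis using interior_of_subset by fastforce
    qed
    moreover have "form_support M p \<phi>J \<subseteq> (\<Union>x\<in>J. p ` cball x (R x))"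
    proof (rule form_support_subset)
      show "closed (\<Union>x\<in>J. p ` cball x (R x))" using J pc by (intro closed_UN) auto
      fix z w assume z: "z \<in> upper_half" "\<phi>J z w \<noteq> 0"
      then have "f z \<noteq> 0" by (auto simp: \<phi>J_def)
      then obtain x where "x \<in> J" "deck_sum (\<kappa> x) z \<noteq> 0" unfolding f_def by (rule sum.not_neutral_contains_not_neutral)
      then show "p z \<in> (\<Union>x\<in>J. p ` cball x (R x))" using hit[of x z] z(1) J(2) by blast
    qed
    moreover have "(\<Union>x\<in>J. p ` cball x (R x)) \<subseteq> U" using Jbox(2) unfolding U_def by blast
    moreover have "\<Phi> i \<in> one_forms p \<and> form_support M p (\<Phi> i) \<subseteq> box_image (Bx (e i))" if i: "i < card J" for i
    proof
      note ei = eJ[OF i] subsetD[OF J(2) eJ[OF i]]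
      show "\<Phi> i \<in> one_forms p" unfolding \<Phi>_def by (rule one_form_mult[OF \<phi> sm[OF ei(2)]]) (rule inv)
      have "form_support M p (\<Phi> i) \<subseteq> p ` cball (e i) (R (e i))"
      proof (rule form_support_subset[OF pc[OF ei(2)]])
        fix z w assume z: "z \<in> upper_half" "\<Phi> i z w \<noteq> 0"
        then show "p z \<in> p ` cball (e i) (R (e i))" using hit[OF ei(2) z(1)] by (auto simp: \<Phi>_def)
      qed
      also have "\<dots> \<subseteq> top_of_set M interior_of box_image (Bx (e i))" by (rule Jbox(2)[OF ei(1)])
      also have "\<dots> \<subseteq> box_image (Bx (e i))" by (rule interior_of_subset)
      finally show "form_support M p (\<Phi> i) \<subseteq> box_image (Bx (e i))" .
    qed
    moreover have "\<phi>J z w = (\<Sum>i<card J. \<Phi> i z w)" for z w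
      unfolding \<phi>J_def f_def \<Phi>_def sum_distrib_right
      using sum.reindex_bij_betw[OF e, of "\<lambda>x. deck_sum (\<kappa> x) z * \<phi> z w"] by (simp add: lessThan_atLeast0)
    ultimately show ?thesis
      using S[unfolded ruelle_sullivan_current_def, THEN conjunct2, THEN conjunct2, rule_format, of U "card J" "\<lambda>i. Bx (e i)" \<phi>J \<Phi>] forms(1)
      by blast
  qed
  have "S \<phi> = S \<phi>J" if S: "ruelle_sullivan_current M p lam G \<nu> S" for S
  proof -
    have "\<phi> = (\<lambda>z w. 1 * \<phi>J z w + 1 * \<phi>N z w)" by (auto simp: \<phi>J_def \<phi>N_def fun_eq_iff algebra_simps)
    moreover have "S (\<lambda>z w. 1 * \<phi>J z w + 1 * \<phi>N z w) = 1 * S \<phi>J + 1 * S \<phi>N"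
      using S forms unfolding ruelle_sullivan_current_def one_current_def by blast
    ultimately show ?thesis using N0[OF S] by simp
  qed
  then have "T \<phi> = T \<phi>J" "T' \<phi> = T' \<phi>J" using T T' by blast+
  then show ?thesis by (simp only: box[OF T] box[OF T'])
qed

end

lemma (in hyp_surface) closed_current_cong:
  assumes "\<And>\<phi>. \<phi> \<in> one_forms p \<Longrightarrow> T' \<phi> = T \<phi>" "one_current p T'" "closed_current p T"
  shows "closed_current p T'"
  using assms d0_one_form by (simp add: closed_current_def)

lemma homology_class_cong:
  assumes "\<And>\<phi>. \<phi> \<in> one_forms p \<Longrightarrow> T' \<phi> = T \<phi>" "closed_current p T" "closed_current p T'"
  shows "homology_class p T' = homology_class p T"
  using assms unfolding homology_class_def homologous_def by auto

theorem theorem1p5: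
  fixes M :: "'m::metric_space set" and p :: "complex \<Rightarrow> 'm"
    and lam :: "'m set" and G :: "(real \<Rightarrow> 'm) set" and \<nu> :: "'m box \<Rightarrow> real measure"
  assumes "closed_oriented_hyperbolic_surface M p"
    and "oriented_lamination M p lam G"
    and "transverse_measure M p lam \<nu>"
  shows "\<exists>T. ruelle_sullivan_current M p lam G \<nu> T \<and>
           (\<forall>T'. ruelle_sullivan_current M p lam G \<nu> T' \<longrightarrow>
              (\<forall>\<phi>\<in>one_forms p. T' \<phi> = T \<phi>) \<and> homology_class p T' = homology_class p T) \<and>
           closed_current p T \<and>
           homology_class p T \<in> H1 p \<and>
           (\<exists>(\<alpha> :: (complex \<Rightarrow> complex) \<Rightarrow> real) (v :: complex \<Rightarrow> real).
              (\<forall>g\<in>deck_group p. \<forall>h\<in>deck_group p. \<alpha> (g \<circ> h) = \<alpha> g + \<alpha> h) \<and>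
              BV_loc v \<and>
              (\<forall>g\<in>deck_group p. AE z in lborel. z \<in> upper_half \<longrightarrow> v (g z) = v z + \<alpha> g) \<and>
              current_eq_d M p T v)"
proof -
  interpret lamination M p lam G \<nu>
    by unfold_locales (rule assms)+
  obtain v where v: "is_primitive v" using primitive_exists by blast
  obtain C \<psi> where \<psi>: "cutoff C \<psi>" using cutoff_exists by blast
  let ?T = "current v \<psi>"
  have rs: "ruelle_sullivan_current M p lam G \<nu> ?T" by (rule current_ruelle_sullivan[OF v \<psi>])
  have closed: "closed_current p ?T"
    using current_one_current[OF v \<psi>] current_closed[OF v \<psi>] by (simp add: closed_current_def)
  have unique: "(\<forall>\<phi>\<in>one_forms p. T' \<phi> = ?T \<phi>) \<and> homology_class p T' = homology_class p ?T"
    if T': "ruelle_sullivan_current M p lam G \<nu> T'" for T'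
  proof -
    have eq: "T' \<phi> = ?T \<phi>" if "\<phi> \<in> one_forms p" for \<phi> by (rule ruelle_sullivan_unique[OF T' rs that])
    have "one_current p T'" using T' by (simp add: ruelle_sullivan_current_def)
    then show ?thesis using eq homology_class_cong[OF eq closed closed_current_cong[OF eq _ closed]] by blast
  qed
  have H1: "homology_class p ?T \<in> H1 p"
    unfolding H1_def homology_class_def by (rule quotientI) (use closed in simp)
  define \<alpha> where "\<alpha> g = v (g \<i>) - v \<i>" for g
  have i: "\<i> \<in> upper_half" by (simp add: upper_half_def)
  have \<alpha>: "v (g z) = v z + \<alpha> g" if g: "g \<in> deck_group p" and z: "z \<in> upper_half" for g z
  proof -
    obtain c where c: "\<And>z. z \<in> upper_half \<Longrightarrow> v (g z) = v z + c" using primitive_deck[OF v g] by blast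
    then show ?thesis using z i by (simp add: \<alpha>_def)
  qed
  have "\<alpha> (g \<circ> h) = \<alpha> g + \<alpha> h" if "g \<in> deck_group p" "h \<in> deck_group p" for g h
  proof -
    have "\<alpha> (g \<circ> h) = v (g (h \<i>)) - v \<i>" by (simp add: \<alpha>_def)
    then show ?thesis using \<alpha>[OF that(1) deck_upper_half[OF that(2) i]] \<alpha>[OF that(2) i] by linarith
  qed
  moreover have "\<forall>g\<in>deck_group p. AE z in lborel. z \<in> upper_half \<longrightarrow> v (g z) = v z + \<alpha> g" using \<alpha> by blast
  ultimately show ?thesis
    using rs unique closed H1 primitive_BV_loc[OF v] current_eq_d_primitive[OF v \<psi>] by blast
qed


end
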